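(* Let $\mathbf{i}=(i_1,\ldots,i_r)$ be a reduced word for $w_0$ such that $(i_1,\ldots,i_{r_K})$ is a reduced word for $w_0^K$. Then $T^\dagger_{\mathbf{i}}$ has $r-r_K$ pairwise non-isomorphic indecomposable direct summands in $\operatorname{Sub} Q_J$.
   Context: Let $\Delta$ be a Dynkin diagram of type $A$, $D$ or $E$ with vertex set $I$; $r$ is the number of positive roots of $\Delta$, $W$ the Weyl group with Coxeter generators $s_i$ $(i\in I)$ and longest element $w_0$ (of length $r$). Let $J\subseteq I$ be non-empty, $K=I\setminus J$, $W_K$ the subgroup of $W$ generated by the $s_k$ $(k\in K)$, $w_0^K$ its longest element, and $r_K=\ell(w_0^K)$ the number of positive roots of the full subdiagram on $K$. $\Lambda$ is the preprojective algebra of $\Delta$ over $\mathbb{C}$ (choose an orientation of $\Delta$, add to each arrow $a:i\to j$ a reverse arrow $a^*:j\to i$, and take the path algebra modulo the ideal generated by $\sum_a (a^*a-aa^* )$). Modules are finite-dimensional. $Q_i$ is the injective hull of the simple module $S_i$; $Q_J=\bigoplus_{j\in J}Q_j$ and $Q=\bigoplus_{i\in I}Q_i$. $\operatorname{Sub} Q_J$ is the full subcategory of $\operatorname{mod}\Lambda$ of modules isomorphic to a submodule of a finite direct sum of copies of $Q_J$. For $M\in\operatorname{mod}\Lambda$ and $i\in I$ let $\mathcal{E}_i^\dagger(M)$ be the quotient of $M$ by the $S_i$-isotypic component of its socle. For a reduced word $\mathbf{i}=(i_1,\dots,i_r)$ of $w_0$ define inductively ${}^\dagger T^{(r+1)}=Q$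 and ${}^\dagger T^{(k)}=\mathcal{E}_{i_k}^\dagger({}^\dagger T^{(k+1)})\oplus Q_{i_k}$ for $1\le k\le r$, and put $T^\dagger_{\mathbf{i}}={}^\dagger T^{(1)}$. (This is a rigid $\Lambda$-module with exactly $r$ pairwise non-isomorphic indecomposable direct summands. A rigid module in $\operatorname{Sub}Q_J$ with $r-r_K$ pairwise non-isomorphic indecomposable direct summands is called complete in $\operatorname{Sub}Q_J$.) *)

theory Defs
  imports Complex_Main "HOL-Algebra.QuotRing" "HOL-Algebra.Module" "HOL-Algebra.Bij"
    "HOL-Algebra.Generated_Groups"
begin

section \<open>Dynkin diagrams, root systems and Weyl groups\<close>

text \<open>Simply laced diagrams are simple graphs; edges are two-element vertex sets.
  The models on \<open>{1..n}\<close> use the Bourbaki labelling.\<close>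

definition A_edges :: "nat \<Rightarrow> nat set set" where
  "A_edges n = {{a, a + 1} | a. 1 \<le> a \<and> a < n}"

definition D_edges :: "nat \<Rightarrow> nat set set" where
  "D_edges n = {{a, a + 1} | a. 1 \<le> a \<and> a < n - 1} \<union> {{n - 2, n}}"

definition E_edges :: "nat \<Rightarrow> nat set set" where
  "E_edges n = {{1, 3}, {2, 4}} \<union> {{a, a + 1} | a. 3 \<le> a \<and> a < n}"

definition dynkin_ADE :: "'v set \<Rightarrow> 'v set set \<Rightarrow> bool" where
  "dynkin_ADE I E \<longleftrightarrow>
    (\<exists>n S f. (S = A_edges n \<and> 1 \<le> n \<or> S = D_edges n \<and> 4 \<le> n \<or> S = E_edges n \<and> n \<in> {6, 7, 8}) \<and>
       bij_betw f {1..n} I \<and> E = (`) f ` S)"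

text \<open>The Weyl group acts on the root lattice, whose elements are given by their
  coordinates with respect to the simple roots. Since \<open>(\<alpha>\<^sub>i, \<alpha>\<^sub>k) = -1\<close> for adjacent \<open>i, k\<close>,
  the reflection \<open>s\<^sub>i\<close> replaces \<open>x\<^sub>i\<close> by \<open>-x\<^sub>i + (\<Sum>k adjacent to i. x\<^sub>k)\<close>.\<close>

definition simple_reflection :: "'v set set \<Rightarrow> 'v \<Rightarrow> ('v \<Rightarrow> int) \<Rightarrow> ('v \<Rightarrow> int)" where
  "simple_reflection E i x = x(i := (\<Sum>k | {i, k} \<in> E. x k) - x i)"

definition simple_root :: "'v \<Rightarrow> ('v \<Rightarrow> int)" where
  "simple_root i = (\<lambda>k. if k = i then 1 else 0)"

definition weyl_group :: "'v set set \<Rightarrow> 'v set \<Rightarrow> (('v \<Rightarrow> int) \<Rightarrow> ('v \<Rightarrow> int)) set" where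
  "weyl_group E K = generate (BijGroup UNIV) (simple_reflection E ` K)"

definition positive_roots :: "'v set \<Rightarrow> 'v set set \<Rightarrow> ('v \<Rightarrow> int) set" where
  "positive_roots I E = {w (simple_root i) | w i. w \<in> weyl_group E I \<and> i \<in> I} \<inter> {x. \<forall>k. 0 \<le> x k}"

definition word_prod :: "'v set set \<Rightarrow> 'v list \<Rightarrow> ('v \<Rightarrow> int) \<Rightarrow> ('v \<Rightarrow> int)" where
  "word_prod E ws = foldr (\<circ>) (map (simple_reflection E) ws) id"

definition coxeter_length :: "'v set \<Rightarrow> 'v set set \<Rightarrow> (('v \<Rightarrow> int) \<Rightarrow> ('v \<Rightarrow> int)) \<Rightarrow> nat" where
  "coxeter_length I E w = (LEAST n. \<exists>ws. set ws \<subseteq> I \<and> length ws = n \<and> word_prod E ws = w)"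

definition reduced_word ::
  "'v set \<Rightarrow> 'v set set \<Rightarrow> (('v \<Rightarrow> int) \<Rightarrow> ('v \<Rightarrow> int)) \<Rightarrow> 'v list \<Rightarrow> bool" where
  "reduced_word I E w ws \<longleftrightarrow>
    set ws \<subseteq> I \<and> word_prod E ws = w \<and> length ws = coxeter_length I E w"

definition longest_element ::
  "'v set \<Rightarrow> 'v set set \<Rightarrow> 'v set \<Rightarrow> (('v \<Rightarrow> int) \<Rightarrow> ('v \<Rightarrow> int)) \<Rightarrow> bool" where
  "longest_element I E K w \<longleftrightarrow>
    w \<in> weyl_group E K \<and> (\<forall>v \<in> weyl_group E K. coxeter_length I E v \<le> coxeter_length I E w)"

section \<open>The preprojective algebra\<close>

definition orientation :: "'v set set \<Rightarrow> ('v \<times> 'v) set \<Rightarrow> bool" where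
  "orientation E \<Omega> \<longleftrightarrow> bij_betw (\<lambda>(i, j). {i, j}) \<Omega> E"

text \<open>The quivers used here have no parallel arrows, so a path \<open>v\<^sub>0 \<rightarrow> v\<^sub>1 \<rightarrow> \<dots> \<rightarrow> v\<^sub>n\<close> is the nonempty
  list \<open>[v\<^sub>0, \<dots>, v\<^sub>n]\<close> of the vertices it visits; \<open>[i]\<close> is the trivial path at \<open>i\<close>.\<close>

definition quiver_path :: "'v set \<Rightarrow> ('v \<times> 'v) set \<Rightarrow> 'v list \<Rightarrow> bool" where
  "quiver_path I A p \<longleftrightarrow> p \<noteq> [] \<and> set p \<subseteq> I \<and> successively (\<lambda>i j. (i, j) \<in> A) p"

text \<open>Elements are finitely supported coefficient functions on paths. Paths compose like functions,
  i.e. in \<open>f \<otimes> g\<close> the path from \<open>g\<close> is traversed first, so that left modules are representations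
  of the quiver.\<close>

definition path_algebra :: "'v set \<Rightarrow> ('v \<times> 'v) set \<Rightarrow> ('v list \<Rightarrow> complex) ring" where
  "path_algebra I A =
    \<lparr>carrier = {f. finite {p. f p \<noteq> 0} \<and> (\<forall>p. f p \<noteq> 0 \<longrightarrow> quiver_path I A p)},
     mult = (\<lambda>f g p. \<Sum>k<length p. f (drop k p) * g (take (Suc k) p)),
     one = (\<lambda>p. if \<exists>i\<in>I. p = [i] then 1 else 0),
     zero = (\<lambda>p. 0),
     add = (\<lambda>f g p. f p + g p)\<rparr>"

definition path_elem :: "'v list \<Rightarrow> 'v list \<Rightarrow> complex" where
  "path_elem p = (\<lambda>q. if q = p then 1 else 0)"

definition double_path_algebra :: "'v set \<Rightarrow> ('v \<times> 'v) set \<Rightarrow> ('v list \<Rightarrow> complex) ring" where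
  "double_path_algebra I \<Omega> = path_algebra I (\<Omega> \<union> \<Omega>\<inverse>)"

definition preprojective_relation :: "'v set \<Rightarrow> ('v \<times> 'v) set \<Rightarrow> 'v list \<Rightarrow> complex" where
  "preprojective_relation I \<Omega> =
    (let P = double_path_algebra I \<Omega>;
         arr = (\<lambda>a. path_elem [fst a, snd a]);
         rev_arr = (\<lambda>a. path_elem [snd a, fst a])
     in \<Oplus>\<^bsub>P\<^esub>a\<in>\<Omega>. (rev_arr a \<otimes>\<^bsub>P\<^esub> arr a) \<ominus>\<^bsub>P\<^esub> (arr a \<otimes>\<^bsub>P\<^esub> rev_arr a))"

definition preprojective_ideal :: "'v set \<Rightarrow> ('v \<times> 'v) set \<Rightarrow> ('v list \<Rightarrow> complex) set" where
  "preprojective_ideal I \<Omega> = Idl\<^bsub>double_path_algebra I \<Omega>\<^esub> {preprojective_relation I \<Omega>}"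

type_synonym 'v preproj = "('v list \<Rightarrow> complex) set"

definition preprojective_algebra :: "'v set \<Rightarrow> ('v \<times> 'v) set \<Rightarrow> 'v preproj ring" where
  "preprojective_algebra I \<Omega> = double_path_algebra I \<Omega> Quot preprojective_ideal I \<Omega>"

text \<open>The structure map from the complex numbers to the preprojective algebra.\<close>

definition scalar :: "'v set \<Rightarrow> ('v \<times> 'v) set \<Rightarrow> complex \<Rightarrow> 'v preproj" where
  "scalar I \<Omega> c =
    preprojective_ideal I \<Omega> +>\<^bsub>double_path_algebra I \<Omega>\<^esub> (\<lambda>p. c * \<one>\<^bsub>double_path_algebra I \<Omega>\<^esub> p)"

section \<open>Modules over a ring\<close>

text \<open>The library's locale \<open>module\<close> requires a commutative ring. We reuse its record type, of which
  only the fields \<open>carrier\<close>, \<open>zero\<close>, \<open>add\<close> and \<open>smult\<close> matter, and its locale \<open>submodule\<close>.\<close>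

locale left_module = R?: ring R + M?: abelian_group M for R (structure) and M (structure) +
  assumes smult_closed:
      "\<lbrakk>a \<in> carrier R; x \<in> carrier M\<rbrakk> \<Longrightarrow> a \<odot>\<^bsub>M\<^esub> x \<in> carrier M"
    and smult_l_distr:
      "\<lbrakk>a \<in> carrier R; b \<in> carrier R; x \<in> carrier M\<rbrakk> \<Longrightarrow>
        (a \<oplus> b) \<odot>\<^bsub>M\<^esub> x = a \<odot>\<^bsub>M\<^esub> x \<oplus>\<^bsub>M\<^esub> b \<odot>\<^bsub>M\<^esub> x"
    and smult_r_distr:
      "\<lbrakk>a \<in> carrier R; x \<in> carrier M; y \<in> carrier M\<rbrakk> \<Longrightarrow>
        a \<odot>\<^bsub>M\<^esub> (x \<oplus>\<^bsub>M\<^esub> y) = a \<odot>\<^bsub>M\<^esub> x \<oplus>\<^bsub>M\<^esub> a \<odot>\<^bsub>M\<^esub> y"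
    and smult_assoc:
      "\<lbrakk>a \<in> carrier R; b \<in> carrier R; x \<in> carrier M\<rbrakk> \<Longrightarrow>
        (a \<otimes> b) \<odot>\<^bsub>M\<^esub> x = a \<odot>\<^bsub>M\<^esub> (b \<odot>\<^bsub>M\<^esub> x)"
    and smult_one:
      "x \<in> carrier M \<Longrightarrow> \<one> \<odot>\<^bsub>M\<^esub> x = x"

abbreviation restrict_module :: "('r, 'm) module \<Rightarrow> 'm set \<Rightarrow> ('r, 'm) module" where
  "restrict_module M H \<equiv> M\<lparr>carrier := H\<rparr>"

definition module_hom :: "'r ring \<Rightarrow> ('r, 'm) module \<Rightarrow> ('r, 'n) module \<Rightarrow> ('m \<Rightarrow> 'n) set" where
  "module_hom R M N = {f \<in> carrier M \<rightarrow> carrier N.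
     (\<forall>x\<in>carrier M. \<forall>y\<in>carrier M. f (x \<oplus>\<^bsub>M\<^esub> y) = f x \<oplus>\<^bsub>N\<^esub> f y) \<and>
     (\<forall>a\<in>carrier R. \<forall>x\<in>carrier M. f (a \<odot>\<^bsub>M\<^esub> x) = a \<odot>\<^bsub>N\<^esub> f x)}"

definition module_iso :: "'r ring \<Rightarrow> ('r, 'm) module \<Rightarrow> ('r, 'n) module \<Rightarrow> bool" where
  "module_iso R M N \<longleftrightarrow> (\<exists>f\<in>module_hom R M N. bij_betw f (carrier M) (carrier N))"

definition quotient_module :: "('r, 'm) module \<Rightarrow> 'm set \<Rightarrow> ('r, 'm set) module" where
  "quotient_module M H =
    \<lparr>carrier = a_rcosets\<^bsub>M\<^esub> H, mult = undefined, one = undefined, zero = H, add = set_add M,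
     smult = (\<lambda>a X. \<Union>x\<in>X. H +>\<^bsub>M\<^esub> (a \<odot>\<^bsub>M\<^esub> x))\<rparr>"

definition direct_sum2 :: "('r, 'm) module \<Rightarrow> ('r, 'n) module \<Rightarrow> ('r, 'm \<times> 'n) module" where
  "direct_sum2 M N =
    \<lparr>carrier = carrier M \<times> carrier N, mult = undefined, one = undefined,
     zero = (\<zero>\<^bsub>M\<^esub>, \<zero>\<^bsub>N\<^esub>),
     add = (\<lambda>(x, y) (x', y'). (x \<oplus>\<^bsub>M\<^esub> x', y \<oplus>\<^bsub>N\<^esub> y')),
     smult = (\<lambda>a (x, y). (a \<odot>\<^bsub>M\<^esub> x, a \<odot>\<^bsub>N\<^esub> y))\<rparr>"

text \<open>Only used for finite index sets, where it coincides with the direct product.\<close>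

definition direct_sum :: "'k set \<Rightarrow> ('k \<Rightarrow> ('r, 'm) module) \<Rightarrow> ('r, 'k \<Rightarrow> 'm) module" where
  "direct_sum A M =
    \<lparr>carrier = (\<Pi>\<^sub>E k\<in>A. carrier (M k)), mult = undefined, one = undefined,
     zero = (\<lambda>k\<in>A. \<zero>\<^bsub>M k\<^esub>),
     add = (\<lambda>x y. \<lambda>k\<in>A. x k \<oplus>\<^bsub>M k\<^esub> y k),
     smult = (\<lambda>a x. \<lambda>k\<in>A. a \<odot>\<^bsub>M k\<^esub> x k)\<rparr>"

definition complementary :: "'r ring \<Rightarrow> ('r, 'm) module \<Rightarrow> 'm set \<Rightarrow> 'm set \<Rightarrow> bool" where
  "complementary R M H H' \<longleftrightarrow>
    submodule H R M \<and> submodule H' R M \<and> H \<inter> H' = {\<zero>\<^bsub>M\<^esub>} \<and> set_add M H H' = carrier M"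

definition direct_summand :: "'r ring \<Rightarrow> ('r, 'm) module \<Rightarrow> 'm set \<Rightarrow> bool" where
  "direct_summand R M H \<longleftrightarrow> (\<exists>H'. complementary R M H H')"

definition indecomposable :: "'r ring \<Rightarrow> ('r, 'm) module \<Rightarrow> bool" where
  "indecomposable R M \<longleftrightarrow> carrier M \<noteq> {\<zero>\<^bsub>M\<^esub>} \<and>
    (\<forall>H H'. complementary R M H H' \<longrightarrow> H = {\<zero>\<^bsub>M\<^esub>} \<or> H' = {\<zero>\<^bsub>M\<^esub>})"

definition simple_module :: "'r ring \<Rightarrow> ('r, 'm) module \<Rightarrow> bool" where
  "simple_module R M \<longleftrightarrow> carrier M \<noteq> {\<zero>\<^bsub>M\<^esub>} \<and>
    (\<forall>H. submodule H R M \<longrightarrow> H = {\<zero>\<^bsub>M\<^esub>} \<or> H = carrier M)"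

definition generated_submodule :: "'r ring \<Rightarrow> ('r, 'm) module \<Rightarrow> 'm set \<Rightarrow> 'm set" where
  "generated_submodule R M B = \<Inter>{H. submodule H R M \<and> B \<subseteq> H}"

definition socle :: "'r ring \<Rightarrow> ('r, 'm) module \<Rightarrow> 'm set" where
  "socle R M = generated_submodule R M
    (\<Union>{H. submodule H R M \<and> simple_module R (restrict_module M H)})"

definition isotypic_component ::
  "'r ring \<Rightarrow> ('r, 's) module \<Rightarrow> ('r, 'm) module \<Rightarrow> 'm set" where
  "isotypic_component R S M = generated_submodule R M
    (\<Union>{H. submodule H R M \<and> module_iso R (restrict_module M H) S})"

section \<open>Modules over the preprojective algebra\<close>

definition fd_module :: "'v set \<Rightarrow> ('v \<times> 'v) set \<Rightarrow> ('v preproj, 'm) module \<Rightarrow> bool" where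
  "fd_module I \<Omega> M \<longleftrightarrow> left_module (preprojective_algebra I \<Omega>) M \<and>
    (\<exists>B. finite B \<and> B \<subseteq> carrier M \<and>
      (\<forall>x\<in>carrier M. \<exists>c. x = (\<Oplus>\<^bsub>M\<^esub>b\<in>B. scalar I \<Omega> (c b) \<odot>\<^bsub>M\<^esub> b)))"

text \<open>Quantification over all finite-dimensional modules ranges over the modules whose carrier
  is a subset (with arbitrary operations) of a fixed type that is large enough to contain an
  isomorphic copy of each of them.\<close>

type_synonym 'v preproj_mod = "('v preproj, nat \<Rightarrow> complex) module"

text \<open>The simple module at \<open>i\<close> is one-dimensional; an element of the algebra acts on it through its
  coefficient at the trivial path at \<open>i\<close>, which is the same for all representatives \<open>f\<close> of
  the coset \<open>a\<close> since the relation has no constant terms.\<close>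

definition simple_at :: "'v \<Rightarrow> ('v preproj, complex) module" where
  "simple_at i =
    \<lparr>carrier = UNIV, mult = undefined, one = undefined, zero = 0, add = (+),
     smult = (\<lambda>a z. (SOME f. f \<in> a) [i] * z)\<rparr>"

definition injective_module :: "'v set \<Rightarrow> ('v \<times> 'v) set \<Rightarrow> ('v preproj, 'm) module \<Rightarrow> bool" where
  "injective_module I \<Omega> M \<longleftrightarrow> fd_module I \<Omega> M \<and>
    (\<forall>(X :: 'v preproj_mod) (Y :: 'v preproj_mod).
      \<forall>f \<in> module_hom (preprojective_algebra I \<Omega>) X Y. \<forall>g \<in> module_hom (preprojective_algebra I \<Omega>) X M.
        fd_module I \<Omega> X \<and> fd_module I \<Omega> Y \<and> inj_on f (carrier X) \<longrightarrow>
        (\<exists>h \<in> module_hom (preprojective_algebra I \<Omega>) Y M. \<forall>x\<in>carrier X. h (f x) = g x))"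

definition injective_hull ::
  "'v set \<Rightarrow> ('v \<times> 'v) set \<Rightarrow> ('v preproj, 's) module \<Rightarrow> ('v preproj, 'm) module \<Rightarrow> bool" where
  "injective_hull I \<Omega> S M \<longleftrightarrow> injective_module I \<Omega> M \<and>
    (\<exists>\<iota> \<in> module_hom (preprojective_algebra I \<Omega>) S M. inj_on \<iota> (carrier S) \<and>
      (\<forall>H. submodule H (preprojective_algebra I \<Omega>) M \<and> H \<noteq> {\<zero>\<^bsub>M\<^esub>} \<longrightarrow> H \<inter> \<iota> ` carrier S \<noteq> {\<zero>\<^bsub>M\<^esub>}))"

definition in_Sub ::
  "'v set \<Rightarrow> ('v \<times> 'v) set \<Rightarrow> ('v preproj, 'n) module \<Rightarrow> ('v preproj, 'm) module \<Rightarrow> bool" where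
  "in_Sub I \<Omega> N M \<longleftrightarrow> fd_module I \<Omega> M \<and>
    (\<exists>n H. submodule H (preprojective_algebra I \<Omega>) (direct_sum {..<n::nat} (\<lambda>_. N)) \<and>
       module_iso (preprojective_algebra I \<Omega>) M (restrict_module (direct_sum {..<n} (\<lambda>_. N)) H))"

definition E_dagger ::
  "'v set \<Rightarrow> ('v \<times> 'v) set \<Rightarrow> 'v \<Rightarrow> ('v preproj, 'm) module \<Rightarrow> ('v preproj, 'm set) module" where
  "E_dagger I \<Omega> i M =
    (let \<Lambda> = preprojective_algebra I \<Omega> in
     quotient_module M (isotypic_component \<Lambda> (simple_at i) (restrict_module M (socle \<Lambda> M))))"

text \<open>\<open>T_dagger I \<Omega> Q ws M\<close> says that \<open>M\<close> is (up to isomorphism) the module obtained from the word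
  \<open>ws\<close> and the indecomposable injectives \<open>Q i\<close>; the suffix \<open>(i\<^sub>k, \<dots>, i\<^sub>r)\<close> of \<open>(i\<^sub>1, \<dots>, i\<^sub>r)\<close>
  corresponds to the intermediate module with index \<open>k\<close>.\<close>

primrec T_dagger ::
  "'v set \<Rightarrow> ('v \<times> 'v) set \<Rightarrow> ('v \<Rightarrow> 'v preproj_mod) \<Rightarrow> 'v list \<Rightarrow> 'v preproj_mod \<Rightarrow> bool" where
  "T_dagger I \<Omega> Q [] M \<longleftrightarrow> fd_module I \<Omega> M \<and>
    module_iso (preprojective_algebra I \<Omega>) M (direct_sum I Q)"
| "T_dagger I \<Omega> Q (i # ws) M \<longleftrightarrow> fd_module I \<Omega> M \<and>
    (\<exists>N. T_dagger I \<Omega> Q ws N \<and>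
      module_iso (preprojective_algebra I \<Omega>) M (direct_sum2 (E_dagger I \<Omega> i N) (Q i)))"

definition num_summands_in_Sub ::
  "'v set \<Rightarrow> ('v \<times> 'v) set \<Rightarrow> ('v preproj, 'n) module \<Rightarrow> ('v preproj, 'm) module \<Rightarrow> nat" where
  "num_summands_in_Sub I \<Omega> N T =
    (let \<Lambda> = preprojective_algebra I \<Omega>;
         \<H> = {H. direct_summand \<Lambda> T H \<and> indecomposable \<Lambda> (restrict_module T H) \<and>
                  in_Sub I \<Omega> N (restrict_module T H)}
     in card (\<H> // {(H, H') \<in> \<H> \<times> \<H>. module_iso \<Lambda> (restrict_module T H) (restrict_module T H')}))"

end

theory Submission
  imports Defs "HOL-Library.Function_Algebras"
begin

text \<open>
  For a submodule \<open>Z\<close> of a module \<open>M\<close> and a vertex \<open>i\<close>, let \<open>\<sigma>\<^sub>i Z\<close> be the largest submodule containing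
  \<open>Z\<close> that agrees with \<open>Z\<close> at all other vertices, and \<open>\<rho>\<^sub>i Z\<close> the smallest submodule of \<open>Z\<close> that does;
  the two operators are adjoint. As \<open>\<sigma>\<^sub>i 0\<close> is the \<open>S\<^sub>i\<close>-isotypic part of the socle, the functor that
  defines \<open>T\<close> sends a quotient \<open>Q\<^sub>j/Z\<close> to \<open>Q\<^sub>j/\<sigma>\<^sub>i Z\<close>. Unfolding the recursion therefore writes \<open>T\<close> as the
  direct sum of the modules \<open>Q\<^sub>j/\<sigma>\<^sub>u 0\<close>, where \<open>\<sigma>\<^sub>u\<close> composes the operators along a word \<open>u\<close> and \<open>(j, u)\<close>
  is either \<open>(j, ws)\<close> with \<open>j\<close> in \<open>I\<close> or consists of a letter of \<open>ws\<close> and the prefix in front of it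
  (\<open>T_dagger_summand_maps\<close>). Everything else is a study of the submodules \<open>\<sigma>\<^sub>u 0\<close> of \<open>Q\<^sub>j\<close>.

  The operators satisfy the braid relations, so \<open>\<sigma>\<^sub>u\<close> depends only on the Weyl group element of a
  reduced word \<open>u\<close>, and \<open>\<sigma>\<^sub>i\<close> does nothing after \<open>\<sigma>\<^sub>u\<close> if \<open>i u\<close> is not reduced (\<open>sig_word\<close>, \<open>sig_descent\<close>).
  Their dimensions are controlled by injectivity: since there are no extensions of \<open>S\<^sub>i\<close> by \<open>Q\<^sub>j\<close>, the
  sequence that leads from the vertex \<open>i\<close> of \<open>Q\<^sub>j\<close> to its neighbours and back is exact in the middle,
  and counting dimensions gives \<open>dim (\<sigma>\<^sub>i Z)\<^sub>i + dim (\<rho>\<^sub>i Z)\<^sub>i = \<delta>\<^sub>i\<^sub>j + (\<Sum>k adjacent to i. dim Z\<^sub>k)\<close>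
  (\<open>dimension_identity\<close>). Hence \<open>\<sigma>\<^sub>i\<close> acts on \<open>\<varpi>\<^sub>j - dim Z\<close>, where \<open>\<varpi>\<^sub>j\<close> is the fundamental weight, as the
  reflection \<open>s\<^sub>i\<close> up to subtracting a nonnegative multiple of \<open>\<alpha>\<^sub>i\<close>. Along a reduced word of the longest element
  these errors, together with those of the \<open>\<rho>\<close>-filtration going down, add up to a nonnegative combination of
  positive roots that is zero; so there are no errors, and \<open>\<sigma>\<^sub>u 0\<close> has dimension vector \<open>\<varpi>\<^sub>j - u \<varpi>\<^sub>j\<close> for
  every reduced \<open>u\<close> (\<open>dimvec_sig\<close>). That the \<open>\<sigma>\<close>-filtration exhausts \<open>Q\<^sub>j\<close> comes from the positive definiteness
  of the form of a Dynkin diagram, which forces every simple subquotient to be one of the \<open>S\<^sub>i\<close> (\<open>socle_step\<close>).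

  The count is read off from these dimensions. The summands \<open>(j, ws)\<close> vanish, and those given by the \<open>r\<close>
  letters of \<open>ws\<close> do not. Each \<open>Q\<^sub>j\<close> has a simple top, at the vertex \<open>i\<close> with \<open>w\<^sub>0 \<alpha>\<^sub>i = - \<alpha>\<^sub>j\<close>,
  so the latter summands are indecomposable; those for different \<open>j\<close> have different tops, and those for the
  same \<open>j\<close> have different dimensions. Finally, a module lies in \<open>Sub Q\<^sub>J\<close> exactly if its socle lives on \<open>J\<close>,
  and \<open>Q\<^sub>j/\<sigma>\<^sub>u 0\<close> has \<open>S\<^sub>i\<close> in its socle exactly if \<open>\<sigma>\<^sub>i\<close> moves \<open>\<sigma>\<^sub>u 0\<close>. A prefix \<open>u\<close> of length at least
  \<open>r\<^sub>K\<close> starts with the longest element of \<open>W\<^sub>K\<close>, so no \<open>\<sigma>\<^sub>i\<close> with \<open>i\<close> in \<open>K\<close> moves anything; for a shorter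
  prefix, whose next letter \<open>j\<close> also lies in \<open>K\<close>, some \<open>\<sigma>\<^sub>i\<close> with \<open>i\<close> in \<open>K\<close> does, by positivity of the root
  \<open>u \<alpha>\<^sub>j\<close>. Thus exactly the letters after the first \<open>r\<^sub>K\<close> contribute, and Krull-Schmidt turns this into a
  statement about arbitrary indecomposable summands.
\<close>

section \<open>Words and roots of a simply laced diagram\<close>

locale simple_graph =
  fixes I :: "'v set" and E :: "'v set set"
  assumes finite_I: "finite I"
    and edgeD: "{i, k} \<in> E \<Longrightarrow> i \<in> I \<and> k \<in> I \<and> i \<noteq> k"
begin

abbreviation nb :: "'v \<Rightarrow> 'v set" where "nb i \<equiv> {k. {i, k} \<in> E}"
abbreviation s :: "'v \<Rightarrow> ('v \<Rightarrow> int) \<Rightarrow> ('v \<Rightarrow> int)" where "s \<equiv> simple_reflection E"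
abbreviation \<alpha> :: "'v \<Rightarrow> ('v \<Rightarrow> int)" where "\<alpha> \<equiv> simple_root"
abbreviation wp :: "'v list \<Rightarrow> ('v \<Rightarrow> int) \<Rightarrow> ('v \<Rightarrow> int)" where "wp \<equiv> word_prod E"
abbreviation len :: "(('v \<Rightarrow> int) \<Rightarrow> ('v \<Rightarrow> int)) \<Rightarrow> nat" where "len \<equiv> coxeter_length I E"

text \<open>The pairing of \<open>x\<close> with the simple coroot at \<open>i\<close>.\<close>

definition coroot :: "'v \<Rightarrow> ('v \<Rightarrow> int) \<Rightarrow> int" where
  "coroot i x = 2 * x i - (\<Sum>k\<in>nb i. x k)"

lemma finite_nb [simp]: "finite (nb i)"
  by (rule finite_subset[OF _ finite_I]) (use edgeD in blast)

lemma not_nb_self [simp]: "{i} \<notin> E"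
  using edgeD[of i i] by auto

lemma s_apply: "s i x k = x k - (if k = i then coroot i x else 0)"
  by (simp add: simple_reflection_def coroot_def)

lemma coroot_add: "coroot i (x + y) = coroot i x + coroot i y"
  by (simp add: coroot_def sum.distrib algebra_simps)

lemma coroot_scale: "coroot i (\<lambda>k. c * x k) = c * coroot i x"
  by (simp add: coroot_def sum_distrib_left algebra_simps)

lemma coroot_root: "coroot i (\<alpha> k) = (if i = k then 2 else if {i, k} \<in> E then -1 else 0)"
proof -
  have "(\<Sum>l\<in>nb i. \<alpha> k l) = (\<Sum>l\<in>nb i. if l = k then 1 else 0)"
    by (simp add: simple_root_def)
  also have "\<dots> = (if {i, k} \<in> E then 1 else 0)" by (subst sum.delta) auto
  finally show ?thesis by (auto simp: coroot_def simple_root_def)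
qed

lemma s_add: "s i (x + y) = s i x + s i y"
  by (rule ext) (simp add: s_apply coroot_add)

lemma s_scale: "s i (\<lambda>k. c * x k) = (\<lambda>k. c * s i x k)"
  by (rule ext) (simp add: s_apply coroot_scale algebra_simps)

lemma s_eq: "s i x = x + (\<lambda>k. - coroot i x * \<alpha> i k)"
  by (rule ext) (simp add: s_apply simple_root_def)

lemma coroot_s: "coroot j (s i x) = coroot j x - coroot i x * coroot j (\<alpha> i)"
  unfolding s_eq coroot_add coroot_scale by simp

lemma s_s [simp]: "s i (s i x) = x"
  by (rule ext) (simp add: s_apply coroot_s coroot_root)

lemma s_comm: "{i, j} \<notin> E \<Longrightarrow> s i (s j x) = s j (s i x)"
  by (cases "i = j") (auto simp: s_apply coroot_s coroot_root insert_commute)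

lemma s_braid: "{i, j} \<in> E \<Longrightarrow> s i (s j (s i x)) = s j (s i (s j x))"
  using edgeD[of i j]
  by (auto simp: s_apply coroot_s coroot_root insert_commute)

lemma s_root_self: "s i (\<alpha> i) = - \<alpha> i"
  by (rule ext) (simp add: s_apply coroot_root, simp add: simple_root_def)

lemma s_root_far: "i \<noteq> j \<Longrightarrow> {i, j} \<notin> E \<Longrightarrow> s i (\<alpha> j) = \<alpha> j"
  by (rule ext) (simp add: s_apply coroot_root)

lemma s_root_near: "{i, j} \<in> E \<Longrightarrow> s i (\<alpha> j) = \<alpha> i + \<alpha> j"
  by (rule ext) (use edgeD[of i j] in \<open>simp add: s_apply coroot_root; simp add: simple_root_def\<close>)

lemma wp_Nil [simp]: "wp [] = id" and wp_Cons [simp]: "wp (i # u) = s i \<circ> wp u"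
  by (simp_all add: word_prod_def)

lemma wp_append [simp]: "wp (u @ v) = wp u \<circ> wp v"
  by (induction u) (auto simp: comp_assoc)

lemma wp_rev [simp]: "wp u (wp (rev u) x) = x" "wp (rev u) (wp u x) = x"
  by (induction u arbitrary: x) auto

lemma wp_add: "wp u (x + y) = wp u x + wp u y"
  by (induction u) (simp_all only: wp_Nil wp_Cons id_apply comp_apply s_add)

lemma wp_scale: "wp u (\<lambda>k. c * x k) = (\<lambda>k. c * wp u x k)"
  by (induction u) (auto simp: s_scale)

lemma wp_uminus: "wp u (- x) = - wp u x"
  using wp_scale[of u "-1" x] by (simp add: fun_Compl_def)

lemma wp_zero [simp]: "wp u 0 = 0"
  using wp_add[of u 0 0] by (metis add_cancel_right_left add_0)

lemma wp_sum: "wp u (sum f A) = (\<Sum>a\<in>A. wp u (f a))"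
proof (induction A rule: infinite_finite_induct)
  case (insert a A)
  then show ?case by (metis sum.insert wp_add)
qed (metis sum.infinite wp_zero, metis sum.empty wp_zero)

lemma wp_inj: "wp u x = wp u y \<Longrightarrow> x = y"
  by (metis wp_rev(2))

lemma wp_rev_eq: "wp u = wp v \<Longrightarrow> wp (rev u) = wp (rev v)"
  by (rule ext) (metis wp_rev)

lemma root_nonneg [simp]: "0 \<le> \<alpha> i" and root_nonzero [simp]: "\<alpha> i \<noteq> 0"
  and root_self [simp]: "\<alpha> i i = 1"
  by (auto simp: simple_root_def le_fun_def fun_eq_iff)

lemma root_inj: "\<alpha> i = \<alpha> j \<Longrightarrow> i = j"
  by (metis root_self simple_root_def zero_neq_one)

definition supp_in :: "'v set \<Rightarrow> ('v \<Rightarrow> int) \<Rightarrow> bool" where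
  "supp_in A x \<longleftrightarrow> (\<forall>k. k \<notin> A \<longrightarrow> x k = 0)"

lemma supp_in_root [simp]: "supp_in A (\<alpha> i) \<longleftrightarrow> i \<in> A"
  by (auto simp: supp_in_def simple_root_def)

lemma wp_outside: "k \<notin> set u \<Longrightarrow> wp u x k = x k"
  by (induction u) (auto simp: s_apply)

lemma supp_in_wp: "set u \<subseteq> A \<Longrightarrow> supp_in A x \<Longrightarrow> supp_in A (wp u x)"
  unfolding supp_in_def using wp_outside by (metis subsetD)

lemma len_le: "set u \<subseteq> I \<Longrightarrow> len (wp u) \<le> length u"
  unfolding coxeter_length_def by (rule Least_le) auto

lemma len_word: assumes "set u \<subseteq> I"
  obtains v where "set v \<subseteq> I" "wp v = wp u" "length v = len (wp u)"
proof -
  have "\<exists>ws. set ws \<subseteq> I \<and> length ws = len (wp u) \<and> word_prod E ws = wp u"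
    unfolding coxeter_length_def by (rule LeastI) (use assms in auto)
  then show thesis using that by auto
qed

definition red :: "'v list \<Rightarrow> bool" where
  "red u \<longleftrightarrow> set u \<subseteq> I \<and> length u = len (wp u)"

lemma red_word: assumes "set u \<subseteq> I"
  obtains v where "red v" "wp v = wp u"
  using len_word[OF assms] by (metis red_def)

lemma redD: "red u \<Longrightarrow> set u \<subseteq> I" "red u \<Longrightarrow> length u = len (wp u)"
  by (auto simp: red_def)

lemma red_letters: "red u \<Longrightarrow> x \<in> set u \<Longrightarrow> x \<in> I"
  by (auto simp: red_def)

lemma red_le: "red u \<Longrightarrow> set v \<subseteq> I \<Longrightarrow> wp v = wp u \<Longrightarrow> length u \<le> length v"
  using len_le[of v] by (simp add: red_def)

lemma redI: "set u \<subseteq> I \<Longrightarrow> (\<And>v. set v \<subseteq> I \<Longrightarrow> wp v = wp u \<Longrightarrow> length u \<le> length v) \<Longrightarrow> red u"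
  using len_word[of u] len_le[of u] by (metis red_def le_antisym)

lemma red_appendD: assumes "red (u @ v)" shows "red u" "red v"
proof -
  show "red u"
  proof (rule redI)
    show "set u \<subseteq> I" using assms by (auto dest: red_letters)
    fix u' assume "set u' \<subseteq> I" "wp u' = wp u"
    then have "length (u @ v) \<le> length (u' @ v)"
      using assms by (intro red_le) (auto dest: red_letters)
    then show "length u \<le> length u'" by simp
  qed
  show "red v"
  proof (rule redI)
    show "set v \<subseteq> I" using assms by (auto dest: red_letters)
    fix v' assume "set v' \<subseteq> I" "wp v' = wp v"
    then have "length (u @ v) \<le> length (u @ v')"
      using assms by (intro red_le) (auto dest: red_letters)
    then show "length v \<le> length v'" by simp
  qed
qed

lemma red_rev: assumes "red u" shows "red (rev u)"
proof (rule redI)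
  show "set (rev u) \<subseteq> I" using assms by (auto dest: red_letters)
  fix v assume v: "set v \<subseteq> I" "wp v = wp (rev u)"
  then have "wp (rev v) = wp u" using wp_rev_eq[of v "rev u"] by simp
  then show "length (rev u) \<le> length v" using red_le[OF assms, of "rev v"] v by simp
qed

lemma red_Nil [simp]: "red []"
  by (rule redI) auto

text \<open>By induction on the length: split off the last letter \<open>j\<close> of a reduced
  word. If \<open>i\<close> and \<open>j\<close> are not adjacent, \<open>s\<^sub>j\<close> fixes \<open>\<alpha>\<^sub>i\<close> and commutes with \<open>s\<^sub>i\<close>; if they are, one reduces
  modulo the dihedral subgroup that they generate, using the braid relation.\<close>

lemma root_positive_of_no_descent:
  "set u \<subseteq> I \<Longrightarrow> i \<in> I \<Longrightarrow> len (wp u) \<le> len (wp (u @ [i])) \<Longrightarrow> 0 \<le> wp u (\<alpha> i)"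
proof (induction "len (wp u)" arbitrary: u i rule: less_induct)
  case less
  obtain u' where u': "red u'" "wp u' = wp u" using red_word[OF less.prems(1)] .
  show ?case
  proof (cases u' rule: rev_cases)
    case Nil
    then show ?thesis using u' by (metis wp_Nil id_apply root_nonneg)
  next
    case (snoc v j)
    have v: "red v" "set v \<subseteq> I" "j \<in> I"
      using u' snoc red_appendD[of v "[j]"] redD(1)[of u'] by auto
    have n: "len (wp u) = Suc (length v)"
      using u' snoc redD(2)[of u'] by simp
    have wu: "wp u = wp v \<circ> s j" using u' snoc by simp
    have lv: "len (wp v) = length v" using v(1) by (simp add: red_def)
    have ij: "i \<noteq> j"
    proof
      assume "i = j"
      then have "wp (u @ [i]) = wp v" using wu by (auto simp: fun_eq_iff)
      then show False using less.prems(3) n lv by simp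
    qed
    have lvj: "0 \<le> wp v (\<alpha> j)"
      by (rule less.hyps) (use n lv v wu in auto)
    show ?thesis
    proof (cases "{i, j} \<in> E")
      case False
      have "len (wp v) \<le> len (wp (v @ [i]))"
      proof (rule ccontr)
        assume c: "\<not> ?thesis"
        obtain x where x: "red x" "wp x = wp (v @ [i])" using red_word[of "v @ [i]"] v less.prems(2) by auto
        have "wp (x @ [j]) = wp (u @ [i])"
          by (rule ext) (simp add: x wu s_comm[OF False])
        then have "len (wp (u @ [i])) \<le> Suc (length x)"
          using len_le[of "x @ [j]"] x v by (auto dest: redD)
        moreover have "length x = len (wp (v @ [i]))" using x by (simp add: red_def)
        ultimately show False using c n lv less.prems(3) by linarith
      qed
      then have "0 \<le> wp v (\<alpha> i)" using less.hyps[of v i] n lv v less.prems(2) by simp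
      then show ?thesis using wu s_root_far[of j i] False ij by (simp add: insert_commute)
    next
      case True
      then have E': "{j, i} \<in> E" by (simp add: insert_commute)
      have wui: "wp u (\<alpha> i) = wp v (\<alpha> j) + wp v (\<alpha> i)"
        using wu s_root_near[OF E'] by (simp add: wp_add)
      show ?thesis
      proof (cases "len (wp v) \<le> len (wp (v @ [i]))")
        case True
        then have "0 \<le> wp v (\<alpha> i)" using less.hyps[of v i] n lv v less.prems(2) by simp
        then show ?thesis using lvj wui by (simp add: le_fun_def)
      next
        case F: False
        obtain x where x: "red x" "wp x = wp (v @ [i])" using red_word[of "v @ [i]"] v less.prems(2) by auto
        have lx: "length x = len (wp x)" "len (wp x) < len (wp v)" using x F by (auto simp: red_def)
        have wv: "wp v = wp x \<circ> s i" using x by (auto simp: fun_eq_iff)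
        have "len (wp x) \<le> len (wp (x @ [j]))"
        proof (rule ccontr)
          assume c: "\<not> ?thesis"
          obtain y where y: "red y" "wp y = wp (x @ [j])" using red_word[of "x @ [j]"] v x(1) redD(1) by auto
          have "wp (y @ [i, j]) = wp (u @ [i])"
            by (rule ext) (simp add: y wu wv s_braid[OF True])
          then have "len (wp (u @ [i])) \<le> length y + 2"
            using len_le[of "y @ [i, j]"] y v less.prems(2) by (auto dest: redD)
          moreover have "length y = len (wp (x @ [j]))" using y by (simp add: red_def)
          ultimately show False using c n lv lx less.prems(3) by linarith
        qed
        then have "0 \<le> wp x (\<alpha> j)"
          using less.hyps[of x j] n lv lx v x(1) by (auto dest: redD)
        moreover have "s i (s j (\<alpha> i)) = \<alpha> j"
          unfolding s_root_near[OF E'] s_add s_root_near[OF True] s_root_self by (rule ext) simp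
        then have "wp u (\<alpha> i) = wp x (\<alpha> j)"
          using wu wv by simp
        ultimately show ?thesis by simp
      qed
    qed
  qed
qed

lemma red_snoc_pos: "red (u @ [i]) \<Longrightarrow> 0 \<le> wp u (\<alpha> i)"
  using red_appendD(1)[of u "[i]"] redD[of "u @ [i]"] redD(2)[of u]
  by (intro root_positive_of_no_descent) auto

lemma not_red_snoc:
  assumes "red u" "i \<in> I" "\<not> red (u @ [i])"
  obtains v where "red (v @ [i])" "wp (v @ [i]) = wp u"
proof -
  have uI: "set u \<subseteq> I" using assms by (auto dest: redD)
  obtain x where x: "red x" "wp x = wp (u @ [i])" using red_word[of "u @ [i]"] uI assms(2) by auto
  have xu: "wp (x @ [i]) = wp u" using x by (auto simp: fun_eq_iff)
  have xI: "set (x @ [i]) \<subseteq> I" using x(1) assms(2) by (auto dest: redD)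
  have l1: "length x \<noteq> Suc (length u)" using assms uI x by (auto simp: red_def)
  have l2: "length x \<le> Suc (length u)" using red_le[OF x(1), of "u @ [i]"] x uI assms by auto
  have l3: "length u \<le> Suc (length x)" using red_le[OF assms(1), of "x @ [i]"] xu xI by auto
  \<comment> \<open>Equal lengths would make both \<open>\<alpha>\<^sub>i\<close> and \<open>s\<^sub>i \<alpha>\<^sub>i = - \<alpha>\<^sub>i\<close> stay positive.\<close>
  have l4: "length x \<noteq> length u"
  proof
    assume eq: "length x = length u"
    have a: "0 \<le> wp u (\<alpha> i)"
      using x eq assms by (intro root_positive_of_no_descent) (auto simp: red_def)
    have b: "0 \<le> wp x (\<alpha> i)"
      by (rule root_positive_of_no_descent) (use x xu eq assms redD in auto)
    have "wp u (\<alpha> i) = - wp x (\<alpha> i)" using xu s_root_self by (metis comp_apply wp_append wp_Cons wp_Nil id_comp comp_id wp_uminus)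
    then have "wp u (\<alpha> i) = 0" using a b by (auto simp: le_fun_def fun_eq_iff) (metis add.inverse_neutral neg_le_0_iff_le order_antisym)
    then show False using wp_inj[of u "\<alpha> i" 0] by simp
  qed
  have "red (x @ [i])"
  proof (rule redI)
    show "set (x @ [i]) \<subseteq> I" by fact
    fix v assume "set v \<subseteq> I" "wp v = wp (x @ [i])"
    then have "length u \<le> length v" using red_le[OF assms(1)] xu by simp
    then show "length (x @ [i]) \<le> length v" using l1 l2 l3 l4 by simp
  qed
  then show thesis using that xu by blast
qed

lemma not_red_snoc_neg: assumes "red u" "i \<in> I" "\<not> red (u @ [i])" shows "wp u (\<alpha> i) \<le> 0"
proof -
  obtain v where v: "red (v @ [i])" "wp (v @ [i]) = wp u" using not_red_snoc[OF assms] .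
  have "wp u (\<alpha> i) = - wp v (\<alpha> i)"
    using v(2) s_root_self by (metis comp_apply wp_append wp_Cons wp_Nil id_comp comp_id wp_uminus)
  then show ?thesis using red_snoc_pos[OF v(1)] by (auto simp: le_fun_def)
qed

lemma root_sign: assumes "set u \<subseteq> I" "i \<in> I" shows "0 \<le> wp u (\<alpha> i) \<or> wp u (\<alpha> i) \<le> 0"
proof -
  obtain v where "red v" "wp v = wp u" using red_word[OF assms(1)] .
  then show ?thesis using red_snoc_pos[of v i] not_red_snoc_neg[of v i] assms(2) by metis
qed

lemma red_Cons_pos: "red (i # u) \<Longrightarrow> 0 \<le> wp (rev u) (\<alpha> i)"
  using red_rev[of "i # u"] red_snoc_pos[of "rev u" i] by simp

lemma not_red_Cons:
  assumes "red u" "i \<in> I" "\<not> red (i # u)"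
  obtains v where "red (i # v)" "wp (i # v) = wp u"
proof -
  have "\<not> red (rev u @ [i])" using red_rev[of "rev u @ [i]"] assms(3) by auto
  then obtain v where v: "red (v @ [i])" "wp (v @ [i]) = wp (rev u)"
    using not_red_snoc[OF red_rev[OF assms(1)] assms(2)] by blast
  have "red (i # rev v)" using red_rev[OF v(1)] by simp
  moreover have "wp (i # rev v) = wp u" using wp_rev_eq[OF v(2)] by simp
  ultimately show thesis using that by blast
qed

lemma not_red_Cons_neg: assumes "red u" "i \<in> I" "\<not> red (i # u)" shows "wp (rev u) (\<alpha> i) \<le> 0"
  using not_red_snoc_neg[OF red_rev[OF assms(1)] assms(2)] assms(3) red_rev[of "rev u @ [i]"] by auto

lemma root_expansion: assumes "supp_in I x" shows "x = (\<Sum>i\<in>I. (\<lambda>k. x i * \<alpha> i k))"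
proof (rule ext)
  fix k
  have "(\<Sum>i\<in>I. (\<lambda>k. x i * \<alpha> i k)) k = (\<Sum>i\<in>I. x i * \<alpha> i k)"
    using finite_I by (induction I) auto
  also have "\<dots> = (\<Sum>i\<in>I. if i = k then x i else 0)" by (rule sum.cong) (auto simp: simple_root_def)
  also have "\<dots> = x k" using assms finite_I by (auto simp: supp_in_def)
  finally show "x k = (\<Sum>i\<in>I. (\<lambda>k. x i * \<alpha> i k)) k" by simp
qed

lemma wp_expansion: assumes "supp_in I x" shows "wp u x k = (\<Sum>i\<in>I. x i * wp u (\<alpha> i) k)"
proof -
  have "wp u x = (\<Sum>i\<in>I. wp u (\<lambda>k. x i * \<alpha> i k))"
    by (subst root_expansion[OF assms]) (rule wp_sum)
  also have "\<dots> = (\<Sum>i\<in>I. (\<lambda>k. x i * wp u (\<alpha> i) k))" by (simp only: wp_scale)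
  finally have "wp u x k = (\<Sum>i\<in>I. (\<lambda>k. x i * wp u (\<alpha> i) k)) k" by simp
  also have "\<dots> = (\<Sum>i\<in>I. x i * wp u (\<alpha> i) k)"
    using finite_I by (induction I) auto
  finally show ?thesis .
qed

lemma reflection_in_Bij: "s i \<in> Bij UNIV"
  unfolding Bij_def extensional_def by (auto intro!: bij_betwI[of _ _ _ "s i"])

lemma wp_in_Bij: "wp u \<in> Bij UNIV"
  unfolding Bij_def extensional_def by (auto intro!: bij_betwI[of _ _ _ "wp (rev u)"])

lemma BijGroup_mult: "f \<in> Bij UNIV \<Longrightarrow> g \<in> Bij UNIV \<Longrightarrow> f \<otimes>\<^bsub>BijGroup UNIV\<^esub> g = f \<circ> g"
  by (auto simp: BijGroup_def compose_def fun_eq_iff)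

lemma weyl_group_words: "weyl_group E K = wp ` {u. set u \<subseteq> K}"
proof (intro equalityI subsetI)
  interpret B: group "BijGroup UNIV" by (rule group_BijGroup)
  fix w assume "w \<in> weyl_group E K"
  then have "w \<in> generate (BijGroup UNIV) (s ` K)" by (simp add: weyl_group_def)
  then show "w \<in> wp ` {u. set u \<subseteq> K}"
  proof induction
    case one
    have "\<one>\<^bsub>BijGroup UNIV\<^esub> = wp []" by (auto simp: BijGroup_def fun_eq_iff)
    then show ?case by (intro image_eqI[of _ _ "[]"]) auto
  next
    case (incl h)
    then obtain i where "i \<in> K" "h = wp [i]" by auto
    then show ?case by (intro image_eqI[of _ _ "[i]"]) auto
  next
    case (inv h)
    then obtain i where i: "i \<in> K" "h = s i" by auto
    have "inv\<^bsub>BijGroup UNIV\<^esub> (s i) = s i"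
      by (rule B.inv_equality)
        (use reflection_in_Bij in \<open>auto simp: BijGroup_mult fun_eq_iff, auto simp: BijGroup_def\<close>)
    then have "inv\<^bsub>BijGroup UNIV\<^esub> h = wp [i]" using i by auto
    then show ?case using i by (intro image_eqI[of _ _ "[i]"]) auto
  next
    case (eng h1 h2)
    then obtain u v where "set u \<subseteq> K" "h1 = wp u" "set v \<subseteq> K" "h2 = wp v" by auto
    then show ?case
      by (intro image_eqI[of _ _ "u @ v"]) (auto simp: BijGroup_mult wp_in_Bij)
  qed
next
  fix w assume "w \<in> wp ` {u. set u \<subseteq> K}"
  then obtain u where "set u \<subseteq> K" "w = wp u" by auto
  then show "w \<in> weyl_group E K"
  proof (induction u arbitrary: w)
    case Nil
    have "w = \<one>\<^bsub>BijGroup UNIV\<^esub>" using Nil by (auto simp: BijGroup_def fun_eq_iff)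
    then show ?case unfolding weyl_group_def by (simp only: generate.one)
  next
    case (Cons i u)
    have "s i \<in> weyl_group E K" using Cons.prems by (auto simp: weyl_group_def intro: generate.incl)
    moreover have "wp u \<in> weyl_group E K" using Cons by auto
    ultimately have "s i \<otimes>\<^bsub>BijGroup UNIV\<^esub> wp u \<in> weyl_group E K"
      unfolding weyl_group_def by (rule generate.eng)
    then show ?case by (simp only: Cons.prems(2) wp_Cons BijGroup_mult wp_in_Bij reflection_in_Bij)
  qed
qed

lemma reduced_word_red: "reduced_word I E w u \<longleftrightarrow> red u \<and> wp u = w"
  by (auto simp: reduced_word_def red_def)

lemma longest_no_ascent:
  assumes "longest_element I E K (wp u)" "red u" "K \<subseteq> I" "i \<in> K"
  shows "\<not> red (i # u)" "\<not> red (u @ [i])"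
proof -
  have w: "wp u \<in> weyl_group E K" and m: "\<And>v. v \<in> weyl_group E K \<Longrightarrow> len v \<le> len (wp u)"
    using assms(1) by (auto simp: longest_element_def)
  obtain v where v: "set v \<subseteq> K" "wp v = wp u" using w by (auto simp: weyl_group_words)
  have "wp (i # u) = wp (i # v)" "wp (u @ [i]) = wp (v @ [i])" using v by auto
  then have "wp (i # u) \<in> weyl_group E K" "wp (u @ [i]) \<in> weyl_group E K"
    using v assms(4) unfolding weyl_group_words
    by (metis (mono_tags, lifting) imageI insert_subset list.simps(15) mem_Collect_eq)
      (metis (mono_tags, lifting) \<open>wp (u @ [i]) = wp (v @ [i])\<close> assms(4) empty_set imageI insert_subset list.simps(15) mem_Collect_eq set_append sup.bounded_iff v(1) empty_subsetI)
  from this[THEN m] show "\<not> red (i # u)" "\<not> red (u @ [i])"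
    using assms(2) by (auto simp: red_def)
qed

lemma longest_neg:
  assumes "longest_element I E K (wp u)" "red u" "K \<subseteq> I" "i \<in> K"
  shows "wp (rev u) (\<alpha> i) \<le> 0" "wp u (\<alpha> i) \<le> 0"
  using not_red_Cons_neg[of u i] not_red_snoc_neg[of u i] longest_no_ascent[OF assms] assms by auto

text \<open>If \<open>k\<close> is the first letter outside \<open>K\<close>, the root \<open>\<beta>\<close> that it inverts has coefficient \<open>1\<close> at \<open>k\<close>.
  An element of the parabolic subgroup keeps this coefficient, whereas reducedness makes the image of
  \<open>\<beta>\<close> negative.\<close>

lemma parabolic_letters:
  assumes "wp u \<in> weyl_group E K" "red u" shows "set u \<subseteq> K"
proof (rule ccontr)
  assume "\<not> set u \<subseteq> K"
  then obtain a k b where u: "u = a @ k # b" "k \<notin> K" "\<forall>x\<in>set a. x \<in> K"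
    using split_list_first_prop[of u "\<lambda>x. x \<notin> K"] by blast
  obtain v where v: "set v \<subseteq> K" "wp v = wp u" using assms(1) by (auto simp: weyl_group_words)
  define \<beta> where "\<beta> = wp a (\<alpha> k)"
  have "\<beta> k = 1" unfolding \<beta>_def using wp_outside[of k a "\<alpha> k"] u by auto
  moreover have "wp (rev u) \<beta> k = \<beta> k"
    using wp_outside[of k "rev v" \<beta>] v u wp_rev_eq[OF v(2)] by auto
  moreover have "wp (rev u) \<beta> = - wp (rev b) (\<alpha> k)"
    by (simp add: u \<beta>_def s_root_self wp_uminus)
  moreover have "red (k # b)" using red_appendD(2)[of a "k # b"] assms(2) u by simp
  ultimately show False using red_Cons_pos[of k b] by (auto simp: le_fun_def dest: spec[of _ k])
qed

lemma positive_rootE: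
  assumes "x \<in> positive_roots I E"
  obtains u i where "set u \<subseteq> I" "i \<in> I" "x = wp u (\<alpha> i)" "0 \<le> x" "supp_in I x"
  using assms supp_in_wp[of _ I "\<alpha> _"] unfolding positive_roots_def weyl_group_words
  by (auto simp: le_fun_def)

lemma positive_rootI: "set u \<subseteq> I \<Longrightarrow> i \<in> I \<Longrightarrow> 0 \<le> wp u (\<alpha> i) \<Longrightarrow> wp u (\<alpha> i) \<in> positive_roots I E"
  unfolding positive_roots_def weyl_group_words by (auto simp: le_fun_def)

text \<open>A positive root other than \<open>\<alpha>\<^sub>i\<close> has a positive coefficient away from \<open>i\<close>, because \<open>\<alpha>\<^sub>i\<close> is the only positive
  multiple of \<open>\<alpha>\<^sub>i\<close> that is a root. The reflection \<open>s\<^sub>i\<close> does not change this coefficient.\<close>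

lemma reflect_positive_root:
  assumes x: "x \<in> positive_roots I E" and "i \<in> I" "x \<noteq> \<alpha> i"
  shows "s i x \<in> positive_roots I E"
proof -
  obtain u j where u: "set u \<subseteq> I" "j \<in> I" "x = wp u (\<alpha> j)" "0 \<le> x" "supp_in I x"
    using positive_rootE[OF x] .
  have sx: "s i x = wp (i # u) (\<alpha> j)" using u by simp
  have iu: "set (i # u) \<subseteq> I" using u assms by auto
  have "0 \<le> s i x"
  proof (rule ccontr)
    assume c: "\<not> 0 \<le> s i x"
    then have neg: "s i x \<le> 0" using root_sign[OF iu u(2)] sx by simp
    have z: "x k = 0" if "k \<noteq> i" for k
      using neg u(4) that by (force simp: le_fun_def s_apply dest: spec[of _ k])
    then have xi: "x = (\<lambda>k. x i * \<alpha> i k)" by (auto simp: simple_root_def fun_eq_iff)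
    have "\<alpha> j = (\<lambda>k. x i * wp (rev u) (\<alpha> i) k)"
      using u(3) xi wp_scale[of "rev u" "x i" "\<alpha> i"] by (metis wp_rev(2))
    then have "1 = x i * wp (rev u) (\<alpha> i) j" by (metis root_self)
    then have "x i dvd 1" by (metis dvd_triv_left)
    then have "x i = 1" using u(4) by (auto simp: le_fun_def dest: spec[of _ i])
    then show False using xi assms(3) by simp
  qed
  then show ?thesis using sx positive_rootI[OF iu u(2)] by simp
qed

definition inversions :: "'v list \<Rightarrow> ('v \<Rightarrow> int) set" where
  "inversions u = {x \<in> positive_roots I E. wp (rev u) x \<le> 0}"

lemma root_pos: "i \<in> I \<Longrightarrow> \<alpha> i \<in> positive_roots I E"
  using positive_rootI[of "[]" i] by simp

lemma not_root_nonpos: "0 \<le> x \<Longrightarrow> x \<le> 0 \<Longrightarrow> x = (0 :: 'v \<Rightarrow> int)"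
  by (rule order_antisym)

lemma inversions_Cons:
  assumes "red (i # u)"
  shows "inversions (i # u) = insert (\<alpha> i) (s i ` inversions u)" "\<alpha> i \<notin> s i ` inversions u"
proof -
  have i: "i \<in> I" using assms by (auto dest: red_letters)
  have pos: "0 \<le> wp (rev u) (\<alpha> i)" by (rule red_Cons_pos[OF assms])
  have ni: "\<alpha> i \<notin> inversions u"
    using pos not_root_nonpos[of "wp (rev u) (\<alpha> i)"] wp_inj[of "rev u" "\<alpha> i" 0]
    by (auto simp: inversions_def)
  show "\<alpha> i \<notin> s i ` inversions u"
  proof
    assume "\<alpha> i \<in> s i ` inversions u"
    then obtain y where y: "y \<in> inversions u" "\<alpha> i = s i y" by auto
    then have "y = - \<alpha> i" by (metis s_s s_root_self)
    moreover have "0 \<le> y" using y by (auto simp: inversions_def elim: positive_rootE)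
    ultimately show False by (auto simp: le_fun_def dest: spec[of _ i])
  qed
  show "inversions (i # u) = insert (\<alpha> i) (s i ` inversions u)"
  proof (intro equalityI subsetI)
    fix x assume x: "x \<in> inversions (i # u)"
    show "x \<in> insert (\<alpha> i) (s i ` inversions u)"
    proof (cases "x = \<alpha> i")
      case False
      then have "s i x \<in> inversions u"
        using x reflect_positive_root[OF _ i False] by (auto simp: inversions_def)
      then show ?thesis by (metis image_eqI insertI2 s_s)
    qed simp
  next
    fix x assume "x \<in> insert (\<alpha> i) (s i ` inversions u)"
    then consider "x = \<alpha> i" | y where "y \<in> inversions u" "x = s i y" by auto
    then show "x \<in> inversions (i # u)"
    proof cases
      case 1
      then show ?thesis using root_pos[OF i] pos
        by (auto simp: inversions_def s_root_self wp_uminus le_fun_def)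
    next
      case 2
      then have "y \<noteq> \<alpha> i" using ni by auto
      then show ?thesis using 2 reflect_positive_root[OF _ i] by (auto simp: inversions_def)
    qed
  qed
qed

lemma card_inversions: "red u \<Longrightarrow> finite (inversions u) \<and> card (inversions u) = length u"
proof (induction u)
  case Nil
  have "x = 0" if "x \<in> inversions []" for x
    using that not_root_nonpos[of x] by (auto simp: inversions_def elim: positive_rootE)
  moreover have "0 \<notin> positive_roots I E" using wp_inj[of _ "\<alpha> _" 0] by (auto elim!: positive_rootE)
  ultimately have "inversions [] = {}" by (auto simp: inversions_def)
  then show ?case by simp
next
  case (Cons i u)
  have "inj (s i)" by (metis injI s_s)
  then show ?case using Cons inversions_Cons[OF Cons.prems] red_appendD(2)[of "[i]" u]
    by (simp add: card_image inj_on_subset)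
qed

lemma inversions_longest:
  assumes "\<And>i. i \<in> I \<Longrightarrow> wp (rev u) (\<alpha> i) \<le> 0" shows "inversions u = positive_roots I E"
proof -
  have "wp (rev u) x \<le> 0" if "x \<in> positive_roots I E" for x
  proof -
    have x: "supp_in I x" "0 \<le> x" using that by (auto elim: positive_rootE)
    show ?thesis unfolding le_fun_def
    proof
      fix k
      have "wp (rev u) x k = (\<Sum>i\<in>I. x i * wp (rev u) (\<alpha> i) k)" by (rule wp_expansion[OF x(1)])
      also have "\<dots> \<le> (\<Sum>i\<in>I. 0)"
        by (rule sum_mono) (use x(2) assms in \<open>auto simp: le_fun_def intro: mult_nonneg_nonpos\<close>)
      finally show "wp (rev u) x k \<le> 0 k" by simp
    qed
  qed
  then show ?thesis by (auto simp: inversions_def)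
qed

text \<open>The longest element makes all simple roots, hence all positive roots, negative, so every positive root
  is an inversion; and the length of a reduced word counts its inversions.\<close>

lemma length_longest:
  assumes "longest_element I E I (wp u)" "red u"
  shows "card (positive_roots I E) = length u" "\<And>v. red v \<Longrightarrow> length v \<le> length u"
proof -
  have "inversions u = positive_roots I E"
    by (rule inversions_longest) (use longest_neg[OF assms] in auto)
  then show "card (positive_roots I E) = length u" using card_inversions[OF assms(2)] by simp
  fix v assume v: "red v"
  then have "wp v \<in> weyl_group E I" unfolding weyl_group_words by (auto dest: red_letters)
  then show "length v \<le> length u" using assms v by (auto simp: longest_element_def red_def)
qed

text \<open>Prolonging \<open>u\<close> on the left terminates because the lengths of reduced words are bounded.\<close>

lemma extend_to_maximal:
  assumes "\<And>v. red v \<Longrightarrow> length v \<le> N" "red u"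
  obtains v where "red (v @ u)" "\<And>i. i \<in> I \<Longrightarrow> \<not> red (i # v @ u)"
proof -
  have "\<exists>v. red (v @ u) \<and> (\<forall>i\<in>I. \<not> red (i # v @ u))"
    using assms(2)
  proof (induction "N - length u" arbitrary: u rule: less_induct)
    case less
    show ?case
    proof (cases "\<forall>i\<in>I. \<not> red (i # u)")
      case True
      then show ?thesis using less.prems by (intro exI[of _ "[]"]) auto
    next
      case False
      then obtain i where i: "red (i # u)" by auto
      have "N - length (i # u) < N - length u" using assms(1)[OF i] by simp
      from less.hyps[OF this i] obtain v where
        "red (v @ i # u)" "\<forall>k\<in>I. \<not> red (k # v @ i # u)" by auto
      then show ?thesis by (intro exI[of _ "v @ [i]"]) auto
    qed
  qed
  then show thesis using that by blast
qed

text \<open>Both \<open>w\<close> and its inverse make all simple roots negative. Expand \<open>\<alpha>\<^sub>i = w (w\<^sup>-\<^sup>1 \<alpha>\<^sub>i)\<close> in the simple roots: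
  the sum of coefficients \<open>1\<close> becomes a sum of products of nonnegative integers, one for each simple root
  occurring in \<open>w\<^sup>-\<^sup>1 \<alpha>\<^sub>i\<close>. So there is only one such root, with multiplicity one.\<close>

lemma longest_permutes_roots:
  assumes "\<And>i. i \<in> I \<Longrightarrow> wp (rev u) (\<alpha> i) \<le> 0" "\<And>i. i \<in> I \<Longrightarrow> wp u (\<alpha> i) \<le> 0" "set u \<subseteq> I"
  obtains \<pi> where "bij_betw \<pi> I I" "\<And>i. i \<in> I \<Longrightarrow> wp (rev u) (\<alpha> i) = - \<alpha> (\<pi> i)"
proof -
  have "\<exists>k\<in>I. wp (rev u) (\<alpha> i) = - \<alpha> k" if i: "i \<in> I" for i
  proof -
    define p where "p = wp (rev u) (\<alpha> i)"
    have sp: "supp_in I p" unfolding p_def by (rule supp_in_wp) (use assms i in auto)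
    have pneg: "p k \<le> 0" for k using assms(1)[OF i] by (simp add: p_def le_fun_def)
    \<comment> \<open>The height of the positive root \<open>- w \<alpha>\<^sub>k\<close>.\<close>
    define q where "q k = (\<Sum>l\<in>I. - wp u (\<alpha> k) l)" for k
    have q1: "q k \<ge> 1" if k: "k \<in> I" for k
    proof -
      have n: "wp u (\<alpha> k) l \<le> 0" for l using assms(2)[OF k] by (simp add: le_fun_def)
      have "supp_in I (wp u (\<alpha> k))" by (rule supp_in_wp) (use assms k in auto)
      moreover have "wp u (\<alpha> k) \<noteq> 0" using wp_inj[of u "\<alpha> k" 0] by auto
      ultimately obtain l where l: "l \<in> I" "wp u (\<alpha> k) l \<noteq> 0"
        by (auto simp: supp_in_def fun_eq_iff)
      have "- wp u (\<alpha> k) l \<le> q k" unfolding q_def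
        using n finite_I l(1) by (intro member_le_sum) auto
      then show ?thesis using n[of l] l(2) by linarith
    qed
    have "\<alpha> i = wp u p" by (simp add: p_def)
    then have "\<alpha> i l = (\<Sum>k\<in>I. p k * wp u (\<alpha> k) l)" for l using wp_expansion[OF sp] by simp
    then have "(\<Sum>l\<in>I. \<alpha> i l) = (\<Sum>l\<in>I. \<Sum>k\<in>I. p k * wp u (\<alpha> k) l)" by simp
    also have "\<dots> = (\<Sum>k\<in>I. \<Sum>l\<in>I. p k * wp u (\<alpha> k) l)" by (rule sum.swap)
    also have "\<dots> = (\<Sum>k\<in>I. - p k * q k)"
      by (simp add: q_def sum_distrib_left sum_negf)
    finally have one: "(\<Sum>k\<in>I. - p k * q k) = 1"
      using i finite_I by (simp add: simple_root_def sum.delta)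
    have "p \<noteq> 0" using wp_inj[of "rev u" "\<alpha> i" 0] by (auto simp: p_def)
    then obtain k where k: "k \<in> I" "p k \<noteq> 0" using sp by (auto simp: supp_in_def fun_eq_iff)
    have nn: "0 \<le> - p l * q l" if "l \<in> I" for l
      using pneg[of l] q1[OF that] by (auto intro: mult_nonpos_nonneg)
    have ge: "- p k \<le> - p k * q k"
      using mult_left_mono[of 1 "q k" "- p k"] pneg[of k] q1[OF k(1)] by simp
    have split: "(\<Sum>l\<in>I. - p l * q l) = - p k * q k + (\<Sum>l\<in>I - {k}. - p l * q l)"
      using finite_I k(1) by (rule sum.remove)
    have rest: "0 \<le> (\<Sum>l\<in>I - {k}. - p l * q l)" using nn by (intro sum_nonneg) auto
    have pk: "p k = -1" using ge split one rest k(2) pneg[of k] by linarith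
    have "(\<Sum>l\<in>I - {k}. - p l * q l) = 0" using ge split one rest pk by linarith
    then have "\<forall>l\<in>I - {k}. - p l * q l = 0"
      using nn finite_I by (subst (asm) sum_nonneg_eq_0_iff) auto
    then have "p l = 0" if "l \<in> I" "l \<noteq> k" for l using q1[OF that(1)] that by fastforce
    then have "p = - \<alpha> k" using sp pk by (fastforce simp: supp_in_def simple_root_def fun_eq_iff)
    then show ?thesis using k(1) p_def by (intro bexI[of _ k]) metis
  qed
  then obtain \<pi> where \<pi>: "\<And>i. i \<in> I \<Longrightarrow> \<pi> i \<in> I \<and> wp (rev u) (\<alpha> i) = - \<alpha> (\<pi> i)" by metis
  have "inj_on \<pi> I"
  proof (rule inj_onI)
    fix i k assume "i \<in> I" "k \<in> I" "\<pi> i = \<pi> k"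
    then have "wp (rev u) (\<alpha> i) = wp (rev u) (\<alpha> k)" using \<pi> by metis
    then show "i = k" using wp_inj root_inj by blast
  qed
  then have "bij_betw \<pi> I I"
    using \<pi> endo_inj_surj[OF finite_I, of \<pi>] by (auto simp: bij_betw_def)
  then show thesis using that \<pi> by blast
qed

section \<open>Weights and the rigidity of reduced words\<close>

definition form :: "('v \<Rightarrow> int) \<Rightarrow> ('v \<Rightarrow> int) \<Rightarrow> int" where
  "form x y = (\<Sum>i\<in>I. x i * coroot i y)"

lemma form_sym: "form x y = form y x"
proof -
  have nb: "(\<Sum>k\<in>nb i. z k) = (\<Sum>k\<in>I. if {i, k} \<in> E then z k else 0)" for i and z :: "'v \<Rightarrow> int"
    by (rule sum.mono_neutral_cong_left) (use finite_I edgeD in auto)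
  have e: "form x y = (\<Sum>i\<in>I. 2 * x i * y i) - (\<Sum>i\<in>I. \<Sum>k\<in>I. if {i, k} \<in> E then x i * y k else 0)" for x y
    by (simp add: form_def coroot_def nb algebra_simps sum_subtractf sum_distrib_left if_distrib cong: if_cong)
  have "(\<Sum>i\<in>I. \<Sum>k\<in>I. if {i, k} \<in> E then x i * y k else 0) = (\<Sum>i\<in>I. \<Sum>k\<in>I. if {i, k} \<in> E then y i * x k else 0)"
    by (subst sum.swap) (auto intro!: sum.cong simp: insert_commute)
  then show ?thesis by (simp add: e algebra_simps)
qed

lemma form_add_right: "form x (y + z) = form x y + form x z"
  by (simp add: form_def coroot_add algebra_simps sum.distrib)

lemma form_root_left: "i \<in> I \<Longrightarrow> form (\<alpha> i) y = coroot i y"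
  using finite_I by (simp add: form_def simple_root_def if_distrib[of "\<lambda>c. c * _"] sum.delta' cong: if_cong)

lemma form_reflection: "i \<in> I \<Longrightarrow> form (s i x) y = form x (s i y)"
proof -
  assume i: "i \<in> I"
  have sc: "form x (\<lambda>k. c * y k) = c * form x y" for x y c
    by (simp add: form_def coroot_scale sum_distrib_left algebra_simps)
  have "form x (s i y) = form x y - coroot i y * coroot i x" for x y
    unfolding s_eq form_add_right sc using form_sym[of x "\<alpha> i"] form_root_left[OF i] by simp
  then show ?thesis using form_sym by (metis mult.commute)
qed

text \<open>Pair \<open>d\<close> with the strictly dominant positive vector \<open>x\<close>: the value is at most \<open>0\<close> by the hypothesis on \<open>d\<close>
  and at least \<open>0\<close> by the one on \<open>x\<close>.\<close>

lemma form_nonneg_eq_0: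
  assumes "\<And>i. i \<in> I \<Longrightarrow> 0 < x i" "\<And>i. i \<in> I \<Longrightarrow> 0 < coroot i x"
    and "\<And>i. i \<in> I \<Longrightarrow> 0 \<le> d i" "\<And>i. i \<in> I \<Longrightarrow> coroot i d \<le> 0" "i \<in> I"
  shows "d i = 0"
proof -
  have "form x d \<le> 0" unfolding form_def
    by (rule sum_nonpos) (use assms less_imp_le in \<open>blast intro: mult_nonneg_nonpos\<close>)
  moreover have nn: "0 \<le> d k * coroot k x" if "k \<in> I" for k
    using assms(2,3) that by (simp add: less_imp_le)
  then have "0 \<le> form d x" unfolding form_def by (rule sum_nonneg)
  ultimately have "form d x = 0" using form_sym[of x d] by simp
  then have "d i * coroot i x = 0"
    using nn finite_I assms(5) unfolding form_def by (subst (asm) sum_nonneg_eq_0_iff) auto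
  then show ?thesis using assms(2)[OF assms(5)] by simp
qed

text \<open>The element \<open>\<varpi>\<^sub>j - u \<varpi>\<^sub>j\<close> of the root lattice, where \<open>\<varpi>\<^sub>j\<close> is the fundamental weight at \<open>j\<close>. The
  recursion avoids weights, which need not lie in the root lattice: \<open>s\<^sub>i \<varpi>\<^sub>j = \<varpi>\<^sub>j - \<delta>\<^sub>i\<^sub>j \<alpha>\<^sub>i\<close>.\<close>

primrec weight_drop :: "'v \<Rightarrow> 'v list \<Rightarrow> ('v \<Rightarrow> int)" where
  "weight_drop j [] = 0"
| "weight_drop j (i # u) = s i (weight_drop j u) + (if i = j then \<alpha> i else 0)"

lemma weight_drop_snoc:
  "weight_drop j (u @ [i]) = weight_drop j u + (if i = j then wp u (\<alpha> i) else 0)"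
proof (induction u)
  case Nil
  have "s i 0 = 0" using wp_zero[of "[i]"] by simp
  then show ?case by (cases "i = j") (simp_all del: plus_fun_apply zero_fun_apply)
next
  case (Cons k u)
  then show ?case by (cases "i = j") (simp_all add: s_add add_ac del: plus_fun_apply zero_fun_apply)
qed

text \<open>Pairing with \<open>\<varpi>\<^sub>j\<close> extracts the \<open>j\<close>-th coefficient, and the form is invariant:
  \<open>(u\<^sup>-\<^sup>1 x, \<varpi>\<^sub>j) = (x, u \<varpi>\<^sub>j)\<close>.\<close>

lemma coefficient_weight_drop:
  "set u \<subseteq> I \<Longrightarrow> wp (rev u) x j = x j - form x (weight_drop j u)"
proof (induction u arbitrary: x)
  case Nil
  then show ?case by (simp add: form_def coroot_def)
next
  case (Cons i u)
  then have i: "i \<in> I" by simp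
  have "form x (\<alpha> i) = coroot i x" using form_sym form_root_left[OF i] by metis
  moreover have "form x 0 = 0" by (simp add: form_def coroot_def)
  moreover have "wp (rev (i # u)) x j = s i x j - form x (s i (weight_drop j u))"
    using Cons.IH[of "s i x"] Cons.prems by (simp add: form_reflection[OF i])
  moreover have "s i x j = x j - (if i = j then coroot i x else 0)" by (simp add: s_apply)
  ultimately show ?case
    by (cases "i = j") (simp_all add: form_add_right del: plus_fun_apply)
qed

text \<open>Transporting all steps to the beginning of the word, one finds \<open>0 = d\<^sub>0 = \<Sum>\<^sub>m \<epsilon>\<^sub>m \<beta>\<^sub>m\<close>, where the \<open>\<beta>\<^sub>m\<close>
  are the roots inverted by a reduced word. They are positive, so all coefficients vanish.\<close>

lemma reduced_rigidity:
  assumes red: "red ws" and \<epsilon>: "\<And>m. m < length ws \<Longrightarrow> 0 \<le> \<epsilon> m"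
    and d: "\<And>m. m < length ws \<Longrightarrow> d m = s (ws ! m) (d (Suc m)) + (\<lambda>k. \<epsilon> m * \<alpha> (ws ! m) k)"
    and ends: "d 0 = 0" "d (length ws) = 0" and m: "m < length ws"
  shows "\<epsilon> m = 0"
proof -
  define \<beta> where "\<beta> m = wp (take m ws) (\<alpha> (ws ! m))" for m
  have \<beta>: "0 \<le> \<beta> m" "\<beta> m \<noteq> 0" if "m < length ws" for m
  proof -
    have "red (take m ws @ [ws ! m])"
      using red_appendD(1)[of "take (Suc m) ws" "drop (Suc m) ws"] red that
      by (metis append_take_drop_id take_Suc_conv_app_nth)
    then show "0 \<le> \<beta> m" unfolding \<beta>_def by (rule red_snoc_pos)
    show "\<beta> m \<noteq> 0" unfolding \<beta>_def using wp_inj[of _ "\<alpha> (ws ! m)" 0] by fastforce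
  qed
  have "k \<le> length ws \<Longrightarrow> d 0 l = (\<Sum>m<k. \<epsilon> m * \<beta> m l) + wp (take k ws) (d k) l" for k l
  proof (induction k)
    case (Suc k)
    then have k: "k < length ws" by simp
    have "wp (take k ws) (d k) = wp (take (Suc k) ws) (d (Suc k)) + (\<lambda>l. \<epsilon> k * \<beta> k l)"
      unfolding d[OF k] wp_add wp_scale \<beta>_def by (simp add: take_Suc_conv_app_nth[OF k])
    then show ?case using Suc k by simp
  qed simp
  from this[of "length ws"] have z: "(\<Sum>m<length ws. \<epsilon> m * \<beta> m l) = 0" for l
    using ends by simp
  obtain l where l: "\<beta> m l \<noteq> 0" using \<beta>(2)[OF m] by (auto simp: fun_eq_iff)
  have "\<epsilon> m * \<beta> m l = 0"
    using z[of l] m \<epsilon> \<beta>(1) by (subst (asm) sum_nonneg_eq_0_iff) (auto simp: le_fun_def)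
  then show ?thesis using l by simp
qed

end

section \<open>A positive vector for the diagrams of type A, D, E\<close>

lemma A_edge_iff: "{a, b} \<in> A_edges n \<longleftrightarrow> 1 \<le> a \<and> a < n \<and> b = a + 1 \<or> 1 \<le> b \<and> b < n \<and> a = b + 1"
  unfolding A_edges_def by (auto simp: doubleton_eq_iff)

lemma D_edge_iff: "{a, b} \<in> D_edges n \<longleftrightarrow> 1 \<le> a \<and> a < n - 1 \<and> b = a + 1 \<or> 1 \<le> b \<and> b < n - 1 \<and> a = b + 1
   \<or> a = n - 2 \<and> b = n \<or> b = n - 2 \<and> a = n"
  unfolding D_edges_def by (auto simp: doubleton_eq_iff)

lemma E_edge_iff: "{a, b} \<in> E_edges n \<longleftrightarrow> (a, b) \<in> {(1, 3), (3, 1), (2, 4), (4, 2)} \<or>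
   3 \<le> a \<and> a < n \<and> b = a + 1 \<or> 3 \<le> b \<and> b < n \<and> a = b + 1"
  unfolding E_edges_def by (auto simp: doubleton_eq_iff)

text \<open>Twice the half sum of the positive roots; its second difference along the chain is \<open>-2\<close>.\<close>

lemma A_positive_vector:
  assumes "1 \<le> a" "a \<le> n"
  shows "0 < 2 * (int a * (int n + 1 - int a)) - (\<Sum>b | {a, b} \<in> A_edges n. int b * (int n + 1 - int b))"
proof -
  define y where "y b = int b * (int n + 1 - int b)" for b
  have nb: "{b. {a, b} \<in> A_edges n} = (if a < n then {a + 1} else {}) \<union> (if 2 \<le> a then {a - 1} else {})"
    using assms by (auto simp: A_edge_iff)
  have "(\<Sum>b | {a, b} \<in> A_edges n. y b) = y (a + 1) + y (a - 1)"
  proof -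
    have "y (a + 1) = 0" if "\<not> a < n" using that assms by (auto simp: y_def)
    moreover have "y (a - 1) = 0" if "\<not> 2 \<le> a" using that assms by (auto simp: y_def)
    moreover have "a + 1 \<noteq> a - 1" by simp
    ultimately show ?thesis unfolding nb by auto
  qed
  then show ?thesis using assms unfolding y_def
    by (simp add: of_nat_diff algebra_simps)
qed

text \<open>The vector \<open>y\<close> is four times the half sum of the positive roots, all of whose coroot values are \<open>1\<close>.
  It is quadratic along the chain and constant on the two vertices of the fork.\<close>

lemma D_positive_vector:
  assumes "1 \<le> a" "a \<le> n" "4 \<le> n"
  defines "y \<equiv> \<lambda>b::nat. if b + 2 \<le> n then 4 * int b * int n - 2 * int b * (int b + 1) else int n * (int n - 1)"
  shows "0 < 2 * y a - (\<Sum>b | {a, b} \<in> D_edges n. y b)"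
proof -
  obtain m where m: "n = m + 4" using assms(3) by (metis add.commute le_Suc_ex)
  consider "a = 1" | "2 \<le> a" "a + 3 \<le> n" | "a + 2 = n" | "a + 1 = n" | "a = n" using assms by linarith
  then show ?thesis
  proof cases
    case 1
    then have "{b. {a, b} \<in> D_edges n} = {2}" using m by (auto simp: D_edge_iff)
    then show ?thesis using 1 m by (simp add: y_def algebra_simps)
  next
    case 2
    then have "{b. {a, b} \<in> D_edges n} = {a + 1, a - 1}" by (auto simp: D_edge_iff)
    then show ?thesis using 2 by (simp add: y_def of_nat_diff algebra_simps)
  next
    case 3
    then have a: "a = m + 2" using m by simp
    have "{b. {a, b} \<in> D_edges n} = {m + 1, m + 3, m + 4}" unfolding a m by (auto simp: D_edge_iff)
    then show ?thesis unfolding a m by (simp add: y_def m algebra_simps)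
  next
    case 4
    then have a: "a = m + 3" using m by simp
    have "{b. {a, b} \<in> D_edges n} = {m + 2}" unfolding a m by (auto simp: D_edge_iff)
    then show ?thesis unfolding a m by (simp add: y_def m algebra_simps)
  next
    case 5
    then have a: "a = m + 4" using m by simp
    have "{b. {a, b} \<in> D_edges n} = {m + 2}" unfolding a m by (auto simp: D_edge_iff)
    then show ?thesis unfolding a m by (simp add: y_def m algebra_simps)
  qed
qed

lemma E_positive_vector:
  assumes "n \<in> {6, 7, 8}"
  obtains y :: "nat \<Rightarrow> int" where "\<And>b. b \<in> {1..n} \<Longrightarrow> 0 < y b"
    "\<And>a. a \<in> {1..n} \<Longrightarrow> 0 < 2 * y a - (\<Sum>b | {a, b} \<in> E_edges n. y b)"
proof -
  have nb: "(\<Sum>b | {a, b} \<in> E_edges n. y b) = (\<Sum>b\<in>{1..n}. if {a, b} \<in> E_edges n then y b else 0)"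
    if "a \<in> {1..n}" for a and y :: "nat \<Rightarrow> int"
    by (rule sum.mono_neutral_cong_left) (use assms that in \<open>auto simp: E_edge_iff\<close>)
  have ivl: "{1..6} = {1, 2, 3, 4, 5, 6::nat}" "{1..7} = {1, 2, 3, 4, 5, 6, 7::nat}"
    "{1..8} = {1, 2, 3, 4, 5, 6, 7, 8::nat}" by auto
  \<comment> \<open>The lists are the coefficients of the sums of the positive roots, in Bourbaki labelling; index \<open>0\<close> is a dummy.\<close>
  have "\<exists>L :: int list. (\<forall>b\<in>{1..n}. 0 < L ! b) \<and>
      (\<forall>a\<in>{1..n}. 0 < 2 * L ! a - (\<Sum>b\<in>{1..n}. if {a, b} \<in> E_edges n then L ! b else 0))"
    using assms
  proof (elim insertE emptyE)
    assume n: "n = 6"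
    show ?thesis unfolding n ivl ball_simps
      by (rule exI[of _ "[0, 16, 22, 30, 42, 30, 16]"]) (simp add: E_edge_iff)
  next
    assume n: "n = 7"
    show ?thesis unfolding n ivl ball_simps
      by (rule exI[of _ "[0, 34, 49, 66, 96, 75, 52, 27]"]) (simp add: E_edge_iff)
  next
    assume n: "n = 8"
    show ?thesis unfolding n ivl ball_simps
      by (rule exI[of _ "[0, 92, 136, 182, 270, 220, 168, 114, 58]"]) (simp add: E_edge_iff)
  qed
  then obtain L :: "int list" where "\<forall>b\<in>{1..n}. 0 < L ! b"
    "\<forall>a\<in>{1..n}. 0 < 2 * L ! a - (\<Sum>b\<in>{1..n}. if {a, b} \<in> E_edges n then L ! b else 0)" by blast
  then show thesis using nb by (intro that[of "\<lambda>b. L ! b"]) simp_all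
qed

lemma dynkin_graph:
  assumes "dynkin_ADE I E"
  shows "simple_graph I E"
    and "\<exists>x. (\<forall>i\<in>I. 0 < x i) \<and> (\<forall>i\<in>I. 0 < simple_graph.coroot E i x)"
proof -
  obtain n S f where S: "S = A_edges n \<and> 1 \<le> n \<or> S = D_edges n \<and> 4 \<le> n \<or> S = E_edges n \<and> n \<in> {6, 7, 8}"
    and f: "bij_betw f {1..n} I" and E: "E = (`) f ` S"
    using assms unfolding dynkin_ADE_def by blast
  have inS: "e \<in> S \<Longrightarrow> \<exists>a b. e = {a, b} \<and> a \<in> {1..n} \<and> b \<in> {1..n} \<and> a \<noteq> b" for e
  proof -
    assume e: "e \<in> S"
    define R where "R e \<longleftrightarrow> (\<exists>a b. e = {a, b} \<and> a \<in> {1..n} \<and> b \<in> {1..n} \<and> a \<noteq> b)" for e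
    have R: "R {c, d}" if "c \<in> {1..n}" "d \<in> {1..n}" "c \<noteq> d" for c d
      unfolding R_def using that by blast
    have "R e" using S e
      by (elim disjE conjE) (auto simp: A_edges_def D_edges_def E_edges_def intro!: R)
    then show ?thesis by (simp only: R_def)
  qed
  have inj: "inj_on f {1..n}" and im: "f ` {1..n} = I" using f by (auto simp: bij_betw_def)
  have edge: "{f a, f b} \<in> E \<longleftrightarrow> {a, b} \<in> S" if "a \<in> {1..n}" "b \<in> {1..n}" for a b
  proof
    assume "{f a, f b} \<in> E"
    then obtain e where e: "e \<in> S" "{f a, f b} = f ` e" unfolding E by auto
    then have "f ` {a, b} = f ` e" by simp
    moreover have "e \<subseteq> {1..n}" using inS[OF e(1)] by auto
    ultimately have "{a, b} = e" using inj_on_image_eq_iff[OF inj, of "{a, b}" e] that by auto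
    then show "{a, b} \<in> S" using e by simp
  next
    assume "{a, b} \<in> S"
    then show "{f a, f b} \<in> E" unfolding E by (intro image_eqI[of _ _ "{a, b}"]) auto
  qed
  have Eel: "i \<in> I \<and> k \<in> I \<and> i \<noteq> k" if ik: "{i, k} \<in> E" for i k
  proof -
    obtain e where e: "e \<in> S" "{i, k} = f ` e" using ik unfolding E by blast
    obtain a b where ab: "e = {a, b}" "a \<in> {1..n}" "b \<in> {1..n}" "a \<noteq> b" using inS[OF e(1)] by blast
    have "f a \<noteq> f b" using ab inj by (auto dest: inj_onD)
    then show ?thesis using e(2) ab im by (auto simp: doubleton_eq_iff)
  qed
  show sg: "simple_graph I E"
    using Eel im by unfold_locales (auto simp flip: im)
  have "\<exists>y::nat \<Rightarrow> int. (\<forall>a\<in>{1..n}. 0 < y a) \<and> (\<forall>a\<in>{1..n}. 0 < 2 * y a - (\<Sum>b | {a, b} \<in> S. y b))"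
    using S
  proof (elim disjE conjE)
    assume "S = A_edges n" "1 \<le> n"
    then show ?thesis
      using A_positive_vector[of _ n] by (intro exI[of _ "\<lambda>b. int b * (int n + 1 - int b)"]) auto
  next
    assume n: "S = D_edges n" "4 \<le> n"
    define y where "y b = (if b + 2 \<le> n then 4 * int b * int n - 2 * int b * (int b + 1) else int n * (int n - 1))" for b
    have "0 < y a" if "a \<in> {1..n}" for a
    proof (cases "a + 2 \<le> n")
      case True
      have "0 < 2 * int a * (2 * int n - int a - 1)" using True that by (intro mult_pos_pos) auto
      then show ?thesis using True by (simp add: y_def algebra_simps)
    qed (use n in \<open>auto simp: y_def\<close>)
    then show ?thesis using n D_positive_vector[of _ n]
      by (intro exI[of _ y]) (auto simp: y_def[abs_def])
  next
    assume "S = E_edges n" "n \<in> {6, 7, 8}"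
    then show ?thesis using E_positive_vector[of n] by metis
  qed
  then obtain y :: "nat \<Rightarrow> int" where y: "\<And>a. a \<in> {1..n} \<Longrightarrow> 0 < y a"
    "\<And>a. a \<in> {1..n} \<Longrightarrow> 0 < 2 * y a - (\<Sum>b | {a, b} \<in> S. y b)" by metis
  define g where "g = the_inv_into {1..n} f"
  have g: "g (f a) = a" if "a \<in> {1..n}" for a using the_inv_into_f_f[OF inj that] by (simp add: g_def)
  show "\<exists>x. (\<forall>i\<in>I. 0 < x i) \<and> (\<forall>i\<in>I. 0 < simple_graph.coroot E i x)"
  proof (intro exI[of _ "y \<circ> g"] conjI ballI)
    fix i assume "i \<in> I"
    then obtain a where a: "a \<in> {1..n}" "i = f a" using im by auto
    show "0 < (y \<circ> g) i" using a g y by simp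
    have "{k. {i, k} \<in> E} = f ` {b. {a, b} \<in> S}"
    proof (intro equalityI subsetI)
      fix k assume "k \<in> {k. {i, k} \<in> E}"
      then have k: "{i, k} \<in> E" by simp
      then obtain b where "b \<in> {1..n}" "k = f b" using Eel im by blast
      then show "k \<in> f ` {b. {a, b} \<in> S}" using k a edge by auto
    next
      fix k assume "k \<in> f ` {b. {a, b} \<in> S}"
      then obtain b where b: "{a, b} \<in> S" "k = f b" by auto
      then have "b \<in> {1..n}" using inS[OF b(1)] by (auto simp: doubleton_eq_iff)
      then show "k \<in> {k. {i, k} \<in> E}" using edge a b by auto
    qed
    moreover have sub: "{b. {a, b} \<in> S} \<subseteq> {1..n}" using inS by (fastforce simp: doubleton_eq_iff)
    ultimately have "(\<Sum>k | {i, k} \<in> E. (y \<circ> g) k) = (\<Sum>b | {a, b} \<in> S. y b)"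
      using g sub by (auto simp: sum.reindex[OF inj_on_subset[OF inj sub]] intro!: sum.cong)
    then show "0 < simple_graph.coroot E i (y \<circ> g)"
      unfolding simple_graph.coroot_def[OF sg] using a g y by simp
  qed
qed

section \<open>Dimension of complex subspaces\<close>

context vector_space
begin

lemma subspace_basis_finite:
  assumes "subspace V" "V \<subseteq> span F" "finite F"
  obtains B where "B \<subseteq> V" "independent B" "finite B" "span B = V" "dim V = card B"
proof -
  obtain B where B: "B \<subseteq> V" "independent B" "V \<subseteq> span B" "card B = dim V"
    using basis_exists[of V] by blast
  have "finite B" using independent_span_bound[OF assms(3) B(2)] B(1) assms(2) by blast
  moreover have "span B = V" using B assms(1) span_minimal by blast
  ultimately show thesis using that B by metis
qed

lemma disjoint_spans:
  assumes "independent (A \<union> B)" "A \<inter> B = {}" "x \<in> span A" "x \<in> span B"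
  shows "x = 0"
proof -
  have r: "representation A x = representation B x"
    using representation_extend[OF assms(1), of x A] representation_extend[OF assms(1), of x B] assms by simp
  have iA: "independent A" using assms(1) independent_mono by blast
  have "{b. representation A x b \<noteq> 0} = {}"
    using representation_ne_zero[of A x] representation_ne_zero[of B x] r assms(2) by fastforce
  then have "(\<Sum>b | representation A x b \<noteq> 0. scale (representation A x b) b) = 0" by (metis sum.empty)
  then show ?thesis using sum_nonzero_representation_eq[OF iA assms(3)] by simp
qed

text \<open>Extend a basis of \<open>A\<close> to the whole space and forget its part in \<open>A\<close>.\<close>

lemma exists_linear_with_kernel:
  assumes "subspace A"
  obtains p where "Vector_Spaces.linear scale scale p" "\<forall>x. p x = 0 \<longleftrightarrow> x \<in> A"
proof -
  interpret pr: vector_space_pair scale scale ..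
  obtain BA where BA: "BA \<subseteq> A" "independent BA" "A \<subseteq> span BA" using basis_exists[of A] by metis
  obtain B where B: "BA \<subseteq> B" "independent B" "UNIV \<subseteq> span B"
    using maximal_independent_subset_extend[of BA UNIV] BA(2) by (metis subset_UNIV)
  obtain p :: "'b \<Rightarrow> 'b" where p: "Vector_Spaces.linear scale scale p" "\<forall>x\<in>B. p x = (if x \<in> BA then 0 else x)"
    using pr.linear_independent_extend[OF B(2), of "\<lambda>x. if x \<in> BA then 0 else x"] by metis
  have spA: "span BA = A" using BA assms span_minimal by blast
  have zero: "p a = 0" if "a \<in> A" for a
  proof (rule pr.linear_eq_0_on_span[OF p(1)])
    show "p b = 0" if "b \<in> BA" for b using that p(2) B(1) by (simp add: subsetD)
    show "a \<in> span BA" using that spA by simp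
  qed
  have ident: "p c = c" if "c \<in> span (B - BA)" for c
  proof -
    have "p c = id c"
    proof (rule pr.linear_eq_on[OF p(1) linear_id that])
      show "p b = id b" if "b \<in> B - BA" for b using that p(2) by simp
    qed
    then show ?thesis by simp
  qed
  have "x \<in> A" if px: "p x = 0" for x
  proof -
    have "x \<in> span (BA \<union> (B - BA))" using B by (metis Un_Diff_cancel Un_absorb1 UNIV_I subsetD)
    then obtain a c where ac: "a \<in> span BA" "c \<in> span (B - BA)" "x = a + c"
      unfolding span_Un by blast
    then have "p x = c" using zero ident spA pr.linear_add[OF p(1)] by simp
    then show ?thesis using px ac spA by simp
  qed
  then show thesis using that[OF p(1)] zero by metis
qed

lemma dim_eq_0_finite:
  assumes "subspace V" "V \<subseteq> span F" "finite F" "dim V = 0" shows "V = {0}"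
proof -
  obtain B where "finite B" "span B = V" "dim V = card B" using subspace_basis_finite[OF assms(1-3)] by blast
  then show ?thesis using assms(4) by auto
qed

end

text \<open>The map is only assumed to be linear on the subspace \<open>V\<close>, which is how restrictions of module
  homomorphisms arise.\<close>

lemma rank_nullity:
  assumes "vector_space_pair s1 s2"
    and V: "module.subspace s1 V" "V \<subseteq> module.span s1 F" "finite F"
    and add: "\<And>x y. x \<in> V \<Longrightarrow> y \<in> V \<Longrightarrow> g (x + y) = g x + g y"
    and sc: "\<And>c x. x \<in> V \<Longrightarrow> g (s1 c x) = s2 c (g x)"
  shows "vector_space.dim s1 V = vector_space.dim s2 (g ` V) + vector_space.dim s1 {x \<in> V. g x = 0}"
proof -
  interpret vector_space_pair s1 s2 by fact
  define K where "K = {x \<in> V. g x = 0}"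
  have g0: "g 0 = 0" using sc[of 0 0] vs1.subspace_0[OF V(1)] by simp
  have K: "vs1.subspace K" unfolding K_def
    by (rule vs1.subspaceI) (use V(1) add sc g0 in \<open>auto simp: vs1.subspace_add vs1.subspace_scale vs1.subspace_0\<close>)
  have KV: "K \<subseteq> V" by (auto simp: K_def)
  obtain BK where BK: "BK \<subseteq> K" "vs1.independent BK" "finite BK" "vs1.span BK = K" "vs1.dim K = card BK"
    using vs1.subspace_basis_finite[OF K _ V(3)] KV V(2) by blast
  obtain B where B: "BK \<subseteq> B" "B \<subseteq> V" "vs1.independent B" "V \<subseteq> vs1.span B"
    using vs1.maximal_independent_subset_extend[of BK V] BK KV by blast
  have fB: "finite B" using vs1.independent_span_bound[OF V(3) B(3)] B(2) V(2) by blast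
  have spB: "vs1.span B = V" using B V(1) vs1.span_minimal by blast
  have dV: "vs1.dim V = card B" using vs1.dim_span_eq_card_independent[OF B(3)] spB by simp
  obtain g' where g': "Vector_Spaces.linear s1 s2 g'" "\<forall>x\<in>B. g' x = g x"
    using linear_independent_extend[OF B(3)] by blast
  have "x \<in> vs1.span B \<Longrightarrow> x \<in> V \<and> g' x = g x" for x
  proof (induction rule: vs1.span_induct_alt)
    case base
    then show ?case using g0 linear_0[OF g'(1)] vs1.subspace_0[OF V(1)] by simp
  next
    case (step c x y)
    then have "x \<in> V" "s1 c x \<in> V" using B(2) vs1.subspace_scale[OF V(1)] by auto
    then show ?case using step g'(2) add sc vs1.subspace_add[OF V(1)]
      by (simp add: linear_add[OF g'(1)] linear_scale[OF g'(1)])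
  qed
  then have eq: "g' x = g x" if "x \<in> V" for x using that spB by blast
  define C where "C = B - BK"
  have CB: "C \<subseteq> V" "BK \<union> C = B" "BK \<inter> C = {}" using B by (auto simp: C_def)
  have iC: "vs1.independent C" using B(3) CB(2) vs1.independent_mono by blast
  have spC: "vs1.span C \<subseteq> V" using CB spB vs1.span_mono[of C B] by auto
  have inj: "inj_on g' (vs1.span C)"
  proof (rule inj_onI)
    fix x y assume xy: "x \<in> vs1.span C" "y \<in> vs1.span C" "g' x = g' y"
    have d: "x - y \<in> vs1.span C" using xy vs1.span_diff by blast
    have "g' (x - y) = 0" using xy linear_diff[OF g'(1)] by simp
    then have "x - y \<in> K" using d spC eq by (auto simp: K_def)
    then have "x - y = 0" using vs1.disjoint_spans[of BK C "x - y"] CB B(3) BK(4) d by simp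
    then show "x = y" by simp
  qed
  have ind: "vs2.independent (g' ` C)" by (rule linear_independent_injective_image[OF g'(1) iC inj])
  have "vs2.span (g' ` B) = g ` V"
    using linear_span_image[OF g'(1), of B] spB eq by (auto simp: image_def)
  moreover have "vs2.span (g' ` B) = vs2.span (g' ` C)"
  proof -
    have "g' ` B \<subseteq> insert 0 (g' ` C)" using CB BK(1) eq KV by (auto simp: K_def)
    from vs2.span_mono[OF this] have "vs2.span (g' ` B) \<subseteq> vs2.span (g' ` C)"
      unfolding vs2.span_insert_0 .
    moreover have "vs2.span (g' ` C) \<subseteq> vs2.span (g' ` B)" using CB by (intro vs2.span_mono) auto
    ultimately show ?thesis by simp
  qed
  ultimately have "vs2.dim (g ` V) = card (g' ` C)"
    using vs2.dim_span_eq_card_independent[OF ind] by simp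
  also have "\<dots> = card C" using inj vs1.span_superset[of C] by (intro card_image) (auto intro: inj_on_subset)
  finally show ?thesis using dV BK(5) CB(2,3) fB by (simp flip: K_def) (metis card_Un_disjoint finite_Un add.commute)
qed

definition fscale :: "complex \<Rightarrow> ('m \<Rightarrow> complex) \<Rightarrow> ('m \<Rightarrow> complex)" where
  "fscale c f = (\<lambda>x. c * f x)"

lemma vector_space_fscale: "vector_space fscale"
  by unfold_locales (auto simp: fscale_def fun_eq_iff algebra_simps)

lemma vector_space_pair_fscale: "vector_space_pair fscale fscale"
  by (intro vector_space_pair.intro vector_space_fscale)

text \<open>A finite-dimensional complex vector space with an explicit carrier, as needed for modules that are
  records. Dimensions are transported from a type-based vector space by coordinates in a chosen basis.\<close>

locale cspace = abelian_group M for M :: "('m, 'z) ring_scheme" (structure) +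
  fixes s :: "complex \<Rightarrow> 'm \<Rightarrow> 'm"
  assumes s_closed [simp]: "x \<in> carrier M \<Longrightarrow> s c x \<in> carrier M"
    and s_add: "x \<in> carrier M \<Longrightarrow> y \<in> carrier M \<Longrightarrow> s c (x \<oplus> y) = s c x \<oplus> s c y"
    and s_plus: "x \<in> carrier M \<Longrightarrow> s (c + d) x = s c x \<oplus> s d x"
    and s_mult: "x \<in> carrier M \<Longrightarrow> s (c * d) x = s c (s d x)"
    and s_one [simp]: "x \<in> carrier M \<Longrightarrow> s 1 x = x"
    and finite_span: "\<exists>B. finite B \<and> B \<subseteq> carrier M \<and> (\<forall>x\<in>carrier M. \<exists>c. x = (\<Oplus>b\<in>B. s (c b) b))"
begin

lemma s_zero_left [simp]: "x \<in> carrier M \<Longrightarrow> s 0 x = \<zero>"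
  using s_plus[of x 0 0] add.l_cancel_one[of "s 0 x" "s 0 x"] by simp

lemma s_zero_right [simp]: "s c \<zero> = \<zero>"
  using s_mult[of \<zero> c 0] by simp

definition lin :: "'m set \<Rightarrow> ('m \<Rightarrow> complex) \<Rightarrow> 'm" where
  "lin B c = (\<Oplus>b\<in>B. s (c b) b)"

lemma lin_closed: "B \<subseteq> carrier M \<Longrightarrow> lin B c \<in> carrier M"
  unfolding lin_def by (rule finsum_closed) auto

lemma lin_add: "finite B \<Longrightarrow> B \<subseteq> carrier M \<Longrightarrow> lin B (\<lambda>b. c b + d b) = lin B c \<oplus> lin B d"
proof -
  assume B: "finite B" "B \<subseteq> carrier M"
  then have "lin B (\<lambda>b. c b + d b) = (\<Oplus>b\<in>B. s (c b) b \<oplus> s (d b) b)"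
    unfolding lin_def by (intro finsum_cong') (auto simp: s_plus)
  also have "\<dots> = lin B c \<oplus> lin B d" unfolding lin_def using B by (intro finsum_addf) auto
  finally show ?thesis .
qed

lemma s_finsum: "finite B \<Longrightarrow> f \<in> B \<rightarrow> carrier M \<Longrightarrow> s c (\<Oplus>b\<in>B. f b) = (\<Oplus>b\<in>B. s c (f b))"
  by (induction B rule: finite_induct) (auto simp: s_add Pi_iff)

lemma lin_scale: "finite B \<Longrightarrow> B \<subseteq> carrier M \<Longrightarrow> lin B (\<lambda>b. a * c b) = s a (lin B c)"
  unfolding lin_def by (subst s_finsum) (auto simp: s_mult subset_eq intro!: finsum_cong')

lemma basis_ex:
  "\<exists>B. finite B \<and> B \<subseteq> carrier M \<and> (\<forall>x\<in>carrier M. \<exists>c. x = lin B c) \<and>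
     (\<forall>c. lin B c = \<zero> \<longrightarrow> (\<forall>b\<in>B. c b = 0))"
proof -
  define P where "P B \<longleftrightarrow> finite B \<and> B \<subseteq> carrier M \<and> (\<forall>x\<in>carrier M. \<exists>c. x = lin B c)" for B
  have "\<exists>B. P B" using finite_span unfolding P_def lin_def by auto
  then obtain B where B: "P B" and min: "\<And>B'. P B' \<Longrightarrow> card B \<le> card B'"
    using ex_has_least_nat[of P _ card] by blast
  have fin: "finite B" "B \<subseteq> carrier M" using B by (auto simp: P_def)
  have "c b = 0" if c: "lin B c = \<zero>" and b: "b \<in> B" for c b
  proof (rule ccontr)
    assume cb: "c b \<noteq> 0"
    have bc: "b \<in> carrier M" and Bb: "B - {b} \<subseteq> carrier M" "finite (B - {b})" using b fin by auto
    have split: "lin B d = s (d b) b \<oplus> lin (B - {b}) d" for d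
    proof -
      have "lin B d = lin (insert b (B - {b})) d" using b by (simp add: insert_absorb)
      also have "\<dots> = s (d b) b \<oplus> lin (B - {b}) d"
        unfolding lin_def using fin bc by (subst finsum_insert) auto
      finally show ?thesis .
    qed
    have "P (B - {b})" unfolding P_def
    proof (intro conjI ballI)
      fix x assume "x \<in> carrier M"
      then obtain d where d: "x = lin B d" using B unfolding P_def by blast
      define e where "e k = d k + (- d b / c b) * c k" for k
      have "lin B e = lin B d \<oplus> s (- d b / c b) (lin B c)"
        unfolding e_def lin_add[OF fin] lin_scale[OF fin] ..
      then have "x = lin B e" using c d fin by (simp add: lin_closed)
      moreover have "e b = 0" using cb by (simp add: e_def)
      ultimately have "x = lin (B - {b}) e" using split[of e] bc Bb by (simp add: lin_closed)
      then show "\<exists>c. x = lin (B - {b}) c" by blast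
    qed (use Bb in auto)
    then have "card B \<le> card (B - {b})" by (rule min)
    then show False using b fin by (metis card_Diff1_less not_le)
  qed
  then show ?thesis using B unfolding P_def by blast
qed

definition basis :: "'m set" where
  "basis = (SOME B. finite B \<and> B \<subseteq> carrier M \<and> (\<forall>x\<in>carrier M. \<exists>c. x = lin B c) \<and>
     (\<forall>c. lin B c = \<zero> \<longrightarrow> (\<forall>b\<in>B. c b = 0)))"

lemma basis: "finite basis" "basis \<subseteq> carrier M" "x \<in> carrier M \<Longrightarrow> \<exists>c. x = lin basis c"
  "lin basis c = \<zero> \<Longrightarrow> b \<in> basis \<Longrightarrow> c b = 0"
  using someI_ex[OF basis_ex, folded basis_def] by blast+

definition coord :: "'m \<Rightarrow> 'm \<Rightarrow> complex" where
  "coord x = (SOME c. x = lin basis c \<and> (\<forall>b. b \<notin> basis \<longrightarrow> c b = 0))"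

lemma coord: assumes "x \<in> carrier M"
  shows "lin basis (coord x) = x" "b \<notin> basis \<Longrightarrow> coord x b = 0"
proof -
  obtain c where c: "x = lin basis c" using basis(3)[OF assms] by blast
  have "lin basis (\<lambda>b. if b \<in> basis then c b else 0) = lin basis c"
    unfolding lin_def using basis(2) by (intro finsum_cong') auto
  then have "\<exists>c. x = lin basis c \<and> (\<forall>b. b \<notin> basis \<longrightarrow> c b = 0)"
    using c by (intro exI[of _ "\<lambda>b. if b \<in> basis then c b else 0"]) auto
  from someI_ex[OF this, folded coord_def]
  show "lin basis (coord x) = x" "b \<notin> basis \<Longrightarrow> coord x b = 0" by auto
qed

lemma coord_unique:
  assumes "\<And>b. b \<notin> basis \<Longrightarrow> c b = 0" shows "coord (lin basis c) = c"
proof (rule ext)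
  fix b
  define x where "x = lin basis c"
  have x: "x \<in> carrier M" using basis(2) by (simp add: x_def lin_closed)
  have "lin basis (\<lambda>b. coord x b + (-1) * c b) = x \<oplus> s (-1) x"
    unfolding lin_add[OF basis(1,2)] lin_scale[OF basis(1,2)] coord(1)[OF x] x_def[symmetric] ..
  also have "\<dots> = s (1 + -1) x" using x by (subst s_plus) auto
  finally have "lin basis (\<lambda>b. coord x b + (-1) * c b) = \<zero>" using x by simp
  from basis(4)[OF this] show "coord (lin basis c) b = c b"
    using coord(2)[OF x] assms by (cases "b \<in> basis") (auto simp: x_def)
qed

lemma coord_add: "x \<in> carrier M \<Longrightarrow> y \<in> carrier M \<Longrightarrow> coord (x \<oplus> y) = coord x + coord y"
  using coord_unique[of "\<lambda>b. coord x b + coord y b"] basis(1,2) coord[of x] coord[of y]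
  by (simp add: lin_add plus_fun_def)

lemma coord_scale: "x \<in> carrier M \<Longrightarrow> coord (s a x) = fscale a (coord x)"
  using coord_unique[of "\<lambda>b. a * coord x b"] basis(1,2) coord[of x]
  by (simp add: lin_scale fscale_def)

lemma coord_inj: "inj_on coord (carrier M)"
  by (rule inj_onI) (metis coord(1))

lemma coord_zero: "coord \<zero> = 0"
  using coord_scale[of \<zero> 0] by (simp add: fscale_def zero_fun_def)

sublocale V: vector_space "fscale :: complex \<Rightarrow> ('m \<Rightarrow> complex) \<Rightarrow> _" by (rule vector_space_fscale)

definition csub :: "'m set \<Rightarrow> bool" where
  "csub H \<longleftrightarrow> H \<subseteq> carrier M \<and> \<zero> \<in> H \<and> (\<forall>x\<in>H. \<forall>y\<in>H. x \<oplus> y \<in> H) \<and> (\<forall>c. \<forall>x\<in>H. s c x \<in> H)"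

definition cdim :: "'m set \<Rightarrow> nat" where "cdim H = V.dim (coord ` H)"

definition delta :: "'m \<Rightarrow> 'm \<Rightarrow> complex" where "delta b = (\<lambda>x. if x = b then 1 else 0)"

lemma coord_span: assumes "x \<in> carrier M" shows "coord x \<in> V.span (delta ` basis)"
proof -
  have "coord x = (\<Sum>b\<in>basis. fscale (coord x b) (delta b))"
  proof (rule ext)
    fix k
    have "(\<Sum>b\<in>basis. fscale (coord x b) (delta b)) k = (\<Sum>b\<in>basis. coord x b * delta b k)"
      using basis(1) by (induction rule: finite_induct) (auto simp: fscale_def)
    also have "\<dots> = (\<Sum>b\<in>basis. if b = k then coord x k else 0)"
      by (rule sum.cong) (auto simp: delta_def)
    also have "\<dots> = coord x k" using coord(2)[OF assms] basis(1) by auto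
    finally show "coord x k = (\<Sum>b\<in>basis. fscale (coord x b) (delta b)) k" by simp
  qed
  then show ?thesis by (metis (no_types, lifting) V.span_sum V.span_scale V.span_base imageI)
qed

lemma coord_subspace: assumes "csub H" shows "V.subspace (coord ` H)" "coord ` H \<subseteq> V.span (delta ` basis)" "finite (delta ` basis)"
proof -
  show "V.subspace (coord ` H)"
  proof (rule V.subspaceI)
    show "0 \<in> coord ` H" using assms coord_zero unfolding csub_def by (metis imageI)
  next
    fix x y assume "x \<in> coord ` H" "y \<in> coord ` H"
    then obtain u v where "u \<in> H" "v \<in> H" "x = coord u" "y = coord v" by auto
    moreover from this have "u \<in> carrier M" "v \<in> carrier M" using assms by (auto simp: csub_def)
    ultimately have "x + y = coord (u \<oplus> v)" "u \<oplus> v \<in> H"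
      using assms by (simp_all only: coord_add) (simp add: csub_def)
    then show "x + y \<in> coord ` H" by (metis imageI)
  next
    fix c x assume "x \<in> coord ` H"
    then obtain u where "u \<in> H" "x = coord u" by auto
    moreover from this have "u \<in> carrier M" using assms by (auto simp: csub_def)
    ultimately have "fscale c x = coord (s c u)" "s c u \<in> H"
      using assms by (simp_all only: coord_scale) (simp add: csub_def)
    then show "fscale c x \<in> coord ` H" by (metis imageI)
  qed
  show "coord ` H \<subseteq> V.span (delta ` basis)" using assms coord_span by (auto simp: csub_def)
  show "finite (delta ` basis)" using basis(1) by simp
qed

lemma csub_zero: "csub {\<zero>}" and csub_carrier: "csub (carrier M)"
  by (auto simp: csub_def)

lemma cdim_zero: "cdim {\<zero>} = 0"
  unfolding cdim_def using coord_zero V.dim_span_eq_card_independent[OF V.independent_empty] by simp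

lemma cdim_eq_0: assumes "csub H" "cdim H = 0" shows "H = {\<zero>}"
proof -
  have "coord ` H = {0}" using V.dim_eq_0_finite[OF coord_subspace[OF assms(1)]] assms(2) by (simp add: cdim_def)
  then have "coord x = coord \<zero>" if "x \<in> H" for x using that coord_zero by auto
  then have "H \<subseteq> {\<zero>}" using assms(1) coord_inj by (auto simp: csub_def subset_eq dest: inj_onD[OF coord_inj])
  then show ?thesis using assms(1) by (auto simp: csub_def)
qed

lemma cdim_line: assumes "x \<in> carrier M" "x \<noteq> \<zero>" shows "csub {s c x | c. True}" "cdim {s c x | c. True} = 1"
proof -
  show "csub {s c x | c. True}" unfolding csub_def
  proof (intro conjI ballI allI)
    show "\<zero> \<in> {s c x | c. True}" using s_zero_left[OF assms(1)] by (metis (mono_tags, lifting) mem_Collect_eq)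
  next
    fix y z assume "y \<in> {s c x | c. True}" "z \<in> {s c x | c. True}"
    then obtain c d where "y = s c x" "z = s d x" by auto
    then have "y \<oplus> z = s (c + d) x" using s_plus[OF assms(1)] by simp
    then show "y \<oplus> z \<in> {s c x | c. True}" by blast
  next
    fix a y assume "y \<in> {s c x | c. True}"
    then obtain c where "y = s c x" by auto
    then have "s a y = s (a * c) x" using s_mult[OF assms(1)] by simp
    then show "s a y \<in> {s c x | c. True}" by blast
  qed (use assms(1) in auto)
  have nz: "coord x \<noteq> 0" using assms coord_zero coord_inj by (metis inj_onD zero_closed)
  have "coord ` {s c x | c. True} = {fscale c (coord x) | c. True}"
    unfolding setcompr_eq_image image_image coord_scale[OF assms(1)] ..
  also have "\<dots> = V.span {coord x}" by (auto simp: V.span_singleton)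
  finally show "cdim {s c x | c. True} = 1"
    unfolding cdim_def using nz V.dim_span_eq_card_independent[of "{coord x}"] by simp
qed

lemma cdim_psub:
  assumes H: "csub H" "csub H'" "H \<subseteq> H'"
  shows "cdim H \<le> cdim H'" "cdim H = cdim H' \<Longrightarrow> H = H'"
proof -
  obtain p :: "('m \<Rightarrow> complex) \<Rightarrow> ('m \<Rightarrow> complex)" where p: "Vector_Spaces.linear fscale fscale p" "\<forall>x. p x = 0 \<longleftrightarrow> x \<in> coord ` H"
    using V.exists_linear_with_kernel[OF coord_subspace(1)[OF H(1)]] by metis
  interpret p: Vector_Spaces.linear fscale fscale p by (rule p(1))
  have "{x \<in> coord ` H'. p x = 0} = coord ` H" using p(2) H(3) by auto
  then have d: "cdim H' = V.dim (p ` coord ` H') + cdim H"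
    unfolding cdim_def using rank_nullity[OF vector_space_pair_fscale coord_subspace[OF H(2)], of p]
    by (simp add: p.add p.scale)
  then show "cdim H \<le> cdim H'" by simp
  assume "cdim H = cdim H'"
  then have 0: "V.dim (p ` coord ` H') = 0" using d by simp
  have "p ` coord ` H' \<subseteq> V.span (p ` delta ` basis)"
    using coord_subspace(2)[OF H(2)] p.span_image by blast
  then have "p ` coord ` H' = {0}"
    using V.dim_eq_0_finite[OF p.subspace_image[OF coord_subspace(1)[OF H(2)]] _ _ 0] coord_subspace(3)[OF H(2)] by blast
  then have "coord ` H' \<subseteq> coord ` H" using p(2) by auto
  then have "coord ` H' = coord ` H" using H(3) by auto
  then have "H' = H" using inj_on_image_eq_iff[OF coord_inj, of H' H] H by (simp add: csub_def)
  then show "H = H'" using H(3) by auto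
qed

lemma csub_Int: "csub A \<Longrightarrow> csub B \<Longrightarrow> csub (A \<inter> B)"
  by (auto simp: csub_def)

lemma csub_sum: assumes A: "csub A" and B: "csub B" shows "csub (set_add M A B)"
proof -
  note c = A[unfolded csub_def] B[unfolded csub_def]
  show ?thesis unfolding csub_def
  proof (intro conjI ballI allI)
    show "set_add M A B \<subseteq> carrier M" using c by (auto simp: set_add_def')
    show "\<zero> \<in> set_add M A B" using c unfolding set_add_def' by (auto intro!: bexI[of _ \<zero>])
  next
    fix x y assume "x \<in> set_add M A B" "y \<in> set_add M A B"
    then obtain a b a' b' where h: "a \<in> A" "b \<in> B" "a' \<in> A" "b' \<in> B" "x = a \<oplus> b" "y = a' \<oplus> b'"
      by (auto simp: set_add_def')
    then have "x \<oplus> y = (a \<oplus> a') \<oplus> (b \<oplus> b')" using c by (simp add: a_ac subset_eq)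
    then show "x \<oplus> y \<in> set_add M A B" using h c unfolding set_add_def' by blast
  next
    fix k x assume "x \<in> set_add M A B"
    then obtain a b where h: "a \<in> A" "b \<in> B" "x = a \<oplus> b" by (auto simp: set_add_def')
    then have "s k x = s k a \<oplus> s k b" using c by (simp add: s_add subset_eq)
    then show "s k x \<in> set_add M A B" using h c unfolding set_add_def' by blast
  qed
qed

text \<open>Rank-nullity for a linear map with kernel \<open>A\<close>, restricted to \<open>B\<close> and to the sum: both have the same image.\<close>

lemma cdim_sum_Int:
  assumes A: "csub A" and B: "csub B"
  shows "cdim (set_add M A B) + cdim (A \<inter> B) = cdim A + cdim B"
proof -
  note c = A[unfolded csub_def] B[unfolded csub_def]
  have AB: "A \<subseteq> carrier M" "B \<subseteq> carrier M" using c by auto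
  obtain p :: "('m \<Rightarrow> complex) \<Rightarrow> ('m \<Rightarrow> complex)" where p: "Vector_Spaces.linear fscale fscale p" "\<forall>x. p x = 0 \<longleftrightarrow> x \<in> coord ` A"
    using V.exists_linear_with_kernel[OF coord_subspace(1)[OF A]] by metis
  interpret p: Vector_Spaces.linear fscale fscale p by (rule p(1))
  have sub: "A \<subseteq> set_add M A B"
  proof
    fix a assume "a \<in> A"
    then have "a = a \<oplus> \<zero>" using subsetD[OF AB(1)] by simp
    then show "a \<in> set_add M A B" using \<open>a \<in> A\<close> c unfolding set_add_def' by blast
  qed
  have rn: "V.dim (coord ` H) = V.dim (p ` coord ` H) + V.dim {x \<in> coord ` H. p x = 0}" if "csub H" for H
    by (rule rank_nullity[OF vector_space_pair_fscale coord_subspace[OF that]]) (simp_all add: p.add p.scale)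
  have "{x \<in> coord ` (set_add M A B). p x = 0} = coord ` A" using p(2) sub by auto
  moreover have "{x \<in> coord ` B. p x = 0} = coord ` (A \<inter> B)"
  proof -
    have "{x \<in> coord ` B. p x = 0} = coord ` A \<inter> coord ` B" using p(2) by auto
    also have "\<dots> = coord ` (A \<inter> B)" using inj_on_image_Int[OF coord_inj AB] by simp
    finally show ?thesis .
  qed
  moreover have "p ` coord ` (set_add M A B) = p ` coord ` B"
  proof (intro equalityI subsetI)
    fix y assume "y \<in> p ` coord ` (set_add M A B)"
    then obtain a b where ab: "a \<in> A" "b \<in> B" "y = p (coord (a \<oplus> b))" by (auto simp: set_add_def')
    moreover have "coord (a \<oplus> b) = coord a + coord b" using ab c by (intro coord_add) auto
    ultimately have "y = p (coord a) + p (coord b)" by (simp only: p.add)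
    also have "p (coord a) = 0" using p(2) ab(1) by auto
    finally show "y \<in> p ` coord ` B" using ab(2) by simp
  next
    fix y assume "y \<in> p ` coord ` B"
    then obtain b where b: "b \<in> B" "y = p (coord b)" by auto
    then have "b = \<zero> \<oplus> b" using subsetD[OF AB(2)] by simp
    then have "b \<in> set_add M A B" using b c unfolding set_add_def' by blast
    then show "y \<in> p ` coord ` (set_add M A B)" using b by blast
  qed
  ultimately show ?thesis using rn[OF csub_sum[OF A B]] rn[OF B] by (simp add: cdim_def)
qed

end

lemma cdim_rank_nullity:
  fixes M :: "('m, 'z) ring_scheme" and N :: "('n, 'y) ring_scheme"
  assumes M: "cspace M s" and N: "cspace N t" and H: "cspace.csub M s H"
    and f: "\<And>x. x \<in> H \<Longrightarrow> f x \<in> carrier N"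
    and add: "\<And>x y. x \<in> H \<Longrightarrow> y \<in> H \<Longrightarrow> f (x \<oplus>\<^bsub>M\<^esub> y) = f x \<oplus>\<^bsub>N\<^esub> f y"
    and sc: "\<And>c x. x \<in> H \<Longrightarrow> f (s c x) = t c (f x)"
  shows "cspace.cdim M s H = cspace.cdim N t (f ` H) + cspace.cdim M s {x \<in> H. f x = \<zero>\<^bsub>N\<^esub>}"
proof -
  interpret M: cspace M s by fact
  interpret N: cspace N t by fact
  have HM: "H \<subseteq> carrier M" using H by (simp add: M.csub_def)
  define \<psi> where "\<psi> = the_inv_into H M.coord"
  have inj: "inj_on M.coord H" using M.coord_inj HM by (rule inj_on_subset)
  have \<psi>: "\<psi> (M.coord x) = x" if "x \<in> H" for x using the_inv_into_f_f[OF inj that] by (simp add: \<psi>_def)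
  define g where "g = N.coord \<circ> f \<circ> \<psi>"
  have g: "g (M.coord x) = N.coord (f x)" if "x \<in> H" for x using \<psi>[OF that] by (simp add: g_def)
  have cl: "x \<oplus>\<^bsub>M\<^esub> y \<in> H" "s c x \<in> H" if "x \<in> H" "y \<in> H" for x y c
    using H that by (auto simp: M.csub_def)
  have "M.V.dim (M.coord ` H) = N.V.dim (g ` M.coord ` H) + M.V.dim {x \<in> M.coord ` H. g x = 0}"
  proof (rule rank_nullity[OF vector_space_pair_fscale M.coord_subspace[OF H]])
    fix x y assume "x \<in> M.coord ` H" "y \<in> M.coord ` H"
    then obtain u v where uv: "u \<in> H" "v \<in> H" "x = M.coord u" "y = M.coord v" by auto
    have "x + y = M.coord (u \<oplus>\<^bsub>M\<^esub> v)" using uv HM by (subst M.coord_add) auto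
    then show "g (x + y) = g x + g y"
      using uv g[of u] g[of v] g[of "u \<oplus>\<^bsub>M\<^esub> v"] cl N.coord_add[of "f u" "f v"] f add by simp
  next
    fix c x assume "x \<in> M.coord ` H"
    then obtain u where u: "u \<in> H" "x = M.coord u" by auto
    have "fscale c x = M.coord (s c u)" using u HM by (subst M.coord_scale) auto
    then show "g (fscale c x) = fscale c (g x)"
      using u g[of u] g[of "s c u"] cl N.coord_scale[of "f u"] f sc by simp
  qed
  moreover have "g ` M.coord ` H = N.coord ` f ` H" using g by (auto simp: image_iff)
  moreover have "{x \<in> M.coord ` H. g x = 0} = M.coord ` {x \<in> H. f x = \<zero>\<^bsub>N\<^esub>}"
  proof -
    have "N.coord (f x) = 0 \<longleftrightarrow> f x = \<zero>\<^bsub>N\<^esub>" if "x \<in> H" for x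
      using N.coord_zero inj_onD[OF N.coord_inj, of "f x" "\<zero>\<^bsub>N\<^esub>"] f[OF that] by auto
    then show ?thesis using g N.coord_zero by auto
  qed
  ultimately show ?thesis by (simp add: M.cdim_def N.cdim_def)
qed

section \<open>Path algebras\<close>

definition path_mult :: "('v list \<Rightarrow> complex) \<Rightarrow> ('v list \<Rightarrow> complex) \<Rightarrow> 'v list \<Rightarrow> complex" where
  "path_mult f g p = (\<Sum>k<length p. f (drop k p) * g (take (Suc k) p))"

lemma path_algebra_simps [simp]:
  "carrier (path_algebra I A) = {f. finite {p. f p \<noteq> 0} \<and> (\<forall>p. f p \<noteq> 0 \<longrightarrow> quiver_path I A p)}"
  "f \<otimes>\<^bsub>path_algebra I A\<^esub> g = path_mult f g"
  "\<one>\<^bsub>path_algebra I A\<^esub> = (\<lambda>p. if \<exists>i\<in>I. p = [i] then 1 else 0)"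
  "\<zero>\<^bsub>path_algebra I A\<^esub> = (\<lambda>p. 0)"
  "f \<oplus>\<^bsub>path_algebra I A\<^esub> g = (\<lambda>p. f p + g p)"
  by (simp_all add: path_algebra_def path_mult_def[abs_def])

text \<open>Both sides sum over the ways to cut the path at two positions.\<close>

lemma path_mult_assoc:
  fixes f g h :: "'v list \<Rightarrow> complex"
  shows "path_mult (path_mult f g) h = path_mult f (path_mult g h)"
proof (rule ext)
  fix p :: "'v list"
  define n where "n = length p"
  define G where "G l k = f (drop (l + k) p) * g (take (Suc k) (drop l p)) * h (take (Suc l) p)" for l k
  have "path_mult (path_mult f g) h p = (\<Sum>l<n. \<Sum>k<n - l. G l k)"
    unfolding path_mult_def G_def n_def by (simp add: sum_distrib_right add.commute)
  also have "\<dots> = (\<Sum>(l, k)\<in>{(l, k). l + k < n}. G l k)"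
    by (subst sum.Sigma) (auto intro!: sum.cong)
  also have "\<dots> = (\<Sum>m<n. \<Sum>l\<le>m. G l (m - l))" by (rule sum.triangle_reindex)
  also have "\<dots> = (\<Sum>m<n. f (drop m p) * path_mult g h (take (Suc m) p))"
  proof (rule sum.cong[OF refl])
    fix m assume m: "m \<in> {..<n}"
    have "path_mult g h (take (Suc m) p) = (\<Sum>l\<le>m. g (drop l (take (Suc m) p)) * h (take (Suc l) (take (Suc m) p)))"
      unfolding path_mult_def using m by (auto simp: n_def lessThan_Suc_atMost min_def intro!: sum.cong)
    also have "\<dots> = (\<Sum>l\<le>m. g (take (Suc (m - l)) (drop l p)) * h (take (Suc l) p))"
      by (rule sum.cong) (auto simp: drop_take Suc_diff_le min_def)
    finally show "(\<Sum>l\<le>m. G l (m - l)) = f (drop m p) * path_mult g h (take (Suc m) p)"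
      by (simp add: G_def sum_distrib_left mult.assoc)
  qed
  also have "\<dots> = path_mult f (path_mult g h) p" by (simp add: path_mult_def n_def)
  finally show "path_mult (path_mult f g) h p = path_mult f (path_mult g h) p" .
qed

lemma path_mult_add: "path_mult (\<lambda>p. f p + g p) h = (\<lambda>p. path_mult f h p + path_mult g h p)"
  "path_mult h (\<lambda>p. f p + g p) = (\<lambda>p. path_mult h f p + path_mult h g p)"
  by (auto simp: path_mult_def fun_eq_iff algebra_simps sum.distrib)

lemma list_cases_2 [case_names Nil Single Pair More]:
  obtains "p = []" | a where "p = [a]" | a b where "p = [a, b]" | a b c q where "p = a # b # c # q"
  by (metis neq_Nil_conv)

text \<open>The combination \<open>\<Sum>\<^sub>i d\<^sub>i e\<^sub>i\<close> of the trivial paths: vertices, scalars and sums of vertices are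
  all of this form.\<close>

definition diag :: "('v \<Rightarrow> complex) \<Rightarrow> 'v list \<Rightarrow> complex" where
  "diag d p = (case p of [i] \<Rightarrow> d i | _ \<Rightarrow> 0)"

lemma diag_simps [simp]: "diag d [] = 0" "diag d [i] = d i" "diag d (i # k # p) = 0"
  by (simp_all add: diag_def)

lemma diag_eq_0: "length p \<noteq> 1 \<Longrightarrow> diag d p = 0"
  by (cases p; cases "tl p") (auto simp: diag_def split: list.splits)

lemma path_mult_diag_right: "path_mult f (diag d) p = (if p = [] then 0 else f p * d (hd p))"
proof (cases p)
  case (Cons i q)
  have "path_mult f (diag d) p = (\<Sum>k<length p. if k = 0 then f p * d i else 0)"
    unfolding path_mult_def by (rule sum.cong) (auto simp: Cons diag_eq_0)
  then show ?thesis using Cons by simp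
qed (simp add: path_mult_def)

lemma path_mult_diag_left: "path_mult (diag d) f p = (if p = [] then 0 else d (last p) * f p)"
proof (cases "p = []")
  case False
  then have "drop (length p - 1) p = [last p]"
    by (metis append_butlast_last_id append_eq_conv_conj length_butlast)
  moreover have "path_mult (diag d) f p = (\<Sum>k<length p. if k = length p - 1 then diag d (drop k p) * f p else 0)"
    unfolding path_mult_def using False by (intro sum.cong) (auto simp: diag_eq_0)
  ultimately show ?thesis using False by (simp add: sum.delta)
qed (simp add: path_mult_def)

lemma quiver_path_glue:
  assumes "k < length p" "quiver_path I A (drop k p)" "quiver_path I A (take (Suc k) p)"
  shows "quiver_path I A p"
proof -
  have p: "p = take k p @ drop k p" and d: "hd (drop k p) = p ! k" and t: "take (Suc k) p = take k p @ [p ! k]"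
    using assms(1) by (simp_all add: hd_drop_conv_nth take_Suc_conv_app_nth)
  have "set p \<subseteq> I" using assms(2,3) set_append[of "take k p" "drop k p"] t unfolding quiver_path_def by auto
  moreover have "successively (\<lambda>i j. (i, j) \<in> A) p"
    using assms(2,3) d unfolding quiver_path_def t successively_append_iff
    by (subst p, subst successively_append_iff) simp
  ultimately show ?thesis using assms(1) by (auto simp: quiver_path_def)
qed

lemma path_mult_nonzero:
  assumes "path_mult f g p \<noteq> 0"
  obtains k where "k < length p" "f (drop k p) \<noteq> 0" "g (take (Suc k) p) \<noteq> 0"
  using assms unfolding path_mult_def by (metis (mono_tags, lifting) lessThan_iff mult_eq_0_iff sum.neutral)

lemma path_mult_closed:
  assumes "f \<in> carrier (path_algebra I A)" "g \<in> carrier (path_algebra I A)"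
  shows "path_mult f g \<in> carrier (path_algebra I A)"
proof -
  have "{p. path_mult f g p \<noteq> 0} \<subseteq> (\<lambda>(q, r). q @ tl r) ` ({p. g p \<noteq> 0} \<times> {p. f p \<noteq> 0})"
  proof
    fix p assume "p \<in> {p. path_mult f g p \<noteq> 0}"
    then obtain k where k: "k < length p" "f (drop k p) \<noteq> 0" "g (take (Suc k) p) \<noteq> 0"
      using path_mult_nonzero by blast
    have "p = take (Suc k) p @ tl (drop k p)" by (metis append_take_drop_id drop_Suc tl_drop)
    then show "p \<in> (\<lambda>(q, r). q @ tl r) ` ({p. g p \<noteq> 0} \<times> {p. f p \<noteq> 0})"
      using k(2,3) by (intro image_eqI[of _ _ "(take (Suc k) p, drop k p)"]) auto
  qed
  then have "finite {p. path_mult f g p \<noteq> 0}" using assms by (auto intro: finite_subset)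
  moreover have "quiver_path I A p" if "path_mult f g p \<noteq> 0" for p
    using path_mult_nonzero[OF that] quiver_path_glue assms by (metis (mono_tags, lifting) mem_Collect_eq path_algebra_simps(1))
  ultimately show ?thesis by simp
qed

lemma one_diag: "(\<lambda>p. if \<exists>i\<in>I. p = [i] then 1 else 0) = diag (\<lambda>i. if i \<in> I then 1 else 0)"
  by (rule ext) (auto simp: diag_def split: list.splits)

lemma quiver_path_hd_last: "quiver_path I A p \<Longrightarrow> p \<noteq> [] \<and> hd p \<in> I \<and> last p \<in> I"
  by (auto simp: quiver_path_def)

lemma diag_closed:
  assumes "finite I" "\<And>i. i \<notin> I \<Longrightarrow> d i = 0"
  shows "diag d \<in> carrier (path_algebra I A)"
proof -
  have sub: "p \<in> (\<lambda>i. [i]) ` I" if nz: "diag d p \<noteq> 0" for p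
  proof -
    obtain i where "p = [i]" "d i \<noteq> 0" using nz by (cases p rule: remdups_adj.cases) auto
    then show ?thesis using assms(2) by auto
  qed
  have "{p. diag d p \<noteq> 0} \<subseteq> (\<lambda>i. [i]) ` I" using sub by blast
  then have "finite {p. diag d p \<noteq> 0}" using assms(1) finite_subset by blast
  moreover have "quiver_path I A p" if "diag d p \<noteq> 0" for p
    using sub[OF that] unfolding quiver_path_def by (elim imageE) simp
  ultimately show ?thesis by simp
qed

lemma ring_path_algebra: assumes "finite I" shows "ring (path_algebra I A)"
proof (rule ringI)
  show "abelian_group (path_algebra I A)"
  proof (rule abelian_groupI)
    fix f assume f: "f \<in> carrier (path_algebra I A)"
    then show "\<exists>g\<in>carrier (path_algebra I A). g \<oplus>\<^bsub>path_algebra I A\<^esub> f = \<zero>\<^bsub>path_algebra I A\<^esub>"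
      by (intro bexI[of _ "\<lambda>p. - f p"]) auto
  next
    fix f g assume "f \<in> carrier (path_algebra I A)" "g \<in> carrier (path_algebra I A)"
    then have "finite ({p. f p \<noteq> 0} \<union> {p. g p \<noteq> 0})" by simp
    then have "finite {p. f p + g p \<noteq> 0}" by (rule rev_finite_subset) auto
    then show "f \<oplus>\<^bsub>path_algebra I A\<^esub> g \<in> carrier (path_algebra I A)"
      using \<open>f \<in> _\<close> \<open>g \<in> _\<close> by (simp, metis add_0)
  qed (auto simp: algebra_simps)
  show "Group.monoid (path_algebra I A)"
  proof (rule monoidI)
    show "\<one>\<^bsub>path_algebra I A\<^esub> \<in> carrier (path_algebra I A)"
      unfolding path_algebra_simps(3) one_diag by (rule diag_closed[OF assms]) simp
  next
    fix f assume f: "f \<in> carrier (path_algebra I A)"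
    have h: "f p = 0 \<or> (p \<noteq> [] \<and> hd p \<in> I \<and> last p \<in> I)" for p using f quiver_path_hd_last[of I A p] by auto
    show "\<one>\<^bsub>path_algebra I A\<^esub> \<otimes>\<^bsub>path_algebra I A\<^esub> f = f"
      unfolding path_algebra_simps one_diag by (rule ext) (use h in \<open>auto simp: path_mult_diag_left\<close>)
    show "f \<otimes>\<^bsub>path_algebra I A\<^esub> \<one>\<^bsub>path_algebra I A\<^esub> = f"
      unfolding path_algebra_simps one_diag by (rule ext) (use h in \<open>auto simp: path_mult_diag_right\<close>)
  next
    fix f g assume "f \<in> carrier (path_algebra I A)" "g \<in> carrier (path_algebra I A)"
    then show "f \<otimes>\<^bsub>path_algebra I A\<^esub> g \<in> carrier (path_algebra I A)"
      using path_mult_closed by (simp only: path_algebra_simps(2))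
  qed (simp add: path_mult_assoc)
qed (simp_all add: path_mult_add)

lemma path_elem_mult: "path_mult (path_elem (x # q)) (path_elem (p @ [x])) = path_elem (p @ x # q)"
proof (rule ext)
  fix r
  have "(drop k r = x # q \<and> take (Suc k) r = p @ [x]) \<longleftrightarrow> (r = p @ x # q \<and> k = length p)" if k: "k < length r" for k
  proof
    assume a: "drop k r = x # q \<and> take (Suc k) r = p @ [x]"
    then have "length (take (Suc k) r) = Suc (length p)" by simp
    then have kp: "k = length p" using k by simp
    have "take (Suc k) r = take k r @ [r ! k]" using k by (rule take_Suc_conv_app_nth)
    then have "take k r = p" using a by simp
    then show "r = p @ x # q \<and> k = length p" using a kp by (metis append_take_drop_id)
  qed auto
  then have "path_mult (path_elem (x # q)) (path_elem (p @ [x])) r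
      = (\<Sum>k<length r. if k = length p then (if r = p @ x # q then 1 else 0) else 0)"
    unfolding path_mult_def path_elem_def by (intro sum.cong) auto
  also have "\<dots> = path_elem (p @ x # q) r" by (auto simp: path_elem_def)
  finally show "path_mult (path_elem (x # q)) (path_elem (p @ [x])) r = path_elem (p @ x # q) r" .
qed

section \<open>The preprojective algebra\<close>

locale preproj = simple_graph I E for I :: "'v set" and E :: "'v set set" +
  fixes \<Omega> :: "('v \<times> 'v) set"
  assumes orient: "orientation E \<Omega>"
begin

definition Ar :: "('v \<times> 'v) set" where "Ar = \<Omega> \<union> \<Omega>\<inverse>"

abbreviation P where "P \<equiv> double_path_algebra I \<Omega>"
abbreviation J where "J \<equiv> preprojective_ideal I \<Omega>"
abbreviation \<Lambda> where "\<Lambda> \<equiv> preprojective_algebra I \<Omega>"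

lemma P_path_algebra: "P = path_algebra I Ar"
  by (simp add: double_path_algebra_def Ar_def)

lemma P_simps:
  "carrier P = {f. finite {p. f p \<noteq> 0} \<and> (\<forall>p. f p \<noteq> 0 \<longrightarrow> quiver_path I Ar p)}"
  "f \<otimes>\<^bsub>P\<^esub> g = path_mult f g"
  "\<one>\<^bsub>P\<^esub> = diag (\<lambda>i. if i \<in> I then 1 else 0)"
  "\<zero>\<^bsub>P\<^esub> = (\<lambda>p. 0)"
  "f \<oplus>\<^bsub>P\<^esub> g = (\<lambda>p. f p + g p)"
  unfolding P_path_algebra by (simp_all add: one_diag)

sublocale P: ring P unfolding P_path_algebra by (rule ring_path_algebra[OF finite_I])

lemma orient_edges: "(\<lambda>(i, j). {i, j}) ` \<Omega> = E" "inj_on (\<lambda>(i, j). {i, j}) \<Omega>"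
  using orient unfolding orientation_def bij_betw_def by simp_all

lemma \<Omega>_edge: assumes "(i, k) \<in> \<Omega>" shows "{i, k} \<in> E"
proof -
  have "(\<lambda>(i, j). {i, j}) (i, k) \<in> E" using imageI[OF assms] orient_edges(1) by metis
  then show ?thesis by simp
qed

lemma Ar_iff: "(i, k) \<in> Ar \<longleftrightarrow> {i, k} \<in> E"
proof
  show "(i, k) \<in> Ar \<Longrightarrow> {i, k} \<in> E"
    using \<Omega>_edge[of i k] \<Omega>_edge[of k i] unfolding Ar_def by (auto simp: insert_commute)
  assume "{i, k} \<in> E"
  then have "{i, k} \<in> (\<lambda>(i, j). {i, j}) ` \<Omega>" using orient_edges(1) by simp
  then obtain a b where "(a, b) \<in> \<Omega>" "{a, b} = {i, k}" by auto
  then show "(i, k) \<in> Ar" unfolding Ar_def by (auto simp: doubleton_eq_iff)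
qed

lemma \<Omega>_antisym: "(i, k) \<in> \<Omega> \<Longrightarrow> (k, i) \<in> \<Omega> \<Longrightarrow> False"
proof -
  assume a: "(i, k) \<in> \<Omega>" "(k, i) \<in> \<Omega>"
  have "(i, k) = (k, i)" by (rule inj_onD[OF orient_edges(2) _ a]) auto
  then show False using edgeD[OF \<Omega>_edge[OF a(1)]] by simp
qed

lemma \<Omega>_sub: "\<Omega> \<subseteq> I \<times> I"
proof (rule subrelI)
  fix i k assume "(i, k) \<in> \<Omega>"
  from edgeD[OF \<Omega>_edge[OF this]] show "(i, k) \<in> I \<times> I" by simp
qed

lemma finite_\<Omega>: "finite \<Omega>"
  using \<Omega>_sub finite_I by (meson finite_SigmaI finite_subset)

text \<open>The sign of the arrow \<open>i \<rightarrow> k\<close> in the preprojective relation.\<close>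

definition \<epsilon> :: "'v \<Rightarrow> 'v \<Rightarrow> complex" where
  "\<epsilon> i k = (if (i, k) \<in> \<Omega> then 1 else if (k, i) \<in> \<Omega> then -1 else 0)"

lemma \<epsilon>_nonzero: "\<epsilon> i k \<noteq> 0 \<longleftrightarrow> {i, k} \<in> E" "\<epsilon> i k * \<epsilon> i k = (if {i, k} \<in> E then 1 else 0)"
  using Ar_iff[of i k] by (auto simp: \<epsilon>_def Ar_def)

abbreviation rel where "rel \<equiv> preprojective_relation I \<Omega>"

abbreviation ve where "ve i \<equiv> diag (\<lambda>k. if k = i then 1 else 0)"
abbreviation ar :: "'v \<Rightarrow> 'v \<Rightarrow> 'v list \<Rightarrow> complex" where "ar i k \<equiv> path_elem [i, k]"
abbreviation sc where "sc c \<equiv> diag (\<lambda>k. if k \<in> I then c else 0)"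

text \<open>The sum of the trivial paths at the neighbours of \<open>i\<close>.\<close>

definition Nb :: "'v \<Rightarrow> 'v list \<Rightarrow> complex" where "Nb i = diag (\<lambda>k. if {i, k} \<in> E then 1 else 0)"

text \<open>The sum of all arrows that leave \<open>i\<close>. At a module it is the map from the space at \<open>i\<close> to the sum of the
  spaces at its neighbours.\<close>

definition Out :: "'v \<Rightarrow> 'v list \<Rightarrow> complex" where
  "Out i p = (case p of [a, b] \<Rightarrow> if a = i \<and> {i, b} \<in> E then 1 else 0 | _ \<Rightarrow> 0)"

text \<open>The signed sum of all arrows that enter \<open>i\<close>. With these signs \<open>In i \<otimes> Out i\<close> is the component of the
  preprojective relation at \<open>i\<close>, so that the two maps form a complex on every module.\<close>

definition In :: "'v \<Rightarrow> 'v list \<Rightarrow> complex" where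
  "In i p = (case p of [b, a] \<Rightarrow> if a = i then \<epsilon> i b else 0 | _ \<Rightarrow> 0)"

lemma Out_simps [simp]: "Out i [] = 0" "Out i [a] = 0" "Out i (a # b # c # q) = 0"
    "Out i [a, b] = (if a = i \<and> {i, b} \<in> E then 1 else 0)"
  and In_simps [simp]: "In i [] = 0" "In i [a] = 0" "In i (a # b # c # q) = 0"
    "In i [b, a] = (if a = i then \<epsilon> i b else 0)"
  by (simp_all add: Out_def In_def)

lemma path_elem_closed: "quiver_path I Ar p \<Longrightarrow> path_elem p \<in> carrier P"
  by (auto simp: P_simps path_elem_def)

lemma quiver_path_2: "quiver_path I Ar [i, k] \<longleftrightarrow> {i, k} \<in> E"
  using edgeD by (auto simp: quiver_path_def Ar_iff)

lemma quiver_path_Cons: "quiver_path I Ar (i # k # p) \<longleftrightarrow> {i, k} \<in> E \<and> quiver_path I Ar (k # p)"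
  using edgeD by (auto simp: quiver_path_def Ar_iff)

lemma gen_closed [simp, intro]:
  "i \<in> I \<Longrightarrow> ve i \<in> carrier P" "{i, k} \<in> E \<Longrightarrow> ar i k \<in> carrier P" "sc c \<in> carrier P"
  "Nb i \<in> carrier P" "Out i \<in> carrier P" "In i \<in> carrier P"
proof -
  show "i \<in> I \<Longrightarrow> ve i \<in> carrier P" "sc c \<in> carrier P" "Nb i \<in> carrier P"
    unfolding Nb_def P_path_algebra by (rule diag_closed[OF finite_I]; use edgeD in auto)+
  show "{i, k} \<in> E \<Longrightarrow> ar i k \<in> carrier P" by (rule path_elem_closed) (simp add: quiver_path_2)
  have fin: "finite ((\<lambda>b. [i, b]) ` nb i)" "finite ((\<lambda>b. [b, i]) ` nb i)" by simp_all
  have o: "\<exists>b\<in>nb i. p = [i, b]" if "Out i p \<noteq> 0" for p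
    using that by (cases p rule: list_cases_2) (auto split: if_splits)
  then have "{p. Out i p \<noteq> 0} \<subseteq> (\<lambda>b. [i, b]) ` nb i" by blast
  then have "finite {p. Out i p \<noteq> 0}" using fin(1) by (rule finite_subset)
  then show "Out i \<in> carrier P" unfolding P_simps using o quiver_path_2 by fastforce
  have n: "\<exists>b\<in>nb i. p = [b, i]" if "In i p \<noteq> 0" for p
    using that by (cases p rule: list_cases_2) (auto simp: \<epsilon>_nonzero split: if_splits)
  then have "{p. In i p \<noteq> 0} \<subseteq> (\<lambda>b. [b, i]) ` nb i" by blast
  then have "finite {p. In i p \<noteq> 0}" using fin(2) by (rule finite_subset)
  then show "In i \<in> carrier P" unfolding P_simps using n quiver_path_2 by (fastforce simp: insert_commute)
qed

lemma P_finsum: "finite X \<Longrightarrow> f \<in> X \<rightarrow> carrier P \<Longrightarrow> (\<Oplus>\<^bsub>P\<^esub>x\<in>X. f x) = (\<lambda>p. \<Sum>x\<in>X. f x p)"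
  by (induction X rule: finite_induct) (auto simp: Pi_iff P_simps(4,5))

lemma P_minus: "f \<in> carrier P \<Longrightarrow> g \<in> carrier P \<Longrightarrow> f \<ominus>\<^bsub>P\<^esub> g = (\<lambda>p. f p - g p)"
proof -
  assume f: "f \<in> carrier P" and g: "g \<in> carrier P"
  have g': "(\<lambda>p. - g p) \<in> carrier P" using g by (simp add: P_simps)
  have "\<ominus>\<^bsub>P\<^esub> g = (\<lambda>p. - g p)" by (rule P.minus_equality[OF _ g g']) (simp add: P_simps)
  then show ?thesis by (simp add: a_minus_def P_simps)
qed

lemma rel_terms:
  assumes "(i, k) \<in> \<Omega>"
  shows "ar k i \<otimes>\<^bsub>P\<^esub> ar i k = path_elem [i, k, i]" "ar i k \<otimes>\<^bsub>P\<^esub> ar k i = path_elem [k, i, k]"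
    "ar i k \<in> carrier P" "ar k i \<in> carrier P"
    "path_elem [i, k, i] \<in> carrier P" "path_elem [k, i, k] \<in> carrier P"
proof -
  have "{i, k} \<in> E" "{k, i} \<in> E" using assms Ar_iff[of i k] by (auto simp: Ar_def insert_commute)
  then show c: "ar i k \<in> carrier P" "ar k i \<in> carrier P" by auto
  show e: "ar k i \<otimes>\<^bsub>P\<^esub> ar i k = path_elem [i, k, i]" "ar i k \<otimes>\<^bsub>P\<^esub> ar k i = path_elem [k, i, k]"
    using path_elem_mult[of k "[i]" "[i]"] path_elem_mult[of i "[k]" "[k]"] by (simp_all add: P_simps)
  show "path_elem [i, k, i] \<in> carrier P" "path_elem [k, i, k] \<in> carrier P"
    unfolding e[symmetric] by (intro P.m_closed c)+
qed

lemma rel_closed: "rel \<in> carrier P"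
  unfolding preprojective_relation_def Let_def
  by (rule P.finsum_closed) (auto simp: rel_terms intro!: P.minus_closed)

text \<open>The relation is supported on the paths that go to a neighbour and return.\<close>

lemma rel_eq: "rel p = (case p of [i, k, l] \<Rightarrow> if l = i then \<epsilon> i k else 0 | _ \<Rightarrow> 0)"
proof -
  define t where "t a = (ar (snd a) (fst a) \<otimes>\<^bsub>P\<^esub> ar (fst a) (snd a)) \<ominus>\<^bsub>P\<^esub> (ar (fst a) (snd a) \<otimes>\<^bsub>P\<^esub> ar (snd a) (fst a))" for a
  have t: "t \<in> \<Omega> \<rightarrow> carrier P" unfolding t_def by (auto simp: rel_terms(3,4))
  have t_eq: "t a = (\<lambda>p. path_elem [fst a, snd a, fst a] p - path_elem [snd a, fst a, snd a] p)" if "a \<in> \<Omega>" for a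
    unfolding t_def using that by (cases a) (simp add: rel_terms P_minus)
  have "rel = (\<Oplus>\<^bsub>P\<^esub>a\<in>\<Omega>. t a)"
    unfolding preprojective_relation_def Let_def t_def ..
  then have "rel p = (\<Sum>a\<in>\<Omega>. t a p)" using P_finsum[OF finite_\<Omega> t] by simp
  also have "\<dots> = (\<Sum>a\<in>\<Omega>. path_elem [fst a, snd a, fst a] p - path_elem [snd a, fst a, snd a] p)"
    by (rule sum.cong) (simp_all add: t_eq)
  also have "\<dots> = (case p of [i, k, l] \<Rightarrow> if l = i then \<epsilon> i k else 0 | _ \<Rightarrow> 0)"
  proof (cases "\<exists>i k. p = [i, k, i]")
    case True
    then obtain i k where p: "p = [i, k, i]" by auto
    have "(\<Sum>a\<in>\<Omega>. path_elem [fst a, snd a, fst a] p - path_elem [snd a, fst a, snd a] p)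
        = (\<Sum>a\<in>\<Omega>. (if a = (i, k) then 1 else 0) - (if a = (k, i) then 1 else 0))"
    proof (rule sum.cong[OF refl])
      fix a :: "'v \<times> 'v"
      obtain x y where a: "a = (x, y)" by (rule prod.exhaust)
      have "path_elem [x, y, x] [i, k, i] = (if x = i \<and> y = k then 1 else 0)"
        "path_elem [y, x, y] [i, k, i] = (if x = k \<and> y = i then 1 else 0)"
        by (auto simp: path_elem_def)
      then show "path_elem [fst a, snd a, fst a] p - path_elem [snd a, fst a, snd a] p
          = (if a = (i, k) then 1 else 0) - (if a = (k, i) then 1 else 0)"
        unfolding p a by (simp only: fst_conv snd_conv prod.inject)
    qed
    also have "\<dots> = (if (i, k) \<in> \<Omega> then 1 else 0) - (if (k, i) \<in> \<Omega> then 1 else 0)"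
      using finite_\<Omega> by (simp add: sum_subtractf)
    also have "\<dots> = \<epsilon> i k"
      by (cases "(i, k) \<in> \<Omega>"; cases "(k, i) \<in> \<Omega>") (simp_all add: \<epsilon>_def, metis \<Omega>_antisym)
    finally show ?thesis by (simp add: p)
  next
    case False
    then have "(\<Sum>a\<in>\<Omega>. path_elem [fst a, snd a, fst a] p - path_elem [snd a, fst a, snd a] p) = 0"
      by (intro sum.neutral) (auto simp: path_elem_def)
    then show ?thesis using False by (auto split: list.splits)
  qed
  finally show ?thesis .
qed


lemma path_ext:
  fixes f g :: "'v list \<Rightarrow> complex"
  assumes "f [] = g []" "\<And>a. f [a] = g [a]" "\<And>a b. f [a, b] = g [a, b]"
    "\<And>a b c q. f (a # b # c # q) = g (a # b # c # q)"
  shows "f = g"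
proof (rule ext)
  fix p show "f p = g p" by (cases p rule: list_cases_2) (simp_all add: assms)
qed

lemma path_mult_Out:
  "path_mult f (Out i) (a # b # q) = (if a = i \<and> {i, b} \<in> E then f (b # q) else 0)"
  "path_mult f (Out i) [a] = 0" "path_mult f (Out i) [] = 0"
proof -
  have "path_mult f (Out i) (a # b # q) =
      (\<Sum>k<length (a # b # q). if k = 1 then (if a = i \<and> {i, b} \<in> E then f (b # q) else 0) else 0)"
    unfolding path_mult_def
  proof (rule sum.cong[OF refl])
    fix k assume "k \<in> {..<length (a # b # q)}"
    then show "f (drop k (a # b # q)) * Out i (take (Suc k) (a # b # q)) =
        (if k = 1 then (if a = i \<and> {i, b} \<in> E then f (b # q) else 0) else 0)"
    proof (cases "k \<ge> 2")
      case True
      then obtain m where m: "k = Suc (Suc m)" by (metis add_2_eq_Suc le_Suc_ex)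
      then have "m < length q" using \<open>k \<in> _\<close> by simp
      then obtain c r where "q = c # r" by (cases q) auto
      then show ?thesis using m by simp
    next
      case False
      then have "k = 0 \<or> k = 1" by auto
      then show ?thesis by auto
    qed
  qed
  also have "\<dots> = (if a = i \<and> {i, b} \<in> E then f (b # q) else 0)"
    by (subst sum.delta) auto
  finally show "path_mult f (Out i) (a # b # q) = (if a = i \<and> {i, b} \<in> E then f (b # q) else 0)" .
qed (simp_all add: path_mult_def)

lemma path_elem_pair: "path_elem [i, k] [] = 0" "path_elem [i, k] [a] = 0"
  "path_elem [i, k] [a, b] = (if a = i \<and> b = k then 1 else 0)" "path_elem [i, k] (a # b # c # q) = 0"
  by (simp_all add: path_elem_def)

lemma rel_simps: "rel [] = 0" "rel [a] = 0" "rel [a, b] = 0"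
  "rel (a # b # c # q) = (if q = [] \<and> c = a then \<epsilon> a b else 0)"
  by (simp_all add: rel_eq split: list.splits)

lemma \<epsilon>_zero: "{i, k} \<notin> E \<Longrightarrow> \<epsilon> i k = 0" "{k, i} \<notin> E \<Longrightarrow> \<epsilon> i k = 0"
  using \<epsilon>_nonzero(1)[of i k] by (auto simp: insert_commute)

lemma In_Cons: "In i (b # c # q) = (if q = [] \<and> c = i then \<epsilon> i b else 0)"
  by (cases q) simp_all

lemma mult_ids:
  "ve i \<otimes>\<^bsub>P\<^esub> ve k = (if i = k then ve i else \<zero>\<^bsub>P\<^esub>)"
  "Out i \<otimes>\<^bsub>P\<^esub> ve i = Out i" "Nb i \<otimes>\<^bsub>P\<^esub> Out i = Out i" "Nb i \<otimes>\<^bsub>P\<^esub> Nb i = Nb i"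
  "In i \<otimes>\<^bsub>P\<^esub> Nb i = In i" "ve i \<otimes>\<^bsub>P\<^esub> In i = In i"
  "ve k \<otimes>\<^bsub>P\<^esub> Out i = (if {i, k} \<in> E then ar i k else \<zero>\<^bsub>P\<^esub>)"
  "{i, k} \<in> E \<Longrightarrow> In i \<otimes>\<^bsub>P\<^esub> ve k = sc (\<epsilon> i k) \<otimes>\<^bsub>P\<^esub> ar k i"
  "ve k \<otimes>\<^bsub>P\<^esub> Nb i = (if {i, k} \<in> E then ve k else \<zero>\<^bsub>P\<^esub>)"
  "Nb i \<otimes>\<^bsub>P\<^esub> ve k = (if {i, k} \<in> E then ve k else \<zero>\<^bsub>P\<^esub>)"
  "ve k \<otimes>\<^bsub>P\<^esub> ar i l = (if k = l then ar i l else \<zero>\<^bsub>P\<^esub>)"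
  "ar i l \<otimes>\<^bsub>P\<^esub> ve k = (if k = i then ar i l else \<zero>\<^bsub>P\<^esub>)"
  "In i \<otimes>\<^bsub>P\<^esub> Out i = rel \<otimes>\<^bsub>P\<^esub> ve i"
  unfolding P_simps Nb_def
  using edgeD
  by (auto intro!: path_ext
      simp: \<epsilon>_zero In_Cons path_mult_diag_left path_mult_diag_right path_mult_Out path_elem_pair rel_simps insert_commute)

lemma P_support: "f \<in> carrier P \<Longrightarrow> f p \<noteq> 0 \<Longrightarrow> p \<noteq> [] \<and> hd p \<in> I \<and> last p \<in> I"
  using quiver_path_hd_last[of I Ar p] by (simp add: P_simps)

lemma sc_mult: "f \<in> carrier P \<Longrightarrow> sc c \<otimes>\<^bsub>P\<^esub> f = (\<lambda>p. c * f p)" "f \<in> carrier P \<Longrightarrow> f \<otimes>\<^bsub>P\<^esub> sc c = (\<lambda>p. c * f p)"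
  using P_support[of f] by (fastforce simp: P_simps(2) path_mult_diag_left path_mult_diag_right fun_eq_iff)+

lemma sc_ids: "sc (c + d) = sc c \<oplus>\<^bsub>P\<^esub> sc d" "sc (c * d) = sc c \<otimes>\<^bsub>P\<^esub> sc d" "sc 1 = \<one>\<^bsub>P\<^esub>"
  unfolding P_simps by (auto intro!: path_ext simp: path_mult_diag_left)

text \<open>The path algebra is spanned by paths, and paths are built by prepending arrows.\<close>

lemma P_induct [consumes 1, case_names zero add scale vertex arrow]:
  assumes f: "f \<in> carrier P" and zero: "Q \<zero>\<^bsub>P\<^esub>"
    and add: "\<And>f g. f \<in> carrier P \<Longrightarrow> g \<in> carrier P \<Longrightarrow> Q f \<Longrightarrow> Q g \<Longrightarrow> Q (f \<oplus>\<^bsub>P\<^esub> g)"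
    and scale: "\<And>c f. f \<in> carrier P \<Longrightarrow> Q f \<Longrightarrow> Q (sc c \<otimes>\<^bsub>P\<^esub> f)"
    and vertex: "\<And>i. i \<in> I \<Longrightarrow> Q (ve i)"
    and arrow: "\<And>i k f. {i, k} \<in> E \<Longrightarrow> f \<in> carrier P \<Longrightarrow> Q f \<Longrightarrow> Q (f \<otimes>\<^bsub>P\<^esub> ar i k)"
  shows "Q f"
proof -
  have path: "Q (path_elem p)" if "quiver_path I Ar p" for p
  proof -
    have "p \<noteq> []" using that by (simp add: quiver_path_def)
    then show ?thesis using that
  proof (induction p rule: list_nonempty_induct)
    case (single i)
    have "path_elem [i] = ve i" by (rule path_ext) (simp_all add: path_elem_def)
    then show ?case using single vertex by (simp add: quiver_path_def)
  next
    case (cons i p)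
    then obtain k q where p: "p = k # q" by (cases p) auto
    have "path_elem (i # k # q) = path_elem (k # q) \<otimes>\<^bsub>P\<^esub> ar i k"
      using path_elem_mult[of k q "[i]"] by (simp add: P_simps)
    then show ?case using cons p arrow[of i k] path_elem_closed by (simp add: quiver_path_Cons)
  qed
  qed
  have "finite {p. f p \<noteq> 0}" using f by (simp add: P_simps)
  then show ?thesis using f
  proof (induction "{p. f p \<noteq> 0}" arbitrary: f rule: finite_psubset_induct)
    case psubset
    show ?case
    proof (cases "{p. f p \<noteq> 0} = {}")
      case True
      then have "f = \<zero>\<^bsub>P\<^esub>" by (auto simp: P_simps fun_eq_iff)
      then show ?thesis using zero by simp
    next
      case False
      then obtain p where p: "f p \<noteq> 0" by auto
      have qp: "quiver_path I Ar p" using psubset.prems p by (simp add: P_simps)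
      define g where "g = f(p := 0)"
      have sub: "{p. g p \<noteq> 0} \<subset> {p. f p \<noteq> 0}" using p by (auto simp: g_def)
      have gP: "g \<in> carrier P" using psubset.prems sub
        unfolding P_simps by (auto simp: g_def intro: finite_subset)
      define h where "h = sc (f p) \<otimes>\<^bsub>P\<^esub> path_elem p"
      have pP: "path_elem p \<in> carrier P" by (rule path_elem_closed[OF qp])
      have h: "h \<in> carrier P" "Q h" unfolding h_def using pP scale[OF pP path[OF qp]] by auto
      have "f = g \<oplus>\<^bsub>P\<^esub> h"
        unfolding h_def sc_mult(1)[OF pP] by (auto simp: P_simps g_def path_elem_def)
      moreover have "Q (g \<oplus>\<^bsub>P\<^esub> h)" using add[OF gP h(1) psubset.hyps(2)[OF sub gP] h(2)] .
      ultimately show ?thesis by simp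
    qed
  qed
qed

text \<open>The part of \<open>f\<close> that consists of the nontrivial paths starting at \<open>i\<close>, with their first arrow removed. A
  module extension of \<open>S\<^sub>i\<close> is determined by the images of its generator under the arrows at \<open>i\<close>, and
  \<open>shift i f\<close> tells how \<open>f\<close> acts on these images.\<close>

definition shift :: "'v \<Rightarrow> ('v list \<Rightarrow> complex) \<Rightarrow> 'v list \<Rightarrow> complex" where
  "shift i f p = (if p = [] then 0 else f (i # p))"

lemma shift_closed: assumes "f \<in> carrier P" shows "shift i f \<in> carrier P"
proof -
  have "{p. shift i f p \<noteq> 0} \<subseteq> (\<lambda>p. i # p) -` {p. f p \<noteq> 0}" by (auto simp: shift_def split: if_splits)
  moreover have "finite ((\<lambda>p. i # p) -` {p. f p \<noteq> 0})"
    using assms by (intro finite_vimageI) (auto simp: P_simps)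
  ultimately have "finite {p. shift i f p \<noteq> 0}" by (rule finite_subset)
  moreover have "quiver_path I Ar p" if nz: "shift i f p \<noteq> 0" for p
  proof -
    obtain k q where p: "p = k # q" using nz by (cases p) (auto simp: shift_def)
    then have "quiver_path I Ar (i # k # q)" using nz assms by (simp add: P_simps shift_def)
    then show ?thesis by (simp add: p quiver_path_Cons)
  qed
  ultimately show ?thesis by (simp add: P_simps)
qed

text \<open>A path starting at \<open>i\<close> loses its first arrow inside \<open>g\<close>, unless the part from \<open>g\<close> is trivial.\<close>

lemma shift_mult: "shift i (f \<otimes>\<^bsub>P\<^esub> g) = (\<lambda>p. (f \<otimes>\<^bsub>P\<^esub> shift i g) p + g [i] * shift i f p)"
proof (rule ext)
  fix p
  show "shift i (f \<otimes>\<^bsub>P\<^esub> g) p = (f \<otimes>\<^bsub>P\<^esub> shift i g) p + g [i] * shift i f p"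
  proof (cases "p = []")
    case False
    have "path_mult f g (i # p) = f (i # p) * g [i] + (\<Sum>k<length p. f (drop k p) * g (i # take (Suc k) p))"
      unfolding path_mult_def by (simp only: list.size add_0_right add_Suc_right sum.lessThan_Suc_shift) simp
    moreover have "(\<Sum>k<length p. f (drop k p) * g (i # take (Suc k) p)) = path_mult f (shift i g) p"
      unfolding path_mult_def using False by (intro sum.cong) (auto simp: shift_def)
    ultimately show ?thesis using False by (simp add: P_simps shift_def)
  qed (simp add: P_simps shift_def path_mult_def)
qed

lemma shift_ids: "shift i rel = In i" "shift i (Out i) = Nb i" "shift i (diag d) = \<zero>\<^bsub>P\<^esub>"
  unfolding Nb_def P_simps
  by (auto intro!: path_ext simp: shift_def rel_simps)

lemma mult_const: "(f \<otimes>\<^bsub>P\<^esub> g) [i] = f [i] * g [i]"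
  by (simp add: P_simps path_mult_def)

sublocale J: ideal J P
  unfolding preprojective_ideal_def by (rule P.genideal_ideal) (simp add: rel_closed)

lemma P_ideal_induct:
  assumes I: "ideal X P" and "rel \<in> X" shows "J \<subseteq> X"
  unfolding preprojective_ideal_def by (rule P.genideal_minimal) (use assms in auto)

lemma rel_in_J: "rel \<in> J"
  unfolding preprojective_ideal_def by (rule P.genideal_self') (rule rel_closed)

lemma P_idealI:
  assumes sub: "X \<subseteq> carrier P" and "\<zero>\<^bsub>P\<^esub> \<in> X" "\<And>f g. f \<in> X \<Longrightarrow> g \<in> X \<Longrightarrow> f \<oplus>\<^bsub>P\<^esub> g \<in> X"
    and l: "\<And>f g. f \<in> X \<Longrightarrow> g \<in> carrier P \<Longrightarrow> g \<otimes>\<^bsub>P\<^esub> f \<in> X"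
    and r: "\<And>f g. f \<in> X \<Longrightarrow> g \<in> carrier P \<Longrightarrow> f \<otimes>\<^bsub>P\<^esub> g \<in> X"
  shows "ideal X P"
proof (rule idealI[OF P.ring_axioms])
  show "subgroup X (add_monoid P)"
  proof (rule P.add.subgroupI)
    fix f assume f: "f \<in> X"
    then have fP: "f \<in> carrier P" using sub by blast
    have "\<ominus>\<^bsub>P\<^esub> f = (\<ominus>\<^bsub>P\<^esub> \<one>\<^bsub>P\<^esub>) \<otimes>\<^bsub>P\<^esub> f" using fP by (simp add: P.l_minus)
    then show "\<ominus>\<^bsub>P\<^esub> f \<in> X" using l[OF f] by simp
  qed (use assms in auto)
qed (use l r in auto)

text \<open>The relation has no constant terms, and the constant term is multiplicative.\<close>

lemma J_const: assumes "f \<in> J" shows "f [i] = 0"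
proof -
  have "ideal {f \<in> carrier P. f [i] = 0} P"
    by (rule P_idealI) (auto simp: mult_const, auto simp: P_simps(4,5))
  moreover have "rel \<in> {f \<in> carrier P. f [i] = 0}" by (simp add: rel_closed rel_simps)
  ultimately show ?thesis using P_ideal_induct assms by blast
qed

definition cls :: "('v list \<Rightarrow> complex) \<Rightarrow> 'v preproj" where "cls f = J +>\<^bsub>P\<^esub> f"

lemma \<Lambda>_ring: "ring \<Lambda>" and \<Lambda>_carrier: "a \<in> carrier \<Lambda> \<longleftrightarrow> (\<exists>f\<in>carrier P. a = cls f)"
  and cls_hom: "cls \<in> ring_hom P \<Lambda>"
proof -
  show "ring \<Lambda>" unfolding preprojective_algebra_def by (rule J.quotient_is_ring)
  show "a \<in> carrier \<Lambda> \<longleftrightarrow> (\<exists>f\<in>carrier P. a = cls f)"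
    unfolding preprojective_algebra_def FactRing_def A_RCOSETS_def' cls_def by auto
  have "cls = (+>\<^bsub>P\<^esub>) J" by (auto simp: cls_def)
  then show "cls \<in> ring_hom P \<Lambda>" unfolding preprojective_algebra_def using J.rcos_ring_hom by simp
qed

lemma cls_simps:
  "f \<in> carrier P \<Longrightarrow> cls f \<in> carrier \<Lambda>"
  "f \<in> carrier P \<Longrightarrow> g \<in> carrier P \<Longrightarrow> cls (f \<otimes>\<^bsub>P\<^esub> g) = cls f \<otimes>\<^bsub>\<Lambda>\<^esub> cls g"
  "f \<in> carrier P \<Longrightarrow> g \<in> carrier P \<Longrightarrow> cls (f \<oplus>\<^bsub>P\<^esub> g) = cls f \<oplus>\<^bsub>\<Lambda>\<^esub> cls g"
  "cls \<one>\<^bsub>P\<^esub> = \<one>\<^bsub>\<Lambda>\<^esub>"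
  using cls_hom by (auto simp: ring_hom_def)

lemma cls_J: "f \<in> J \<Longrightarrow> cls f = \<zero>\<^bsub>\<Lambda>\<^esub>"
  unfolding cls_def preprojective_algebra_def FactRing_def using J.a_rcos_const by simp

lemma cls_mem: "f \<in> carrier P \<Longrightarrow> g \<in> cls f \<longleftrightarrow> (\<exists>h\<in>J. g = h \<oplus>\<^bsub>P\<^esub> f)"
  unfolding cls_def a_r_coset_def' by auto

text \<open>Evaluating the simple modules involves a chosen representative of a coset.\<close>

lemma cls_some: assumes "f \<in> carrier P" shows "\<exists>h\<in>J. (SOME g. g \<in> cls f) = h \<oplus>\<^bsub>P\<^esub> f"
proof -
  have "f \<in> cls f" unfolding cls_mem[OF assms] using J.zero_closed assms
    by (intro bexI[of _ "\<zero>\<^bsub>P\<^esub>"]) (auto)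
  then have "(SOME g. g \<in> cls f) \<in> cls f" by (rule someI[of "\<lambda>g. g \<in> cls f"])
  then show ?thesis using cls_mem[OF assms] by blast
qed

lemma scalar_cls: "scalar I \<Omega> c = cls (sc c)"
proof -
  have "(\<lambda>p. c * \<one>\<^bsub>P\<^esub> p) = sc c" unfolding P_simps by (rule path_ext) auto
  then show ?thesis by (simp add: scalar_def cls_def)
qed

end

section \<open>Modules over the preprojective algebra\<close>

locale lam_mod = preproj I E \<Omega> for I :: "'v set" and E and \<Omega> +
  fixes M :: "('v preproj, 'm) module" (structure)
  assumes fd: "fd_module I \<Omega> M"
begin

lemma lam_left_module: "left_module \<Lambda> M"
  using fd by (simp add: fd_module_def)

sublocale M: abelian_group M
  using lam_left_module by (simp add: left_module_def)

text \<open>The action of the path algebra through its quotient, which avoids representatives of cosets.\<close>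

definition act :: "('v list \<Rightarrow> complex) \<Rightarrow> 'm \<Rightarrow> 'm" where
  "act f x = cls f \<odot>\<^bsub>M\<^esub> x"

lemma act_closed [simp]: "f \<in> carrier P \<Longrightarrow> x \<in> carrier M \<Longrightarrow> act f x \<in> carrier M"
  using left_module.smult_closed[OF lam_left_module] by (simp add: act_def cls_simps)

lemma act_mult: "f \<in> carrier P \<Longrightarrow> g \<in> carrier P \<Longrightarrow> x \<in> carrier M \<Longrightarrow> act (f \<otimes>\<^bsub>P\<^esub> g) x = act f (act g x)"
  using left_module.smult_assoc[OF lam_left_module] by (simp add: act_def cls_simps)

lemma act_plus: "f \<in> carrier P \<Longrightarrow> g \<in> carrier P \<Longrightarrow> x \<in> carrier M \<Longrightarrow> act (f \<oplus>\<^bsub>P\<^esub> g) x = act f x \<oplus> act g x"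
  using left_module.smult_l_distr[OF lam_left_module] by (simp add: act_def cls_simps)

lemma act_add: "f \<in> carrier P \<Longrightarrow> x \<in> carrier M \<Longrightarrow> y \<in> carrier M \<Longrightarrow> act f (x \<oplus> y) = act f x \<oplus> act f y"
  using left_module.smult_r_distr[OF lam_left_module] by (simp add: act_def cls_simps)

lemma act_one [simp]: "x \<in> carrier M \<Longrightarrow> act \<one>\<^bsub>P\<^esub> x = x"
  using left_module.smult_one[OF lam_left_module] by (simp add: act_def cls_simps)

lemma act_zero [simp]: "x \<in> carrier M \<Longrightarrow> act \<zero>\<^bsub>P\<^esub> x = \<zero>"
  using act_plus[of "\<zero>\<^bsub>P\<^esub>" "\<zero>\<^bsub>P\<^esub>" x] by simp

lemma act_diag_zero [simp]: "x \<in> carrier M \<Longrightarrow> act (diag (\<lambda>k. 0)) x = \<zero>"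
proof -
  have "diag (\<lambda>k. 0) = \<zero>\<^bsub>P\<^esub>" unfolding P_simps by (rule path_ext) auto
  then show "x \<in> carrier M \<Longrightarrow> act (diag (\<lambda>k. 0)) x = \<zero>" by simp
qed

lemma act_zero_right [simp]: "f \<in> carrier P \<Longrightarrow> act f \<zero> = \<zero>"
  using act_add[of f \<zero> \<zero>] by simp

lemma act_J: "f \<in> J \<Longrightarrow> x \<in> carrier M \<Longrightarrow> act f x = \<zero>"
  using act_zero[of x] cls_J[of f] cls_J[OF J.zero_closed] by (simp add: act_def)

lemma smult_act: "f \<in> carrier P \<Longrightarrow> cls f \<odot>\<^bsub>M\<^esub> x = act f x"
  by (simp add: act_def)

abbreviation sv :: "complex \<Rightarrow> 'm \<Rightarrow> 'm" where "sv c \<equiv> act (sc c)"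

sublocale C: cspace M sv
proof unfold_locales
  obtain B where B: "finite B" "B \<subseteq> carrier M"
    "\<forall>x\<in>carrier M. \<exists>c. x = (\<Oplus>b\<in>B. scalar I \<Omega> (c b) \<odot>\<^bsub>M\<^esub> b)"
    using fd unfolding fd_module_def by blast
  then show "\<exists>B. finite B \<and> B \<subseteq> carrier M \<and> (\<forall>x\<in>carrier M. \<exists>c. x = (\<Oplus>b\<in>B. sv (c b) b))"
    by (intro exI[of _ B]) (simp add: scalar_cls smult_act)
qed (simp_all add: act_add sc_ids act_plus act_mult)

lemma sv_commute: "f \<in> carrier P \<Longrightarrow> x \<in> carrier M \<Longrightarrow> act f (sv c x) = sv c (act f x)"
  using sc_mult[of f c] by (simp flip: act_mult)

lemma minus_sv: "x \<in> carrier M \<Longrightarrow> \<ominus> x = sv (-1) x"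
proof -
  assume x: "x \<in> carrier M"
  have "x \<oplus> sv (-1) x = sv (1 + -1) x" by (simp only: C.s_plus[OF x] C.s_one[OF x])
  also have "\<dots> = sv 0 x" by (simp only: add.right_inverse)
  also have "\<dots> = \<zero>" by (rule C.s_zero_left[OF x])
  finally have "sv (-1) x \<oplus> x = \<zero>" using x by (simp add: M.a_comm)
  then show ?thesis using x by (intro M.minus_equality) auto
qed

lemma minus_zero [simp]: "\<ominus> \<zero> = \<zero>"
  by (simp add: minus_sv)

lemma act_minus: "f \<in> carrier P \<Longrightarrow> x \<in> carrier M \<Longrightarrow> y \<in> carrier M \<Longrightarrow> act f (x \<ominus> y) = act f x \<ominus> act f y"
  by (simp add: a_minus_def act_add minus_sv sv_commute)

abbreviation sm :: "'m set \<Rightarrow> bool" where "sm H \<equiv> submodule H \<Lambda> M"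

lemma smI:
  assumes "H \<subseteq> carrier M" "\<zero> \<in> H" "\<And>x y. x \<in> H \<Longrightarrow> y \<in> H \<Longrightarrow> x \<oplus> y \<in> H"
    and "\<And>f x. f \<in> carrier P \<Longrightarrow> x \<in> H \<Longrightarrow> act f x \<in> H"
  shows "sm H"
proof (rule submodule.intro)
  show "subgroup H (add_monoid M)"
  proof (rule M.add.subgroupI)
    fix x assume "x \<in> H"
    then show "\<ominus> x \<in> H" using assms minus_sv by auto
  qed (use assms in auto)
  show "submodule_axioms H \<Lambda> M"
    using assms(4) by unfold_locales (auto simp: \<Lambda>_carrier act_def)
qed

lemma smD:
  assumes "sm H"
  shows "H \<subseteq> carrier M" "\<zero> \<in> H" "x \<in> H \<Longrightarrow> y \<in> H \<Longrightarrow> x \<oplus> y \<in> H"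
    "f \<in> carrier P \<Longrightarrow> x \<in> H \<Longrightarrow> act f x \<in> H" "x \<in> H \<Longrightarrow> x \<in> carrier M" "x \<in> H \<Longrightarrow> \<ominus> x \<in> H"
    "x \<in> H \<Longrightarrow> y \<in> H \<Longrightarrow> x \<ominus> y \<in> H"
proof -
  interpret submodule H \<Lambda> M by fact
  show "H \<subseteq> carrier M" "\<zero> \<in> H" "x \<in> H \<Longrightarrow> y \<in> H \<Longrightarrow> x \<oplus> y \<in> H" "x \<in> H \<Longrightarrow> x \<in> carrier M"
    using subset one_closed m_closed by auto
  show "f \<in> carrier P \<Longrightarrow> x \<in> H \<Longrightarrow> act f x \<in> H"
    using smult_closed[of "cls f" x] cls_simps(1)[of f] by (simp add: act_def)
  show *: "x \<in> H \<Longrightarrow> \<ominus> x \<in> H" for x using m_inv_closed by (simp add: a_inv_def)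
  show "x \<in> H \<Longrightarrow> y \<in> H \<Longrightarrow> x \<ominus> y \<in> H" using *[of y] m_closed by (simp add: a_minus_def)
qed

lemma sm_csub: "sm H \<Longrightarrow> C.csub H"
  unfolding C.csub_def using smD[of H] by auto

text \<open>Vertices and arrows generate the algebra.\<close>

lemma sm_generators:
  assumes H: "C.csub H" and v: "\<And>i x. i \<in> I \<Longrightarrow> x \<in> H \<Longrightarrow> act (ve i) x \<in> H"
    and a: "\<And>i k x. {i, k} \<in> E \<Longrightarrow> x \<in> H \<Longrightarrow> act (ar i k) x \<in> H"
  shows "sm H"
proof (rule smI)
  show c: "H \<subseteq> carrier M" "\<zero> \<in> H" "\<And>x y. x \<in> H \<Longrightarrow> y \<in> H \<Longrightarrow> x \<oplus> y \<in> H"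
    using H by (auto simp: C.csub_def)
  have sv: "\<And>c x. x \<in> H \<Longrightarrow> sv c x \<in> H" using H by (auto simp: C.csub_def)
  fix f x assume f: "f \<in> carrier P" and "x \<in> H"
  have "\<forall>x\<in>H. act f x \<in> H" using f
  proof (induction rule: P_induct)
    case zero
    then show ?case using c by auto
  next
    case (add f g)
    then show ?case using c by (auto simp: act_plus)
  next
    case (scale c f)
    then show ?case using c sv by (auto simp: act_mult subset_eq)
  next
    case (vertex i)
    then show ?case using v by auto
  next
    case (arrow i k f)
    then show ?case using c a by (auto simp: act_mult subset_eq)
  qed
  then show "act f x \<in> H" using \<open>x \<in> H\<close> by blast
qed

lemma sm_zero: "sm {\<zero>}" and sm_carrier: "sm (carrier M)"
  by (rule smI; auto)+

lemma ve_ve: "i \<in> I \<Longrightarrow> k \<in> I \<Longrightarrow> x \<in> carrier M \<Longrightarrow> act (ve k) (act (ve i) x) = (if i = k then act (ve i) x else \<zero>)"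
  by (auto simp: mult_ids simp flip: act_mult)

text \<open>The trivial paths add up to the identity.\<close>

lemma components_in:
  assumes H: "C.csub H" and x: "x \<in> carrier M" and c: "\<And>k. k \<in> I \<Longrightarrow> act (ve k) x \<in> H"
  shows "x \<in> H"
proof -
  have "finite A \<Longrightarrow> A \<subseteq> I \<Longrightarrow> act (diag (\<lambda>k. if k \<in> A then 1 else 0)) x \<in> H
      \<and> diag (\<lambda>k. if k \<in> A then 1 else 0) \<in> carrier P" for A
  proof (induction A rule: finite_induct)
    case empty
    have "diag (\<lambda>k. if k \<in> {} then 1 else 0) = \<zero>\<^bsub>P\<^esub>" unfolding P_simps by (rule path_ext) auto
    then show ?case using H x by (auto simp: C.csub_def)
  next
    case (insert i A)
    have "diag (\<lambda>k. if k \<in> insert i A then 1 else 0) = ve i \<oplus>\<^bsub>P\<^esub> diag (\<lambda>k. if k \<in> A then 1 else 0)"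
      unfolding P_simps using insert(2) by (intro path_ext) auto
    then show ?case using insert c[of i] H x by (auto simp: act_plus C.csub_def)
  qed
  from this[OF finite_I order_refl] have "act (diag (\<lambda>k. if k \<in> I then 1 else 0)) x \<in> H" by simp
  then show ?thesis using x act_one[OF x] by (simp add: P_simps(3))
qed

lemma ve_Out: "k \<in> I \<Longrightarrow> x \<in> carrier M \<Longrightarrow> act (ve k) (act (Out i) x) = (if {i, k} \<in> E then act (ar i k) x else \<zero>)"
  by (auto simp: mult_ids simp flip: act_mult)

lemma ve_Nb: "k \<in> I \<Longrightarrow> x \<in> carrier M \<Longrightarrow> act (ve k) (act (Nb i) x) = (if {i, k} \<in> E then act (ve k) x else \<zero>)"
  by (auto simp: mult_ids simp flip: act_mult)

lemma ve_ar: "i \<in> I \<Longrightarrow> {k, l} \<in> E \<Longrightarrow> x \<in> carrier M \<Longrightarrow> act (ve i) (act (ar k l) x) = (if l = i then act (ar k l) x else \<zero>)"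
  by (auto simp: mult_ids simp flip: act_mult)

lemma ar_ve: "i \<in> I \<Longrightarrow> {k, l} \<in> E \<Longrightarrow> x \<in> carrier M \<Longrightarrow> act (ar k l) (act (ve i) x) = (if k = i then act (ar k l) x else \<zero>)"
  by (auto simp: mult_ids simp flip: act_mult)

lemma Out_ve: "i \<in> I \<Longrightarrow> x \<in> carrier M \<Longrightarrow> act (Out i) (act (ve i) x) = act (Out i) x"
  by (simp add: mult_ids flip: act_mult)

lemma ve_In: "i \<in> I \<Longrightarrow> x \<in> carrier M \<Longrightarrow> act (ve i) (act (In i) x) = act (In i) x"
  by (simp add: mult_ids flip: act_mult)

lemma In_Nb: "x \<in> carrier M \<Longrightarrow> act (In i) (act (Nb i) x) = act (In i) x"
  by (simp add: mult_ids flip: act_mult)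

lemma Nb_Out: "x \<in> carrier M \<Longrightarrow> act (Nb i) (act (Out i) x) = act (Out i) x"
  by (simp add: mult_ids flip: act_mult)

lemma Nb_Nb: "x \<in> carrier M \<Longrightarrow> act (Nb i) (act (Nb i) x) = act (Nb i) x"
  by (simp add: mult_ids flip: act_mult)

lemma In_ve: "{i, k} \<in> E \<Longrightarrow> x \<in> carrier M \<Longrightarrow> act (In i) (act (ve k) x) = sv (\<epsilon> i k) (act (ar k i) x)"
  using edgeD[of i k] by (auto simp: mult_ids insert_commute simp flip: act_mult)

lemma ar_In: "{i, k} \<in> E \<Longrightarrow> x \<in> carrier M \<Longrightarrow> act (ar k i) x = act (In i) (sv (\<epsilon> i k) (act (ve k) x))"
proof -
  assume e: "{i, k} \<in> E" and x: "x \<in> carrier M"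
  have k: "k \<in> I" "ar k i \<in> carrier P" using edgeD[OF e] e by (auto simp: insert_commute)
  have "act (In i) (sv (\<epsilon> i k) (act (ve k) x)) = sv (\<epsilon> i k) (sv (\<epsilon> i k) (act (ar k i) x))"
    using x k by (simp add: sv_commute[of "In i"] In_ve[OF e x])
  also have "\<dots> = sv (\<epsilon> i k * \<epsilon> i k) (act (ar k i) x)" using x k by (subst C.s_mult) auto
  also have "\<epsilon> i k * \<epsilon> i k = 1" using e by (simp add: \<epsilon>_nonzero(2))
  also have "sv 1 (act (ar k i) x) = act (ar k i) x" by (rule C.s_one[OF act_closed[OF k(2) x]])
  finally show ?thesis by simp
qed

lemma In_Out: "i \<in> I \<Longrightarrow> x \<in> carrier M \<Longrightarrow> act (In i) (act (Out i) x) = \<zero>"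
proof -
  assume i: "i \<in> I" and x: "x \<in> carrier M"
  have "rel \<otimes>\<^bsub>P\<^esub> ve i \<in> J" using rel_in_J i by (intro J.I_r_closed) auto
  then show ?thesis using x act_J[of "In i \<otimes>\<^bsub>P\<^esub> Out i" x] by (simp add: mult_ids(13) flip: act_mult)
qed

section \<open>Changing a submodule at one vertex\<close>

text \<open>The largest submodule whose components outside \<open>B\<close> lie in \<open>Z\<close>. Quantifying over all \<open>f\<close> is what
  makes this a submodule.\<close>

definition satur :: "'v set \<Rightarrow> 'm set \<Rightarrow> 'm set" where
  "satur B Z = {x \<in> carrier M. \<forall>f\<in>carrier P. \<forall>k\<in>I - B. act (ve k \<otimes>\<^bsub>P\<^esub> f) x \<in> Z}"

abbreviation \<sigma> :: "'v \<Rightarrow> 'm set \<Rightarrow> 'm set" where "\<sigma> i \<equiv> satur {i}"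

text \<open>The operators \<open>\<sigma>\<close> along a word, with the last letter applied first.\<close>

definition sig :: "'v list \<Rightarrow> 'm set \<Rightarrow> 'm set" where
  "sig u Z = foldr \<sigma> u Z"

lemma sig_simps [simp]: "sig [] Z = Z" "sig (i # u) Z = \<sigma> i (sig u Z)" "sig (u @ v) Z = sig u (sig v Z)"
  by (simp_all add: sig_def)

lemma satur_sm: assumes "sm Z" shows "sm (satur B Z)"
proof (rule smI)
  note Z = smD[OF assms]
  show "satur B Z \<subseteq> carrier M" by (auto simp: satur_def)
  show "\<zero> \<in> satur B Z" using Z by (simp add: satur_def)
  show "x \<oplus> y \<in> satur B Z" if "x \<in> satur B Z" "y \<in> satur B Z" for x y
    using that Z by (simp add: satur_def act_add)
  show "act f x \<in> satur B Z" if "f \<in> carrier P" "x \<in> satur B Z" for f x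
    using that by (simp add: satur_def P.m_assoc flip: act_mult)
qed

lemma satur_component: "x \<in> satur B Z \<Longrightarrow> k \<in> I - B \<Longrightarrow> act (ve k) x \<in> Z"
  unfolding satur_def using P.one_closed by (fastforce dest: bspec[of _ _ "\<one>\<^bsub>P\<^esub>"])

lemma sub_satur_iff:
  assumes "sm Y" shows "Y \<subseteq> satur B Z \<longleftrightarrow> (\<forall>k\<in>I - B. \<forall>y\<in>Y. act (ve k) y \<in> Z)"
proof
  assume "Y \<subseteq> satur B Z"
  then show "\<forall>k\<in>I - B. \<forall>y\<in>Y. act (ve k) y \<in> Z" using satur_component by blast
next
  assume a: "\<forall>k\<in>I - B. \<forall>y\<in>Y. act (ve k) y \<in> Z"
  note Y = smD[OF assms]
  show "Y \<subseteq> satur B Z"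
  proof
    fix y assume y: "y \<in> Y"
    have "act (ve k \<otimes>\<^bsub>P\<^esub> f) y \<in> Z" if "f \<in> carrier P" "k \<in> I - B" for f k
      using a Y(4)[OF that(1) y] that Y(5)[OF y] by (simp add: act_mult)
    then show "y \<in> satur B Z" using Y(5)[OF y] by (simp add: satur_def)
  qed
qed

lemma satur_incl: "sm Z \<Longrightarrow> Z \<subseteq> satur B Z"
  using sub_satur_iff[of Z B Z] smD(4)[of Z] by auto

lemma satur_mono: "Z \<subseteq> Z' \<Longrightarrow> satur B Z \<subseteq> satur B Z'"
  by (auto simp: satur_def)

lemma satur_satur: assumes "sm Z" shows "satur B (satur C Z) \<subseteq> satur (B \<union> C) Z"
proof -
  have "act (ve k) y \<in> Z" if "k \<in> I - (B \<union> C)" "y \<in> satur B (satur C Z)" for k y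
  proof -
    have "act (ve k) y \<in> satur C Z" using satur_component[OF that(2)] that(1) by auto
    then have "act (ve k) (act (ve k) y) \<in> Z" using satur_component that(1) by blast
    moreover have "y \<in> carrier M" using that(2) by (auto simp: satur_def)
    ultimately show ?thesis using that(1) by (simp add: ve_ve)
  qed
  then show ?thesis using sub_satur_iff[OF satur_sm[OF satur_sm[OF assms]]] by blast
qed

lemma \<sigma>_idem: "sm Z \<Longrightarrow> \<sigma> i (\<sigma> i Z) = \<sigma> i Z"
  using satur_satur[of Z "{i}" "{i}"] satur_incl[OF satur_sm, of Z "{i}" "{i}"] by auto

lemma sig_sm: "sm Z \<Longrightarrow> sm (sig u Z)"
  by (induction u) (auto intro: satur_sm)

lemma sig_incl: "sm Z \<Longrightarrow> Z \<subseteq> sig u Z"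
proof (induction u)
  case (Cons i u)
  show ?case using order_trans[OF Cons.IH[OF Cons.prems] satur_incl[OF sig_sm[OF Cons.prems]]] by simp
qed simp

lemma sig_mono: "Z \<subseteq> Z' \<Longrightarrow> sig u Z \<subseteq> sig u Z'"
  by (induction u) (simp_all add: satur_mono)

lemma Out_in_of_\<sigma>: assumes "sm Z" "x \<in> \<sigma> i Z" shows "act (Out i) x \<in> Z"
proof -
  have x: "x \<in> carrier M" using assms(2) by (simp add: satur_def)
  have "act (ve k) (act (Out i) x) \<in> Z" if k: "k \<in> I" for k
  proof (cases "k = i")
    case True
    then show ?thesis using x k smD(2)[OF assms(1)] by (simp add: ve_Out)
  next
    case False
    then have "act (ve k \<otimes>\<^bsub>P\<^esub> Out i) x \<in> Z" using assms(2) k by (simp add: satur_def)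
    then show ?thesis using x k by (simp add: act_mult)
  qed
  then show ?thesis using components_in[OF sm_csub[OF assms(1)]] x by simp
qed

text \<open>Such an \<open>x\<close> together with \<open>Z\<close> spans a submodule that differs from \<open>Z\<close> only at \<open>i\<close>.\<close>

lemma mem_\<sigma>:
  assumes Z: "sm Z" and x: "x \<in> carrier M" "act (ve i) x = x" "act (Out i) x \<in> Z" and i: "i \<in> I"
  shows "x \<in> \<sigma> i Z"
proof -
  note z = smD[OF Z]
  define Y where "Y = {z \<oplus> sv c x | z c. z \<in> Z}"
  have zero: "act (ve k) x = \<zero>" if "k \<in> I" "k \<noteq> i" for k
    using ve_ve[of i k x] that x i by simp
  have arr: "act (ar k l) x \<in> Z" if e: "{k, l} \<in> E" for k l
  proof (cases "k = i")
    case True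
    then show ?thesis using ve_Out[of l x i] e edgeD[OF e] x z(4)[of "ve l" "act (Out i) x"] by auto
  next
    case False
    then show ?thesis using ar_ve[OF i e x(1)] x(2) z(2) by simp
  qed
  have YI: "z \<oplus> sv c x \<in> Y" if "z \<in> Z" for z c using that by (auto simp: Y_def)
  have ZY: "z \<in> Y" if "z \<in> Z" for z using YI[OF that, of 0] C.s_zero_left[OF x(1)] z(5)[OF that] by simp
  have "sm Y"
  proof (rule sm_generators)
    show "C.csub Y" unfolding C.csub_def
    proof (intro conjI ballI allI)
      show "Y \<subseteq> carrier M" using z(5) x by (auto simp: Y_def)
      show "\<zero> \<in> Y" by (rule ZY[OF z(2)])
    next
      fix a b assume "a \<in> Y" "b \<in> Y"
      then obtain z1 c1 z2 c2 where h: "z1 \<in> Z" "z2 \<in> Z" "a = z1 \<oplus> sv c1 x" "b = z2 \<oplus> sv c2 x"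
        by (auto simp: Y_def)
      have "a \<oplus> b = (z1 \<oplus> z2) \<oplus> sv (c1 + c2) x"
        unfolding h C.s_plus[OF x(1)] using z(5) h(1,2) x by (simp add: M.a_ac)
      then show "a \<oplus> b \<in> Y" using YI z(3) h(1,2) by simp
    next
      fix c a assume "a \<in> Y"
      then obtain z1 c1 where h: "z1 \<in> Z" "a = z1 \<oplus> sv c1 x" by (auto simp: Y_def)
      have "sv c a = sv c z1 \<oplus> sv (c * c1) x"
        unfolding h C.s_mult[OF x(1)] using z(5) h(1) x by (simp add: act_add)
      then show "sv c a \<in> Y" using YI z(4) h(1) by simp
    qed
  next
    fix k a assume k: "k \<in> I" and "a \<in> Y"
    then obtain z1 c1 where h: "z1 \<in> Z" "a = z1 \<oplus> sv c1 x" by (auto simp: Y_def)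
    have "act (ve k) a = act (ve k) z1 \<oplus> sv c1 (act (ve k) x)"
      unfolding h using z(5) h(1) x k by (simp add: act_add sv_commute)
    then show "act (ve k) a \<in> Y" using YI ZY z(4)[of "ve k" z1] z(5) h(1) zero[of k] k x by (cases "k = i") auto
  next
    fix k l a assume e: "{k, l} \<in> E" and "a \<in> Y"
    then obtain z1 c1 where h: "z1 \<in> Z" "a = z1 \<oplus> sv c1 x" by (auto simp: Y_def)
    have "act (ar k l) a = act (ar k l) z1 \<oplus> sv c1 (act (ar k l) x)"
      unfolding h using z(5) h(1) x e by (simp add: act_add sv_commute)
    then show "act (ar k l) a \<in> Y" using ZY z(3,4) arr[OF e] h(1) e by simp
  qed
  moreover have "act (ve k) y \<in> Z" if k: "k \<in> I - {i}" and "y \<in> Y" for k y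
  proof -
    obtain z1 c1 where h: "z1 \<in> Z" "y = z1 \<oplus> sv c1 x" using \<open>y \<in> Y\<close> by (auto simp: Y_def)
    have "act (ve k) y = act (ve k) z1 \<oplus> sv c1 (act (ve k) x)"
      unfolding h using z(5) h(1) x k by (simp add: act_add sv_commute)
    then show ?thesis using z(4)[of "ve k" z1] z(5) h(1) zero[of k] k by auto
  qed
  ultimately have "Y \<subseteq> \<sigma> i Z" using sub_satur_iff[of Y "{i}" Z] by blast
  moreover have "x \<in> Y" using YI[OF z(2), of 1] C.s_one[OF x(1)] x(1) by simp
  ultimately show ?thesis by blast
qed

lemma \<sigma>_iff:
  assumes Z: "sm Z" and x: "x \<in> carrier M" and i: "i \<in> I"
    and c: "\<And>k. k \<in> I \<Longrightarrow> k \<noteq> i \<Longrightarrow> act (ve k) x \<in> Z" and o: "act (Out i) x \<in> Z"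
  shows "x \<in> \<sigma> i Z"
proof (rule components_in[OF sm_csub[OF satur_sm[OF Z]] x])
  fix k assume k: "k \<in> I"
  show "act (ve k) x \<in> \<sigma> i Z"
  proof (cases "k = i")
    case True
    then show ?thesis using mem_\<sigma>[OF Z, of "act (ve i) x" i] x i o by (simp add: ve_ve Out_ve)
  next
    case False
    then show ?thesis using c[OF k] satur_incl[OF Z, of "{i}"] by blast
  qed
qed

text \<open>Without arrows between \<open>i\<close> and \<open>j\<close>, the components at the two vertices can be added independently.\<close>

lemma satur_pair_far:
  assumes Z: "sm Z" and ij: "i \<in> I" "j \<in> I" "i \<noteq> j" "{i, j} \<notin> E"
  shows "\<sigma> i (\<sigma> j Z) = satur {i, j} Z"
proof
  show "\<sigma> i (\<sigma> j Z) \<subseteq> satur {i, j} Z" using satur_satur[OF Z, of "{i}" "{j}"] by (simp add: insert_commute)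
  define X where "X = satur {i, j} Z"
  have X: "sm X" unfolding X_def by (rule satur_sm[OF Z])
  note x = smD[OF X]
  have comp: "act (ve k) x \<in> Z" if "x \<in> X" "k \<in> I" "k \<noteq> i" "k \<noteq> j" for x k
    using satur_component[of x "{i, j}" Z k] that by (auto simp: X_def)
  have at: "act (ve a) x \<in> \<sigma> a Z" if xX: "x \<in> X" and a: "a = i \<and> b = j \<or> a = j \<and> b = i" for x a b
  proof (rule mem_\<sigma>[OF Z])
    have ab: "a \<in> I" "b \<in> I" "{a, b} \<notin> E" "a \<noteq> b" using a ij by (auto simp: insert_commute)
    then show "a \<in> I" by simp
    show "act (ve a) x \<in> carrier M" "act (ve a) (act (ve a) x) = act (ve a) x"
      using x(5)[OF xX] ab by (auto simp: ve_ve)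
    have o: "act (Out a) x \<in> X" using x(4) xX by simp
    have "act (Out a) x \<in> Z"
    proof (rule components_in[OF sm_csub[OF Z]])
      fix k assume k: "k \<in> I"
      show "act (ve k) (act (Out a) x) \<in> Z"
        using comp[OF o k] ve_Out[OF k x(5)[OF xX], of a] smD(2)[OF Z] ab a by (cases "k = a \<or> k = b") auto
    qed (use x(5)[OF o] in simp)
    then show "act (Out a) (act (ve a) x) \<in> Z" using x(5)[OF xX] ab by (simp add: Out_ve)
  qed
  have "X \<subseteq> \<sigma> i (\<sigma> j Z)"
  proof
    fix y assume y: "y \<in> X"
    show "y \<in> \<sigma> i (\<sigma> j Z)"
    proof (rule components_in[OF sm_csub[OF satur_sm[OF satur_sm[OF Z]]] x(5)[OF y]])
      fix k assume k: "k \<in> I"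
      have i1: "\<sigma> i Z \<subseteq> \<sigma> i (\<sigma> j Z)" by (rule satur_mono[OF satur_incl[OF Z]])
      have i2: "\<sigma> j Z \<subseteq> \<sigma> i (\<sigma> j Z)" by (rule satur_incl[OF satur_sm[OF Z]])
      show "act (ve k) y \<in> \<sigma> i (\<sigma> j Z)"
        using at[OF y, of i j] at[OF y, of j i] comp[OF y k] i1 i2 satur_incl[OF Z, of "{j}"]
        by (cases "k = i"; cases "k = j") auto
    qed
  qed
  then show "satur {i, j} Z \<subseteq> \<sigma> i (\<sigma> j Z)" by (simp add: X_def)
qed

text \<open>The braid relation: both sides of it are the saturation with respect to both vertices. For \<open>x\<close> in
  the latter, \<open>y = Out i x\<close> lies in \<open>Z\<close> up to its component at \<open>j\<close>. The preprojective relation at \<open>i\<close>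
  expresses the return of this component to \<open>i\<close> by elements of \<open>Z\<close>, so it is already added by the innermost
  \<open>\<sigma> j\<close>.\<close>

lemma satur_pair_near:
  assumes Z: "sm Z" and e: "{i, j} \<in> E"
  shows "\<sigma> j (\<sigma> i (\<sigma> j Z)) = satur {i, j} Z"
proof
  have ij: "i \<in> I" "j \<in> I" "i \<noteq> j" using edgeD[OF e] by auto
  have "\<sigma> j (\<sigma> i (\<sigma> j Z)) \<subseteq> \<sigma> j (satur {i, j} Z)"
    using satur_satur[OF Z, of "{i}" "{j}"] by (intro satur_mono) (simp add: insert_commute)
  also have "\<dots> \<subseteq> satur {i, j} Z" using satur_satur[OF Z, of "{j}" "{i, j}"] by (simp add: insert_commute)
  finally show "\<sigma> j (\<sigma> i (\<sigma> j Z)) \<subseteq> satur {i, j} Z" .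
  define X where "X = satur {i, j} Z"
  have X: "sm X" unfolding X_def by (rule satur_sm[OF Z])
  note x = smD[OF X] and z = smD[OF Z]
  have comp: "act (ve k) x \<in> Z" if "x \<in> X" "k \<in> I" "k \<noteq> i" "k \<noteq> j" for x k
    using satur_component[of x "{i, j}" Z k] that by (auto simp: X_def)
  have s1: "sm (\<sigma> j Z)" and s2: "sm (\<sigma> i (\<sigma> j Z))" and s3: "sm (\<sigma> j (\<sigma> i (\<sigma> j Z)))"
    using Z by (auto intro: satur_sm)
  have i1: "Z \<subseteq> \<sigma> j Z" "\<sigma> j Z \<subseteq> \<sigma> i (\<sigma> j Z)" "\<sigma> i (\<sigma> j Z) \<subseteq> \<sigma> j (\<sigma> i (\<sigma> j Z))"
    by (rule satur_incl[OF Z], rule satur_incl[OF s1], rule satur_incl[OF s2])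
  have at_i: "act (ve i) x \<in> \<sigma> i (\<sigma> j Z)" if xX: "x \<in> X" for x
  proof (rule mem_\<sigma>[OF s1])
    have xM: "x \<in> carrier M" by (rule x(5)[OF xX])
    show "act (ve i) x \<in> carrier M" "act (ve i) (act (ve i) x) = act (ve i) x" "i \<in> I"
      using xM ij by (auto simp: ve_ve)
    define y where "y = act (Out i) x"
    have y: "y \<in> X" "y \<in> carrier M" unfolding y_def using x(4) xX xM by auto
    have yk: "act (ve k) y \<in> Z" if "k \<in> I" "k \<noteq> j" for k
      using comp[OF y(1) that(1)] that ve_Out[OF that(1) xM, of i] z(2) y_def by (cases "k = i") auto
    have d: "y \<ominus> act (ve j) y \<in> Z"
    proof (rule components_in[OF sm_csub[OF Z]])
      fix k assume k: "k \<in> I"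
      then have "act (ve k) (y \<ominus> act (ve j) y) = act (ve k) y \<ominus> (if j = k then act (ve j) y else \<zero>)"
        using y(2) ij by (simp add: act_minus ve_ve)
      then show "act (ve k) (y \<ominus> act (ve j) y) \<in> Z"
        using yk[OF k] y(2) k z(2) by (cases "k = j") (auto simp: M.r_neg a_minus_def)
    qed (use y(2) ij in simp)
    have "act (In i) y = \<zero>" unfolding y_def using ij xM by (simp add: In_Out)
    then have "act (In i) (act (ve j) y) = \<ominus> act (In i) (y \<ominus> act (ve j) y)"
    proof -
      assume 0: "act (In i) y = \<zero>"
      have "act (In i) (y \<ominus> act (ve j) y) = act (In i) y \<ominus> act (In i) (act (ve j) y)"
        using y(2) ij by (intro act_minus) auto
      then show ?thesis using 0 y(2) ij by (simp add: a_minus_def)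
    qed
    then have "act (In i) (act (ve j) y) \<in> Z" using z(4)[OF _ d, of "In i"] z(6) by simp
    then have "sv (\<epsilon> i j) (act (In i) (act (ve j) y)) \<in> Z" using z(4) by simp
    then have "act (ar j i) y \<in> Z" using ar_In[OF e y(2)] y(2) ij by (simp add: sv_commute[of "In i"])
    then have o: "act (Out j) y \<in> Z"
    proof -
      assume ar: "act (ar j i) y \<in> Z"
      show ?thesis
      proof (rule components_in[OF sm_csub[OF Z]])
        fix k assume k: "k \<in> I"
        have "act (Out j) y \<in> X" using x(4) y(1) by simp
        then show "act (ve k) (act (Out j) y) \<in> Z"
          using comp[OF \<open>act (Out j) y \<in> X\<close> k] ve_Out[OF k y(2), of j] z(2) ar by (cases "k = i"; cases "k = j") auto
      qed (use y(2) in simp)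
    qed
    have "y \<in> \<sigma> j Z" by (rule \<sigma>_iff[OF Z y(2)]) (use yk o ij in auto)
    then show "act (Out i) (act (ve i) x) \<in> \<sigma> j Z" using ij xM by (simp add: Out_ve y_def)
  qed
  have at_j: "act (ve j) x \<in> \<sigma> j (\<sigma> i (\<sigma> j Z))" if xX: "x \<in> X" for x
  proof (rule mem_\<sigma>[OF s2])
    have xM: "x \<in> carrier M" by (rule x(5)[OF xX])
    show "act (ve j) x \<in> carrier M" "act (ve j) (act (ve j) x) = act (ve j) x" "j \<in> I"
      using xM ij by (auto simp: ve_ve)
    have oX: "act (Out j) x \<in> X" using x(4) xX by simp
    have "act (Out j) x \<in> \<sigma> i (\<sigma> j Z)"
    proof (rule components_in[OF sm_csub[OF s2]])
      fix k assume k: "k \<in> I"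
      show "act (ve k) (act (Out j) x) \<in> \<sigma> i (\<sigma> j Z)"
        using comp[OF oX k] at_i[OF oX] ve_Out[OF k xM, of j] smD(2)[OF s2] i1
        by (cases "k = i"; cases "k = j") auto
    qed (use x(5)[OF oX] in simp)
    then show "act (Out j) (act (ve j) x) \<in> \<sigma> i (\<sigma> j Z)" using ij xM by (simp add: Out_ve)
  qed
  have "X \<subseteq> \<sigma> j (\<sigma> i (\<sigma> j Z))"
  proof
    fix y assume y: "y \<in> X"
    show "y \<in> \<sigma> j (\<sigma> i (\<sigma> j Z))"
    proof (rule components_in[OF sm_csub[OF s3] x(5)[OF y]])
      fix k assume k: "k \<in> I"
      show "act (ve k) y \<in> \<sigma> j (\<sigma> i (\<sigma> j Z))"
        using comp[OF y k] at_i[OF y] at_j[OF y] i1 by (cases "k = i"; cases "k = j") auto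
    qed
  qed
  then show "satur {i, j} Z \<subseteq> \<sigma> j (\<sigma> i (\<sigma> j Z))" by (simp add: X_def)
qed

end

context simple_graph begin

lemma red_same_length: "red u \<Longrightarrow> set v \<subseteq> I \<Longrightarrow> wp v = wp u \<Longrightarrow> length v = length u \<Longrightarrow> red v"
  by (simp add: red_def)

lemma neg_not_red_Cons: "wp (rev u) (\<alpha> i) \<le> 0 \<Longrightarrow> \<not> red (i # u)"
  using red_Cons_pos[of i u] not_root_nonpos[of "wp (rev u) (\<alpha> i)"] wp_inj[of "rev u" "\<alpha> i" 0] by auto

lemma descent_neg: "red (i # u) \<Longrightarrow> wp (rev (i # u)) (\<alpha> i) \<le> 0"
  using red_Cons_pos[of i u] by (simp add: s_root_self wp_uminus le_fun_def)

lemma s_wp_cancel: "s i \<circ> wp a = s i \<circ> wp b \<Longrightarrow> wp a = wp b"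
  by (rule ext) (metis comp_apply s_s)

end

context lam_mod begin

text \<open>By induction as in Matsumoto's theorem. If the first letters \<open>i\<close> and \<open>j\<close> differ, both are left
  descents, so there is a reduced word starting with \<open>i j\<close> or \<open>i j i\<close>. Its first letters can be exchanged by the
  commutation or braid relation, and the induction hypothesis applies to what follows the first letter.\<close>

lemma sig_word:
  assumes Z: "sm Z"
  shows "red u \<Longrightarrow> red v \<Longrightarrow> wp u = wp v \<Longrightarrow> sig u Z = sig v Z"
proof (induction "length u" arbitrary: u v rule: less_induct)
  case less
  have len: "length u = length v" using less.prems by (simp add: red_def)
  show ?case
  proof (cases u)
    case Nil
    then show ?thesis using len by simp
  next
    case (Cons i a)
    then obtain j b where v: "v = j # b" using len by (cases v) auto
    note u = Cons
    have ra: "red a" "red b" using less.prems red_appendD(2)[of "[i]" a] red_appendD(2)[of "[j]" b] u v by auto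
    have ij: "i \<in> I" "j \<in> I" using less.prems u v by (auto dest: red_letters)
    have la: "length a < length u" "length b < length u" "length a = length b" using u v len by auto
    have w: "s i \<circ> wp a = s j \<circ> wp b" using less.prems(3) u v by simp
    show ?thesis
    proof (cases "i = j")
      case True
      then have "wp a = wp b" using w s_wp_cancel by blast
      then show ?thesis using less.hyps[OF la(1) ra] u v True by simp
    next
      case False
      have rev: "wp (rev u) = wp (rev v)" by (rule wp_rev_eq[OF less.prems(3)])
      have neg: "wp (rev u) (\<alpha> j) \<le> 0" "wp (rev u) (\<alpha> i) \<le> 0"
        using descent_neg[of i a] descent_neg[of j b] less.prems(1,2) u v rev by (simp_all del: wp_append)
      have reva: "wp (rev u) x = wp (rev a) (s i x)" for x using u by simp
      have revas: "wp (rev a) x = wp (rev u) (s i x)" for x using reva by simp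
      show ?thesis
      proof (cases "{i, j} \<in> E")
        case far: False
        have "wp (rev a) (\<alpha> j) \<le> 0" using revas neg s_root_far[OF False far] by simp
        then obtain c where c: "red (j # c)" "wp (j # c) = wp a"
          using not_red_Cons[OF ra(1) ij(2) neg_not_red_Cons] by blast
        have lc: "length (j # c) = length a" using c ra(1) by (simp add: red_def)
        have cI: "set c \<subseteq> I" using c(1) by (auto dest: red_letters)
        have "s j \<circ> wp b = s j \<circ> wp (i # c)"
        proof (rule ext)
          fix x show "(s j \<circ> wp b) x = (s j \<circ> wp (i # c)) x"
            using w c(2) s_comm[OF far, of "wp c x"] by (metis comp_apply wp_Cons)
        qed
        then have wb: "wp (i # c) = wp b" using s_wp_cancel by metis
        have "red (i # c)" using red_same_length[OF ra(2) _ wb] cI ij lc la(3) by simp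
        then have "sig b Z = sig (i # c) Z" using less.hyps[OF la(2) ra(2)] wb by simp
        moreover have "sig a Z = sig (j # c) Z" using less.hyps[OF la(1) ra(1) c(1)] c(2) by simp
        moreover have "\<sigma> i (\<sigma> j (sig c Z)) = \<sigma> j (\<sigma> i (sig c Z))"
          using satur_pair_far[OF sig_sm[OF Z], of i j c] satur_pair_far[OF sig_sm[OF Z], of j i c] ij False far
          by (simp add: insert_commute)
        ultimately show ?thesis using u v by simp
      next
        case near: True
        then have near': "{j, i} \<in> E" by (simp add: insert_commute)
        have nsum: "wp (rev u) (\<alpha> i + \<alpha> j) \<le> 0" unfolding wp_add using neg by (auto simp: le_fun_def intro: add_nonpos_nonpos)
        have "wp (rev a) (\<alpha> j) \<le> 0" unfolding revas s_root_near[OF near] by (rule nsum)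
        then obtain c where c: "red (j # c)" "wp (j # c) = wp a"
          using not_red_Cons[OF ra(1) ij(2) neg_not_red_Cons] by blast
        have lc: "length (j # c) = length a" using c ra(1) by (simp add: red_def)
        have rc: "red c" using red_appendD(2)[of "[j]" c] c(1) by simp
        have "wp (rev a) = wp (rev (j # c))" using wp_rev_eq[OF c(2)] by simp
        then have "wp (rev c) x = wp (rev a) (s j x)" for x by simp
        moreover have "s i (s j (\<alpha> i)) = \<alpha> j"
          unfolding s_root_near[OF near'] s_add s_root_near[OF near] s_root_self by (rule ext) simp
        ultimately have "wp (rev c) (\<alpha> i) \<le> 0" using revas neg(1) by simp
        then obtain d where d: "red (i # d)" "wp (i # d) = wp c"
          using not_red_Cons[OF rc ij(1) neg_not_red_Cons] by blast
        have ld: "length (i # d) = length c" using d rc by (simp add: red_def)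
        have dI: "set d \<subseteq> I" using d(1) by (auto dest: red_letters)
        have wa: "wp (j # i # d) = wp a" using c(2) d(2) by simp
        have r1: "red (j # i # d)" by (rule red_same_length[OF ra(1) _ wa]) (use dI ij lc ld in auto)
        have "s j \<circ> wp b = s j \<circ> wp (i # j # d)"
        proof (rule ext)
          fix x
          have "(s j \<circ> wp b) x = (s i \<circ> wp a) x" using w by simp
          also have "\<dots> = s i (s j (s i (wp d x)))" unfolding wa[symmetric] by simp
          also have "\<dots> = s j (s i (s j (wp d x)))" by (rule s_braid[OF near])
          finally show "(s j \<circ> wp b) x = (s j \<circ> wp (i # j # d)) x" by simp
        qed
        then have wb: "wp (i # j # d) = wp b" using s_wp_cancel by metis
        have r2: "red (i # j # d)" by (rule red_same_length[OF ra(2) _ wb]) (use dI ij lc ld la in auto)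
        have "sig a Z = sig (j # i # d) Z" by (rule less.hyps[OF la(1) ra(1) r1 wa[symmetric]])
        moreover have "sig b Z = sig (i # j # d) Z" by (rule less.hyps[OF la(2) ra(2) r2 wb[symmetric]])
        moreover have "\<sigma> i (\<sigma> j (\<sigma> i (sig d Z))) = \<sigma> j (\<sigma> i (\<sigma> j (sig d Z)))"
          using satur_pair_near[OF sig_sm[OF Z] near, of d] satur_pair_near[OF sig_sm[OF Z] near', of d]
          by (simp add: insert_commute)
        ultimately show ?thesis using u v by simp
      qed
    qed
  qed
qed

text \<open>The element of \<open>u\<close> also has a reduced word that starts with \<open>i\<close>, and \<open>\<sigma> i\<close> is idempotent.\<close>

lemma sig_descent:
  assumes "sm Z" "red u" "i \<in> I" "\<not> red (i # u)" shows "\<sigma> i (sig u Z) = sig u Z"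
proof -
  obtain v where v: "red (i # v)" "wp (i # v) = wp u" using not_red_Cons[OF assms(2-4)] .
  have "sig u Z = \<sigma> i (sig v Z)" using sig_word[OF assms(1,2) v(1)] v(2) by simp
  then show ?thesis using \<sigma>_idem[OF sig_sm[OF assms(1)]] by simp
qed

text \<open>The smallest submodule of \<open>Y\<close> with the same components away from \<open>i\<close>: its component at \<open>i\<close> is what the
  arrows ending at \<open>i\<close> produce.\<close>

definition \<rho> :: "'v \<Rightarrow> 'm set \<Rightarrow> 'm set" where
  "\<rho> i Y = {y \<in> Y. act (ve i) y \<in> act (In i) ` Y}"

lemma image_csub: assumes H: "C.csub H" and f: "f \<in> carrier P" shows "C.csub (act f ` H)"
proof -
  note h = H[unfolded C.csub_def]
  have HM: "x \<in> H \<Longrightarrow> x \<in> carrier M" for x using h by auto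
  show ?thesis unfolding C.csub_def
  proof (intro conjI ballI allI)
    show "act f ` H \<subseteq> carrier M" using HM f by auto
    show "\<zero> \<in> act f ` H" using h f by (metis act_zero_right imageI)
  next
    fix x y assume "x \<in> act f ` H" "y \<in> act f ` H"
    then obtain u v where "u \<in> H" "v \<in> H" "x = act f u" "y = act f v" by auto
    then have "x \<oplus> y = act f (u \<oplus> v)" "u \<oplus> v \<in> H" using HM f h by (simp_all add: act_add)
    then show "x \<oplus> y \<in> act f ` H" by (metis imageI)
  next
    fix c x assume "x \<in> act f ` H"
    then obtain u where "u \<in> H" "x = act f u" by auto
    then have "sv c x = act f (sv c u)" "sv c u \<in> H" using HM f h by (simp_all add: sv_commute[of f])
    then show "sv c x \<in> act f ` H" by (metis imageI)
  qed
qed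

lemma \<rho>_sm: assumes "sm Y" "i \<in> I" shows "sm (\<rho> i Y)"
proof (rule sm_generators)
  note y = smD[OF assms(1)]
  have im: "C.csub (act (In i) ` Y)" by (rule image_csub[OF sm_csub[OF assms(1)]]) simp
  note im' = im[unfolded C.csub_def]
  show "C.csub (\<rho> i Y)" unfolding C.csub_def
  proof (intro conjI ballI allI)
    show "\<rho> i Y \<subseteq> carrier M" using y by (auto simp: \<rho>_def)
    show "\<zero> \<in> \<rho> i Y" using y im' assms(2) by (auto simp: \<rho>_def)
  next
    fix a b assume "a \<in> \<rho> i Y" "b \<in> \<rho> i Y"
    then show "a \<oplus> b \<in> \<rho> i Y" using y im' assms(2) by (auto simp: \<rho>_def act_add)
  next
    fix c a assume a: "a \<in> \<rho> i Y"
    then have "sv c (act (ve i) a) \<in> act (In i) ` Y" "sv c a \<in> Y" "a \<in> carrier M"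
      using y im' by (auto simp: \<rho>_def)
    then show "sv c a \<in> \<rho> i Y" using assms(2) by (simp add: \<rho>_def sv_commute[of "ve i"])
  qed
next
  note y = smD[OF assms(1)]
  fix k a assume "k \<in> I" "a \<in> \<rho> i Y"
  then show "act (ve k) a \<in> \<rho> i Y"
    using y(4)[of "ve k" a] y(5)[of a] assms(2) imageI[OF y(2), of "act (In i)"]
    by (auto simp: \<rho>_def ve_ve)
next
  note y = smD[OF assms(1)]
  fix k l a assume e: "{k, l} \<in> E" and a: "a \<in> \<rho> i Y"
  then have aY: "a \<in> Y" "a \<in> carrier M" "act (ar k l) a \<in> Y" "k \<in> I"
    using y e edgeD[OF e] by (auto simp: \<rho>_def)
  have "act (ve i) (act (ar k l) a) \<in> act (In i) ` Y"
  proof (cases "l = i")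
    case True
    then have "{i, k} \<in> E" using e by (simp add: insert_commute)
    from ar_In[OF this aY(2)] have "act (ar k i) a \<in> act (In i) ` Y"
      using y(4) aY by simp
    then show ?thesis using True ve_ar[OF assms(2) e aY(2)] by simp
  next
    case False
    then show ?thesis using ve_ar[OF assms(2) e aY(2)] imageI[OF y(2), of "act (In i)"] by simp
  qed
  then show "act (ar k l) a \<in> \<rho> i Y" using aY by (simp add: \<rho>_def)
qed

lemma \<rho>_sub: "\<rho> i Y \<subseteq> Y"
  by (auto simp: \<rho>_def)

text \<open>Either inclusion says that \<open>Z\<close> contains all components of \<open>Y\<close> away from \<open>i\<close>.\<close>

lemma \<rho>_\<sigma>_adjoint:
  assumes Y: "sm Y" and Z: "sm Z" and i: "i \<in> I"
  shows "\<rho> i Y \<subseteq> Z \<longleftrightarrow> Y \<subseteq> \<sigma> i Z"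
proof
  note y = smD[OF Y] and z = smD[OF Z]
  assume a: "\<rho> i Y \<subseteq> Z"
  show "Y \<subseteq> \<sigma> i Z" unfolding sub_satur_iff[OF Y]
  proof (intro ballI)
    fix k x assume k: "k \<in> I - {i}" and x: "x \<in> Y"
    then have "act (ve k) x \<in> \<rho> i Y"
      using y(4)[of "ve k" x] y(5)[OF x] i imageI[OF y(2), of "act (In i)"] by (auto simp: \<rho>_def ve_ve)
    then show "act (ve k) x \<in> Z" using a by blast
  qed
next
  note y = smD[OF Y] and z = smD[OF Z]
  assume a: "Y \<subseteq> \<sigma> i Z"
  have comp: "act (ve k) x \<in> Z" if "k \<in> I" "k \<noteq> i" "x \<in> Y" for k x
    using a sub_satur_iff[OF Y, of "{i}" Z] that by blast
  have In: "act (In i) x \<in> Z" if x: "x \<in> Y" for x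
  proof -
    have "act (Nb i) x \<in> Z"
    proof (rule components_in[OF sm_csub[OF Z]])
      fix k assume "k \<in> I"
      then show "act (ve k) (act (Nb i) x) \<in> Z"
        using comp[OF _ _ x, of k] ve_Nb[OF _ y(5)[OF x], of k i] z(2) by (cases "k = i") auto
    qed (use y(5)[OF x] in simp)
    then have "act (In i) (act (Nb i) x) \<in> Z" by (rule z(4)[rotated]) simp
    then show ?thesis using In_Nb[OF y(5)[OF x]] by simp
  qed
  show "\<rho> i Y \<subseteq> Z"
  proof
    fix x assume x: "x \<in> \<rho> i Y"
    then have xY: "x \<in> Y" by (simp add: \<rho>_def)
    show "x \<in> Z"
    proof (rule components_in[OF sm_csub[OF Z] y(5)[OF xY]])
      fix k assume k: "k \<in> I"
      show "act (ve k) x \<in> Z"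
      proof (cases "k = i")
        case True
        then obtain x' where "x' \<in> Y" "act (ve i) x = act (In i) x'" using x by (auto simp: \<rho>_def)
        then show ?thesis using True In by simp
      next
        case False
        then show ?thesis using comp[OF k _ xY] by simp
      qed
    qed
  qed
qed

text \<open>The dimension vector, extended by \<open>0\<close> outside \<open>I\<close> so that it lies in the root lattice.\<close>

definition dimvec :: "'m set \<Rightarrow> 'v \<Rightarrow> int" where
  "dimvec Z k = (if k \<in> I then int (C.cdim (act (ve k) ` Z)) else 0)"

lemma cdim_act:
  assumes "C.csub H" "f \<in> carrier P"
  shows "C.cdim H = C.cdim (act f ` H) + C.cdim {x \<in> H. act f x = \<zero>}"
proof -
  have h: "x \<in> H \<Longrightarrow> x \<in> carrier M" for x using assms(1) by (auto simp: C.csub_def)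
  show ?thesis
    by (rule cdim_rank_nullity[OF C.cspace_axioms C.cspace_axioms assms(1)])
      (use h assms(2) in \<open>auto simp: act_add sv_commute[of f]\<close>)
qed

abbreviation ind :: "'v set \<Rightarrow> 'v list \<Rightarrow> complex" where "ind A \<equiv> diag (\<lambda>k. if k \<in> A then 1 else 0)"

lemma ind_closed: "A \<subseteq> I \<Longrightarrow> ind A \<in> carrier P"
  unfolding P_path_algebra by (rule diag_closed[OF finite_I]) auto

lemma ve_ind: "k \<in> I \<Longrightarrow> A \<subseteq> I \<Longrightarrow> x \<in> carrier M \<Longrightarrow> act (ve k) (act (ind A) x) = (if k \<in> A then act (ve k) x else \<zero>)"
proof -
  assume a: "k \<in> I" "A \<subseteq> I" "x \<in> carrier M"
  have "ve k \<otimes>\<^bsub>P\<^esub> ind A = (if k \<in> A then ve k else \<zero>\<^bsub>P\<^esub>)"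
    unfolding P_simps by (auto intro!: path_ext simp: path_mult_diag_left)
  then show ?thesis using a ind_closed[OF a(2)] by (simp flip: act_mult)
qed

lemma components_eq:
  assumes "x \<in> carrier M" "y \<in> carrier M" "\<And>k. k \<in> I \<Longrightarrow> act (ve k) x = act (ve k) y" shows "x = y"
proof -
  have "x \<ominus> y \<in> {\<zero>}"
  proof (rule components_in[OF C.csub_zero])
    fix k assume k: "k \<in> I"
    have "act (ve k) (x \<ominus> y) = act (ve k) x \<ominus> act (ve k) y" using assms k by (intro act_minus) auto
    then show "act (ve k) (x \<ominus> y) \<in> {\<zero>}" using assms k by (simp add: M.r_neg a_minus_def)
  qed (use assms in simp)
  then have "x \<oplus> \<ominus> y = \<zero>" by (simp add: a_minus_def)
  then have "\<ominus> (\<ominus> y) = x" using assms(1,2) by (intro M.minus_equality) auto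
  then show ?thesis using assms(2) by simp
qed

lemma cdim_ind:
  assumes Z: "sm Z" and A: "A \<subseteq> I"
  shows "int (C.cdim (act (ind A) ` Z)) = (\<Sum>k\<in>A. dimvec Z k)"
proof -
  have "finite A" using A finite_I finite_subset by blast
  then show ?thesis using A
  proof (induction A rule: finite_induct)
    case empty
    have "act (ind {}) ` Z = {\<zero>}" using smD[OF Z] by auto
    then show ?case using C.cdim_zero by (simp only: sum.empty of_nat_0)
  next
    case (insert i A)
    note z = smD[OF Z]
    have i: "i \<in> I" "A \<subseteq> I" using insert by auto
    have indZ: "act (ind B) x \<in> Z" if "x \<in> Z" "B \<subseteq> I" for x B using z(4) ind_closed that by blast
    have zM: "x \<in> Z \<Longrightarrow> x \<in> carrier M" for x using z(5) .
    have sub: "C.csub (act (ind (insert i A)) ` Z)"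
      by (rule image_csub[OF sm_csub[OF Z] ind_closed[OF insert.prems]])
    have "act (ve i) ` act (ind (insert i A)) ` Z = act (ve i) ` Z"
      using ve_ind[OF i(1) insert.prems] zM by (auto simp: image_image cong: image_cong)
    moreover have "{x \<in> act (ind (insert i A)) ` Z. act (ve i) x = \<zero>} = act (ind A) ` Z"
    proof (intro equalityI subsetI)
      fix y assume "y \<in> {x \<in> act (ind (insert i A)) ` Z. act (ve i) x = \<zero>}"
      then obtain x where x: "x \<in> Z" "y = act (ind (insert i A)) x" "act (ve i) y = \<zero>" by auto
      have "y = act (ind A) x"
        by (rule components_eq)
          (use x zM[OF x(1)] ve_ind[OF _ insert.prems zM[OF x(1)]] ve_ind[OF _ i(2) zM[OF x(1)]]
            ind_closed[OF insert.prems] ind_closed[OF i(2)] insert(2) in auto)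
      then show "y \<in> act (ind A) ` Z" using x by blast
    next
      fix y assume "y \<in> act (ind A) ` Z"
      then obtain x where x: "x \<in> Z" "y = act (ind A) x" by auto
      have y: "y \<in> Z" "y \<in> carrier M" using x indZ[OF x(1) i(2)] zM by auto
      have "y = act (ind (insert i A)) y"
        by (rule components_eq)
          (use x zM[OF x(1)] y ve_ind[OF _ insert.prems y(2)] ve_ind[OF _ i(2) zM[OF x(1)]]
            ind_closed[OF insert.prems] in auto)
      moreover have "act (ve i) y = \<zero>" using ve_ind[OF i zM[OF x(1)]] x insert(2) by simp
      ultimately show "y \<in> {x \<in> act (ind (insert i A)) ` Z. act (ve i) x = \<zero>}" using y by blast
    qed
    ultimately have "C.cdim (act (ind (insert i A)) ` Z) = C.cdim (act (ve i) ` Z) + C.cdim (act (ind A) ` Z)"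
      using cdim_act[OF sub, of "ve i"] i(1) by simp
    then show ?case using insert i by (simp add: dimvec_def)
  qed
qed

lemma cdim_dimvec: "sm Z \<Longrightarrow> int (C.cdim Z) = (\<Sum>k\<in>I. dimvec Z k)"
proof -
  assume Z: "sm Z"
  have "act (ind I) ` Z = Z"
    using smD(5)[OF Z] act_one by (auto simp: P_simps(3) image_iff)
  then show ?thesis using cdim_ind[OF Z order_refl] by simp
qed

lemma cdim_Nb: "sm Z \<Longrightarrow> int (C.cdim (act (Nb i) ` Z)) = (\<Sum>k\<in>nb i. dimvec Z k)"
  using cdim_ind[of Z "nb i"] edgeD by (auto simp: Nb_def)

lemma dimvec_mono: "sm Y \<Longrightarrow> sm Z \<Longrightarrow> Y \<subseteq> Z \<Longrightarrow> dimvec Y k \<le> dimvec Z k"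
  unfolding dimvec_def
  using C.cdim_psub(1)[OF image_csub[OF sm_csub] image_csub[OF sm_csub] image_mono] by (cases "k \<in> I") simp_all

lemma dimvec_eq: assumes "sm Y" "sm Z" "Y \<subseteq> Z" "\<And>k. k \<in> I \<Longrightarrow> dimvec Y k = dimvec Z k" shows "Y = Z"
proof (rule C.cdim_psub(2)[OF sm_csub sm_csub])
  show "C.cdim Y = C.cdim Z" using cdim_dimvec[OF assms(1)] cdim_dimvec[OF assms(2)] assms(4) by simp
qed (use assms in auto)

lemma \<sigma>_off: assumes Z: "sm Z" and k: "k \<in> I" "k \<noteq> i" shows "act (ve k) ` \<sigma> i Z = act (ve k) ` Z"
proof
  show "act (ve k) ` Z \<subseteq> act (ve k) ` \<sigma> i Z" using satur_incl[OF Z] by blast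
  show "act (ve k) ` \<sigma> i Z \<subseteq> act (ve k) ` Z"
  proof
    fix y assume "y \<in> act (ve k) ` \<sigma> i Z"
    then obtain x where x: "x \<in> \<sigma> i Z" "y = act (ve k) x" by auto
    then have "y \<in> Z" using satur_component[OF x(1), of k] k by simp
    moreover have "y = act (ve k) y" using x k by (simp add: satur_def ve_ve)
    ultimately show "y \<in> act (ve k) ` Z" by blast
  qed
qed

lemma \<rho>_off: assumes Y: "sm Y" and k: "k \<in> I" "k \<noteq> i" "i \<in> I" shows "act (ve k) ` \<rho> i Y = act (ve k) ` Y"
proof
  note y = smD[OF Y]
  show "act (ve k) ` \<rho> i Y \<subseteq> act (ve k) ` Y" using \<rho>_sub by blast
  show "act (ve k) ` Y \<subseteq> act (ve k) ` \<rho> i Y"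
  proof
    fix z assume "z \<in> act (ve k) ` Y"
    then obtain x where x: "x \<in> Y" "z = act (ve k) x" by auto
    then have "z \<in> \<rho> i Y"
      using y(4)[of "ve k" x] y(5)[OF x(1)] k imageI[OF y(2), of "act (In i)"] by (auto simp: \<rho>_def ve_ve)
    moreover have "z = act (ve k) z" using x y(5)[OF x(1)] k by (simp add: ve_ve)
    ultimately show "z \<in> act (ve k) ` \<rho> i Y" by blast
  qed
qed

lemma \<rho>_at: assumes Y: "sm Y" and i: "i \<in> I" shows "act (ve i) ` \<rho> i Y = act (In i) ` Y"
proof
  note y = smD[OF Y]
  show "act (ve i) ` \<rho> i Y \<subseteq> act (In i) ` Y" by (auto simp: \<rho>_def)
  show "act (In i) ` Y \<subseteq> act (ve i) ` \<rho> i Y"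
  proof
    fix z assume "z \<in> act (In i) ` Y"
    then obtain x where x: "x \<in> Y" "z = act (In i) x" by auto
    then have z: "z \<in> Y" "act (ve i) z = z" using y(4)[of "In i" x] y(5)[OF x(1)] i by (auto simp: ve_In)
    then have "z \<in> \<rho> i Y" using x by (auto simp: \<rho>_def)
    then show "z \<in> act (ve i) ` \<rho> i Y" using z(2) by (metis imageI)
  qed
qed

lemma dimvec_off: "sm Z \<Longrightarrow> i \<in> I \<Longrightarrow> k \<noteq> i \<Longrightarrow> dimvec (\<sigma> i Z) k = dimvec Z k" "sm Z \<Longrightarrow> i \<in> I \<Longrightarrow> k \<noteq> i \<Longrightarrow> dimvec (\<rho> i Z) k = dimvec Z k"
  unfolding dimvec_def by (simp_all add: \<sigma>_off \<rho>_off)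

end

context lam_mod begin

lemma sm_sum: assumes "sm A" "sm B" shows "sm (set_add M A B)"
proof (rule smI)
  note c = C.csub_sum[OF sm_csub[OF assms(1)] sm_csub[OF assms(2)], unfolded C.csub_def]
  show "set_add M A B \<subseteq> carrier M" "\<zero> \<in> set_add M A B"
    "x \<in> set_add M A B \<Longrightarrow> y \<in> set_add M A B \<Longrightarrow> x \<oplus> y \<in> set_add M A B" for x y
    using c by auto
  fix f x assume f: "f \<in> carrier P" and "x \<in> set_add M A B"
  then obtain a b where ab: "a \<in> A" "b \<in> B" "x = a \<oplus> b" by (auto simp: set_add_def')
  then have "act f x = act f a \<oplus> act f b" using f smD(5)[OF assms(1)] smD(5)[OF assms(2)] by (simp add: act_add)
  then show "act f x \<in> set_add M A B"
    using ab smD(4)[OF assms(1) f] smD(4)[OF assms(2) f] unfolding set_add_def' by blast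
qed

lemma sum_incl: assumes "sm A" "sm B" shows "A \<subseteq> set_add M A B" "B \<subseteq> set_add M A B"
proof -
  note a = smD[OF assms(1)] and b = smD[OF assms(2)]
  show "A \<subseteq> set_add M A B"
  proof
    fix x assume "x \<in> A"
    moreover from this have "x = x \<oplus> \<zero>" using a(5) by simp
    ultimately show "x \<in> set_add M A B" unfolding set_add_def' using b(2) by blast
  qed
  show "B \<subseteq> set_add M A B"
  proof
    fix x assume "x \<in> B"
    moreover from this have "x = \<zero> \<oplus> x" using b(5) by simp
    ultimately show "x \<in> set_add M A B" unfolding set_add_def' using a(2) by blast
  qed
qed

lemma sum_least: assumes "sm X" "A \<subseteq> X" "B \<subseteq> X" shows "set_add M A B \<subseteq> X"
  using assms smD(3)[OF assms(1)] by (auto simp: set_add_def')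

lemma in_line: assumes "x \<in> carrier M" shows "\<zero> \<in> {sv c x | c. True}" "x \<in> {sv c x | c. True}"
proof -
  show "\<zero> \<in> {sv c x | c. True}" by (rule CollectI, rule exI[of _ 0]) (simp only: C.s_zero_left[OF assms] simp_thms)
  show "x \<in> {sv c x | c. True}" by (rule CollectI, rule exI[of _ 1]) (simp only: C.s_one[OF assms] simp_thms)
qed

lemma unscale: assumes "x \<in> carrier M" "c \<noteq> 0" shows "sv (1 / c) (sv c x) = x"
proof -
  have "sv (1 / c) (sv c x) = sv (1 / c * c) x" by (rule C.s_mult[OF assms(1), symmetric])
  also have "1 / c * c = 1" using assms(2) by simp
  finally show ?thesis unfolding C.s_one[OF assms(1)] .
qed

text \<open>Such a vector spans a copy of \<open>S\<^sub>i\<close>.\<close>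

lemma line_sm:
  assumes x: "x \<in> carrier M" "act (ve i) x = x" "act (Out i) x = \<zero>" and i: "i \<in> I"
  shows "sm {sv c x | c. True}"
proof (cases "x = \<zero>")
  case True
  then have "{sv c x | c. True} = {\<zero>}" by auto
  then show ?thesis using sm_zero by simp
next
  case False
  have zero: "act (ve k) x = \<zero>" if "k \<in> I" "k \<noteq> i" for k
    using ve_ve[of i k x] that x i by simp
  have arr: "act (ar k l) x = \<zero>" if e: "{k, l} \<in> E" for k l
  proof (cases "k = i")
    case True
    then show ?thesis using ve_Out[of l x i] e edgeD[OF e] x by auto
  next
    case False
    then show ?thesis using ar_ve[OF i e x(1)] x(2) by simp
  qed
  have 0: "\<zero> \<in> {sv c x | c. True}" by (rule in_line(1)[OF x(1)])
  show ?thesis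
  proof (rule sm_generators[OF C.cdim_line(1)[OF x(1) False]])
    fix k y assume k: "k \<in> I" and "y \<in> {sv c x | c. True}"
    then obtain c where y: "y = sv c x" by blast
    then have "act (ve k) y = sv c (act (ve k) x)" unfolding y by (intro sv_commute x(1) gen_closed(1) k)
    then show "act (ve k) y \<in> {sv c x | c. True}" using zero[OF k] x(2) 0 by (cases "k = i") auto
  next
    fix k l y assume e: "{k, l} \<in> E" and "y \<in> {sv c x | c. True}"
    then obtain c where y: "y = sv c x" by blast
    then have "act (ar k l) y = sv c (act (ar k l) x)" unfolding y by (intro sv_commute x(1) gen_closed(2) e)
    then show "act (ar k l) y \<in> {sv c x | c. True}" using arr[OF e] 0 by simp
  qed
qed

end

section \<open>Injective hulls of the simple modules\<close>

text \<open>Injectivity of a module is tested on modules carried by sets of complex sequences. The extension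
  of \<open>Q\<close> by a one-dimensional space needs a pair of a sequence and a number, so the number is put in front
  of the sequence.\<close>

definition enc :: "(nat \<Rightarrow> complex) \<Rightarrow> complex \<Rightarrow> nat \<Rightarrow> complex" where
  "enc q c = (\<lambda>n. case n of 0 \<Rightarrow> c | Suc m \<Rightarrow> q m)"

definition dec :: "(nat \<Rightarrow> complex) \<Rightarrow> nat \<Rightarrow> complex" where
  "dec x = (\<lambda>n. x (Suc n))"

lemma enc_dec [simp]: "dec (enc q c) = q" "enc q c 0 = c" "enc (dec x) (x 0) = x"
  by (auto simp: enc_def dec_def fun_eq_iff split: nat.splits)

lemma enc_inject [simp]: "enc q c = enc q' c' \<longleftrightarrow> q = q' \<and> c = c'"
  by (metis enc_dec(1,2))

text \<open>The bound \<open>N\<close> on the lengths of reduced words makes it possible to extend every reduced word to one for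
  the longest element.\<close>

locale inj_hull = lam_mod I E \<Omega> Q
  for I :: "'v set" and E and \<Omega> and Q :: "'v preproj_mod" (structure) +
  fixes j :: 'v and N :: nat
  assumes dynkin: "dynkin_ADE I E"
    and bounded: "red v \<Longrightarrow> length v \<le> N"
    and j: "j \<in> I"
    and hull: "injective_hull I \<Omega> (simple_at j) Q"
begin

lemma shift_mult': "f \<in> carrier P \<Longrightarrow> g \<in> carrier P \<Longrightarrow> shift i (f \<otimes>\<^bsub>P\<^esub> g) = (f \<otimes>\<^bsub>P\<^esub> shift i g) \<oplus>\<^bsub>P\<^esub> (sc (g [i]) \<otimes>\<^bsub>P\<^esub> shift i f)"
  unfolding shift_mult sc_mult(1)[OF shift_closed] by (simp add: P_simps(5))

lemma shift_add: "shift i (f \<oplus>\<^bsub>P\<^esub> g) = shift i f \<oplus>\<^bsub>P\<^esub> shift i g"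
  by (auto simp: P_simps(5) shift_def fun_eq_iff)

definition ext_act :: "'v \<Rightarrow> (nat \<Rightarrow> complex) \<Rightarrow> ('v list \<Rightarrow> complex) \<Rightarrow> (nat \<Rightarrow> complex) \<Rightarrow> nat \<Rightarrow> complex" where
  "ext_act i y f x = enc (act f (dec x) \<oplus> sv (x 0) (act (shift i f) y)) (f [i] * x 0)"

text \<open>The extension of \<open>S\<^sub>i\<close> by \<open>Q\<close> with a new vector at \<open>i\<close> whose image under the arrows leaving \<open>i\<close> is \<open>y\<close>.
  It is a module over the preprojective algebra if \<open>In i\<close> kills \<open>y\<close>.\<close>

definition ext_mod :: "'v \<Rightarrow> (nat \<Rightarrow> complex) \<Rightarrow> 'v preproj_mod" where
  "ext_mod i y = \<lparr>carrier = {x. dec x \<in> carrier Q}, mult = undefined, one = undefined, zero = enc \<zero> 0,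
     add = (\<lambda>x x'. enc (dec x \<oplus> dec x') (x 0 + x' 0)), smult = (\<lambda>a. ext_act i y (SOME f. f \<in> a))\<rparr>"

context
  fixes i :: 'v and y :: "nat \<Rightarrow> complex"
  assumes i: "i \<in> I" and y: "y \<in> carrier Q" "act (In i) y = \<zero>"
begin

abbreviation Ext where "Ext \<equiv> ext_mod i y"

lemma Ext_simps: "x \<in> carrier Ext \<longleftrightarrow> dec x \<in> carrier Q" "\<zero>\<^bsub>Ext\<^esub> = enc \<zero> 0"
  "x \<oplus>\<^bsub>Ext\<^esub> x' = enc (dec x \<oplus> dec x') (x 0 + x' 0)"
  by (simp_all add: ext_mod_def)

text \<open>The \<open>f\<close> in the ideal with this property form an ideal, and the generator has it: removing the
  first arrow from the relation at \<open>i\<close> leaves \<open>In i\<close>.\<close>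

lemma J_shift: assumes "f \<in> J" shows "act (shift i f) y = \<zero>"
proof -
  have JP: "g \<in> J \<Longrightarrow> g \<in> carrier P" for g using J.a_subset by blast
  have "ideal {f \<in> J. act (shift i f) y = \<zero>} P"
  proof (rule P_idealI)
    show "\<zero>\<^bsub>P\<^esub> \<in> {f \<in> J. act (shift i f) y = \<zero>}"
    proof -
      have "shift i \<zero>\<^bsub>P\<^esub> = \<zero>\<^bsub>P\<^esub>" by (auto simp: P_simps(4) shift_def fun_eq_iff)
      then show ?thesis using y(1) J.zero_closed by simp
    qed
  next
    fix f g assume "f \<in> {f \<in> J. act (shift i f) y = \<zero>}" "g \<in> {f \<in> J. act (shift i f) y = \<zero>}"
    then show "f \<oplus>\<^bsub>P\<^esub> g \<in> {f \<in> J. act (shift i f) y = \<zero>}"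
      using y(1) JP J.a_closed by (simp add: shift_add act_plus shift_closed)
  next
    fix f g assume fg: "f \<in> {f \<in> J. act (shift i f) y = \<zero>}" "g \<in> carrier P"
    then have fP: "f \<in> carrier P" "f [i] = 0" using JP J_const by auto
    have "shift i (g \<otimes>\<^bsub>P\<^esub> f) = g \<otimes>\<^bsub>P\<^esub> shift i f"
      unfolding shift_mult fP(2) by simp
    then show "g \<otimes>\<^bsub>P\<^esub> f \<in> {f \<in> J. act (shift i f) y = \<zero>}"
      using fg fP(1) y(1) J.I_l_closed by (simp add: act_mult shift_closed)
    have "act (shift i (f \<otimes>\<^bsub>P\<^esub> g)) y = act f (act (shift i g) y) \<oplus> sv (g [i]) (act (shift i f) y)"
      using fg fP(1) y(1) by (simp add: shift_mult' act_plus act_mult shift_closed)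
    also have "act f (act (shift i g) y) = \<zero>" using fg y(1) by (intro act_J) (auto simp: shift_closed)
    finally show "f \<otimes>\<^bsub>P\<^esub> g \<in> {f \<in> J. act (shift i f) y = \<zero>}" using fg J.I_r_closed by simp
  qed (use JP in auto)
  moreover have "rel \<in> {f \<in> J. act (shift i f) y = \<zero>}" using rel_in_J y(2) by (simp add: shift_ids)
  ultimately show ?thesis using P_ideal_induct assms by blast
qed

lemma Ext_smult: assumes f: "f \<in> carrier P" and x: "x \<in> carrier Ext" shows "cls f \<odot>\<^bsub>Ext\<^esub> x = ext_act i y f x"
proof -
  obtain h where h: "h \<in> J" "(SOME g. g \<in> cls f) = h \<oplus>\<^bsub>P\<^esub> f" using cls_some[OF f] by blast
  have hP: "h \<in> carrier P" using h(1) J.a_subset by blast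
  have "ext_act i y (h \<oplus>\<^bsub>P\<^esub> f) x = ext_act i y f x"
    using x y(1) hP f act_J[OF h(1)] J_shift[OF h(1)] J_const[OF h(1), of i]
    by (simp add: ext_act_def Ext_simps act_plus shift_add shift_closed) (simp add: P_simps(5))
  then show ?thesis using h(2) by (simp add: ext_mod_def)
qed

lemma Ext_group: "abelian_group Ext"
proof (rule abelian_groupI)
  fix x assume "x \<in> carrier Ext"
  then show "\<exists>x'\<in>carrier Ext. x' \<oplus>\<^bsub>Ext\<^esub> x = \<zero>\<^bsub>Ext\<^esub>"
    by (intro bexI[of _ "enc (\<ominus> dec x) (- x 0)"]) (auto simp: Ext_simps M.l_neg)
qed (auto simp: Ext_simps M.a_ac)

lemma Ext_module: "left_module \<Lambda> Ext"
proof (rule left_module.intro[OF \<Lambda>_ring Ext_group], unfold_locales)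
  fix a x assume a: "a \<in> carrier \<Lambda>" and x: "x \<in> carrier Ext"
  then obtain f where f: "f \<in> carrier P" "a = cls f" by (auto simp: \<Lambda>_carrier)
  show "a \<odot>\<^bsub>Ext\<^esub> x \<in> carrier Ext"
    using x f y(1) by (simp add: Ext_smult ext_act_def Ext_simps shift_closed)
  fix b assume "b \<in> carrier \<Lambda>"
  then obtain g where g: "g \<in> carrier P" "b = cls g" by (auto simp: \<Lambda>_carrier)
  have gx: "ext_act i y g x \<in> carrier Ext" using x g y(1) by (simp add: ext_act_def Ext_simps shift_closed)
  have fg: "f \<oplus>\<^bsub>P\<^esub> g \<in> carrier P" "f \<otimes>\<^bsub>P\<^esub> g \<in> carrier P" using f g by auto
  have xs: "dec x \<in> carrier Q" using x by (simp add: Ext_simps)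
  have sf: "shift i f \<in> carrier P" "shift i g \<in> carrier P" using f g shift_closed by auto
  have cl: "act f (dec x) \<in> carrier Q" "act g (dec x) \<in> carrier Q" "act (shift i f) y \<in> carrier Q"
     "act (shift i g) y \<in> carrier Q" "act f (act g (dec x)) \<in> carrier Q" "act f (act (shift i g) y) \<in> carrier Q"
    using xs y(1) f(1) g(1) sf by auto
  have "ext_act i y (f \<oplus>\<^bsub>P\<^esub> g) x = ext_act i y f x \<oplus>\<^bsub>Ext\<^esub> ext_act i y g x"
  proof -
    have c: "(f \<oplus>\<^bsub>P\<^esub> g) [i] = f [i] + g [i]" by (simp add: P_simps(5))
    show ?thesis using cl f(1) g(1) sf xs y(1)
      unfolding ext_act_def Ext_simps enc_dec enc_inject c
      by (simp add: shift_add act_plus act_add M.a_ac algebra_simps)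
  qed
  then show "(a \<oplus>\<^bsub>\<Lambda>\<^esub> b) \<odot>\<^bsub>Ext\<^esub> x = a \<odot>\<^bsub>Ext\<^esub> x \<oplus>\<^bsub>Ext\<^esub> b \<odot>\<^bsub>Ext\<^esub> x"
    using Ext_smult[OF fg(1) x] Ext_smult[OF f(1) x] Ext_smult[OF g(1) x] cls_simps(3)[OF f(1) g(1)] f g by simp
  have "ext_act i y (f \<otimes>\<^bsub>P\<^esub> g) x = ext_act i y f (ext_act i y g x)"
  proof -
    have e: "sv (g [i] * x 0) z = sv (x 0) (sv (g [i]) z)" if "z \<in> carrier Q" for z
      unfolding mult.commute[of "g [i]"] by (rule C.s_mult[OF that])
    show ?thesis using cl f(1) g(1) sf xs y(1) unfolding ext_act_def enc_dec mult_const enc_inject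
      by (simp add: shift_mult' act_plus act_mult act_add e[OF cl(3)] sv_commute[OF f(1)] M.a_ac)
  qed
  then show "(a \<otimes>\<^bsub>\<Lambda>\<^esub> b) \<odot>\<^bsub>Ext\<^esub> x = a \<odot>\<^bsub>Ext\<^esub> (b \<odot>\<^bsub>Ext\<^esub> x)"
    using Ext_smult[OF fg(2) x] Ext_smult[OF f(1) gx] Ext_smult[OF g(1) x] cls_simps(2)[OF f(1) g(1)] f g by simp
next
  fix a x x' assume a: "a \<in> carrier \<Lambda>" and x: "x \<in> carrier Ext" "x' \<in> carrier Ext"
  then obtain f where f: "f \<in> carrier P" "a = cls f" by (auto simp: \<Lambda>_carrier)
  have xs: "dec x \<in> carrier Q" "dec x' \<in> carrier Q" "act (shift i f) y \<in> carrier Q" "x \<oplus>\<^bsub>Ext\<^esub> x' \<in> carrier Ext"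
    using x y(1) f(1) shift_closed by (auto simp: Ext_simps)
  have "ext_act i y f (x \<oplus>\<^bsub>Ext\<^esub> x') = ext_act i y f x \<oplus>\<^bsub>Ext\<^esub> ext_act i y f x'"
    using xs f(1) unfolding ext_act_def Ext_simps enc_dec enc_inject C.s_plus[OF xs(3)]
    by (simp add: act_add M.a_ac algebra_simps)
  then show "a \<odot>\<^bsub>Ext\<^esub> (x \<oplus>\<^bsub>Ext\<^esub> x') = a \<odot>\<^bsub>Ext\<^esub> x \<oplus>\<^bsub>Ext\<^esub> a \<odot>\<^bsub>Ext\<^esub> x'"
    using Ext_smult[OF f(1)] xs(4) x f by simp
next
  fix x assume x: "x \<in> carrier Ext"
  have s: "shift i \<one>\<^bsub>P\<^esub> = \<zero>\<^bsub>P\<^esub>" unfolding P_simps(3) by (rule shift_ids)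
  have "\<one>\<^bsub>P\<^esub> [i] = 1" using i by (simp add: P_simps(3))
  then have "ext_act i y \<one>\<^bsub>P\<^esub> x = x" using x y(1) by (simp add: ext_act_def s Ext_simps)
  then show "\<one>\<^bsub>\<Lambda>\<^esub> \<odot>\<^bsub>Ext\<^esub> x = x" using Ext_smult[OF P.one_closed x] cls_simps(4) by simp
qed

lemma ext_act_enc: "ext_act i y g (enc q c) = enc (act g q \<oplus> sv c (act (shift i g) y)) (g [i] * c)"
  by (simp only: ext_act_def enc_dec)

lemma ext_act_old: "g \<in> carrier P \<Longrightarrow> q \<in> carrier Q \<Longrightarrow> ext_act i y g (enc q 0) = enc (act g q) 0"
  using C.s_zero_left[of "act (shift i g) y"] y(1) by (simp add: ext_act_enc shift_closed)

lemma Ext_fd: "fd_module I \<Omega> Ext"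
  unfolding fd_module_def
proof (intro conjI Ext_module)
  interpret Ext: abelian_group Ext by (rule Ext_group)
  define e where "e b = enc b 0" for b
  define v where "v = enc \<zero> 1"
  have vY: "v \<in> carrier Ext" and eY: "b \<in> carrier Q \<Longrightarrow> e b \<in> carrier Ext" for b
    by (simp_all add: v_def e_def Ext_simps)
  have fs: "(\<Oplus>\<^bsub>Ext\<^esub>b\<in>B. e (g b)) = e (\<Oplus>b\<in>B. g b)" if "finite B" "g \<in> B \<rightarrow> carrier Q" for B and g :: "(nat \<Rightarrow> complex) \<Rightarrow> _"
    using that
  proof (induction B rule: finite_induct)
    case empty
    then show ?case by (simp add: e_def Ext_simps)
  next
    case (insert b B)
    then have "(\<Oplus>\<^bsub>Ext\<^esub>b\<in>insert b B. e (g b)) = e (g b) \<oplus>\<^bsub>Ext\<^esub> (\<Oplus>\<^bsub>Ext\<^esub>b\<in>B. e (g b))"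
      by (intro Ext.finsum_insert) (auto intro!: eY)
    then show ?case using insert by (simp add: Ext_simps e_def Pi_iff)
  qed
  have sce: "scalar I \<Omega> c \<odot>\<^bsub>Ext\<^esub> e b = e (sv c b)" "scalar I \<Omega> c \<odot>\<^bsub>Ext\<^esub> v = enc \<zero> c" if "b \<in> carrier Q" for b c
  proof -
    have "scalar I \<Omega> c \<odot>\<^bsub>Ext\<^esub> z = enc (sv c (dec z)) (c * z 0)" if "z \<in> carrier Ext" for z
    proof -
      have "sc c [i] = c" using i by simp
      then show ?thesis using that i y(1) unfolding scalar_cls Ext_smult[OF gen_closed(3) that] ext_act_def
        by (simp add: shift_ids Ext_simps)
    qed
    from this[OF eY[OF that]] this[OF vY] show "scalar I \<Omega> c \<odot>\<^bsub>Ext\<^esub> e b = e (sv c b)" "scalar I \<Omega> c \<odot>\<^bsub>Ext\<^esub> v = enc \<zero> c"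
      by (simp_all add: e_def v_def)
  qed
  have inj: "inj_on e C.basis" by (simp add: inj_on_def e_def)
  have vB: "v \<notin> e ` C.basis" by (auto simp: v_def e_def)
  show "\<exists>B. finite B \<and> B \<subseteq> carrier Ext \<and> (\<forall>x\<in>carrier Ext. \<exists>c. x = (\<Oplus>\<^bsub>Ext\<^esub>b\<in>B. scalar I \<Omega> (c b) \<odot>\<^bsub>Ext\<^esub> b))"
  proof (intro exI[of _ "insert v (e ` C.basis)"] conjI ballI)
    show "finite (insert v (e ` C.basis))" using C.basis(1) by simp
    show "insert v (e ` C.basis) \<subseteq> carrier Ext" using vY eY C.basis(2) by auto
    fix x assume x: "x \<in> carrier Ext"
    then obtain c where c: "dec x = C.lin C.basis c" using C.basis(3) by (auto simp: Ext_simps)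
    define c' where "c' z = (if z = v then x 0 else c (dec z))" for z
    have cl: "scalar I \<Omega> (c' z) \<odot>\<^bsub>Ext\<^esub> z \<in> carrier Ext" if z: "z \<in> insert v (e ` C.basis)" for z
    proof (cases "z = v")
      case True
      then show ?thesis using sce(2)[OF M.zero_closed, of "c' z"] by (simp add: Ext_simps)
    next
      case False
      then obtain b where "b \<in> carrier Q" "z = e b" using z C.basis(2) by auto
      then show ?thesis using sce(1)[of b "c' z"] eY by simp
    qed
    have "(\<Oplus>\<^bsub>Ext\<^esub>z\<in>insert v (e ` C.basis). scalar I \<Omega> (c' z) \<odot>\<^bsub>Ext\<^esub> z)
        = scalar I \<Omega> (c' v) \<odot>\<^bsub>Ext\<^esub> v \<oplus>\<^bsub>Ext\<^esub> (\<Oplus>\<^bsub>Ext\<^esub>z\<in>e ` C.basis. scalar I \<Omega> (c' z) \<odot>\<^bsub>Ext\<^esub> z)"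
      using C.basis(1) vB cl by (intro Ext.finsum_insert) auto
    also have "(\<Oplus>\<^bsub>Ext\<^esub>z\<in>e ` C.basis. scalar I \<Omega> (c' z) \<odot>\<^bsub>Ext\<^esub> z) = (\<Oplus>\<^bsub>Ext\<^esub>b\<in>C.basis. scalar I \<Omega> (c' (e b)) \<odot>\<^bsub>Ext\<^esub> e b)"
      using cl inj by (intro Ext.finsum_reindex) auto
    also have "\<dots> = (\<Oplus>\<^bsub>Ext\<^esub>b\<in>C.basis. e (sv (c b) b))"
    proof (rule Ext.finsum_cong')
      fix b assume b: "b \<in> C.basis"
      have "c' (e b) = c b" using b vB by (auto simp: c'_def e_def)
      then show "scalar I \<Omega> (c' (e b)) \<odot>\<^bsub>Ext\<^esub> e b = e (sv (c b) b)" using sce(1) b C.basis(2) by auto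
    qed (use eY C.basis(2) in \<open>auto simp: subset_eq\<close>)
    also have "\<dots> = e (dec x)" unfolding c C.lin_def using C.basis(1,2) by (intro fs) auto
    also have "scalar I \<Omega> (c' v) \<odot>\<^bsub>Ext\<^esub> v = enc \<zero> (x 0)" using sce(2)[OF M.zero_closed] by (simp add: c'_def)
    also have "enc \<zero> (x 0) \<oplus>\<^bsub>Ext\<^esub> e (dec x) = x" using x by (simp add: Ext_simps e_def)
    finally have "x = (\<Oplus>\<^bsub>Ext\<^esub>b\<in>insert v (e ` C.basis). scalar I \<Omega> (c' b) \<odot>\<^bsub>Ext\<^esub> b)" by (rule sym)
    then show "\<exists>c. x = (\<Oplus>\<^bsub>Ext\<^esub>b\<in>insert v (e ` C.basis). scalar I \<Omega> (c b) \<odot>\<^bsub>Ext\<^esub> b)" by (rule exI[of _ c'])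
  qed
qed

text \<open>Exactness in the middle of \<open>Q\<^sub>i \<rightarrow> \<Oplus>\<^sub>k Q\<^sub>k \<rightarrow> Q\<^sub>i\<close>, the sum being over the neighbours of \<open>i\<close>: as \<open>Q\<close> is
  injective, the extension defined by \<open>y\<close> splits, and the new vector goes to a preimage of \<open>y\<close>.\<close>

lemma vertex_complex_exact: assumes "act (Nb i) y = y" shows "\<exists>x\<in>carrier Q. act (ve i) x = x \<and> act (Out i) x = y"
proof -
  have inj: "injective_module I \<Omega> Q" using hull by (simp add: injective_hull_def)
  define f where "f q = enc q 0" for q
  have fh: "f \<in> module_hom \<Lambda> Q Ext"
    unfolding module_hom_def
    by (auto simp: f_def Ext_simps \<Lambda>_carrier Ext_smult smult_act ext_act_old)
  have gh: "(\<lambda>q. q) \<in> module_hom \<Lambda> Q Q" by (auto simp: module_hom_def)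
  have "inj_on f (carrier Q)" by (simp add: inj_on_def f_def)
  then have "\<exists>h\<in>module_hom \<Lambda> Ext Q. \<forall>x\<in>carrier Q. h (f x) = (\<lambda>q. q) x"
    using inj[unfolded injective_module_def, THEN conjunct2, rule_format, OF fh gh] fd Ext_fd by blast
  then obtain h where h: "h \<in> module_hom \<Lambda> Ext Q" "\<forall>x\<in>carrier Q. h (f x) = x" by auto
  define v where "v = enc \<zero> 1"
  have vY: "v \<in> carrier Ext" by (simp add: v_def Ext_simps)
  have ha: "h (ext_act i y g v) = act g (h v)" if "g \<in> carrier P" for g
  proof -
    have "h (cls g \<odot>\<^bsub>Ext\<^esub> v) = cls g \<odot> h v"
      using h(1) vY cls_simps(1)[OF that] unfolding module_hom_def by auto
    then show ?thesis unfolding Ext_smult[OF that vY] smult_act[OF that] .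
  qed
  have hv: "h v \<in> carrier Q" using h(1) vY by (auto simp: module_hom_def)
  have "ext_act i y (ve i) v = v" using i y(1) by (simp add: ext_act_enc v_def shift_ids)
  then have 1: "act (ve i) (h v) = h v" using ha[of "ve i"] i by simp
  have "ext_act i y (Out i) v = f y" using y(1) assms
    by (simp add: ext_act_enc v_def f_def shift_ids)
  then have "act (Out i) (h v) = y" using ha[of "Out i"] h(2) y(1) by simp
  then show ?thesis using 1 hv by blast
qed

end

text \<open>The image of \<open>1\<close> under the embedding of \<open>S\<^sub>j\<close>: the hull is an essential extension.\<close>

lemma socle_vector:
  obtains s0 where "s0 \<in> carrier Q" "s0 \<noteq> \<zero>" "act (ve j) s0 = s0" "act (Out j) s0 = \<zero>"
    "\<And>H. sm H \<Longrightarrow> H \<noteq> {\<zero>} \<Longrightarrow> s0 \<in> H"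
proof -
  obtain \<iota> where \<iota>: "\<iota> \<in> module_hom \<Lambda> (simple_at j) Q" "inj_on \<iota> (carrier (simple_at j))"
    "\<And>H. sm H \<Longrightarrow> H \<noteq> {\<zero>} \<Longrightarrow> H \<inter> \<iota> ` carrier (simple_at j) \<noteq> {\<zero>}"
    using hull unfolding injective_hull_def by blast
  have car: "carrier (simple_at j) = UNIV" by (simp add: simple_at_def)
  have sm_s: "cls f \<odot>\<^bsub>simple_at j\<^esub> z = f [j] * z" if f: "f \<in> carrier P" for f z
  proof -
    obtain h where h: "h \<in> J" "(SOME g. g \<in> cls f) = h \<oplus>\<^bsub>P\<^esub> f" using cls_some[OF f] by blast
    then show ?thesis using J_const[OF h(1), of j] by (simp add: simple_at_def P_simps(5))
  qed
  have ia: "\<iota> (f [j] * z) = act f (\<iota> z)" if f: "f \<in> carrier P" for f z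
  proof -
    have "\<iota> (cls f \<odot>\<^bsub>simple_at j\<^esub> z) = cls f \<odot> \<iota> z"
      using \<iota>(1) cls_simps(1)[OF f] car unfolding module_hom_def by auto
    then show ?thesis unfolding sm_s[OF f] smult_act[OF f] .
  qed
  define s0 where "s0 = \<iota> 1"
  have iQ: "\<iota> z \<in> carrier Q" for z using \<iota>(1) car by (auto simp: module_hom_def)
  have "\<iota> 0 = \<iota> (\<zero>\<^bsub>P\<^esub> [j] * 1)" by (simp add: P_simps(4))
  also have "\<dots> = \<zero>" unfolding ia[OF P.zero_closed] by (rule act_zero[OF iQ])
  finally have i0: "\<iota> 0 = \<zero>" .
  have ic: "\<iota> c = sv c s0" for c using ia[of "sc c" 1] j by (simp add: s0_def)
  show thesis
  proof (rule that[of s0])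
    show s0Q: "s0 \<in> carrier Q" by (simp add: s0_def iQ)
    show "s0 \<noteq> \<zero>" using \<iota>(2) i0 car inj_onD[of \<iota> UNIV 1 0] by (auto simp: s0_def)
    show "act (ve j) s0 = s0" using ia[of "ve j" 1] j by (simp add: s0_def)
    show "act (Out j) s0 = \<zero>" using ia[of "Out j" 1] i0 by (simp add: s0_def)
    fix H assume H: "sm H" "H \<noteq> {\<zero>}"
    have "H \<inter> range \<iota> \<noteq> {\<zero>}" using \<iota>(3)[OF H] car by simp
    moreover have "\<zero> \<in> H \<inter> range \<iota>" using smD(2)[OF H(1)] i0 by (metis IntI rangeI)
    ultimately obtain c where c: "\<iota> c \<in> H" "\<iota> c \<noteq> \<zero>" by blast
    have cn: "c \<noteq> 0" using c(2) i0 by auto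
    have "sv (1 / c) (\<iota> c) \<in> H" by (rule smD(4)[OF H(1) _ c(1)]) simp
    then show "s0 \<in> H" unfolding ic unscale[OF s0Q cn] .
  qed
qed

text \<open>Any such vector spans a submodule, which contains the socle vector.\<close>

lemma socle_dim:
  assumes "i \<in> I"
  shows "C.cdim {x \<in> carrier Q. act (ve i) x = x \<and> act (Out i) x = \<zero>} = (if i = j then 1 else 0)"
proof -
  obtain s0 where s0: "s0 \<in> carrier Q" "s0 \<noteq> \<zero>" "act (ve j) s0 = s0" "act (Out j) s0 = \<zero>"
    "\<And>H. sm H \<Longrightarrow> H \<noteq> {\<zero>} \<Longrightarrow> s0 \<in> H" using socle_vector by metis
  have main: "i = j \<and> x \<in> {sv c s0 | c. True}"
    if x: "x \<in> carrier Q" "act (ve i) x = x" "act (Out i) x = \<zero>" "x \<noteq> \<zero>" for x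
  proof -
    have "x \<in> {sv c x | c. True}" by (rule in_line(2)[OF x(1)])
    then have "{sv c x | c. True} \<noteq> {\<zero>}" using x(4) by blast
    then obtain c where c: "s0 = sv c x" using s0(5)[OF line_sm[OF x(1-3) assms]] by auto
    have cn: "c \<noteq> 0" using c s0(2) x(1) C.s_zero_left by auto
    have "x = sv (1 / c) s0" unfolding c by (rule unscale[OF x(1) cn, symmetric])
    moreover have "i = j"
    proof (rule ccontr)
      assume "i \<noteq> j"
      have "s0 = sv c (act (ve j) x)" using c s0(3) x(1) j by (simp add: sv_commute[of "ve j"])
      also have "act (ve j) x = \<zero>" using ve_ve[OF assms j x(1)] x(2) \<open>i \<noteq> j\<close> by simp
      finally show False using s0(2) by simp
    qed
    ultimately show ?thesis by blast
  qed
  show ?thesis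
  proof (cases "i = j")
    case True
    have "sv c s0 \<in> carrier Q \<and> act (ve i) (sv c s0) = sv c s0 \<and> act (Out i) (sv c s0) = \<zero>" for c
      using s0 True assms by (simp add: sv_commute[of "ve j"] sv_commute[of "Out j"])
    moreover have "\<zero> \<in> {sv c s0 | c. True}" by (rule in_line(1)[OF s0(1)])
    ultimately have "{x \<in> carrier Q. act (ve i) x = x \<and> act (Out i) x = \<zero>} = {sv c s0 | c. True}"
      using main by blast
    then show ?thesis using C.cdim_line(2)[OF s0(1,2)] True by simp
  next
    case False
    then have "{x \<in> carrier Q. act (ve i) x = x \<and> act (Out i) x = \<zero>} = {\<zero>}" using main assms by auto
    then show ?thesis using C.cdim_zero False by simp
  qed
qed

text \<open>At the vertex \<open>i\<close> the module \<open>\<sigma> i Z\<close> is the preimage of \<open>Z\<close> under \<open>Out i\<close>. The kernel of \<open>Out i\<close> is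
  the socle, of dimension \<open>\<delta>\<^sub>i\<^sub>j\<close>, and by exactness its image is the kernel of \<open>In i\<close> on the components of
  \<open>Z\<close> at the neighbours; the image of \<open>In i\<close> on these is the component of \<open>\<rho> i Z\<close> at \<open>i\<close>.\<close>

lemma dimension_identity:
  assumes Z: "sm Z" and i: "i \<in> I"
  shows "dimvec (\<sigma> i Z) i + dimvec (\<rho> i Z) i = (if i = j then 1 else 0) + (\<Sum>k\<in>nb i. dimvec Z k)"
proof -
  note z = smD[OF Z]
  have sZ: "sm (\<sigma> i Z)" by (rule satur_sm[OF Z])
  define A where "A = act (ve i) ` \<sigma> i Z"
  define B where "B = act (Nb i) ` Z"
  have cA: "C.csub A" unfolding A_def by (rule image_csub[OF sm_csub[OF sZ]]) (use i in simp)
  have cB: "C.csub B" unfolding B_def by (rule image_csub[OF sm_csub[OF Z]]) simp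
  have A: "x \<in> A \<longleftrightarrow> x \<in> \<sigma> i Z \<and> act (ve i) x = x" for x
  proof
    assume "x \<in> A"
    then obtain y where y: "y \<in> \<sigma> i Z" "x = act (ve i) y" by (auto simp: A_def)
    then show "x \<in> \<sigma> i Z \<and> act (ve i) x = x" using smD(4,5)[OF sZ] i by (simp add: ve_ve)
  qed (metis A_def imageI)
  have BZ: "B \<subseteq> Z" unfolding B_def using z(4) by auto
  have out: "act (Out i) ` A = {z \<in> B. act (In i) z = \<zero>}"
  proof (intro equalityI subsetI)
    fix w assume "w \<in> act (Out i) ` A"
    then obtain x where x: "x \<in> \<sigma> i Z" "w = act (Out i) x" using A by auto
    have xQ: "x \<in> carrier Q" using x(1) smD(5)[OF sZ] by blast
    have "w \<in> Z" using Out_in_of_\<sigma>[OF Z x(1)] x(2) by simp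
    moreover have "act (Nb i) w = w" using Nb_Out[OF xQ] x(2) by simp
    ultimately have "w \<in> B" unfolding B_def by (metis imageI)
    then show "w \<in> {z \<in> B. act (In i) z = \<zero>}" using In_Out[OF i xQ] x(2) by simp
  next
    fix w assume w: "w \<in> {z \<in> B. act (In i) z = \<zero>}"
    have wQ: "w \<in> carrier Q" "w \<in> Z" using w BZ z(5) by auto
    have "act (Nb i) w = w" using w z(5) by (auto simp: B_def Nb_Nb)
    then obtain x where x: "x \<in> carrier Q" "act (ve i) x = x" "act (Out i) x = w"
      using vertex_complex_exact[OF i wQ(1)] w by auto
    then have "x \<in> A" using mem_\<sigma>[OF Z x(1,2) _ i] wQ(2) A by simp
    then show "w \<in> act (Out i) ` A" using x(3) by blast
  qed
  have ker: "{x \<in> A. act (Out i) x = \<zero>} = {x \<in> carrier Q. act (ve i) x = x \<and> act (Out i) x = \<zero>}"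
    using A smD(5)[OF sZ] mem_\<sigma>[OF Z _ _ _ i] z(2) by auto
  have "C.cdim A = C.cdim {z \<in> B. act (In i) z = \<zero>} + (if i = j then 1 else 0)"
    using cdim_act[OF cA, of "Out i"] out ker socle_dim[OF i] by simp
  moreover have "C.cdim B = C.cdim (act (In i) ` B) + C.cdim {z \<in> B. act (In i) z = \<zero>}"
    using cdim_act[OF cB, of "In i"] by simp
  moreover have "act (In i) ` B = act (ve i) ` \<rho> i Z"
    unfolding \<rho>_at[OF Z i] B_def image_image using In_Nb z(5) by (auto cong: image_cong)
  ultimately have "int (C.cdim A) + int (C.cdim (act (ve i) ` \<rho> i Z)) = (if i = j then 1 else 0) + int (C.cdim B)"
    by simp
  then show ?thesis using cdim_Nb[OF Z, of i] i by (simp add: dimvec_def A_def B_def)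
qed

end

context lam_mod begin

lemma \<rho>_mono: "Y \<subseteq> Z \<Longrightarrow> \<rho> i Y \<subseteq> \<rho> i Z"
  by (auto simp: \<rho>_def)

lemma \<sigma>_mono: "Y \<subseteq> Z \<Longrightarrow> \<sigma> i Y \<subseteq> \<sigma> i Z"
  by (rule satur_mono)

lemma csub_sum_least:
  assumes "C.csub X" "A \<subseteq> X" "B \<subseteq> X" shows "set_add M A B \<subseteq> X"
proof
  fix x assume "x \<in> set_add M A B"
  then obtain a b where "a \<in> A" "b \<in> B" "x = a \<oplus> b" by (auto simp: set_add_def')
  then show "x \<in> X" using assms by (simp add: C.csub_def subset_eq)
qed

lemma comp_csub: "sm Z \<Longrightarrow> i \<in> I \<Longrightarrow> C.csub (act (ve i) ` Z)"
  by (rule image_csub[OF sm_csub]) simp_all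

end

section \<open>Dimension vectors along a reduced word\<close>

context inj_hull begin

text \<open>The quotient \<open>Y/Z\<close> has a submodule isomorphic to some \<open>S\<^sub>i\<close>. Otherwise take a minimal \<open>Y'\<close> above \<open>Z\<close>.
  It meets \<open>\<sigma> i Z\<close> only in \<open>Z\<close>, and by adjointness \<open>\<rho> i Y'\<close> and \<open>Z\<close> span \<open>Y'\<close>, for all \<open>i\<close>. Then the dimension
  identities for \<open>Z\<close> and \<open>Y'\<close> show that the dimension vector \<open>d \<ge> 0\<close> of \<open>Y'/Z\<close> has no positive coroot value,
  which is impossible for a Dynkin diagram unless \<open>d = 0\<close>.\<close>

lemma socle_step:
  assumes Z: "sm Z" and Y: "sm Y" and ZY: "Z \<subset> Y"
  shows "\<exists>i\<in>I. \<exists>y\<in>Y \<inter> \<sigma> i Z. y \<notin> Z"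
proof (rule ccontr)
  assume c: "\<not> ?thesis"
  obtain Y' where Y': "sm Y'" "Z \<subset> Y'" "Y' \<subseteq> Y"
    and min: "\<And>X. sm X \<Longrightarrow> Z \<subset> X \<Longrightarrow> X \<subseteq> Y \<Longrightarrow> C.cdim Y' \<le> C.cdim X"
  proof -
    have "\<exists>X. (sm X \<and> Z \<subset> X \<and> X \<subseteq> Y) \<and> (\<forall>X'. sm X' \<and> Z \<subset> X' \<and> X' \<subseteq> Y \<longrightarrow> C.cdim X \<le> C.cdim X')"
      by (rule ex_has_least_nat[of _ Y]) (use Y ZY in blast)
    then show thesis using that by blast
  qed
  have inter: "Y' \<inter> \<sigma> i Z = Z" if "i \<in> I" for i
    using c that Y'(2,3) satur_incl[OF Z, of "{i}"] by blast
  have sum: "set_add Q (\<rho> i Y') Z = Y'" if i: "i \<in> I" for i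
  proof -
    have r: "sm (\<rho> i Y')" by (rule \<rho>_sm[OF Y'(1) i])
    have s: "sm (set_add Q (\<rho> i Y') Z)" by (rule sm_sum[OF r Z])
    have sub: "set_add Q (\<rho> i Y') Z \<subseteq> Y'" using sum_least[OF Y'(1) \<rho>_sub] Y'(2) by blast
    have "\<not> \<rho> i Y' \<subseteq> Z"
      using \<rho>_\<sigma>_adjoint[OF Y'(1) Z i] inter[OF i] Y'(2) by blast
    then have "Z \<subset> set_add Q (\<rho> i Y') Z" using sum_incl[OF r Z] by blast
    from min[OF s this] have "C.cdim Y' \<le> C.cdim (set_add Q (\<rho> i Y') Z)" using sub Y'(3) by blast
    then have "C.cdim (set_add Q (\<rho> i Y') Z) = C.cdim Y'"
      using C.cdim_psub(1)[OF sm_csub[OF s] sm_csub[OF Y'(1)] sub] by simp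
    then show ?thesis by (rule C.cdim_psub(2)[OF sm_csub[OF s] sm_csub[OF Y'(1)] sub])
  qed
  have ZY': "Z \<subseteq> Y'" using Y'(2) by blast
  define d where "d k = dimvec Y' k - dimvec Z k" for k
  have le: "coroot i d \<le> 0" if i: "i \<in> I" for i
  proof -
    note zs = satur_sm[OF Z, of "{i}"] and ys = satur_sm[OF Y'(1), of "{i}"]
    note zr = \<rho>_sm[OF Z i] and yr = \<rho>_sm[OF Y'(1) i]
    have 1: "dimvec Y' i + dimvec (\<sigma> i Z) i \<le> dimvec (\<sigma> i Y') i + dimvec Z i"
    proof -
      let ?A = "act (ve i) ` \<sigma> i Z" and ?B = "act (ve i) ` Y'"
      have cA: "C.csub ?A" and cB: "C.csub ?B" using comp_csub[OF zs i] comp_csub[OF Y'(1) i] by auto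
      have fixpt: "act (ve i) x = x" if "x \<in> ?A" for x
        using that smD(5)[OF zs] i by (auto simp: ve_ve)
      have "?A \<inter> ?B \<subseteq> act (ve i) ` Z"
      proof
        fix x assume x: "x \<in> ?A \<inter> ?B"
        then have "x \<in> \<sigma> i Z" "x \<in> Y'" using smD(4)[OF zs, of "ve i"] smD(4)[OF Y'(1), of "ve i"] i by auto
        then have "x \<in> Z" using inter[OF i] by blast
        then show "x \<in> act (ve i) ` Z" using fixpt[of x] x by (metis IntD1 imageI)
      qed
      then have "C.cdim (?A \<inter> ?B) \<le> C.cdim (act (ve i) ` Z)"
        by (rule C.cdim_psub(1)[OF C.csub_Int[OF cA cB] comp_csub[OF Z i]])
      moreover have "C.cdim (set_add Q ?A ?B) \<le> C.cdim (act (ve i) ` \<sigma> i Y')"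
      proof (rule C.cdim_psub(1)[OF C.csub_sum[OF cA cB] comp_csub[OF ys i]])
        have "?A \<subseteq> act (ve i) ` \<sigma> i Y'" "?B \<subseteq> act (ve i) ` \<sigma> i Y'"
          by (rule image_mono[OF \<sigma>_mono[OF ZY']], rule image_mono[OF satur_incl[OF Y'(1)]])
        then show "set_add Q ?A ?B \<subseteq> act (ve i) ` \<sigma> i Y'"
          by (rule csub_sum_least[OF comp_csub[OF ys i]])
      qed
      ultimately show ?thesis using C.cdim_sum_Int[OF cA cB] i by (simp add: dimvec_def)
    qed
    have 2: "dimvec Y' i + dimvec (\<rho> i Z) i \<le> dimvec (\<rho> i Y') i + dimvec Z i"
    proof -
      let ?A = "act (ve i) ` \<rho> i Y'" and ?B = "act (ve i) ` Z"
      have cA: "C.csub ?A" and cB: "C.csub ?B" using comp_csub[OF yr i] comp_csub[OF Z i] by auto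
      have "act (ve i) ` \<rho> i Z \<subseteq> ?A \<inter> ?B" using \<rho>_mono[OF ZY'] \<rho>_sub by blast
      then have "C.cdim (act (ve i) ` \<rho> i Z) \<le> C.cdim (?A \<inter> ?B)"
        by (rule C.cdim_psub(1)[OF comp_csub[OF zr i] C.csub_Int[OF cA cB]])
      moreover have "act (ve i) ` Y' \<subseteq> set_add Q ?A ?B"
      proof
        fix x assume "x \<in> act (ve i) ` Y'"
        then obtain y where y: "y \<in> Y'" "x = act (ve i) y" by auto
        then have "y \<in> set_add Q (\<rho> i Y') Z" using sum[OF i] by simp
        then obtain a b where ab: "a \<in> \<rho> i Y'" "b \<in> Z" "y = a \<oplus> b"
          by (auto simp: set_add_def')
        then have "x = act (ve i) a \<oplus> act (ve i) b"
          using y smD(5)[OF yr] smD(5)[OF Z] i by (simp add: act_add)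
        then show "x \<in> set_add Q ?A ?B" using ab unfolding set_add_def' by blast
      qed
      then have "C.cdim (act (ve i) ` Y') \<le> C.cdim (set_add Q ?A ?B)"
        by (rule C.cdim_psub(1)[OF comp_csub[OF Y'(1) i] C.csub_sum[OF cA cB]])
      ultimately show ?thesis using C.cdim_sum_Int[OF cA cB] i by (simp add: dimvec_def)
    qed
    have "coroot i d = 2 * dimvec Y' i - 2 * dimvec Z i - ((\<Sum>k\<in>nb i. dimvec Y' k) - (\<Sum>k\<in>nb i. dimvec Z k))"
      by (simp add: coroot_def d_def sum_subtractf)
    then show ?thesis using 1 2 dimension_identity[OF Z i] dimension_identity[OF Y'(1) i] by simp
  qed
  obtain x where x: "\<forall>i\<in>I. 0 < x i" "\<forall>i\<in>I. 0 < coroot i x" using dynkin_graph(2)[OF dynkin] by blast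
  have "d i = 0" if "i \<in> I" for i
    by (rule form_nonneg_eq_0[of x d]) (use x le dimvec_mono[OF Z Y'(1) ZY'] that in \<open>auto simp: d_def\<close>)
  then have "Z = Y'" using dimvec_eq[OF Z Y'(1) ZY'] by (simp add: d_def)
  then show False using Y'(2) by simp
qed

text \<open>By \<open>socle_step\<close> a proper submodule would still be enlarged by some \<open>\<sigma> i\<close>, but \<open>i u\<close> is not reduced.\<close>

lemma sig_full:
  assumes "red u" "\<And>i. i \<in> I \<Longrightarrow> \<not> red (i # u)" shows "sig u {\<zero>} = carrier Q"
proof (rule ccontr)
  assume "sig u {\<zero>} \<noteq> carrier Q"
  then have "sig u {\<zero>} \<subset> carrier Q" using smD(1)[OF sig_sm[OF sm_zero]] by blast
  from socle_step[OF sig_sm[OF sm_zero] sm_carrier this] show False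
    using sig_descent[OF sm_zero assms(1) _ assms(2)] by blast
qed

text \<open>Going along the word, \<open>S\<close> decreases from \<open>Q\<close> to \<open>0\<close> by undoing \<open>\<sigma>\<close>, and \<open>R\<close> decreases by applying \<open>\<rho>\<close>;
  by adjointness \<open>R \<subseteq> S\<close>, so \<open>R\<close> ends in \<open>0\<close> as well. The dimension identity shows that each step
  is a reflection, up to \<open>\<delta>\<close> and an error: for \<open>S\<close> the error \<open>e \<ge> 0\<close> increases the upper term, for \<open>R\<close>
  the error \<open>e' \<ge> 0\<close> decreases it. In the difference of the two dimension vectors, which is \<open>0\<close> at both
  ends, the terms \<open>\<delta>\<close> cancel and the errors add up, so rigidity makes them vanish.\<close>

lemma dimvec_maximal_word:
  assumes red: "red ws" and full: "sig ws {\<zero>} = carrier Q" and m: "m \<le> length ws"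
  shows "dimvec (sig (drop m ws) {\<zero>}) = weight_drop j (drop m ws)"
proof -
  define n where "n = length ws"
  define S where "S m = sig (drop m ws) {\<zero>}" for m
  define R where "R m = foldl (\<lambda>Y i. \<rho> i Y) (carrier Q) (take m ws)" for m
  have wI: "ws ! m \<in> I" if "m < n" for m using red that by (auto simp: n_def intro: red_letters)
  have S: "sm (S m)" for m unfolding S_def by (rule sig_sm[OF sm_zero])
  have S_Suc: "S m = \<sigma> (ws ! m) (S (Suc m))" if "m < n" for m
    using Cons_nth_drop_Suc[of m ws] that unfolding S_def n_def by (metis sig_simps(2))
  have R_Suc: "R (Suc m) = \<rho> (ws ! m) (R m)" if "m < n" for m
    using that unfolding R_def n_def by (simp add: take_Suc_conv_app_nth)
  have R: "m \<le> n \<Longrightarrow> sm (R m)" for m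
  proof (induction m)
    case 0
    then show ?case by (simp add: R_def sm_carrier)
  next
    case (Suc m)
    then show ?case using R_Suc[of m] \<rho>_sm[of "R m" "ws ! m"] wI[of m] by simp
  qed
  have RS: "m \<le> n \<Longrightarrow> R m \<subseteq> S m" for m
  proof (induction m)
    case 0
    then show ?case using full by (simp add: R_def S_def)
  next
    case (Suc m)
    then show ?case using \<rho>_\<sigma>_adjoint[OF R[of m] S[of "Suc m"] wI[of m]] R_Suc[of m] S_Suc[of m] by simp
  qed
  have Sn: "S n = {\<zero>}" by (simp add: S_def n_def)
  have Rn: "R n = {\<zero>}" using RS[of n] smD(2)[OF R[of n]] Sn by auto
  define z where "z m = dimvec (S m)" for m
  define y where "y m = dimvec (R m)" for m
  define e where "e m = z (Suc m) (ws ! m) - dimvec (\<rho> (ws ! m) (S (Suc m))) (ws ! m)" for m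
  define e' where "e' m = dimvec (\<sigma> (ws ! m) (R m)) (ws ! m) - y m (ws ! m)" for m
  define \<delta> where "\<delta> m = (if ws ! m = j then 1 else 0 :: int)" for m
  have z_step: "z m = s (ws ! m) (z (Suc m)) + (\<lambda>k. (\<delta> m + e m) * \<alpha> (ws ! m) k)" if "m < n" for m
  proof (rule ext)
    fix k
    show "z m k = (s (ws ! m) (z (Suc m)) + (\<lambda>k. (\<delta> m + e m) * \<alpha> (ws ! m) k)) k"
      using dimension_identity[of "S (Suc m)" "ws ! m", OF S wI[OF that]]
        dimvec_off(1)[of "S (Suc m)" "ws ! m" k, OF S wI[OF that]] S_Suc[OF that]
      by (cases "k = ws ! m") (simp_all add: z_def e_def \<delta>_def s_apply coroot_def simple_root_def)
  qed
  have y_step: "y m = s (ws ! m) (y (Suc m)) + (\<lambda>k. (\<delta> m - e' m) * \<alpha> (ws ! m) k)" if mn: "m < n" for m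
  proof (rule ext)
    fix k
    have nbs: "(\<Sum>k\<in>nb (ws ! m). y (Suc m) k) = (\<Sum>k\<in>nb (ws ! m). y m k)"
    proof (rule sum.cong[OF refl])
      fix k assume "k \<in> nb (ws ! m)"
      then have "k \<noteq> ws ! m" by auto
      then show "y (Suc m) k = y m k"
        using dimvec_off(2)[of "R m" "ws ! m" k, OF R wI[OF mn]] R_Suc[OF mn] mn by (simp add: y_def)
    qed
    show "y m k = (s (ws ! m) (y (Suc m)) + (\<lambda>k. (\<delta> m - e' m) * \<alpha> (ws ! m) k)) k"
    proof (cases "k = ws ! m")
      case True
      have "dimvec (\<sigma> (ws ! m) (R m)) (ws ! m) + y (Suc m) (ws ! m) = \<delta> m + (\<Sum>k\<in>nb (ws ! m). y m k)"
        using dimension_identity[of "R m" "ws ! m", OF R wI[OF mn]] mn R_Suc[OF mn] by (simp add: y_def \<delta>_def)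
      then show ?thesis using True nbs by (simp add: s_apply coroot_def simple_root_def e'_def)
    next
      case False
      then show ?thesis using dimvec_off(2)[of "R m" "ws ! m" k, OF R wI[OF mn]] R_Suc[OF mn] mn
        by (simp add: y_def s_apply simple_root_def)
    qed
  qed
  have e: "0 \<le> e m" "0 \<le> e' m" if "m < n" for m
    using dimvec_mono[OF \<rho>_sm[OF S wI[OF that]] S \<rho>_sub, of "Suc m" "ws ! m"]
      dimvec_mono[of "R m" "\<sigma> (ws ! m) (R m)" "ws ! m", OF R satur_sm[OF R] satur_incl[OF R]] that
    by (simp_all add: e_def e'_def z_def y_def)
  have "e m + e' m = 0" if "m < n" for m
  proof (rule reduced_rigidity[OF red, of "\<lambda>m. e m + e' m" "\<lambda>m. z m + - y m"])
    fix m assume "m < length ws"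
    then have mn: "m < n" by (simp add: n_def)
    show "0 \<le> e m + e' m" using e[OF mn] by simp
    show "z m + - y m = s (ws ! m) (z (Suc m) + - y (Suc m)) + (\<lambda>k. (e m + e' m) * \<alpha> (ws ! m) k)"
    proof (rule ext)
      fix k
      have "s (ws ! m) (- y (Suc m)) k = - s (ws ! m) (y (Suc m)) k"
        using wp_uminus[of "[ws ! m]" "y (Suc m)"] by simp
      then show "(z m + - y m) k = (s (ws ! m) (z (Suc m) + - y (Suc m)) + (\<lambda>k. (e m + e' m) * \<alpha> (ws ! m) k)) k"
        unfolding s_add by (subst z_step[OF mn], subst y_step[OF mn]) (simp add: algebra_simps)
    qed
  next
    show "z 0 + - y 0 = 0" using full by (auto simp: z_def y_def S_def R_def fun_eq_iff)
    show "z (length ws) + - y (length ws) = 0" using Sn Rn by (auto simp: z_def y_def n_def fun_eq_iff)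
    show "m < length ws" using that by (simp add: n_def)
  qed
  then have e0: "e m = 0" if "m < n" for m using e[OF that] that by (metis add_nonneg_eq_0_iff)
  have "z m = weight_drop j (drop m ws)" if "m \<le> n" for m
    using that
  proof (induction "n - m" arbitrary: m)
    case 0
    then have "m = n" by simp
    have "dimvec {\<zero>} k = 0" for k
    proof -
      have "act (ve k) ` {\<zero>} = {\<zero>}" if "k \<in> I" using that by simp
      then show ?thesis using C.cdim_zero by (simp add: dimvec_def)
    qed
    then show ?case using \<open>m = n\<close> Sn by (auto simp: z_def n_def fun_eq_iff)
  next
    case (Suc l)
    then have mn: "m < n" by simp
    have ih: "z (Suc m) = weight_drop j (drop (Suc m) ws)" using Suc by simp
    have dr: "drop m ws = ws ! m # drop (Suc m) ws" using mn by (simp add: n_def Cons_nth_drop_Suc)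
    show ?case unfolding dr weight_drop.simps z_step[OF mn] ih[symmetric]
      by (rule ext) (simp add: \<delta>_def e0[OF mn])
  qed
  from this[of m] m show ?thesis by (simp add: z_def S_def n_def)
qed

text \<open>Every reduced word is a suffix of one for the longest element.\<close>

lemma dimvec_sig: assumes "red u" shows "dimvec (sig u {\<zero>}) = weight_drop j u"
proof -
  obtain v where v: "red (v @ u)" "\<And>i. i \<in> I \<Longrightarrow> \<not> red (i # v @ u)"
    using extend_to_maximal[OF bounded assms] by blast
  show ?thesis using dimvec_maximal_word[OF v(1) sig_full[OF v], of "length v"] by simp
qed

text \<open>The dimension vectors differ by the root \<open>v \<alpha>\<^sub>j\<close>.\<close>

lemma sig_grows: assumes "red (v @ [j])" shows "sig v {\<zero>} \<subset> sig (v @ [j]) {\<zero>}"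
proof
  have rv: "red v" using red_appendD(1) assms by blast
  show "sig v {\<zero>} \<subseteq> sig (v @ [j]) {\<zero>}" using sig_mono[of "{\<zero>}" "\<sigma> j {\<zero>}" v] satur_incl[OF sm_zero] by simp
  show "sig v {\<zero>} \<noteq> sig (v @ [j]) {\<zero>}"
  proof
    assume "sig v {\<zero>} = sig (v @ [j]) {\<zero>}"
    then have "weight_drop j v = weight_drop j v + wp v (\<alpha> j)"
      using dimvec_sig[OF rv] dimvec_sig[OF assms] weight_drop_snoc[of j v j] by simp
    then have "wp v (\<alpha> j) = 0" by (metis add_cancel_right_right)
    then show False using wp_inj[of v "\<alpha> j" 0] by simp
  qed
qed

lemma sig_not_full: assumes "red (v @ j # w)" shows "sig v {\<zero>} \<noteq> carrier Q"
proof -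
  have "red (v @ [j])" using red_appendD(1)[of "v @ [j]" w] assms by simp
  from sig_grows[OF this] show ?thesis using smD(1)[OF sig_sm[OF sm_zero]] by blast
qed

lemma sig_strict:
  assumes "red (v @ j # w)" shows "sig v {\<zero>} \<subset> sig (v @ j # w) {\<zero>}"
proof -
  have "red (v @ [j])" using red_appendD(1)[of "v @ [j]" w] assms by simp
  from sig_grows[OF this] have "sig v {\<zero>} \<subset> sig (v @ [j]) {\<zero>}" .
  also have "\<dots> = sig v (\<sigma> j {\<zero>})" by simp
  also have "\<dots> \<subseteq> sig v (\<sigma> j (sig w {\<zero>}))"
    by (rule sig_mono[OF \<sigma>_mono[OF sig_incl[OF sm_zero]]])
  finally show ?thesis by simp
qed

text \<open>If no \<open>\<sigma> i\<close> with \<open>i \<in> K\<close> moves the submodule, then the coefficient of \<open>\<alpha>\<^sub>j\<close> in \<open>v\<^sup>-\<^sup>1 \<alpha>\<^sub>i\<close> is at most \<open>0\<close> for all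
  these \<open>i\<close>: either \<open>v\<^sup>-\<^sup>1 \<alpha>\<^sub>i\<close> is negative, or \<open>i v\<close> is reduced and this coefficient is the difference of two
  equal dimensions. But \<open>\<beta> = v \<alpha>\<^sub>j\<close> is a nonnegative combination of these \<open>\<alpha>\<^sub>i\<close>, and \<open>v\<^sup>-\<^sup>1 \<beta> = \<alpha>\<^sub>j\<close> has
  coefficient \<open>1\<close>.\<close>

lemma parabolic_socle:
  assumes red: "red (v @ [j])" and K: "set (v @ [j]) \<subseteq> K" "K \<subseteq> I"
  shows "\<exists>i\<in>K. \<sigma> i (sig v {\<zero>}) \<noteq> sig v {\<zero>}"
proof (rule ccontr)
  assume c: "\<not> ?thesis"
  have rv: "red v" using red_appendD(1) red by blast
  have vI: "set v \<subseteq> I" using K by auto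
  define \<beta> where "\<beta> = wp v (\<alpha> j)"
  have \<beta>: "0 \<le> \<beta>" unfolding \<beta>_def by (rule red_snoc_pos[OF red])
  have supp: "supp_in K \<beta>" unfolding \<beta>_def by (rule supp_in_wp) (use K in auto)
  then have suppI: "supp_in I \<beta>" using K(2) by (auto simp: supp_in_def)
  have neg: "wp (rev v) (\<alpha> i) j \<le> 0" if i: "i \<in> K" for i
  proof -
    have iI: "i \<in> I" using i K by auto
    show ?thesis
    proof (cases "red (i # v)")
      case False
      then show ?thesis using not_red_Cons_neg[OF rv iI] by (simp add: le_fun_def)
    next
      case True
      have "\<sigma> i (sig v {\<zero>}) = sig v {\<zero>}" using c i by blast
      then have "weight_drop j (i # v) = weight_drop j v" using dimvec_sig[OF True] dimvec_sig[OF rv] by simp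
      then have "weight_drop j (i # v) i = weight_drop j v i" by (rule arg_cong[of _ _ "\<lambda>f. f i"])
      then have "s i (weight_drop j v) i + (if i = j then 1 else 0) = weight_drop j v i"
        by (cases "i = j") simp_all
      then have "coroot i (weight_drop j v) = (if i = j then 1 else 0)" by (simp add: s_apply)
      then show ?thesis using coefficient_weight_drop[OF vI, of "\<alpha> i" j] form_root_left[OF iI]
        by (simp add: simple_root_def)
    qed
  qed
  have "1 = wp (rev v) \<beta> j" by (simp add: \<beta>_def)
  also have "\<dots> = (\<Sum>i\<in>I. \<beta> i * wp (rev v) (\<alpha> i) j)" by (rule wp_expansion[OF suppI])
  also have "\<dots> \<le> 0"
  proof (rule sum_nonpos)
    fix i assume "i \<in> I"
    show "\<beta> i * wp (rev v) (\<alpha> i) j \<le> 0"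
    proof (cases "i \<in> K")
      case True
      then show ?thesis using neg \<beta> by (auto simp: le_fun_def intro: mult_nonneg_nonpos)
    next
      case False
      then show ?thesis using supp by (simp add: supp_in_def)
    qed
  qed
  finally show False by simp
qed

text \<open>As \<open>\<sigma> i\<close> does not change \<open>Q\<close>, the dimension identity for \<open>Q\<close> gives the codimension of \<open>\<rho> i Q\<close>, that
  is, the multiplicity of \<open>S\<^sub>i\<close> in the top of \<open>Q\<close>. It is minus the pairing of \<open>\<alpha>\<^sub>i\<close> with \<open>w\<^sub>0 \<varpi>\<^sub>j\<close>, hence
  minus the coefficient of \<open>\<alpha>\<^sub>j\<close> in \<open>w\<^sub>0\<^sup>-\<^sup>1 \<alpha>\<^sub>i = - \<alpha>\<^bsub>\<pi> i\<^esub>\<close>.\<close>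

lemma top_vertex:
  assumes red: "red ws" and l: "\<And>i. i \<in> I \<Longrightarrow> \<not> red (i # ws)"
    and \<pi>: "\<And>i. i \<in> I \<Longrightarrow> wp (rev ws) (\<alpha> i) = - \<alpha> (\<pi> i)" and i: "i \<in> I"
  shows "\<pi> i \<noteq> j \<Longrightarrow> \<rho> i (carrier Q) = carrier Q"
    and "\<pi> i = j \<Longrightarrow> C.cdim (carrier Q) = C.cdim (\<rho> i (carrier Q)) + 1"
proof -
  let ?Q = "carrier Q"
  have wsI: "set ws \<subseteq> I" using red redD by blast
  have r: "sm (\<rho> i ?Q)" by (rule \<rho>_sm[OF sm_carrier i])
  have q: "dimvec ?Q = weight_drop j ws"
    using dimvec_sig[OF red] sig_full[OF red l] by simp
  have full: "\<sigma> i ?Q = ?Q" using satur_incl[OF sm_carrier, of "{i}"] by (auto simp: satur_def)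
  have "dimvec ?Q i + dimvec (\<rho> i ?Q) i = (if i = j then 1 else 0) + (\<Sum>k\<in>nb i. dimvec ?Q k)"
    using dimension_identity[OF sm_carrier i] full by simp
  then have "dimvec ?Q i - dimvec (\<rho> i ?Q) i = coroot i (dimvec ?Q) - (if i = j then 1 else 0)"
    by (simp add: coroot_def)
  also have "\<dots> = - wp (rev ws) (\<alpha> i) j"
    using coefficient_weight_drop[OF wsI, of "\<alpha> i" j] form_root_left[OF i] q by (simp add: simple_root_def)
  also have "\<dots> = (if \<pi> i = j then 1 else 0)" using \<pi>[OF i] by (simp add: simple_root_def)
  finally have d: "dimvec ?Q i - dimvec (\<rho> i ?Q) i = (if \<pi> i = j then 1 else 0)" .
  show "\<pi> i \<noteq> j \<Longrightarrow> \<rho> i ?Q = ?Q"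
  proof (rule dimvec_eq[OF r sm_carrier \<rho>_sub])
    fix k assume "\<pi> i \<noteq> j" "k \<in> I"
    then show "dimvec (\<rho> i ?Q) k = dimvec ?Q k"
      using d dimvec_off(2)[OF sm_carrier i, of k] by (cases "k = i") auto
  qed
  assume "\<pi> i = j"
  then have d1: "dimvec ?Q i = dimvec (\<rho> i ?Q) i + 1" using d by simp
  have "int (C.cdim ?Q) = dimvec ?Q i + (\<Sum>k\<in>I - {i}. dimvec ?Q k)"
    using cdim_dimvec[OF sm_carrier] finite_I i by (simp add: sum.remove)
  also have "(\<Sum>k\<in>I - {i}. dimvec ?Q k) = (\<Sum>k\<in>I - {i}. dimvec (\<rho> i ?Q) k)"
    using dimvec_off(2)[OF sm_carrier i] by (intro sum.cong) auto
  also have "dimvec ?Q i + (\<Sum>k\<in>I - {i}. dimvec (\<rho> i ?Q) k) = int (C.cdim (\<rho> i ?Q)) + 1"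
    using cdim_dimvec[OF r] finite_I i d1 by (simp add: sum.remove)
  finally show "C.cdim ?Q = C.cdim (\<rho> i ?Q) + 1" by simp
qed

text \<open>A maximal proper submodule \<open>X\<close> has, by \<open>socle_step\<close>, some \<open>\<sigma> k X = Q\<close>, hence contains \<open>\<rho> k Q\<close>. The latter
  is proper only for \<open>k = i\<close>, and then of codimension one, so \<open>X = \<rho> i Q\<close>.\<close>

lemma local_module:
  assumes red: "red ws" and l: "\<And>i. i \<in> I \<Longrightarrow> \<not> red (i # ws)"
    and \<pi>: "\<And>i. i \<in> I \<Longrightarrow> wp (rev ws) (\<alpha> i) = - \<alpha> (\<pi> i)" and inj: "inj_on \<pi> I"
    and i: "i \<in> I" "\<pi> i = j"
  shows "sm Y \<Longrightarrow> Y \<noteq> carrier Q \<Longrightarrow> Y \<subseteq> \<rho> i (carrier Q)"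
    and "\<rho> i (carrier Q) \<noteq> carrier Q"
proof -
  let ?Q = "carrier Q"
  have top1: "\<rho> k ?Q = ?Q" if "k \<in> I" "\<pi> k \<noteq> j" for k
    using top_vertex(1)[OF red l \<pi>] that by blast
  have r: "sm (\<rho> i ?Q)" by (rule \<rho>_sm[OF sm_carrier i(1)])
  have codim: "C.cdim ?Q = C.cdim (\<rho> i ?Q) + 1" using top_vertex(2)[OF red l \<pi>] i by blast
  then show "\<rho> i ?Q \<noteq> ?Q" by auto
  assume Y: "sm Y" "Y \<noteq> ?Q"
  obtain X where X: "sm X" "Y \<subseteq> X" "X \<noteq> ?Q"
    and max: "\<And>X'. sm X' \<Longrightarrow> Y \<subseteq> X' \<Longrightarrow> X' \<noteq> ?Q \<Longrightarrow> C.cdim X' \<le> C.cdim X"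
  proof -
    have "\<exists>X. (sm X \<and> Y \<subseteq> X \<and> X \<noteq> ?Q) \<and> (\<forall>X'. sm X' \<and> Y \<subseteq> X' \<and> X' \<noteq> ?Q \<longrightarrow> C.cdim X' \<le> C.cdim X)"
    proof (rule ex_has_greatest_nat[of "\<lambda>X. sm X \<and> Y \<subseteq> X \<and> X \<noteq> ?Q" Y C.cdim "Suc (C.cdim ?Q)"])
      show "sm Y \<and> Y \<subseteq> Y \<and> Y \<noteq> ?Q" using Y by simp
      show "\<forall>X. sm X \<and> Y \<subseteq> X \<and> X \<noteq> ?Q \<longrightarrow> C.cdim X < Suc (C.cdim ?Q)"
        using C.cdim_psub(1)[OF sm_csub sm_csub[OF sm_carrier]] smD(1) le_imp_less_Suc by blast
    qed
    then show thesis using that by blast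
  qed
  have XQ: "X \<subset> ?Q" using X smD(1) by blast
  obtain k x where k: "k \<in> I" "x \<in> \<sigma> k X" "x \<notin> X" using socle_step[OF X(1) sm_carrier XQ] by blast
  have sk: "sm (\<sigma> k X)" by (rule satur_sm[OF X(1)])
  have "\<sigma> k X = ?Q"
  proof (rule ccontr)
    assume "\<sigma> k X \<noteq> ?Q"
    then have "C.cdim (\<sigma> k X) \<le> C.cdim X" using max[OF sk] X(2) satur_incl[OF X(1), of "{k}"] by blast
    then have "X = \<sigma> k X"
      using C.cdim_psub[OF sm_csub[OF X(1)] sm_csub[OF sk] satur_incl[OF X(1)]] by simp
    then show False using k by simp
  qed
  then have rX: "\<rho> k ?Q \<subseteq> X" using \<rho>_\<sigma>_adjoint[OF sm_carrier X(1) k(1)] by simp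
  have "\<pi> k = j" using top1[OF k(1)] rX XQ by auto
  then have ki: "k = i" using inj_onD[OF inj, of k i] k(1) i by simp
  have "C.cdim X \<noteq> C.cdim ?Q" using C.cdim_psub(2)[OF sm_csub[OF X(1)] sm_csub[OF sm_carrier]] XQ by blast
  moreover have "C.cdim X \<le> C.cdim ?Q" using C.cdim_psub(1)[OF sm_csub[OF X(1)] sm_csub[OF sm_carrier]] XQ by blast
  moreover have "C.cdim (\<rho> i ?Q) \<le> C.cdim X"
    using C.cdim_psub(1)[OF sm_csub[OF r] sm_csub[OF X(1)]] rX ki by blast
  ultimately have "C.cdim (\<rho> i ?Q) = C.cdim X" using codim by simp
  then have "\<rho> i ?Q = X" using C.cdim_psub(2)[OF sm_csub[OF r] sm_csub[OF X(1)]] rX ki by blast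
  then show "Y \<subseteq> \<rho> i ?Q" using X(2) by simp
qed

end

section \<open>Submodules as modules, and homomorphisms\<close>

context cspace begin

lemma coord_finsum:
  "finite B \<Longrightarrow> B \<subseteq> carrier M \<Longrightarrow> coord (\<Oplus>b\<in>B. s (c b) b) = (\<Sum>b\<in>B. fscale (c b) (coord b))"
proof (induction B rule: finite_induct)
  case empty
  then show ?case by (simp add: coord_zero)
next
  case (insert b B)
  have cl: "(\<lambda>b. s (c b) b) \<in> B \<rightarrow> carrier M" "s (c b) b \<in> carrier M" "b \<in> carrier M" using insert by auto
  have "coord (\<Oplus>b\<in>insert b B. s (c b) b) = coord (s (c b) b \<oplus> (\<Oplus>b\<in>B. s (c b) b))"
    using insert cl by simp
  also have "\<dots> = coord (s (c b) b) + coord (\<Oplus>b\<in>B. s (c b) b)"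
    using cl by (intro coord_add finsum_closed)
  also have "\<dots> = fscale (c b) (coord b) + (\<Sum>b\<in>B. fscale (c b) (coord b))"
    using insert.IH insert.prems cl(3) coord_scale by simp
  also have "\<dots> = (\<Sum>b\<in>insert b B. fscale (c b) (coord b))" using insert.hyps by (rule sum.insert[symmetric])
  finally show ?case .
qed

lemma csub_finite_span:
  assumes H: "csub H"
  shows "\<exists>B. finite B \<and> B \<subseteq> H \<and> (\<forall>x\<in>H. \<exists>c. x = (\<Oplus>b\<in>B. s (c b) b))"
proof -
  obtain B' where B': "B' \<subseteq> coord ` H" "finite B'" "V.span B' = coord ` H"
    using V.subspace_basis_finite[OF coord_subspace[OF H]] by metis
  have HM: "H \<subseteq> carrier M" using H by (simp add: csub_def)
  define B where "B = {x \<in> H. coord x \<in> B'}"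
  have inj: "inj_on coord B" using coord_inj HM by (auto simp: B_def intro: inj_on_subset)
  have img: "coord ` B = B'" using B'(1) by (auto simp: B_def)
  have fB: "finite B" using B'(2) inj img finite_imageD by blast
  have BM: "B \<subseteq> carrier M" using HM by (auto simp: B_def)
  have "\<exists>c. x = (\<Oplus>b\<in>B. s (c b) b)" if x: "x \<in> H" for x
  proof -
    have "coord x \<in> V.span B'" using x B'(3) by blast
    then obtain u where "coord x = (\<Sum>v\<in>B'. fscale (u v) v)" using V.span_finite[OF B'(2)] by auto
    also have "\<dots> = (\<Sum>b\<in>B. fscale (u (coord b)) (coord b))"
      unfolding img[symmetric] by (rule sum.reindex_cong[OF inj refl refl])
    also have "\<dots> = coord (\<Oplus>b\<in>B. s (u (coord b)) b)" by (rule coord_finsum[OF fB BM, symmetric])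
    finally have "x = (\<Oplus>b\<in>B. s (u (coord b)) b)"
      using x HM BM by (intro inj_onD[OF coord_inj]) (auto intro!: finsum_closed)
    then show ?thesis by (rule exI[of _ "\<lambda>b. u (coord b)"])
  qed
  then show ?thesis using fB B_def by (intro exI[of _ B]) auto
qed

end

context preproj begin

lemma simple_at_smult: assumes f: "f \<in> carrier P" shows "cls f \<odot>\<^bsub>simple_at i\<^esub> z = f [i] * z"
proof -
  obtain h where h: "h \<in> J" "(SOME g. g \<in> cls f) = h \<oplus>\<^bsub>P\<^esub> f" using cls_some[OF f] by blast
  then show ?thesis using J_const[OF h(1), of i] by (simp add: simple_at_def P_simps(5))
qed

end

context lam_mod begin

lemma act_finsum: "f \<in> carrier P \<Longrightarrow> finite A \<Longrightarrow> y \<in> A \<rightarrow> carrier M \<Longrightarrow> act f (\<Oplus>a\<in>A. y a) = (\<Oplus>a\<in>A. act f (y a))"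
proof -
  assume f: "f \<in> carrier P"
  show "finite A \<Longrightarrow> y \<in> A \<rightarrow> carrier M \<Longrightarrow> act f (\<Oplus>a\<in>A. y a) = (\<Oplus>a\<in>A. act f (y a))"
    by (induction A rule: finite_induct) (use f in \<open>auto simp: act_add Pi_iff\<close>)
qed

lemma sub_module: assumes H: "sm H" shows "left_module \<Lambda> (restrict_module M H)"
proof -
  note h = smD[OF H]
  have ag: "abelian_group (restrict_module M H)"
  proof (rule abelian_groupI)
    fix x assume x: "x \<in> carrier (restrict_module M H)"
    then show "\<exists>y\<in>carrier (restrict_module M H). y \<oplus>\<^bsub>restrict_module M H\<^esub> x = \<zero>\<^bsub>restrict_module M H\<^esub>"
      using h(5,6) by (intro bexI[of _ "\<ominus> x"]) (auto simp: M.l_neg)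
  qed (use h(2,3,5) in \<open>auto simp: M.a_ac\<close>)
  show ?thesis
  proof (rule left_module.intro[OF \<Lambda>_ring ag], unfold_locales)
    fix a x assume a: "a \<in> carrier \<Lambda>" "x \<in> carrier (restrict_module M H)"
    then obtain f where "f \<in> carrier P" "a = cls f" by (auto simp: \<Lambda>_carrier)
    then show "a \<odot>\<^bsub>restrict_module M H\<^esub> x \<in> carrier (restrict_module M H)"
      using a h(4) by (simp add: smult_act)
  qed (use h(5) left_module.smult_l_distr[OF lam_left_module] left_module.smult_r_distr[OF lam_left_module]
        left_module.smult_assoc[OF lam_left_module] left_module.smult_one[OF lam_left_module] in auto)
qed

lemma finsum_restrict:
  assumes H: "sm H" shows "finite A \<Longrightarrow> y \<in> A \<rightarrow> H \<Longrightarrow> finsum (restrict_module M H) y A = (\<Oplus>a\<in>A. y a)"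
proof (induction A rule: finite_induct)
  interpret R: abelian_group "restrict_module M H" using sub_module[OF H] by (simp add: left_module_def)
  {
    case empty
    then show ?case by simp
  next
    case (insert a A)
    have "y a \<in> H" "y \<in> A \<rightarrow> H" "y \<in> A \<rightarrow> carrier M" "y a \<in> carrier M"
      using insert.prems smD(5)[OF H] by auto
    then show ?case using insert by (subst R.finsum_insert) auto
  }
qed

lemma sub_fd: assumes H: "sm H" shows "fd_module I \<Omega> (restrict_module M H)"
  unfolding fd_module_def
proof (intro conjI sub_module[OF H])
  obtain B where B: "finite B" "B \<subseteq> H" "\<forall>x\<in>H. \<exists>c. x = (\<Oplus>b\<in>B. sv (c b) b)"
    using C.csub_finite_span[OF sm_csub[OF H]] by blast
  have "finsum (restrict_module M H) (\<lambda>b. scalar I \<Omega> (c b) \<odot>\<^bsub>restrict_module M H\<^esub> b) B = (\<Oplus>b\<in>B. sv (c b) b)" for c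
    using B(1,2) smD(4)[OF H] by (subst finsum_restrict[OF H]) (auto simp: scalar_cls smult_act subset_eq)
  then show "\<exists>B. finite B \<and> B \<subseteq> carrier (restrict_module M H) \<and> (\<forall>x\<in>carrier (restrict_module M H). \<exists>c. x = finsum (restrict_module M H) (\<lambda>b. scalar I \<Omega> (c b) \<odot>\<^bsub>restrict_module M H\<^esub> b) B)"
    using B by (intro exI[of _ B]) simp
qed

lemma sub_lam_mod: assumes "sm H" shows "lam_mod I E \<Omega> (restrict_module M H)"
  by unfold_locales (rule sub_fd[OF assms])

lemma act_restrict: assumes "sm H" shows "lam_mod.act I \<Omega> (restrict_module M H) = act"
  by (intro ext) (simp add: lam_mod.act_def[OF sub_lam_mod[OF assms]] act_def)

lemma sm_restrict: assumes H: "sm H" shows "submodule X \<Lambda> (restrict_module M H) \<longleftrightarrow> sm X \<and> X \<subseteq> H"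
proof -
  interpret R: lam_mod I E \<Omega> "restrict_module M H" by (rule sub_lam_mod[OF H])
  have ra: "R.act = act" by (rule act_restrict[OF H])
  show ?thesis
  proof
    assume X: "submodule X \<Lambda> (restrict_module M H)"
    note x = R.smD[OF X, unfolded ra]
    have XH: "X \<subseteq> H" using x(1) by simp
    have "sm X"
      by (rule smI) (use x(2,3,4) XH smD(1)[OF H] in auto)
    then show "sm X \<and> X \<subseteq> H" using XH by simp
  next
    assume X: "sm X \<and> X \<subseteq> H"
    then have x: "sm X" by simp
    show "submodule X \<Lambda> (restrict_module M H)"
      by (rule R.smI, unfold ra) (use X smD(2,3,4)[OF x] in auto)
  qed
qed

lemma homI:
  fixes N :: "('v preproj, 'n) module"
  assumes N: "lam_mod I E \<Omega> N" and "\<And>x. x \<in> carrier M \<Longrightarrow> h x \<in> carrier N"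
    and "\<And>x y. x \<in> carrier M \<Longrightarrow> y \<in> carrier M \<Longrightarrow> h (x \<oplus> y) = h x \<oplus>\<^bsub>N\<^esub> h y"
    and "\<And>f x. f \<in> carrier P \<Longrightarrow> x \<in> carrier M \<Longrightarrow> h (act f x) = lam_mod.act I \<Omega> N f (h x)"
  shows "h \<in> module_hom \<Lambda> M N"
  unfolding module_hom_def
  using assms(2-4) by (auto simp: \<Lambda>_carrier act_def lam_mod.act_def[OF N])

end

locale lam_hom = M: lam_mod I E \<Omega> M + N: lam_mod I E \<Omega> N
  for I :: "'v set" and E and \<Omega> and M :: "('v preproj, 'm) module" and N :: "('v preproj, 'n) module" +
  fixes h :: "'m \<Rightarrow> 'n"
  assumes hom: "h \<in> module_hom M.\<Lambda> M N"
begin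

lemma h_closed [simp]: "x \<in> carrier M \<Longrightarrow> h x \<in> carrier N"
  using hom by (auto simp: module_hom_def)

lemma h_add: "x \<in> carrier M \<Longrightarrow> y \<in> carrier M \<Longrightarrow> h (x \<oplus>\<^bsub>M\<^esub> y) = h x \<oplus>\<^bsub>N\<^esub> h y"
  using hom by (auto simp: module_hom_def)

lemma h_act: assumes "f \<in> carrier M.P" "x \<in> carrier M" shows "h (M.act f x) = N.act f (h x)"
proof -
  have "h (M.cls f \<odot>\<^bsub>M\<^esub> x) = M.cls f \<odot>\<^bsub>N\<^esub> h x"
    using hom M.cls_simps(1)[OF assms(1)] assms(2) by (auto simp: module_hom_def)
  then show ?thesis by (simp add: M.act_def N.act_def)
qed

lemma h_zero [simp]: "h \<zero>\<^bsub>M\<^esub> = \<zero>\<^bsub>N\<^esub>"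
  using h_act[OF M.P.zero_closed M.M.zero_closed] by simp

lemma h_diff: "x \<in> carrier M \<Longrightarrow> y \<in> carrier M \<Longrightarrow> h (x \<ominus>\<^bsub>M\<^esub> y) = h x \<ominus>\<^bsub>N\<^esub> h y"
  using h_act[of "M.sc (-1)" y] by (simp add: a_minus_def h_add M.minus_sv N.minus_sv)

lemma h_finsum: "finite A \<Longrightarrow> y \<in> A \<rightarrow> carrier M \<Longrightarrow> h (\<Oplus>\<^bsub>M\<^esub>a\<in>A. y a) = (\<Oplus>\<^bsub>N\<^esub>a\<in>A. h (y a))"
  by (induction A rule: finite_induct) (auto simp: h_add Pi_iff)

lemma vimage_sm: assumes "N.sm Z" shows "M.sm {x \<in> carrier M. h x \<in> Z}"
  by (rule M.smI) (use N.smD[OF assms] in \<open>auto simp: h_add h_act\<close>)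

lemma image_sm: assumes "M.sm Y" shows "N.sm (h ` Y)"
proof (rule N.smI)
  note y = M.smD[OF assms]
  show "h ` Y \<subseteq> carrier N" using y(5) by auto
  show "\<zero>\<^bsub>N\<^esub> \<in> h ` Y" using imageI[OF y(2), of h] by simp
next
  note y = M.smD[OF assms]
  fix a b assume "a \<in> h ` Y" "b \<in> h ` Y"
  then obtain u v where uv: "u \<in> Y" "v \<in> Y" "a = h u" "b = h v" by blast
  then have "a \<oplus>\<^bsub>N\<^esub> b = h (u \<oplus>\<^bsub>M\<^esub> v)" using y(5) by (simp add: h_add)
  then show "a \<oplus>\<^bsub>N\<^esub> b \<in> h ` Y" using y(3) uv by simp
next
  note y = M.smD[OF assms]
  fix f a assume f: "f \<in> carrier M.P" and "a \<in> h ` Y"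
  then obtain u where u: "u \<in> Y" "a = h u" by blast
  then have "N.act f a = h (M.act f u)" using y(5) f by (simp add: h_act)
  then show "N.act f a \<in> h ` Y" using y(4)[OF f] u by simp
qed

text \<open>Saturation commutes with preimages, which is why iterated quotients by socles are quotients by
  iterated saturations.\<close>

lemma vimage_satur: "{x \<in> carrier M. h x \<in> N.satur B Z} = M.satur B {x \<in> carrier M. h x \<in> Z}"
  by (auto simp: N.satur_def M.satur_def h_act[symmetric])

lemma inj_ker: assumes "\<And>x. x \<in> carrier M \<Longrightarrow> h x = \<zero>\<^bsub>N\<^esub> \<Longrightarrow> x = \<zero>\<^bsub>M\<^esub>" shows "inj_on h (carrier M)"
proof (rule inj_onI)
  fix x y assume xy: "x \<in> carrier M" "y \<in> carrier M" "h x = h y"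
  have "h (x \<ominus>\<^bsub>M\<^esub> y) = h x \<ominus>\<^bsub>N\<^esub> h y" by (rule h_diff[OF xy(1,2)])
  also have "\<dots> = \<zero>\<^bsub>N\<^esub>" unfolding xy(3) using h_closed[OF xy(2)] by (simp add: a_minus_def N.M.r_neg)
  finally have "h (x \<ominus>\<^bsub>M\<^esub> y) = \<zero>\<^bsub>N\<^esub>" .
  then have "x \<ominus>\<^bsub>M\<^esub> y = \<zero>\<^bsub>M\<^esub>" using assms[of "x \<ominus>\<^bsub>M\<^esub> y"] xy by simp
  then have "x \<oplus>\<^bsub>M\<^esub> \<ominus>\<^bsub>M\<^esub> y = \<zero>\<^bsub>M\<^esub>" by (simp add: a_minus_def)
  then have "\<ominus>\<^bsub>M\<^esub> (\<ominus>\<^bsub>M\<^esub> y) = x" using xy by (intro M.M.minus_equality) auto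
  then show "x = y" using xy by simp
qed

lemma rank: assumes "M.sm Y" shows "M.C.cdim Y = N.C.cdim (h ` Y) + M.C.cdim {x \<in> Y. h x = \<zero>\<^bsub>N\<^esub>}"
  by (rule cdim_rank_nullity[OF M.C.cspace_axioms N.C.cspace_axioms M.sm_csub[OF assms]])
    (use M.smD(5)[OF assms] in \<open>auto simp: h_add h_act\<close>)

lemma ker_sm: "M.sm {x \<in> carrier M. h x = \<zero>\<^bsub>N\<^esub>}"
  using vimage_sm[OF N.sm_zero] by simp

end

context lam_mod begin

lemma endo: "h \<in> module_hom \<Lambda> M M \<Longrightarrow> lam_hom I E \<Omega> M M h"
  by unfold_locales

lemma hom_lam_hom: "lam_mod I E \<Omega> N \<Longrightarrow> h \<in> module_hom \<Lambda> M N \<Longrightarrow> lam_hom I E \<Omega> M N h"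
  by (intro lam_hom.intro lam_mod_axioms lam_hom_axioms.intro)

lemma inj_endo_bij:
  assumes h: "h \<in> module_hom \<Lambda> M M" and inj: "\<And>x. x \<in> carrier M \<Longrightarrow> h x = \<zero> \<Longrightarrow> x = \<zero>"
  shows "bij_betw h (carrier M) (carrier M)"
proof -
  interpret h: lam_hom I E \<Omega> M M h by (rule endo[OF h])
  have "{x \<in> carrier M. h x = \<zero>} = {\<zero>}" using inj by auto
  then have "C.cdim (carrier M) = C.cdim (h ` carrier M)"
    using h.rank[OF sm_carrier] C.cdim_zero by simp
  moreover have "h ` carrier M \<subseteq> carrier M" using h.h_closed by blast
  ultimately have "h ` carrier M = carrier M"
    using C.cdim_psub(2)[OF sm_csub[OF h.image_sm[OF sm_carrier]] sm_csub[OF sm_carrier]] by simp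
  then show ?thesis using h.inj_ker[OF inj] by (simp add: bij_betw_def)
qed

lemma pow_endo: assumes h: "h \<in> module_hom \<Lambda> M M" shows "(h ^^ n) \<in> module_hom \<Lambda> M M"
proof (induction n)
  case 0
  then show ?case by (auto simp: module_hom_def)
next
  case (Suc n)
  then show ?case using h left_module.smult_closed[OF lam_left_module] unfolding module_hom_def by (auto simp: Pi_iff)
qed

text \<open>Fitting's lemma: for large \<open>n\<close> the module is the direct sum of the kernel and the image of \<open>h ^^ n\<close>.\<close>

lemma fitting:
  assumes ind: "indecomposable \<Lambda> M" and h: "h \<in> module_hom \<Lambda> M M"
    and nb: "\<not> bij_betw h (carrier M) (carrier M)"
  shows "\<exists>n. \<forall>x\<in>carrier M. (h ^^ n) x = \<zero>"
proof -
  define K where "K n = {x \<in> carrier M. (h ^^ n) x = \<zero>}" for n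
  define R where "R n = (h ^^ n) ` carrier M" for n
  have lh: "lam_hom I E \<Omega> M M (h ^^ n)" for n by (rule endo[OF pow_endo[OF h]])
  interpret h: lam_hom I E \<Omega> M M h by (rule endo[OF h])
  have hc: "(h ^^ n) x \<in> carrier M" if "x \<in> carrier M" for n x using lam_hom.h_closed[OF lh that] .
  have K: "sm (K n)" for n unfolding K_def by (rule lam_hom.ker_sm[OF lh])
  have R: "sm (R n)" for n unfolding R_def by (rule lam_hom.image_sm[OF lh sm_carrier])
  have dim: "C.cdim (carrier M) = C.cdim (R n) + C.cdim (K n)" for n
    unfolding R_def K_def by (rule lam_hom.rank[OF lh sm_carrier])
  obtain m where m: "\<And>k. C.cdim (R m) \<le> C.cdim (R k)"
    using ex_has_least_nat[of "\<lambda>_. True" 0 "\<lambda>k. C.cdim (R k)"] by auto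
  have Rdec: "R (k + l) \<subseteq> R k" for k l
    unfolding R_def funpow_add using hc by auto
  \<comment> \<open>The exponent must be positive for \<open>h\<close> to be injective when \<open>h ^^ n\<close> is.\<close>
  define n where "n = Suc m"
  have min: "C.cdim (R n) \<le> C.cdim (R k)" for k
    using m[of k] C.cdim_psub(1)[OF sm_csub[OF R] sm_csub[OF R] Rdec[of m 1]] by (simp add: n_def)
  have RR: "R (n + n) = R n"
    using C.cdim_psub[OF sm_csub[OF R] sm_csub[OF R] Rdec[of n n]] min[of "n + n"] by simp
  have "K n \<subseteq> K (n + n)"
    unfolding K_def funpow_add using lam_hom.h_zero[OF lh] by auto
  moreover have "C.cdim (K n) = C.cdim (K (n + n))" using dim[of n] dim[of "n + n"] RR by simp
  ultimately have KK: "K (n + n) = K n" using C.cdim_psub(2)[OF sm_csub[OF K] sm_csub[OF K]] by blast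
  have "complementary \<Lambda> M (K n) (R n)" unfolding complementary_def
  proof (intro conjI K R)
    show "K n \<inter> R n = {\<zero>}"
    proof
      show "{\<zero>} \<subseteq> K n \<inter> R n" using smD(2)[OF K] smD(2)[OF R] by auto
      show "K n \<inter> R n \<subseteq> {\<zero>}"
      proof
        fix x assume x: "x \<in> K n \<inter> R n"
        then obtain y where y: "y \<in> carrier M" "x = (h ^^ n) y" by (auto simp: R_def)
        then have "y \<in> K (n + n)" using x by (simp add: K_def funpow_add)
        then have "y \<in> K n" using KK by simp
        then show "x \<in> {\<zero>}" using y by (simp add: K_def)
      qed
    qed
    show "set_add M (K n) (R n) = carrier M"
    proof
      show "set_add M (K n) (R n) \<subseteq> carrier M"
        by (rule sum_least[OF sm_carrier smD(1)[OF K] smD(1)[OF R]])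
      show "carrier M \<subseteq> set_add M (K n) (R n)"
      proof
        fix x assume x: "x \<in> carrier M"
        have "(h ^^ n) x \<in> R (n + n)" unfolding RR using x by (simp add: R_def)
        then obtain y where y: "y \<in> carrier M" "(h ^^ n) x = (h ^^ n) ((h ^^ n) y)"
          by (auto simp: R_def funpow_add)
        define z where "z = (h ^^ n) y"
        have z: "z \<in> R n" "z \<in> carrier M" using y hc by (auto simp: R_def z_def)
        have "(h ^^ n) (x \<ominus> z) = \<zero>"
          using lam_hom.h_diff[OF lh x z(2), of n] y(2) hc[OF z(2)] by (simp add: z_def a_minus_def M.r_neg)
        then have "x \<ominus> z \<in> K n" using x z by (simp add: K_def)
        moreover have "x = (x \<ominus> z) \<oplus> z" using x z by (simp add: a_minus_def M.a_assoc M.l_neg)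
        ultimately show "x \<in> set_add M (K n) (R n)" using z(1) unfolding set_add_def' by blast
      qed
    qed
  qed
  then have "K n = {\<zero>} \<or> R n = {\<zero>}" using ind unfolding indecomposable_def by blast
  then show ?thesis
  proof
    assume "R n = {\<zero>}"
    then show ?thesis unfolding R_def by (intro exI[of _ n]) blast
  next
    assume k: "K n = {\<zero>}"
    have "bij_betw h (carrier M) (carrier M)"
    proof (rule inj_endo_bij[OF h])
      fix x assume x: "x \<in> carrier M" "h x = \<zero>"
      have "(h ^^ n) x = (h ^^ m) (h x)" unfolding n_def by (simp add: funpow_swap1)
      then have "x \<in> K n" using x lam_hom.h_zero[OF lh] by (simp add: K_def)
      then show "x = \<zero>" using k by simp
    qed
    then show ?thesis using nb by simp
  qed
qed

text \<open>The endomorphism ring of an indecomposable module is local. By induction it suffices to consider two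
  summands: if \<open>\<phi> a\<close> is not bijective, then \<open>u\<^sup>-\<^sup>1 \<phi> a\<close> is nilpotent by Fitting's lemma, so that \<open>u - \<phi> a\<close> is
  injective.\<close>

lemma bijective_summand:
  assumes ind: "indecomposable \<Lambda> M" and A: "finite A"
  shows "u \<in> module_hom \<Lambda> M M \<Longrightarrow> bij_betw u (carrier M) (carrier M) \<Longrightarrow>
    (\<And>a. a \<in> A \<Longrightarrow> \<phi> a \<in> module_hom \<Lambda> M M) \<Longrightarrow>
    (\<And>x. x \<in> carrier M \<Longrightarrow> u x = (\<Oplus>a\<in>A. \<phi> a x)) \<Longrightarrow>
    \<exists>a\<in>A. bij_betw (\<phi> a) (carrier M) (carrier M)"
  using A
proof (induction A arbitrary: u rule: finite_induct)
  case empty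
  have "x = \<zero>" if x: "x \<in> carrier M" for x
  proof -
    have "u x = u \<zero>" using empty(4)[OF x] empty(4)[OF M.zero_closed] by simp
    then show ?thesis using empty(2) x by (auto simp: bij_betw_def dest: inj_onD)
  qed
  then have "carrier M = {\<zero>}" by auto
  then show ?case using ind by (simp add: indecomposable_def)
next
  case (insert a A)
  show ?case
  proof (cases "bij_betw (\<phi> a) (carrier M) (carrier M)")
    case True
    then show ?thesis by blast
  next
    case False
    interpret u: lam_hom I E \<Omega> M M u by (rule endo[OF insert.prems(1)])
    have pa: "\<phi> a \<in> module_hom \<Lambda> M M" by (rule insert.prems(3)) simp
    interpret p: lam_hom I E \<Omega> M M "\<phi> a" by (rule endo[OF pa])
    define w where "w = the_inv_into (carrier M) u"
    have inj: "inj_on u (carrier M)" and im: "u ` carrier M = carrier M"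
      using insert.prems(2) by (auto simp: bij_betw_def)
    have w1: "w (u x) = x" if "x \<in> carrier M" for x using the_inv_into_f_f[OF inj that] by (simp add: w_def)
    have w2: "u (w x) = x" if "x \<in> carrier M" for x using f_the_inv_into_f[OF inj] that im by (simp add: w_def)
    have wc: "w x \<in> carrier M" if "x \<in> carrier M" for x
      using the_inv_into_into[OF inj, of x "carrier M"] that im by (simp add: w_def)
    define \<psi> where "\<psi> x = w (\<phi> a x)" for x
    have \<psi>: "\<psi> \<in> module_hom \<Lambda> M M"
    proof (rule homI[OF lam_mod_axioms])
      fix x y assume xy: "x \<in> carrier M" "y \<in> carrier M"
      have "u (\<psi> x \<oplus> \<psi> y) = \<phi> a (x \<oplus> y)" using xy wc by (simp add: \<psi>_def u.h_add w2 p.h_add)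
      then show "\<psi> (x \<oplus> y) = \<psi> x \<oplus> \<psi> y" using w1[of "\<psi> x \<oplus> \<psi> y"] xy wc by (simp add: \<psi>_def)
    next
      fix f x assume fx: "f \<in> carrier P" "x \<in> carrier M"
      have "u (act f (\<psi> x)) = \<phi> a (act f x)" using fx wc by (simp add: \<psi>_def u.h_act w2 p.h_act)
      then show "\<psi> (act f x) = act f (\<psi> x)" using w1[of "act f (\<psi> x)"] fx wc by (simp add: \<psi>_def)
    qed (simp add: \<psi>_def wc)
    have "\<not> bij_betw \<psi> (carrier M) (carrier M)"
    proof
      assume b: "bij_betw \<psi> (carrier M) (carrier M)"
      have "bij_betw (u \<circ> \<psi>) (carrier M) (carrier M)" by (rule bij_betw_trans[OF b insert.prems(2)])
      then have "bij_betw (\<phi> a) (carrier M) (carrier M)"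
        by (rule bij_betw_cong[THEN iffD1, rotated]) (simp add: \<psi>_def w2)
      then show False using False by simp
    qed
    then obtain n where n: "\<forall>x\<in>carrier M. (\<psi> ^^ n) x = \<zero>" using fitting[OF ind \<psi>] by blast
    define v where "v x = (\<Oplus>b\<in>A. \<phi> b x)" for x
    have phc: "(\<lambda>b. \<phi> b x) \<in> A \<rightarrow> carrier M" if "x \<in> carrier M" for x
    proof
      fix b assume "b \<in> A"
      then have "\<phi> b \<in> module_hom \<Lambda> M M" using insert.prems(3) by simp
      then show "\<phi> b x \<in> carrier M" using that by (auto simp: module_hom_def)
    qed
    have vc: "v x \<in> carrier M" if "x \<in> carrier M" for x unfolding v_def by (rule M.finsum_closed[OF phc[OF that]])
    have uv: "u x = \<phi> a x \<oplus> v x" if "x \<in> carrier M" for x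
      using insert.prems(4)[OF that] insert.hyps phc[OF that] p.h_closed[OF that] by (simp add: v_def)
    have cancel: "y = z" if "x \<oplus> y = x \<oplus> z" "x \<in> carrier M" "y \<in> carrier M" "z \<in> carrier M" for x y z
      using that by simp
    have v: "v \<in> module_hom \<Lambda> M M"
    proof (rule homI[OF lam_mod_axioms vc])
      fix x y assume xy: "x \<in> carrier M" "y \<in> carrier M"
      have "\<phi> a (x \<oplus> y) \<oplus> v (x \<oplus> y) = u (x \<oplus> y)" by (rule uv[symmetric]) (use xy in simp)
      also have "\<dots> = (\<phi> a x \<oplus> v x) \<oplus> (\<phi> a y \<oplus> v y)" unfolding u.h_add[OF xy] uv[OF xy(1)] uv[OF xy(2)] ..
      also have "\<dots> = \<phi> a (x \<oplus> y) \<oplus> (v x \<oplus> v y)" using xy vc by (simp add: p.h_add M.a_ac)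
      finally have "\<phi> a (x \<oplus> y) \<oplus> v (x \<oplus> y) = \<phi> a (x \<oplus> y) \<oplus> (v x \<oplus> v y)" .
      then show "v (x \<oplus> y) = v x \<oplus> v y" by (rule cancel) (use xy vc in auto)
    next
      fix f x assume fx: "f \<in> carrier P" "x \<in> carrier M"
      have "\<phi> a (act f x) \<oplus> v (act f x) = u (act f x)" by (rule uv[symmetric]) (use fx in simp)
      also have "\<dots> = act f (\<phi> a x \<oplus> v x)" unfolding u.h_act[OF fx] uv[OF fx(2)] ..
      also have "\<dots> = \<phi> a (act f x) \<oplus> act f (v x)" using fx vc by (simp add: p.h_act act_add)
      finally have "\<phi> a (act f x) \<oplus> v (act f x) = \<phi> a (act f x) \<oplus> act f (v x)" .
      then show "v (act f x) = act f (v x)" by (rule cancel) (use fx vc in auto)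
    qed
    have "bij_betw v (carrier M) (carrier M)"
    proof (rule inj_endo_bij[OF v])
      fix x assume x: "x \<in> carrier M" "v x = \<zero>"
      then have "u x = \<phi> a x" using uv[OF x(1)] by simp
      then have fixed: "\<psi> x = x" using w1[OF x(1)] by (simp add: \<psi>_def)
      have "(\<psi> ^^ n) x = x" by (induction n) (simp_all add: fixed)
      then show "x = \<zero>" using n x(1) by simp
    qed
    then have "\<exists>b\<in>A. bij_betw (\<phi> b) (carrier M) (carrier M)"
      using insert.IH[OF v] insert.prems(3) v_def by blast
    then show ?thesis by blast
  qed
qed

end

context lam_mod begin

section \<open>The isotypic component of the socle\<close>

lemma sm_Int: assumes A: "sm A" and B: "sm B" shows "sm (A \<inter> B)"
proof (rule smI)
  show "A \<inter> B \<subseteq> carrier M" "\<zero> \<in> A \<inter> B" using smD(1,2)[OF A] smD(2)[OF B] by auto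
  show "x \<oplus> y \<in> A \<inter> B" if "x \<in> A \<inter> B" "y \<in> A \<inter> B" for x y
    using that smD(3)[OF A, of x y] smD(3)[OF B, of x y] by simp
  show "act f x \<in> A \<inter> B" if "f \<in> carrier P" "x \<in> A \<inter> B" for f x
    using that smD(4)[OF A that(1)] smD(4)[OF B that(1)] by simp
qed

lemma \<sigma>0_iff: assumes i: "i \<in> I"
  shows "x \<in> \<sigma> i {\<zero>} \<longleftrightarrow> x \<in> carrier M \<and> act (ve i) x = x \<and> act (Out i) x = \<zero>"
proof
  assume x: "x \<in> \<sigma> i {\<zero>}"
  have xM: "x \<in> carrier M" using x by (simp add: satur_def)
  have "act (ve i) x = x"
  proof (rule components_eq)
    fix k assume k: "k \<in> I"
    show "act (ve k) (act (ve i) x) = act (ve k) x"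
      using satur_component[OF x, of k] k i xM by (cases "k = i") (auto simp: ve_ve)
  qed (use xM i in auto)
  then show "x \<in> carrier M \<and> act (ve i) x = x \<and> act (Out i) x = \<zero>"
    using xM Out_in_of_\<sigma>[OF sm_zero x] by simp
next
  assume "x \<in> carrier M \<and> act (ve i) x = x \<and> act (Out i) x = \<zero>"
  then show "x \<in> \<sigma> i {\<zero>}" using mem_\<sigma>[OF sm_zero _ _ _ i] by simp
qed

lemma line_act:
  assumes x: "x \<in> carrier M" "act (ve i) x = x" "act (Out i) x = \<zero>" and i: "i \<in> I" and f: "f \<in> carrier P"
  shows "act f x = sv (f [i]) x"
  using f
proof (induction rule: P_induct)
  case zero
  have "\<zero>\<^bsub>P\<^esub> [i] = 0" by (simp add: P_simps(4))
  then show ?case using C.s_zero_left[OF x(1)] act_zero[OF x(1)] by (simp only:)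
next
  case (add f g)
  have "(f \<oplus>\<^bsub>P\<^esub> g) [i] = f [i] + g [i]" by (simp add: P_simps(5))
  then show ?case using act_plus[OF add(1,2) x(1)] C.s_plus[OF x(1), of "f [i]" "g [i]"] add(3,4) by (simp only:)
next
  case (scale c f)
  have "(sc c \<otimes>\<^bsub>P\<^esub> f) [i] = c * f [i]" using i by (simp add: mult_const)
  then show ?case using act_mult[OF gen_closed(3) scale(1) x(1), of c] C.s_mult[OF x(1), of c "f [i]"] scale(2) by (simp only:)
next
  case (vertex k)
  show ?case
  proof (cases "k = i")
    case True
    have "ve k [i] = 1" using True by simp
    then show ?thesis using x(2) True C.s_one[OF x(1)] by (simp only:)
  next
    case False
    have "ve k [i] = 0" using False by simp
    moreover have "act (ve k) x = \<zero>" using ve_ve[OF i vertex x(1)] x(2) False by simp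
    ultimately show ?thesis using C.s_zero_left[OF x(1)] by (simp only:)
  qed
next
  case (arrow k l f)
  have "act (ar k l) x = \<zero>"
  proof (cases "k = i")
    case True
    then show ?thesis using ve_Out[of l x i] arrow(1) edgeD[OF arrow(1)] x by auto
  next
    case False
    then show ?thesis using ar_ve[OF i arrow(1) x(1)] x(2) by simp
  qed
  then have "act (f \<otimes>\<^bsub>P\<^esub> ar k l) x = \<zero>" using arrow(1,2) x(1) by (simp add: act_mult)
  moreover have "(f \<otimes>\<^bsub>P\<^esub> ar k l) [i] = 0" by (simp add: mult_const path_elem_pair)
  ultimately show ?case using C.s_zero_left[OF x(1)] by (simp only:)
qed

abbreviation line :: "'m \<Rightarrow> 'm set" where "line x \<equiv> {sv c x | c. True}"

lemma sv_inj: assumes x: "x \<in> carrier M" "x \<noteq> \<zero>" and eq: "sv c x = sv d x" shows "c = d"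
proof (rule ccontr)
  assume "c \<noteq> d"
  then have cd: "c - d \<noteq> 0" by simp
  have "sv d x \<oplus> sv (c - d) x = sv (d + (c - d)) x" by (rule C.s_plus[OF x(1), symmetric])
  also have "d + (c - d) = c" by simp
  finally have "sv d x \<oplus> sv (c - d) x = sv d x" using eq by simp
  then have z: "sv (c - d) x = \<zero>" using x(1) by simp
  have "x = sv (1 / (c - d)) (sv (c - d) x)" by (rule unscale[OF x(1) cd, symmetric])
  also have "\<dots> = \<zero>" unfolding z by simp
  finally show False using x(2) by simp
qed

lemma line_iso:
  assumes x: "x \<in> carrier M" "act (ve i) x = x" "act (Out i) x = \<zero>" "x \<noteq> \<zero>" and i: "i \<in> I"
  obtains \<phi> where "\<phi> \<in> module_hom \<Lambda> (restrict_module M (line x)) (simple_at i)"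
    "bij_betw \<phi> (line x) UNIV" "\<And>c. \<phi> (sv c x) = c"
proof -
  define \<phi> where "\<phi> y = (THE c. y = sv c x)" for y
  have \<phi>: "\<phi> (sv c x) = c" for c
    unfolding \<phi>_def by (rule the_equality) (auto dest: sv_inj[OF x(1,4)])
  have "\<phi> \<in> module_hom \<Lambda> (restrict_module M (line x)) (simple_at i)"
    unfolding module_hom_def
  proof (intro CollectI conjI ballI)
    show "\<phi> \<in> carrier (restrict_module M (line x)) \<rightarrow> carrier (simple_at i)" by (simp add: simple_at_def)
  next
    fix y z assume "y \<in> carrier (restrict_module M (line x))" "z \<in> carrier (restrict_module M (line x))"
    then obtain c d where "y = sv c x" "z = sv d x" by auto
    then show "\<phi> (y \<oplus>\<^bsub>restrict_module M (line x)\<^esub> z) = \<phi> y \<oplus>\<^bsub>simple_at i\<^esub> \<phi> z"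
      using \<phi> C.s_plus[OF x(1), of c d, symmetric] by (simp add: simple_at_def)
  next
    fix a y assume a: "a \<in> carrier \<Lambda>" and "y \<in> carrier (restrict_module M (line x))"
    then obtain c where y: "y = sv c x" by auto
    obtain f where f: "f \<in> carrier P" "a = cls f" using a by (auto simp: \<Lambda>_carrier)
    have "act f y = sv c (act f x)" unfolding y by (rule sv_commute[OF f(1) x(1)])
    also have "\<dots> = sv (c * f [i]) x"
      unfolding line_act[OF x(1-3) i f(1)] by (rule C.s_mult[OF x(1), symmetric])
    finally have "\<phi> (act f y) = c * f [i]" using \<phi> by simp
    then show "\<phi> (a \<odot>\<^bsub>restrict_module M (line x)\<^esub> y) = a \<odot>\<^bsub>simple_at i\<^esub> \<phi> y"
      using f simple_at_smult[OF f(1)] \<phi> y by (simp add: smult_act mult.commute)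
  qed
  moreover have "bij_betw \<phi> (line x) UNIV"
  proof (rule bij_betwI[of _ _ _ "\<lambda>c. sv c x"])
    fix y assume "y \<in> line x"
    then obtain c where y: "y = sv c x" by auto
    show "sv (\<phi> y) x = y" unfolding y by (subst \<phi>) (rule refl)
  qed (auto simp: \<phi>)
  ultimately show thesis using that \<phi> by blast
qed

lemma generated_sm: assumes "B \<subseteq> carrier M" shows "sm (generated_submodule \<Lambda> M B)"
proof -
  have top: "carrier M \<in> {H. sm H \<and> B \<subseteq> H}" using sm_carrier assms by simp
  show ?thesis unfolding generated_submodule_def
  proof (rule smI)
    show "\<Inter>{H. sm H \<and> B \<subseteq> H} \<subseteq> carrier M" using top by blast
    show "\<zero> \<in> \<Inter>{H. sm H \<and> B \<subseteq> H}" using smD(2) by blast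
  qed (use smD(3,4) in blast)+
qed

text \<open>A nonzero vector of \<open>\<sigma> i {\<zero>}\<close> lives at \<open>i\<close> and is killed by all arrows, so it spans a copy of \<open>S\<^sub>i\<close>, and
  every copy of \<open>S\<^sub>i\<close> arises in this way.\<close>

lemma isotypic_socle: assumes i: "i \<in> I"
  shows "isotypic_component \<Lambda> (simple_at i) (restrict_module M (socle \<Lambda> M)) = \<sigma> i {\<zero>}"
proof -
  define S where "S = socle \<Lambda> M"
  define SS where "SS = \<Union>{H. sm H \<and> simple_module \<Lambda> (restrict_module M H)}"
  have SSM: "SS \<subseteq> carrier M" using smD(1) by (auto simp: SS_def)
  have S: "sm S" unfolding S_def socle_def using generated_sm[OF SSM] by (simp add: SS_def)
  have SSS: "SS \<subseteq> S" unfolding S_def socle_def generated_submodule_def SS_def by blast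
  have s0: "sm (\<sigma> i {\<zero>})" by (rule satur_sm[OF sm_zero])
  have lineS: "sm (line x) \<and> line x \<subseteq> S \<and> module_iso \<Lambda> (restrict_module M (line x)) (simple_at i)"
    if x: "x \<in> \<sigma> i {\<zero>}" "x \<noteq> \<zero>" for x
  proof -
    have x': "x \<in> carrier M" "act (ve i) x = x" "act (Out i) x = \<zero>" using x(1) \<sigma>0_iff[OF i] by auto
    have l: "sm (line x)" by (rule line_sm[OF x' i])
    have "simple_module \<Lambda> (restrict_module M (line x))" unfolding simple_module_def
    proof (intro conjI allI impI)
      show "carrier (restrict_module M (line x)) \<noteq> {\<zero>\<^bsub>restrict_module M (line x)\<^esub>}"
        using in_line(2)[OF x'(1)] x(2) by auto
      fix H assume "submodule H \<Lambda> (restrict_module M (line x))"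
      then have H: "sm H" "H \<subseteq> line x" using sm_restrict[OF l] by auto
      show "H = {\<zero>\<^bsub>restrict_module M (line x)\<^esub>} \<or> H = carrier (restrict_module M (line x))"
      proof (cases "H = {\<zero>}")
        case False
        then obtain y where y: "y \<in> H" "y \<noteq> \<zero>" using smD(2)[OF H(1)] by blast
        then obtain c where c: "y = sv c x" using H(2) by auto
        have c0: "c \<noteq> 0" using y(2) C.s_zero_left[OF x'(1)] c by auto
        have "sv (1 / c) y \<in> H" using smD(4)[OF H(1) gen_closed(3) y(1)] .
        then have "x \<in> H" unfolding c unscale[OF x'(1) c0] .
        then have "line x \<subseteq> H" using smD(4)[OF H(1) gen_closed(3)] by blast
        then show ?thesis using H(2) by simp
      qed simp
    qed
    then have "line x \<subseteq> S" using l SSS by (auto simp: SS_def)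
    moreover have "module_iso \<Lambda> (restrict_module M (line x)) (simple_at i)"
    proof (rule line_iso[OF x' x(2) i])
      fix \<phi> assume "\<phi> \<in> module_hom \<Lambda> (restrict_module M (line x)) (simple_at i)" "bij_betw \<phi> (line x) UNIV"
      then show ?thesis unfolding module_iso_def by (intro bexI[of _ \<phi>]) (simp_all add: simple_at_def)
    qed
    ultimately show ?thesis using l by simp
  qed
  have s0S: "\<sigma> i {\<zero>} \<subseteq> S"
  proof
    fix x assume x: "x \<in> \<sigma> i {\<zero>}"
    show "x \<in> S"
    proof (cases "x = \<zero>")
      case True
      then show ?thesis using smD(2)[OF S] by simp
    next
      case False
      then show ?thesis using lineS[OF x False] in_line(2)[OF smD(5)[OF s0 x]] by blast
    qed
  qed
  define \<H> where "\<H> = {H. sm H \<and> H \<subseteq> S \<and> module_iso \<Lambda> (restrict_module M H) (simple_at i)}"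
  have HH: "{H. submodule H \<Lambda> (restrict_module M S) \<and> module_iso \<Lambda> (restrict_module (restrict_module M S) H) (simple_at i)} = \<H>"
    unfolding \<H>_def sm_restrict[OF S] by auto
  have in_s0: "H \<subseteq> \<sigma> i {\<zero>}" if H: "H \<in> \<H>" for H
  proof
    fix x assume x: "x \<in> H"
    have smH: "sm H" using H by (simp add: \<H>_def)
    obtain \<phi> where \<phi>: "\<phi> \<in> module_hom \<Lambda> (restrict_module M H) (simple_at i)" "inj_on \<phi> H"
      using H unfolding \<H>_def module_iso_def bij_betw_def by auto
    have pa: "\<phi> (act f y) = f [i] * \<phi> y" if "y \<in> H" "f \<in> carrier P" for y f
    proof -
      have "\<phi> (cls f \<odot>\<^bsub>M\<^esub> y) = cls f \<odot>\<^bsub>simple_at i\<^esub> \<phi> y"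
        using \<phi>(1) that(1) cls_simps(1)[OF that(2)] unfolding module_hom_def by auto
      then show ?thesis unfolding simple_at_smult[OF that(2)] smult_act[OF that(2)] .
    qed
    have z: "\<phi> \<zero> = 0" using pa[OF smD(2)[OF smH] gen_closed(5), of i] by simp
    have "act (ve i) x = x"
      using pa[OF x gen_closed(1)[OF i]] inj_onD[OF \<phi>(2) _ smD(4)[OF smH gen_closed(1)[OF i] x] x] by simp
    moreover have "act (Out i) x = \<zero>"
      using pa[OF x gen_closed(5), of i] z inj_onD[OF \<phi>(2) _ smD(4)[OF smH gen_closed(5) x] smD(2)[OF smH]] by simp
    ultimately show "x \<in> \<sigma> i {\<zero>}" using \<sigma>0_iff[OF i] smD(5)[OF smH x] by simp
  qed
  have "isotypic_component \<Lambda> (simple_at i) (restrict_module M S) = \<Inter>{H. sm H \<and> H \<subseteq> S \<and> \<Union>\<H> \<subseteq> H}"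
    unfolding isotypic_component_def generated_submodule_def HH sm_restrict[OF S]
    by (simp add: conj_assoc \<H>_def)
  also have "\<dots> = \<sigma> i {\<zero>}"
  proof
    have "\<sigma> i {\<zero>} \<in> {H. sm H \<and> H \<subseteq> S \<and> \<Union>\<H> \<subseteq> H}" using s0 s0S in_s0 by blast
    then show "\<Inter>{H. sm H \<and> H \<subseteq> S \<and> \<Union>\<H> \<subseteq> H} \<subseteq> \<sigma> i {\<zero>}" by blast
    show "\<sigma> i {\<zero>} \<subseteq> \<Inter>{H. sm H \<and> H \<subseteq> S \<and> \<Union>\<H> \<subseteq> H}"
    proof (rule Inter_greatest, rule subsetI)
      fix H x assume H: "H \<in> {H. sm H \<and> H \<subseteq> S \<and> \<Union>\<H> \<subseteq> H}" and x: "x \<in> \<sigma> i {\<zero>}"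
      show "x \<in> H"
      proof (cases "x = \<zero>")
        case True
        then show ?thesis using H smD(2) by blast
      next
        case False
        then have "line x \<in> \<H>" using lineS[OF x False] by (simp add: \<H>_def)
        then show ?thesis using H in_line(2)[OF smD(5)[OF s0 x]] by blast
      qed
    qed
  qed
  finally show ?thesis by (simp add: S_def)
qed

section \<open>Internal direct sums\<close>

text \<open>Some of the \<open>H a\<close> may be zero.\<close>

definition direct :: "'a set \<Rightarrow> ('a \<Rightarrow> 'm set) \<Rightarrow> bool" where
  "direct A H \<longleftrightarrow> finite A \<and> (\<forall>a\<in>A. sm (H a)) \<and>
     (\<forall>x\<in>carrier M. \<exists>y\<in>Pi A H. x = (\<Oplus>a\<in>A. y a)) \<and>
     (\<forall>y\<in>Pi A H. (\<Oplus>a\<in>A. y a) = \<zero> \<longrightarrow> (\<forall>a\<in>A. y a = \<zero>))"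

lemma direct_unique:
  assumes d: "direct A H" and y: "y \<in> Pi A H" "z \<in> Pi A H" "(\<Oplus>a\<in>A. y a) = (\<Oplus>a\<in>A. z a)" and a: "a \<in> A"
  shows "y a = z a"
proof -
  have A: "finite A" and H: "\<And>a. a \<in> A \<Longrightarrow> sm (H a)" using d by (auto simp: direct_def)
  have yM: "y \<in> A \<rightarrow> carrier M" "z \<in> A \<rightarrow> carrier M" using y(1,2) smD(5)[OF H] by (auto simp: Pi_iff)
  have "(\<Oplus>a\<in>A. y a \<oplus> sv (-1) (z a)) = (\<Oplus>a\<in>A. y a) \<oplus> (\<Oplus>a\<in>A. sv (-1) (z a))"
    by (rule M.finsum_addf) (use yM in \<open>auto simp: Pi_iff\<close>)
  also have "(\<Oplus>a\<in>A. sv (-1) (z a)) = sv (-1) (\<Oplus>a\<in>A. z a)" using A yM(2) by (intro act_finsum[symmetric] gen_closed)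
  also have "(\<Oplus>a\<in>A. y a) \<oplus> sv (-1) (\<Oplus>a\<in>A. z a) = \<zero>"
    using y(3) M.finsum_closed[OF yM(2)] by (simp add: M.r_neg flip: minus_sv)
  finally have "(\<Oplus>a\<in>A. y a \<oplus> sv (-1) (z a)) = \<zero>" .
  moreover have "(\<lambda>a. y a \<oplus> sv (-1) (z a)) \<in> Pi A H"
    using y(1,2) smD(3,4)[OF H] by (auto simp: Pi_iff)
  ultimately have "y a \<oplus> sv (-1) (z a) = \<zero>" using d a unfolding direct_def by blast
  then have "y a \<oplus> \<ominus> z a = \<zero>" using yM a by (auto simp: minus_sv Pi_iff)
  then have "\<ominus> (\<ominus> z a) = y a" using yM a by (intro M.minus_equality) (auto simp: Pi_iff)
  then show ?thesis using yM a by (auto simp: Pi_iff)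
qed

lemma direct_projections:
  assumes d: "direct A H"
  obtains p where "\<And>a. a \<in> A \<Longrightarrow> p a \<in> module_hom \<Lambda> M M"
    "\<And>a x. a \<in> A \<Longrightarrow> x \<in> carrier M \<Longrightarrow> p a x \<in> H a"
    "\<And>x. x \<in> carrier M \<Longrightarrow> x = (\<Oplus>a\<in>A. p a x)"
    "\<And>a b x. a \<in> A \<Longrightarrow> b \<in> A \<Longrightarrow> x \<in> H b \<Longrightarrow> p a x = (if a = b then x else \<zero>)"
proof -
  have A: "finite A" and H: "\<And>a. a \<in> A \<Longrightarrow> sm (H a)" using d by (auto simp: direct_def)
  have HM: "y \<in> Pi A H \<Longrightarrow> y \<in> A \<rightarrow> carrier M" for y using smD(5)[OF H] by (auto simp: Pi_iff)
  define q where "q x = (SOME y. y \<in> Pi A H \<and> x = (\<Oplus>a\<in>A. y a))" for x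
  define p where "p a x = q x a" for a x
  have q: "q x \<in> Pi A H \<and> x = (\<Oplus>a\<in>A. q x a)" if "x \<in> carrier M" for x
  proof -
    have "\<exists>y. y \<in> Pi A H \<and> x = (\<Oplus>a\<in>A. y a)" using d that unfolding direct_def by blast
    then show ?thesis unfolding q_def by (rule someI_ex)
  qed
  have qu: "p a x = y a" if "x \<in> carrier M" "y \<in> Pi A H" "x = (\<Oplus>a\<in>A. y a)" "a \<in> A" for a x y
    unfolding p_def by (rule direct_unique[OF d]) (use q[OF that(1)] that in auto)
  have pH: "p a x \<in> H a" if "a \<in> A" "x \<in> carrier M" for a x using q[OF that(2)] that(1) by (auto simp: p_def)
  have sum: "x = (\<Oplus>a\<in>A. p a x)" if "x \<in> carrier M" for x using q[OF that] by (simp add: p_def)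
  have ppi: "(\<lambda>a. p a x) \<in> Pi A H" if "x \<in> carrier M" for x using pH that by auto
  show thesis
  proof (rule that[of p])
    fix a assume a: "a \<in> A"
    show "p a \<in> module_hom \<Lambda> M M"
    proof (rule homI[OF lam_mod_axioms])
      fix x assume "x \<in> carrier M"
      then show "p a x \<in> carrier M" using pH[OF a] smD(5)[OF H[OF a]] by blast
    next
      fix x y assume xy: "x \<in> carrier M" "y \<in> carrier M"
      show "p a (x \<oplus> y) = p a x \<oplus> p a y"
      proof (rule qu[OF _ _ _ a])
        show "(\<lambda>a. p a x \<oplus> p a y) \<in> Pi A H" using ppi xy smD(3)[OF H] by (auto simp: Pi_iff)
        have "(\<Oplus>a\<in>A. p a x \<oplus> p a y) = (\<Oplus>a\<in>A. p a x) \<oplus> (\<Oplus>a\<in>A. p a y)"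
          using HM[OF ppi] xy by (intro M.finsum_addf) auto
        then show "x \<oplus> y = (\<Oplus>a\<in>A. p a x \<oplus> p a y)" using sum xy by simp
      qed (use xy in simp)
    next
      fix f x assume fx: "f \<in> carrier P" "x \<in> carrier M"
      show "p a (act f x) = act f (p a x)"
      proof (rule qu[OF _ _ _ a])
        show "(\<lambda>a. act f (p a x)) \<in> Pi A H" using ppi fx smD(4)[OF H] by (auto simp: Pi_iff)
        show "act f x = (\<Oplus>a\<in>A. act f (p a x))"
          using act_finsum[OF fx(1) A HM[OF ppi[OF fx(2)]]] sum[OF fx(2)] by simp
      qed (use fx in simp)
    qed
  next
    fix a b x assume ab: "a \<in> A" "b \<in> A" "x \<in> H b"
    have xM: "x \<in> carrier M" using smD(5)[OF H[OF ab(2)] ab(3)] .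
    have "p a x = (\<lambda>a. if b = a then x else \<zero>) a"
    proof (rule qu[OF xM _ _ ab(1)])
      show "(\<lambda>a. if b = a then x else \<zero>) \<in> Pi A H" using ab smD(2)[OF H] by auto
      show "x = (\<Oplus>a\<in>A. if b = a then x else \<zero>)"
        using M.finsum_singleton[OF ab(2) A, of "\<lambda>_. x"] xM by simp
    qed
    then show "p a x = (if a = b then x else \<zero>)" by auto
  qed (use pH sum in auto)
qed

lemma direct_summandI: assumes d: "direct A H" and a: "a \<in> A" shows "direct_summand \<Lambda> M (H a)"
proof -
  obtain p where p: "p a \<in> module_hom \<Lambda> M M" "\<And>x. x \<in> carrier M \<Longrightarrow> p a x \<in> H a"
    "\<And>x. x \<in> H a \<Longrightarrow> p a x = x"
    using direct_projections[OF d] a by metis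
  have H: "sm (H a)" using d a by (simp add: direct_def)
  interpret p: lam_hom I E \<Omega> M M "p a" by (rule endo[OF p(1)])
  define K where "K = {x \<in> carrier M. p a x = \<zero>}"
  have "complementary \<Lambda> M (H a) K" unfolding complementary_def
  proof (intro conjI H)
    show K: "sm K" unfolding K_def by (rule p.ker_sm)
    show "H a \<inter> K = {\<zero>}" using p(3) smD(2)[OF H] smD(2)[OF K] by (auto simp: K_def)
    show "set_add M (H a) K = carrier M"
    proof
      show "set_add M (H a) K \<subseteq> carrier M" by (rule sum_least[OF sm_carrier smD(1)[OF H] smD(1)[OF K]])
      show "carrier M \<subseteq> set_add M (H a) K"
      proof
        fix x assume x: "x \<in> carrier M"
        have px: "p a x \<in> H a" "p a x \<in> carrier M" using p(2)[OF x] x by auto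
        have "p a (x \<ominus> p a x) = p a x \<ominus> p a (p a x)" by (rule p.h_diff[OF x px(2)])
        also have "\<dots> = \<zero>" unfolding p(3)[OF px(1)] using px(2) by (simp add: a_minus_def M.r_neg)
        finally have "x \<ominus> p a x \<in> K" using x px by (simp add: K_def)
        moreover have "x = p a x \<oplus> (x \<ominus> p a x)" using x px(2) by (simp add: a_minus_def M.a_ac M.r_neg)
        ultimately show "x \<in> set_add M (H a) K" using px(1) unfolding set_add_def' by blast
      qed
    qed
  qed
  then show ?thesis by (auto simp: direct_summand_def)
qed

lemma complementary_direct:
  assumes "complementary \<Lambda> M X X'" shows "direct {True, False} (\<lambda>b. if b then X else X')"
proof -
  have X: "sm X" "sm X'" "X \<inter> X' = {\<zero>}" "set_add M X X' = carrier M"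
    using assms by (auto simp: complementary_def)
  have fs: "(\<Oplus>a\<in>{True, False}. y a) = y True \<oplus> y False"
    if "y \<in> Pi {True, False} (\<lambda>b. if b then X else X')" for y
    using that smD(5)[OF X(1)] smD(5)[OF X(2)] by (subst M.finsum_insert) (auto simp: Pi_iff)
  show ?thesis unfolding direct_def
  proof (intro conjI ballI impI)
    fix x assume "x \<in> carrier M"
    then have "x \<in> set_add M X X'" using X(4) by simp
    then obtain u v where "u \<in> X" "v \<in> X'" "x = u \<oplus> v" by (auto simp: set_add_def')
    then show "\<exists>y\<in>Pi {True, False} (\<lambda>b. if b then X else X'). x = (\<Oplus>a\<in>{True, False}. y a)"
      using fs[of "\<lambda>b. if b then u else v"] by (intro bexI[of _ "\<lambda>b. if b then u else v"]) auto
  next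
    fix y a assume y: "y \<in> Pi {True, False} (\<lambda>b. if b then X else X')" and z: "(\<Oplus>a\<in>{True, False}. y a) = \<zero>"
      and a: "a \<in> {True, False}"
    have yX: "y True \<in> X" "y False \<in> X'" using y by (auto simp: Pi_iff)
    have yM: "y True \<in> carrier M" "y False \<in> carrier M" using smD(5)[OF X(1)] smD(5)[OF X(2)] yX by auto
    have "y True \<oplus> y False = \<zero>" using z fs[OF y] by simp
    then have "y True = \<ominus> y False" using M.minus_equality[of "y True" "y False"] yM by simp
    then have "y True \<in> X \<inter> X'" using yX smD(6)[OF X(2)] by simp
    then have "y True = \<zero>" using X(3) by blast
    moreover from this have "y False = \<zero>" using \<open>y True \<oplus> y False = \<zero>\<close> yM by simp
    ultimately show "y a = \<zero>" by (cases a) auto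
  qed (use X in auto)
qed

text \<open>The argument of Krull and Schmidt: the identity of \<open>X\<close> is the sum of the endomorphisms that project \<open>X\<close> to
  \<open>H a\<close> and then back to \<open>X\<close>, so one of them is bijective. Then \<open>H a\<close> is the direct sum of the image \<open>U\<close> of
  \<open>X\<close> and the kernel \<open>V\<close> of the projection back to \<open>X\<close>, and indecomposability gives \<open>U = H a\<close>.\<close>

lemma summand_iso:
  assumes d: "direct A H"
    and ind: "\<And>a. a \<in> A \<Longrightarrow> H a \<noteq> {\<zero>} \<Longrightarrow> indecomposable \<Lambda> (restrict_module M (H a))"
    and X: "direct_summand \<Lambda> M X" "indecomposable \<Lambda> (restrict_module M X)"
  shows "\<exists>a\<in>A. H a \<noteq> {\<zero>} \<and> module_iso \<Lambda> (restrict_module M X) (restrict_module M (H a))"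
proof -
  have A: "finite A" and H: "\<And>a. a \<in> A \<Longrightarrow> sm (H a)" using d by (auto simp: direct_def)
  obtain p where p: "\<And>a. a \<in> A \<Longrightarrow> p a \<in> module_hom \<Lambda> M M"
    "\<And>a x. a \<in> A \<Longrightarrow> x \<in> carrier M \<Longrightarrow> p a x \<in> H a"
    "\<And>x. x \<in> carrier M \<Longrightarrow> x = (\<Oplus>a\<in>A. p a x)"
    using direct_projections[OF d] by metis
  obtain X' where X': "complementary \<Lambda> M X X'" using X(1) by (auto simp: direct_summand_def)
  have smX: "sm X" using X' by (simp add: complementary_def)
  obtain q where q: "q \<in> module_hom \<Lambda> M M" "\<And>x. x \<in> carrier M \<Longrightarrow> q x \<in> X" "\<And>x. x \<in> X \<Longrightarrow> q x = x"
  proof (rule direct_projections[OF complementary_direct[OF X']])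
    fix r
    assume r: "\<And>a. a \<in> {True, False} \<Longrightarrow> r a \<in> module_hom \<Lambda> M M"
      "\<And>a x. a \<in> {True, False} \<Longrightarrow> x \<in> carrier M \<Longrightarrow> r a x \<in> (if a then X else X')"
      "\<And>a b x. a \<in> {True, False} \<Longrightarrow> b \<in> {True, False} \<Longrightarrow> x \<in> (if b then X else X') \<Longrightarrow> r a x = (if a = b then x else \<zero>)"
    show thesis
      by (rule that[of "r True"]) (use r(1)[of True] r(2)[of True] r(3)[of True True] in auto)
  qed
  interpret q: lam_hom I E \<Omega> M M q by (rule endo[OF q(1)])
  interpret R: lam_mod I E \<Omega> "restrict_module M X" by (rule sub_lam_mod[OF smX])
  have ra: "R.act = act" by (rule act_restrict[OF smX])
  have XM: "x \<in> X \<Longrightarrow> x \<in> carrier M" for x using smD(5)[OF smX] .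
  have phi: "(\<lambda>x. q (p a x)) \<in> module_hom \<Lambda> (restrict_module M X) (restrict_module M X)" if a: "a \<in> A" for a
  proof -
    interpret p: lam_hom I E \<Omega> M M "p a" by (rule endo[OF p(1)[OF a]])
    show ?thesis
      by (rule R.homI[OF R.lam_mod_axioms], unfold ra)
        (use q(2) XM in \<open>auto simp: p.h_add p.h_act q.h_add q.h_act\<close>)
  qed
  have "\<exists>a\<in>A. bij_betw (\<lambda>x. q (p a x)) (carrier (restrict_module M X)) (carrier (restrict_module M X))"
  proof (rule R.bijective_summand[OF X(2) A, of "\<lambda>x. x"])
    show "(\<lambda>x. x) \<in> module_hom \<Lambda> (restrict_module M X) (restrict_module M X)" by (auto simp: module_hom_def)
    fix x assume "x \<in> carrier (restrict_module M X)"
    then have x: "x \<in> X" by simp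
    have pc: "(\<lambda>a. p a x) \<in> A \<rightarrow> carrier M" using p(2) smD(5)[OF H] XM[OF x] by blast
    have "x = q (\<Oplus>a\<in>A. p a x)" using q(3)[OF x] p(3)[OF XM[OF x]] by simp
    also have "\<dots> = (\<Oplus>a\<in>A. q (p a x))" by (rule q.h_finsum[OF A pc])
    also have "\<dots> = finsum (restrict_module M X) (\<lambda>a. q (p a x)) A"
      by (rule finsum_restrict[OF smX A, symmetric]) (use q(2) pc in auto)
    finally show "x = finsum (restrict_module M X) (\<lambda>a. q (p a x)) A" .
  qed (use phi in \<open>auto simp: bij_betw_def\<close>)
  then obtain a where a: "a \<in> A" and bij: "bij_betw (\<lambda>x. q (p a x)) X X" by auto
  interpret p: lam_hom I E \<Omega> M M "p a" by (rule endo[OF p(1)[OF a]])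
  have Ha: "sm (H a)" by (rule H[OF a])
  define U where "U = p a ` X"
  define V where "V = H a \<inter> {x \<in> carrier M. q x = \<zero>}"
  have U: "sm U" unfolding U_def by (rule p.image_sm[OF smX])
  have V: "sm V"
    unfolding V_def by (rule sm_Int[OF Ha q.ker_sm])
  have UH: "U \<subseteq> H a" unfolding U_def using p(2)[OF a] XM by auto
  have VH: "V \<subseteq> H a" by (auto simp: V_def)
  have inj: "x = y" if "x \<in> X" "y \<in> X" "q (p a x) = q (p a y)" for x y
    using bij that by (auto simp: bij_betw_def dest: inj_onD)
  have X0: "X \<noteq> {\<zero>}" using X(2) by (simp add: indecomposable_def)
  have UV: "U \<inter> V = {\<zero>}"
  proof
    show "{\<zero>} \<subseteq> U \<inter> V" using smD(2)[OF U] smD(2)[OF V] by simp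
    show "U \<inter> V \<subseteq> {\<zero>}"
    proof
      fix y assume y: "y \<in> U \<inter> V"
      then obtain x where x: "x \<in> X" "y = p a x" by (auto simp: U_def)
      then have "q (p a x) = q (p a \<zero>)" using y by (simp add: V_def)
      then have "x = \<zero>" using inj x(1) smD(2)[OF smX] by blast
      then show "y \<in> {\<zero>}" using x(2) by simp
    qed
  qed
  have sum: "set_add M U V = H a"
  proof
    show "set_add M U V \<subseteq> H a" by (rule sum_least[OF Ha UH VH])
    show "H a \<subseteq> set_add M U V"
    proof
      fix h assume h: "h \<in> H a"
      have hM: "h \<in> carrier M" using smD(5)[OF Ha h] .
      obtain x where x: "x \<in> X" "q h = q (p a x)" using bij q(2)[OF hM] by (auto simp: bij_betw_def)
      have u: "p a x \<in> U" "p a x \<in> carrier M" using x(1) XM by (auto simp: U_def)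
      have "q (h \<ominus> p a x) = q h \<ominus> q (p a x)" by (rule q.h_diff[OF hM u(2)])
      also have "\<dots> = \<zero>" unfolding x(2) using u(2) by (simp add: a_minus_def M.r_neg)
      finally have "h \<ominus> p a x \<in> V" using hM u smD(7)[OF Ha h subsetD[OF UH u(1)]] by (simp add: V_def)
      moreover have "h = p a x \<oplus> (h \<ominus> p a x)" using hM u(2) by (simp add: a_minus_def M.a_ac M.r_neg)
      ultimately show "h \<in> set_add M U V" using u(1) unfolding set_add_def' by blast
    qed
  qed
  obtain x0 where x0: "x0 \<in> X" "x0 \<noteq> \<zero>" using X0 smD(2)[OF smX] by blast
  have px0: "p a x0 \<noteq> \<zero>"
  proof
    assume "p a x0 = \<zero>"
    then have "q (p a x0) = q (p a \<zero>)" by simp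
    then show False using inj x0 smD(2)[OF smX] by blast
  qed
  have U0: "U \<noteq> {\<zero>}" using px0 x0(1) by (auto simp: U_def)
  have H0: "H a \<noteq> {\<zero>}" using U0 UH smD(2)[OF U] by blast
  have "complementary \<Lambda> (restrict_module M (H a)) U V"
    unfolding complementary_def sm_restrict[OF Ha]
    using U V UH VH UV sum by (simp add: set_add_def set_mult_def)
  then have "V = {\<zero>}" using ind[OF a H0] U0 unfolding indecomposable_def by auto
  then have UHa: "U = H a" using sum smD(5)[OF U] by (auto simp: set_add_def')
  have "p a \<in> module_hom \<Lambda> (restrict_module M X) (restrict_module M (H a))"
    using p(1)[OF a] p(2)[OF a] XM by (auto simp: module_hom_def)
  moreover have "bij_betw (p a) X (H a)"
    unfolding bij_betw_def using inj UHa by (auto simp: U_def inj_on_def)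
  ultimately have "module_iso \<Lambda> (restrict_module M X) (restrict_module M (H a))"
    unfolding module_iso_def by (intro bexI[of _ "p a"]) simp_all
  then show ?thesis using a H0 by blast
qed

end

section \<open>The summands of the module of a word\<close>

text \<open>The label \<open>(j, u)\<close> stands for the quotient of \<open>Q\<^sub>j\<close> by \<open>\<sigma>\<^sub>u 0\<close>. Passing from \<open>ws\<close> to \<open>i # ws\<close> puts \<open>i\<close> in
  front of all words and adds the new summand \<open>Q\<^sub>i\<close>.\<close>

primrec labels :: "'v set \<Rightarrow> 'v list \<Rightarrow> ('v \<times> 'v list) set" where
  "labels I [] = (\<lambda>j. (j, [])) ` I"
| "labels I (i # ws) = insert (i, []) ((\<lambda>(j, u). (j, i # u)) ` labels I ws)"

lemma finite_labels: "finite I \<Longrightarrow> finite (labels I ws)"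
  by (induction ws) auto

lemma labels_iff: "(j, u) \<in> labels I ws \<longleftrightarrow> (j \<in> I \<and> u = ws) \<or> (\<exists>k<length ws. j = ws ! k \<and> u = take k ws)"
proof (induction ws arbitrary: u)
  case Nil
  then show ?case by auto
next
  case (Cons i ws)
  have ex: "(\<exists>k<length (i # ws). P k) \<longleftrightarrow> P 0 \<or> (\<exists>k<length ws. P (Suc k))" for P
    by (metis (no_types, lifting) Suc_less_eq length_Cons not0_implies_Suc zero_less_Suc)
  have "(j, u) \<in> labels I (i # ws) \<longleftrightarrow> (j = i \<and> u = []) \<or> (\<exists>u'. u = i # u' \<and> (j, u') \<in> labels I ws)"
    by auto
  also have "\<dots> \<longleftrightarrow> (j \<in> I \<and> u = i # ws) \<or> (\<exists>k<length (i # ws). j = (i # ws) ! k \<and> u = take k (i # ws))"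
    unfolding Cons.IH ex by auto
  finally show ?case .
qed

lemma labels_in: "set ws \<subseteq> I \<Longrightarrow> a \<in> labels I ws \<Longrightarrow> fst a \<in> I"
  using labels_iff[of "fst a" "snd a" I ws] by (auto dest: nth_mem)

context lam_mod begin

lemma iso_inverse:
  fixes D :: "('v preproj, 'd) module"
  assumes g: "g \<in> module_hom \<Lambda> M D" "bij_betw g (carrier M) (carrier D)"
  defines "w \<equiv> the_inv_into (carrier M) g"
  shows "\<And>d. d \<in> carrier D \<Longrightarrow> w d \<in> carrier M" "\<And>d. d \<in> carrier D \<Longrightarrow> g (w d) = d"
    "\<And>x. x \<in> carrier M \<Longrightarrow> w (g x) = x"
    "\<And>d e. d \<in> carrier D \<Longrightarrow> e \<in> carrier D \<Longrightarrow> w (d \<oplus>\<^bsub>D\<^esub> e) = w d \<oplus> w e"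
    "\<And>f d. f \<in> carrier P \<Longrightarrow> d \<in> carrier D \<Longrightarrow> w (cls f \<odot>\<^bsub>D\<^esub> d) = act f (w d)"
proof -
  have inj: "inj_on g (carrier M)" and im: "g ` carrier M = carrier D" using g(2) by (auto simp: bij_betw_def)
  show w1: "w (g x) = x" if "x \<in> carrier M" for x using the_inv_into_f_f[OF inj that] by (simp add: w_def)
  show w2: "g (w d) = d" if "d \<in> carrier D" for d using f_the_inv_into_f[OF inj] that im by (simp add: w_def)
  show wc: "w d \<in> carrier M" if "d \<in> carrier D" for d
    using the_inv_into_into[OF inj, of d "carrier M"] that im by (simp add: w_def)
  have g_add: "g (x \<oplus> y) = g x \<oplus>\<^bsub>D\<^esub> g y" if "x \<in> carrier M" "y \<in> carrier M" for x y
    using g(1) that by (auto simp: module_hom_def)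
  have g_act: "g (act f x) = cls f \<odot>\<^bsub>D\<^esub> g x" if "f \<in> carrier P" "x \<in> carrier M" for f x
    using g(1) that cls_simps(1)[OF that(1)] by (auto simp: module_hom_def act_def)
  show "w (d \<oplus>\<^bsub>D\<^esub> e) = w d \<oplus> w e" if de: "d \<in> carrier D" "e \<in> carrier D" for d e
  proof -
    have "w (g (w d \<oplus> w e)) = w d \<oplus> w e" using de wc by (intro w1) simp
    then show ?thesis using de wc w2 g_add by simp
  qed
  show "w (cls f \<odot>\<^bsub>D\<^esub> d) = act f (w d)" if fd: "f \<in> carrier P" "d \<in> carrier D" for f d
  proof -
    have "w (g (act f (w d))) = act f (w d)" using fd wc by (intro w1) simp
    then show ?thesis using fd wc w2 g_act by simp
  qed
qed

lemma sm_abelian_subgroup: assumes "sm K" shows "abelian_subgroup K M"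
proof -
  interpret submodule K \<Lambda> M by fact
  have "additive_subgroup K M" by (intro additive_subgroup.intro subgroup_axioms)
  then show ?thesis using M.abelian_group_axioms by (rule abelian_subgroupI3)
qed

lemma quotient_facts:
  assumes K: "sm K"
  shows "x \<in> carrier M \<Longrightarrow> K +> x \<in> carrier (quotient_module M K)"
    "X \<in> carrier (quotient_module M K) \<Longrightarrow> \<exists>x\<in>carrier M. X = K +> x"
    "x \<in> carrier M \<Longrightarrow> y \<in> carrier M \<Longrightarrow> (K +> x) \<oplus>\<^bsub>quotient_module M K\<^esub> (K +> y) = K +> (x \<oplus> y)"
    "f \<in> carrier P \<Longrightarrow> x \<in> carrier M \<Longrightarrow> cls f \<odot>\<^bsub>quotient_module M K\<^esub> (K +> x) = K +> act f x"
    "x \<in> carrier M \<Longrightarrow> K +> x = K \<longleftrightarrow> x \<in> K"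
    "K +> \<zero> = K"
proof -
  interpret K: abelian_subgroup K M by (rule sm_abelian_subgroup[OF K])
  note k = smD[OF K]
  show "x \<in> carrier M \<Longrightarrow> K +> x \<in> carrier (quotient_module M K)"
    unfolding quotient_module_def A_RCOSETS_def' by auto
  show "X \<in> carrier (quotient_module M K) \<Longrightarrow> \<exists>x\<in>carrier M. X = K +> x"
    unfolding quotient_module_def A_RCOSETS_def' by auto
  show "x \<in> carrier M \<Longrightarrow> y \<in> carrier M \<Longrightarrow> (K +> x) \<oplus>\<^bsub>quotient_module M K\<^esub> (K +> y) = K +> (x \<oplus> y)"
    unfolding quotient_module_def using K.a_rcos_sum by simp
  have mem: "y \<in> K +> x \<longleftrightarrow> (\<exists>z\<in>K. y = z \<oplus> x)" for x y by (auto simp: a_r_coset_def')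
  show z: "K +> \<zero> = K" using k(5) by (force simp: a_r_coset_def')
  show eq: "x \<in> carrier M \<Longrightarrow> K +> x = K \<longleftrightarrow> x \<in> K" for x
    using K.a_rcos_const[of x] K.a_rcos_self[of x] by blast
  have shift: "K +> (z \<oplus> x) = K +> x" if "z \<in> K" "x \<in> carrier M" for z x
  proof (rule K.a_repr_independence'[symmetric])
    show "z \<oplus> x \<in> K +> x" unfolding mem by (rule bexI[OF refl that(1)])
  qed (rule that(2))
  assume f: "f \<in> carrier P" and x: "x \<in> carrier M"
  have "K +> cls f \<odot>\<^bsub>M\<^esub> y = K +> act f x" if yx: "y \<in> K +> x" for y
  proof -
    obtain z where z: "z \<in> K" "y = z \<oplus> x" using yx[unfolded mem] by (rule bexE)
    have zM: "z \<in> carrier M" by (rule k(5)[OF z(1)])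
    have "act f y = act f z \<oplus> act f x" unfolding z(2) by (rule act_add[OF f zM x])
    then have "cls f \<odot> y = act f z \<oplus> act f x" by (simp only: smult_act[OF f])
    moreover have "K +> (act f z \<oplus> act f x) = K +> act f x"
      by (rule shift[OF k(4)[OF f z(1)] act_closed[OF f x]])
    ultimately show ?thesis by (simp only:)
  qed
  moreover have "x \<in> K +> x" using K.a_rcos_self[OF x] .
  ultimately show "cls f \<odot>\<^bsub>quotient_module M K\<^esub> (K +> x) = K +> act f x"
    unfolding quotient_module_def by auto
qed

end

locale fd_family = preproj I E \<Omega> for I :: "'v set" and E and \<Omega> +
  fixes Q :: "'v \<Rightarrow> 'v preproj_mod"
  assumes Q_fd: "i \<in> I \<Longrightarrow> fd_module I \<Omega> (Q i)"
begin

lemma Q_lam: "i \<in> I \<Longrightarrow> lam_mod I E \<Omega> (Q i)"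
  by (intro lam_mod.intro preproj_axioms lam_mod_axioms.intro Q_fd)

abbreviation sigQ :: "'v \<Rightarrow> 'v list \<Rightarrow> (nat \<Rightarrow> complex) set" where
  "sigQ j u \<equiv> lam_mod.sig I \<Omega> (Q j) u {\<zero>\<^bsub>Q j\<^esub>}"

text \<open>The maps \<open>f a\<close> exhibit \<open>T\<close> as the internal direct sum of quotients of the modules \<open>Q\<^sub>j\<close>. Describing the
  quotients by maps out of \<open>Q\<^sub>j\<close> with prescribed kernels avoids iterated quotient modules, whose
  elements have ever growing types. Labels of zero quotients are kept.\<close>

definition summand_maps :: "'v preproj_mod \<Rightarrow> 'v list \<Rightarrow> ('v \<times> 'v list \<Rightarrow> (nat \<Rightarrow> complex) \<Rightarrow> nat \<Rightarrow> complex) \<Rightarrow> bool" where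
  "summand_maps T ws f \<longleftrightarrow>
    (\<forall>a\<in>labels I ws. f a \<in> module_hom \<Lambda> (Q (fst a)) T \<and>
       {x \<in> carrier (Q (fst a)). f a x = \<zero>\<^bsub>T\<^esub>} = sigQ (fst a) (snd a)) \<and>
    (\<forall>x\<in>carrier T. \<exists>y\<in>Pi (labels I ws) (\<lambda>a. carrier (Q (fst a))). x = (\<Oplus>\<^bsub>T\<^esub>a\<in>labels I ws. f a (y a))) \<and>
    (\<forall>y\<in>Pi (labels I ws) (\<lambda>a. carrier (Q (fst a))). (\<Oplus>\<^bsub>T\<^esub>a\<in>labels I ws. f a (y a)) = \<zero>\<^bsub>T\<^esub> \<longrightarrow>
       (\<forall>a\<in>labels I ws. f a (y a) = \<zero>\<^bsub>T\<^esub>))"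

text \<open>The step of the recursion, with the direct sum replaced by maps \<open>p\<close> and \<open>r\<close> into \<open>M\<close>. The kernel of \<open>p\<close>
  is the isotypic part of the socle, and its preimage under \<open>f a\<close> is the next saturation of the kernel of
  \<open>f a\<close>. The images of the \<open>p \<circ> f a\<close> remain independent because a sum lies in the kernel of \<open>p\<close>
  only if each of its terms does.\<close>

lemma summand_maps_step:
  assumes N: "lam_mod I E \<Omega> N" and M: "lam_mod I E \<Omega> M" and i: "i \<in> I" and ws: "set ws \<subseteq> I"
    and f: "summand_maps N ws f"
    and p: "p \<in> module_hom \<Lambda> N M" "\<And>n. n \<in> carrier N \<Longrightarrow> p n = \<zero>\<^bsub>M\<^esub> \<longleftrightarrow> n \<in> lam_mod.satur I \<Omega> N {i} {\<zero>\<^bsub>N\<^esub>}"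
    and r: "r \<in> module_hom \<Lambda> (Q i) M" "\<And>q. q \<in> carrier (Q i) \<Longrightarrow> r q = \<zero>\<^bsub>M\<^esub> \<Longrightarrow> q = \<zero>\<^bsub>Q i\<^esub>"
    and span: "\<And>x. x \<in> carrier M \<Longrightarrow> \<exists>n\<in>carrier N. \<exists>q\<in>carrier (Q i). x = p n \<oplus>\<^bsub>M\<^esub> r q"
    and ind: "\<And>n q. n \<in> carrier N \<Longrightarrow> q \<in> carrier (Q i) \<Longrightarrow> p n \<oplus>\<^bsub>M\<^esub> r q = \<zero>\<^bsub>M\<^esub> \<Longrightarrow> p n = \<zero>\<^bsub>M\<^esub> \<and> r q = \<zero>\<^bsub>M\<^esub>"
  shows "\<exists>g. summand_maps M (i # ws) g"
proof -
  interpret N: lam_mod I E \<Omega> N by fact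
  interpret M: lam_mod I E \<Omega> M by fact
  interpret Qi: lam_mod I E \<Omega> "Q i" by (rule Q_lam[OF i])
  interpret p: lam_hom I E \<Omega> N M p by (rule N.hom_lam_hom[OF M p(1)])
  interpret r: lam_hom I E \<Omega> "Q i" M r by (rule Qi.hom_lam_hom[OF M r(1)])
  define B where "B = labels I ws"
  have fB: "finite B" unfolding B_def by (rule finite_labels[OF finite_I])
  have BI: "fst a \<in> I" if "a \<in> B" for a using labels_in[OF ws] that by (simp add: B_def)
  define push where "push = (\<lambda>(j, u). (j :: 'v, i # u))"
  have inj: "inj_on push B" by (auto simp: inj_on_def push_def)
  have B': "labels I (i # ws) = insert (i, []) (push ` B)" by (simp add: B_def push_def)
  have new: "(i, []) \<notin> push ` B" by (auto simp: push_def)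
  have push_simps: "fst (push a) = fst a" "snd (push a) = i # snd a" for a by (auto simp: push_def split: prod.splits)
  define g where "g a = (if snd a = [] then r else p \<circ> f (fst a, tl (snd a)))" for a :: "'v \<times> 'v list"
  have g: "g (i, []) = r" "g (push a) = p \<circ> f a" for a by (simp_all add: g_def push_simps)
  have fh: "f a \<in> module_hom \<Lambda> (Q (fst a)) N" if "a \<in> B" for a using f that by (simp add: summand_maps_def B_def)
  have fker: "{x \<in> carrier (Q (fst a)). f a x = \<zero>\<^bsub>N\<^esub>} = sigQ (fst a) (snd a)" if "a \<in> B" for a
    using f that by (simp add: summand_maps_def B_def)
  have fl: "lam_hom I E \<Omega> (Q (fst a)) N (f a)" if "a \<in> B" for a
    using lam_mod.hom_lam_hom[OF Q_lam[OF BI[OF that]] N fh[OF that]] .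
  have fc: "f a x \<in> carrier N" if "a \<in> B" "x \<in> carrier (Q (fst a))" for a x
    using lam_hom.h_closed[OF fl[OF that(1)] that(2)] .
  have sum: "(\<Oplus>\<^bsub>M\<^esub>a\<in>labels I (i # ws). g a (y a)) = r (y (i, [])) \<oplus>\<^bsub>M\<^esub> p (\<Oplus>\<^bsub>N\<^esub>a\<in>B. f a (y (push a)))"
    if y: "y \<in> Pi (labels I (i # ws)) (\<lambda>a. carrier (Q (fst a)))" for y
  proof -
    have y0: "y (i, []) \<in> carrier (Q i)" using y B' by (auto simp: Pi_iff)
    have yB: "y (push a) \<in> carrier (Q (fst a))" if "a \<in> B" for a
      using y B' that push_simps(1)[of a] by (metis (no_types, lifting) Pi_mem imageI insertI2)
    have c: "(\<lambda>a. f a (y (push a))) \<in> B \<rightarrow> carrier N" using fc yB by blast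
    have gc: "(\<lambda>a. g a (y a)) \<in> push ` B \<rightarrow> carrier M"
    proof
      fix a assume "a \<in> push ` B"
      then obtain b where b: "b \<in> B" "a = push b" by blast
      show "g a (y a) \<in> carrier M" unfolding b(2) g(2) comp_def by (intro p.h_closed fc b(1) yB)
    qed
    have "(\<Oplus>\<^bsub>M\<^esub>a\<in>labels I (i # ws). g a (y a)) = g (i, []) (y (i, [])) \<oplus>\<^bsub>M\<^esub> (\<Oplus>\<^bsub>M\<^esub>a\<in>push ` B. g a (y a))"
      unfolding B' using fB new gc y0 g(1) by (intro M.M.finsum_insert) auto
    also have "(\<Oplus>\<^bsub>M\<^esub>a\<in>push ` B. g a (y a)) = (\<Oplus>\<^bsub>M\<^esub>a\<in>B. g (push a) (y (push a)))"
      by (rule M.M.finsum_reindex[OF gc inj])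
    also have "\<dots> = p (\<Oplus>\<^bsub>N\<^esub>a\<in>B. f a (y (push a)))"
      unfolding g(2) comp_def by (rule p.h_finsum[OF fB c, symmetric])
    finally show ?thesis by (simp add: g(1))
  qed
  have "summand_maps M (i # ws) g" unfolding summand_maps_def
  proof (intro conjI ballI impI)
    fix a assume "a \<in> labels I (i # ws)"
    then consider "a = (i, [])" | b where "b \<in> B" "a = push b" unfolding B' by blast
    then have "g a \<in> module_hom \<Lambda> (Q (fst a)) M \<and>
      {x \<in> carrier (Q (fst a)). g a x = \<zero>\<^bsub>M\<^esub>} = sigQ (fst a) (snd a)"
    proof cases
      case 1
      have "{x \<in> carrier (Q i). r x = \<zero>\<^bsub>M\<^esub>} = {\<zero>\<^bsub>Q i\<^esub>}"
        using r(2) r.h_zero Qi.M.zero_closed by blast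
      then show ?thesis using 1 g(1) r(1) by simp
    next
      case 2
      interpret Qb: lam_mod I E \<Omega> "Q (fst b)" by (rule Q_lam[OF BI[OF 2(1)]])
      interpret fb: lam_hom I E \<Omega> "Q (fst b)" N "f b" by (rule fl[OF 2(1)])
      have h: "g a \<in> module_hom \<Lambda> (Q (fst a)) M"
        unfolding 2(2) g(2) push_simps
        by (rule Qb.homI[OF M]) (auto simp: fb.h_add p.h_add fb.h_act p.h_act)
      have "{x \<in> carrier (Q (fst a)). g a x = \<zero>\<^bsub>M\<^esub>} = {x \<in> carrier (Q (fst b)). f b x \<in> N.satur {i} {\<zero>\<^bsub>N\<^esub>}}"
        unfolding 2(2) g(2) push_simps using p(2) by auto
      also have "\<dots> = Qb.satur {i} {x \<in> carrier (Q (fst b)). f b x \<in> {\<zero>\<^bsub>N\<^esub>}}" by (rule fb.vimage_satur)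
      also have "\<dots> = sigQ (fst a) (snd a)" using fker[OF 2(1)] by (simp add: 2(2) push_simps)
      finally show ?thesis using h by blast
    qed
    then show "g a \<in> module_hom \<Lambda> (Q (fst a)) M"
      "{x \<in> carrier (Q (fst a)). g a x = \<zero>\<^bsub>M\<^esub>} = sigQ (fst a) (snd a)" by blast+
  next
    fix x assume x: "x \<in> carrier M"
    obtain n q where nq: "n \<in> carrier N" "q \<in> carrier (Q i)" "x = p n \<oplus>\<^bsub>M\<^esub> r q" using span[OF x] by blast
    obtain y where y: "y \<in> Pi B (\<lambda>a. carrier (Q (fst a)))" "n = (\<Oplus>\<^bsub>N\<^esub>a\<in>B. f a (y a))"
      using f nq(1) unfolding summand_maps_def B_def by blast
    define z where "z a = (if snd a = [] then q else y (fst a, tl (snd a)))" for a :: "'v \<times> 'v list"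
    have z: "z (i, []) = q" "z (push a) = y a" for a by (simp_all add: z_def push_simps)
    have zP: "z \<in> Pi (labels I (i # ws)) (\<lambda>a. carrier (Q (fst a)))"
      unfolding B' using nq(2) y(1) z push_simps by (auto simp: Pi_iff)
    have "x = (\<Oplus>\<^bsub>M\<^esub>a\<in>labels I (i # ws). g a (z a))"
      unfolding sum[OF zP] z using y(2) nq by (simp add: M.M.a_comm)
    then show "\<exists>y\<in>Pi (labels I (i # ws)) (\<lambda>a. carrier (Q (fst a))). x = (\<Oplus>\<^bsub>M\<^esub>a\<in>labels I (i # ws). g a (y a))"
      using zP by blast
  next
    fix y a assume y: "y \<in> Pi (labels I (i # ws)) (\<lambda>a. carrier (Q (fst a)))"
      and s0: "(\<Oplus>\<^bsub>M\<^esub>a\<in>labels I (i # ws). g a (y a)) = \<zero>\<^bsub>M\<^esub>" and a: "a \<in> labels I (i # ws)"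
    have y0: "y (i, []) \<in> carrier (Q i)" using y B' by (auto simp: Pi_iff)
    have yB: "y (push a) \<in> carrier (Q (fst a))" if "a \<in> B" for a
      using y B' that push_simps(1)[of a] by (metis (no_types, lifting) Pi_mem imageI insertI2)
    define n where "n = (\<Oplus>\<^bsub>N\<^esub>a\<in>B. f a (y (push a)))"
    have c: "(\<lambda>a. f a (y (push a))) \<in> B \<rightarrow> carrier N" using fc yB by blast
    have nN: "n \<in> carrier N" unfolding n_def by (rule N.M.finsum_closed[OF c])
    have "p n \<oplus>\<^bsub>M\<^esub> r (y (i, [])) = \<zero>\<^bsub>M\<^esub>" using s0 sum[OF y] nN y0 by (simp add: n_def M.M.a_comm)
    then have pn: "p n = \<zero>\<^bsub>M\<^esub>" "r (y (i, [])) = \<zero>\<^bsub>M\<^esub>" using ind[OF nN y0] by auto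
    have ns: "n \<in> N.satur {i} {\<zero>\<^bsub>N\<^esub>}" using p(2)[OF nN] pn(1) by simp
    have fs: "f b (y (push b)) \<in> N.satur {i} {\<zero>\<^bsub>N\<^esub>}" if b: "b \<in> B" for b
    proof -
      have "N.act (ve k \<otimes>\<^bsub>P\<^esub> h) (f b (y (push b))) \<in> {\<zero>\<^bsub>N\<^esub>}" if h: "h \<in> carrier P" "k \<in> I - {i}" for h k
      proof -
        define m where "m = ve k \<otimes>\<^bsub>P\<^esub> h"
        have mP: "m \<in> carrier P" using h by (simp add: m_def)
        define z where "z a = lam_mod.act I \<Omega> (Q (fst a)) m (y (push a))" for a
        have zP: "z \<in> Pi B (\<lambda>a. carrier (Q (fst a)))"
          unfolding z_def using lam_mod.act_closed[OF Q_lam[OF BI] mP] yB by blast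
        have fz: "f a (z a) = N.act m (f a (y (push a)))" if "a \<in> B" for a
          unfolding z_def by (rule lam_hom.h_act[OF fl[OF that] mP yB[OF that]])
        have "(\<Oplus>\<^bsub>N\<^esub>a\<in>B. f a (z a)) = (\<Oplus>\<^bsub>N\<^esub>a\<in>B. N.act m (f a (y (push a))))"
        proof (rule N.M.finsum_cong'[OF refl])
          show "(\<lambda>a. N.act m (f a (y (push a)))) \<in> B \<rightarrow> carrier N"
            by (intro Pi_I N.act_closed mP funcset_mem[OF c])
        qed (rule fz)
        also have "\<dots> = N.act m n" unfolding n_def by (rule N.act_finsum[OF mP fB c, symmetric])
        also have "\<dots> = \<zero>\<^bsub>N\<^esub>" using ns h by (simp add: N.satur_def m_def)
        finally have z0: "(\<Oplus>\<^bsub>N\<^esub>a\<in>B. f a (z a)) = \<zero>\<^bsub>N\<^esub>" .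
        have "f b (z b) = \<zero>\<^bsub>N\<^esub>"
          using conjunct2[OF conjunct2[OF f[unfolded summand_maps_def]], folded B_def] zP z0 b by (elim ballE impE) auto
        then show ?thesis using fz[OF b] by (simp add: m_def)
      qed
      then show ?thesis unfolding N.satur_def using funcset_mem[OF c b] by blast
    qed
    consider "a = (i, [])" | b where "b \<in> B" "a = push b" using a unfolding B' by blast
    then show "g a (y a) = \<zero>\<^bsub>M\<^esub>"
    proof cases
      case 1
      then show ?thesis using g(1) pn(2) by simp
    next
      case 2
      then show ?thesis unfolding 2(2) g(2) comp_def using p(2)[OF funcset_mem[OF c 2(1)]] fs[OF 2(1)] by simp
    qed
  qed
  then show ?thesis by blast
qed

lemma summand_maps_Nil:
  assumes T: "lam_mod I E \<Omega> T" and iso: "module_iso \<Lambda> T (direct_sum I Q)"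
  shows "\<exists>f. summand_maps T [] f"
proof -
  interpret T: lam_mod I E \<Omega> T by fact
  let ?D = "direct_sum I Q"
  obtain g where g: "g \<in> module_hom \<Lambda> T ?D" "bij_betw g (carrier T) (carrier ?D)"
    using iso unfolding module_iso_def by blast
  define w where "w = the_inv_into (carrier T) g"
  note w = T.iso_inverse[OF g, folded w_def]
  have D: "carrier ?D = (\<Pi>\<^sub>E k\<in>I. carrier (Q k))" "d \<oplus>\<^bsub>?D\<^esub> e = (\<lambda>k\<in>I. d k \<oplus>\<^bsub>Q k\<^esub> e k)"
    "a \<odot>\<^bsub>?D\<^esub> d = (\<lambda>k\<in>I. a \<odot>\<^bsub>Q k\<^esub> d k)" for a d e
    by (simp_all add: direct_sum_def)
  define e where "e j q = (\<lambda>k\<in>I. if k = j then q else \<zero>\<^bsub>Q k\<^esub>)" for j q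
  have eD: "e j q \<in> carrier ?D" if "j \<in> I" "q \<in> carrier (Q j)" for j q
    using that Q_lam lam_mod.smD(2)[OF Q_lam lam_mod.sm_carrier[OF Q_lam]] by (auto simp: D e_def)
  define f where "f a = w \<circ> e (fst a)" for a :: "'v \<times> 'v list"
  have labels: "labels I [] = (\<lambda>j. (j, [])) ` I" by simp
  have proj: "(\<lambda>x. g x k) \<in> module_hom \<Lambda> T (Q k)" if k: "k \<in> I" for k
    using g(1) k unfolding module_hom_def by (auto simp: D Pi_iff PiE_iff)
  have pf: "g (f (j, u) q) k = (if k = j then q else \<zero>\<^bsub>Q k\<^esub>)" if "j \<in> I" "k \<in> I" "q \<in> carrier (Q j)" for j k q u
    using w(2)[OF eD[OF that(1,3)]] that(2) by (simp add: f_def e_def)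
  have fc: "f (j, u) q \<in> carrier T" if "j \<in> I" "q \<in> carrier (Q j)" for j u q
    using w(1)[OF eD[OF that]] by (simp add: f_def)
  have fin: "finite (labels I [])" by (rule finite_labels[OF finite_I])
  have psum: "g (\<Oplus>\<^bsub>T\<^esub>a\<in>labels I []. f a (y a)) k = y (k, [])"
    if y: "y \<in> Pi (labels I []) (\<lambda>a. carrier (Q (fst a)))" and k: "k \<in> I" for y k
  proof -
    interpret Qk: lam_mod I E \<Omega> "Q k" by (rule Q_lam[OF k])
    interpret h: lam_hom I E \<Omega> T "Q k" "\<lambda>x. g x k" by (rule T.hom_lam_hom[OF Qk.lam_mod_axioms proj[OF k]])
    have yc: "y (j, []) \<in> carrier (Q j)" if "j \<in> I" for j using y that by (auto simp: Pi_iff)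
    have "g (\<Oplus>\<^bsub>T\<^esub>a\<in>labels I []. f a (y a)) k = (\<Oplus>\<^bsub>Q k\<^esub>a\<in>labels I []. g (f a (y a)) k)"
      by (rule h.h_finsum[OF fin]) (use fc yc in auto)
    also have "\<dots> = (\<Oplus>\<^bsub>Q k\<^esub>a\<in>labels I []. if (k, []) = a then y a else \<zero>\<^bsub>Q k\<^esub>)"
      by (rule Qk.M.finsum_cong') (use pf[OF _ k] yc k in auto)
    also have "\<dots> = y (k, [])"
    proof -
      have "(\<Oplus>\<^bsub>Q k\<^esub>a\<in>labels I []. if (k, []) = a then y (k, []) else \<zero>\<^bsub>Q k\<^esub>) = y (k, [])"
        using Qk.M.finsum_singleton[of "(k, [])" "labels I []" "\<lambda>_. y (k, [])"] k fin yc[OF k] by simp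
      moreover have "(\<lambda>a. if (k, []) = a then y a else \<zero>\<^bsub>Q k\<^esub>) = (\<lambda>a. if (k, []) = a then y (k, []) else \<zero>\<^bsub>Q k\<^esub>)"
        by auto
      ultimately show ?thesis by (simp only:)
    qed
    finally show ?thesis .
  qed
  have sumc: "(\<Oplus>\<^bsub>T\<^esub>a\<in>labels I []. f a (y a)) \<in> carrier T"
    if y: "y \<in> Pi (labels I []) (\<lambda>a. carrier (Q (fst a)))" for y
    by (rule T.M.finsum_closed) (use y fc in \<open>auto simp: Pi_iff\<close>)
  have hom: "f (j, u) \<in> module_hom \<Lambda> (Q j) T" if j: "j \<in> I" for j u
  proof -
    interpret Qj: lam_mod I E \<Omega> "Q j" by (rule Q_lam[OF j])
    have z: "\<zero>\<^bsub>Q k\<^esub> \<oplus>\<^bsub>Q k\<^esub> \<zero>\<^bsub>Q k\<^esub> = \<zero>\<^bsub>Q k\<^esub>" if "k \<in> I" for k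
    proof -
      interpret Qk: lam_mod I E \<Omega> "Q k" by (rule Q_lam[OF that])
      show ?thesis by simp
    qed
    have za: "cls h \<odot>\<^bsub>Q k\<^esub> \<zero>\<^bsub>Q k\<^esub> = \<zero>\<^bsub>Q k\<^esub>" if "k \<in> I" "h \<in> carrier P" for k h
    proof -
      interpret Qk: lam_mod I E \<Omega> "Q k" by (rule Q_lam[OF that(1)])
      show ?thesis using that(2) by (simp add: Qk.smult_act)
    qed
    have e_add: "e j (q \<oplus>\<^bsub>Q j\<^esub> q') = e j q \<oplus>\<^bsub>?D\<^esub> e j q'" for q q'
      unfolding D e_def by (rule restrict_ext) (simp add: z)
    have e_act: "e j (Qj.act h q) = cls h \<odot>\<^bsub>?D\<^esub> e j q" if "h \<in> carrier P" "q \<in> carrier (Q j)" for h q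
      unfolding D e_def by (rule restrict_ext) (use that in \<open>simp add: za flip: Qj.smult_act\<close>)
    show "f (j, u) \<in> module_hom \<Lambda> (Q j) T"
    proof (rule Qj.homI[OF T])
      show "f (j, u) q \<in> carrier T" if "q \<in> carrier (Q j)" for q using fc[OF j that] .
      show "f (j, u) (q \<oplus>\<^bsub>Q j\<^esub> q') = f (j, u) q \<oplus>\<^bsub>T\<^esub> f (j, u) q'" if "q \<in> carrier (Q j)" "q' \<in> carrier (Q j)" for q q'
        unfolding f_def comp_def fst_conv e_add by (rule w(4)) (use that eD j in auto)
      show "f (j, u) (Qj.act h q) = T.act h (f (j, u) q)" if "h \<in> carrier P" "q \<in> carrier (Q j)" for h q
        unfolding f_def comp_def fst_conv e_act[OF that] by (rule w(5)) (use that eD j in auto)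
    qed
  qed
  have "summand_maps T [] f" unfolding summand_maps_def
  proof (intro conjI ballI impI)
    fix a assume "a \<in> labels I []"
    then obtain j where j: "j \<in> I" "a = (j, [])" by auto
    interpret Qj: lam_mod I E \<Omega> "Q j" by (rule Q_lam[OF j(1)])
    interpret fa: lam_hom I E \<Omega> "Q j" T "f a" unfolding j(2) by (rule Qj.hom_lam_hom[OF T hom[OF j(1)]])
    show "f a \<in> module_hom \<Lambda> (Q (fst a)) T"
      using hom[OF j(1)] j(2) by simp
    have "q = \<zero>\<^bsub>Q j\<^esub>" if q: "q \<in> carrier (Q j)" "f a q = \<zero>\<^bsub>T\<^esub>" for q
    proof -
      have "f a q = f a \<zero>\<^bsub>Q j\<^esub>" using q(2) fa.h_zero by simp
      then have "g (f (j, []) q) j = g (f (j, []) \<zero>\<^bsub>Q j\<^esub>) j" using j(2) by simp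
      then show ?thesis using pf[OF j(1) j(1)] q(1) by simp
    qed
    then show "{x \<in> carrier (Q (fst a)). f a x = \<zero>\<^bsub>T\<^esub>} = sigQ (fst a) (snd a)"
      using fa.h_zero j(2) by auto
  next
    fix x assume x: "x \<in> carrier T"
    have gx: "g x \<in> carrier ?D" using g(1) x by (auto simp: module_hom_def)
    define y where "y a = g x (fst a)" for a :: "'v \<times> 'v list"
    have y: "y \<in> Pi (labels I []) (\<lambda>a. carrier (Q (fst a)))" using gx by (auto simp: y_def D)
    have "g (\<Oplus>\<^bsub>T\<^esub>a\<in>labels I []. f a (y a)) = g x"
    proof (rule PiE_ext)
      show "g (\<Oplus>\<^bsub>T\<^esub>a\<in>labels I []. f a (y a)) \<in> (\<Pi>\<^sub>E k\<in>I. carrier (Q k))"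
        using g(1) sumc[OF y] by (auto simp: module_hom_def simp flip: D(1))
      show "g x \<in> (\<Pi>\<^sub>E k\<in>I. carrier (Q k))" using gx D(1) by simp
      show "g (\<Oplus>\<^bsub>T\<^esub>a\<in>labels I []. f a (y a)) k = g x k" if "k \<in> I" for k
        using psum[OF y that] by (simp add: y_def)
    qed
    then have "x = (\<Oplus>\<^bsub>T\<^esub>a\<in>labels I []. f a (y a))" using w(3)[OF x] w(3)[OF sumc[OF y]] by simp
    then show "\<exists>y\<in>Pi (labels I []) (\<lambda>a. carrier (Q (fst a))). x = (\<Oplus>\<^bsub>T\<^esub>a\<in>labels I []. f a (y a))" using y by blast
  next
    fix y a assume y: "y \<in> Pi (labels I []) (\<lambda>a. carrier (Q (fst a)))"
      and s0: "(\<Oplus>\<^bsub>T\<^esub>a\<in>labels I []. f a (y a)) = \<zero>\<^bsub>T\<^esub>" and a: "a \<in> labels I []"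
    obtain j where j: "j \<in> I" "a = (j, [])" using a by auto
    interpret Qj: lam_mod I E \<Omega> "Q j" by (rule Q_lam[OF j(1)])
    interpret h: lam_hom I E \<Omega> T "Q j" "\<lambda>x. g x j" by (rule T.hom_lam_hom[OF Qj.lam_mod_axioms proj[OF j(1)]])
    have y0: "y (j, []) = \<zero>\<^bsub>Q j\<^esub>" using psum[OF y j(1)] s0 h.h_zero by simp
    interpret fj: lam_hom I E \<Omega> "Q j" T "f (j, [])" by (rule Qj.hom_lam_hom[OF T hom[OF j(1)]])
    show "f a (y a) = \<zero>\<^bsub>T\<^esub>" using y0 fj.h_zero j(2) by simp
  qed
  then show ?thesis by blast
qed


lemma summand_maps_Cons:
  assumes N: "lam_mod I E \<Omega> N" and M: "lam_mod I E \<Omega> M" and i: "i \<in> I" and ws: "set ws \<subseteq> I"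
    and f: "summand_maps N ws f" and iso: "module_iso \<Lambda> M (direct_sum2 (E_dagger I \<Omega> i N) (Q i))"
  shows "\<exists>g. summand_maps M (i # ws) g"
proof -
  interpret N: lam_mod I E \<Omega> N by fact
  interpret M: lam_mod I E \<Omega> M by fact
  interpret Qi: lam_mod I E \<Omega> "Q i" by (rule Q_lam[OF i])
  define K where "K = N.satur {i} {\<zero>\<^bsub>N\<^esub>}"
  have K: "N.sm K" unfolding K_def by (rule N.satur_sm[OF N.sm_zero])
  note q = N.quotient_facts[OF K]
  let ?X = "quotient_module N K" and ?c = "a_r_coset N K"
  have E: "E_dagger I \<Omega> i N = ?X" by (simp add: E_dagger_def Let_def N.isotypic_socle[OF i] K_def)
  let ?D = "direct_sum2 ?X (Q i)"
  have z: "\<zero>\<^bsub>?X\<^esub> = K" by (simp add: quotient_module_def)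
  have D: "carrier ?D = carrier ?X \<times> carrier (Q i)"
    "(a, b) \<oplus>\<^bsub>?D\<^esub> (a', b') = (a \<oplus>\<^bsub>?X\<^esub> a', b \<oplus>\<^bsub>Q i\<^esub> b')"
    "h \<odot>\<^bsub>?D\<^esub> (a, b) = (h \<odot>\<^bsub>?X\<^esub> a, h \<odot>\<^bsub>Q i\<^esub> b)" for a b a' b' h
    by (simp_all add: direct_sum2_def)
  obtain g where g: "g \<in> module_hom \<Lambda> M ?D" "bij_betw g (carrier M) (carrier ?D)"
    using iso unfolding module_iso_def E by blast
  define w where "w = the_inv_into (carrier M) g"
  note w = M.iso_inverse[OF g, folded w_def]
  define p where "p n = w (?c n, \<zero>\<^bsub>Q i\<^esub>)" for n
  define r where "r x = w (K, x)" for x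
  have Kc: "K \<in> carrier ?X" using q(1)[OF N.M.zero_closed] q(6) by simp
  have pD: "(?c n, \<zero>\<^bsub>Q i\<^esub>) \<in> carrier ?D" if "n \<in> carrier N" for n using q(1)[OF that] by (simp add: D)
  have rD: "(K, x) \<in> carrier ?D" if "x \<in> carrier (Q i)" for x using Kc that by (simp add: D)
  have K_add: "K \<oplus>\<^bsub>?X\<^esub> K = K" using q(3)[OF N.M.zero_closed N.M.zero_closed] q(6) by simp
  have c_K: "?c n \<oplus>\<^bsub>?X\<^esub> K = ?c n" if "n \<in> carrier N" for n
    using q(3)[OF that N.M.zero_closed] q(6) that by simp
  have K_act: "cls h \<odot>\<^bsub>?X\<^esub> K = K" if "h \<in> carrier P" for h
    using q(4)[OF that N.M.zero_closed] q(6) that by simp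
  have p_hom: "p \<in> module_hom \<Lambda> N M"
  proof (rule N.homI[OF M])
    show "p n \<in> carrier M" if "n \<in> carrier N" for n unfolding p_def by (rule w(1)[OF pD[OF that]])
    show "p (n \<oplus>\<^bsub>N\<^esub> n') = p n \<oplus>\<^bsub>M\<^esub> p n'" if "n \<in> carrier N" "n' \<in> carrier N" for n n'
      unfolding p_def w(4)[OF pD[OF that(1)] pD[OF that(2)], symmetric] D q(3)[OF that] by simp
    show "p (N.act h n) = M.act h (p n)" if "h \<in> carrier P" "n \<in> carrier N" for h n
      unfolding p_def w(5)[OF that(1) pD[OF that(2)], symmetric] D q(4)[OF that] 
      using that(1) by (simp add: Qi.smult_act)
  qed
  have r_hom: "r \<in> module_hom \<Lambda> (Q i) M"
  proof (rule Qi.homI[OF M])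
    show "r x \<in> carrier M" if "x \<in> carrier (Q i)" for x unfolding r_def by (rule w(1)[OF rD[OF that]])
    show "r (x \<oplus>\<^bsub>Q i\<^esub> y) = r x \<oplus>\<^bsub>M\<^esub> r y" if "x \<in> carrier (Q i)" "y \<in> carrier (Q i)" for x y
      unfolding r_def w(4)[OF rD[OF that(1)] rD[OF that(2)], symmetric] D K_add ..
    show "r (Qi.act h x) = M.act h (r x)" if "h \<in> carrier P" "x \<in> carrier (Q i)" for h x
      unfolding r_def w(5)[OF that(1) rD[OF that(2)], symmetric] D K_act[OF that(1)] Qi.smult_act[OF that(1)] ..
  qed
  have pr: "p n \<oplus>\<^bsub>M\<^esub> r x = w (?c n, x)" if "n \<in> carrier N" "x \<in> carrier (Q i)" for n x
    unfolding p_def r_def w(4)[OF pD[OF that(1)] rD[OF that(2)], symmetric] D c_K[OF that(1)]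
    using that(2) by simp
  interpret p: lam_hom I E \<Omega> N M p by (rule N.hom_lam_hom[OF M p_hom])
  interpret r: lam_hom I E \<Omega> "Q i" M r by (rule Qi.hom_lam_hom[OF M r_hom])
  have w0: "w (K, \<zero>\<^bsub>Q i\<^esub>) = \<zero>\<^bsub>M\<^esub>" using r.h_zero by (simp add: r_def)
  have zero: "n \<in> K \<and> x = \<zero>\<^bsub>Q i\<^esub>" if n: "n \<in> carrier N" "x \<in> carrier (Q i)" and e: "w (?c n, x) = \<zero>\<^bsub>M\<^esub>" for n x
  proof -
    have "(?c n, x) \<in> carrier ?D" using q(1)[OF n(1)] n(2) by (simp add: D)
    then have "(?c n, x) = g (w (?c n, x))" by (rule w(2)[symmetric])
    also have "\<dots> = g (w (K, \<zero>\<^bsub>Q i\<^esub>))" unfolding e w0 ..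
    also have "\<dots> = (K, \<zero>\<^bsub>Q i\<^esub>)" by (rule w(2)[OF rD[OF Qi.M.zero_closed]])
    finally show ?thesis using q(5)[OF n(1)] by simp
  qed
  have p0: "p n = \<zero>\<^bsub>M\<^esub> \<longleftrightarrow> n \<in> K" if n: "n \<in> carrier N" for n
  proof
    show "p n = \<zero>\<^bsub>M\<^esub> \<Longrightarrow> n \<in> K" using zero[OF n Qi.M.zero_closed] by (simp add: p_def)
    show "n \<in> K \<Longrightarrow> p n = \<zero>\<^bsub>M\<^esub>" using q(5)[OF n] w0 by (simp add: p_def)
  qed
  show ?thesis
  proof (rule summand_maps_step[OF N M i ws f p_hom p0[unfolded K_def] r_hom])
    show "x = \<zero>\<^bsub>Q i\<^esub>" if "x \<in> carrier (Q i)" "r x = \<zero>\<^bsub>M\<^esub>" for x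
      using zero[OF N.M.zero_closed that(1)] that(2) q(6) by (simp add: r_def)
    show "\<exists>n\<in>carrier N. \<exists>x\<in>carrier (Q i). m = p n \<oplus>\<^bsub>M\<^esub> r x" if m: "m \<in> carrier M" for m
    proof -
      have gm: "g m \<in> carrier ?D" using g(1) m by (auto simp: module_hom_def)
      then obtain X x where Xx: "g m = (X, x)" "X \<in> carrier ?X" "x \<in> carrier (Q i)" unfolding D by blast
      obtain n where n: "n \<in> carrier N" "X = ?c n" using q(2)[OF Xx(2)] by blast
      have "m = p n \<oplus>\<^bsub>M\<^esub> r x" unfolding pr[OF n(1) Xx(3)] using w(3)[OF m] Xx(1) n(2) by simp
      then show ?thesis using n(1) Xx(3) by blast
    qed
    show "p n = \<zero>\<^bsub>M\<^esub> \<and> r x = \<zero>\<^bsub>M\<^esub>" if "n \<in> carrier N" "x \<in> carrier (Q i)" "p n \<oplus>\<^bsub>M\<^esub> r x = \<zero>\<^bsub>M\<^esub>" for n x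
      using zero[OF that(1,2)] that(3) p0[OF that(1)] unfolding pr[OF that(1,2)] by simp
  qed
qed

lemma T_dagger_summand_maps:
  "T_dagger I \<Omega> Q ws T \<Longrightarrow> set ws \<subseteq> I \<Longrightarrow> lam_mod I E \<Omega> T \<and> (\<exists>f. summand_maps T ws f)"
proof (induction ws arbitrary: T)
  case Nil
  then have T: "lam_mod I E \<Omega> T"
    by (intro lam_mod.intro preproj_axioms lam_mod_axioms.intro) simp
  show ?case using summand_maps_Nil[OF T] Nil T by simp
next
  case (Cons i ws)
  then have T: "lam_mod I E \<Omega> T"
    by (intro lam_mod.intro preproj_axioms lam_mod_axioms.intro) simp
  from Cons.prems(1) obtain N where N: "T_dagger I \<Omega> Q ws N"
    and iso: "module_iso \<Lambda> T (direct_sum2 (E_dagger I \<Omega> i N) (Q i))" by auto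
  have i: "i \<in> I" "set ws \<subseteq> I" using Cons.prems(2) by auto
  have "lam_mod I E \<Omega> N" and "\<exists>f. summand_maps N ws f" using Cons.IH[OF N i(2)] by auto
  then show ?case using summand_maps_Cons[OF _ T i _ iso] T by blast
qed

end

section \<open>Images of a module with a unique maximal submodule\<close>

lemma module_iso_refl: "module_iso R M M"
proof -
  have "id \<in> module_hom R M M" by (simp add: module_hom_def)
  then show ?thesis unfolding module_iso_def by (rule bexI[rotated]) simp
qed

lemma module_iso_trans: assumes "module_iso R A B" "module_iso R B C" shows "module_iso R A C"
proof -
  obtain f g where f: "f \<in> module_hom R A B" "bij_betw f (carrier A) (carrier B)"
    and g: "g \<in> module_hom R B C" "bij_betw g (carrier B) (carrier C)"
    using assms unfolding module_iso_def by auto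
  have fc: "f x \<in> carrier B" if "x \<in> carrier A" for x using f(1) that by (auto simp: module_hom_def)
  have "g \<circ> f \<in> module_hom R A C" using f(1) g(1) fc by (simp add: module_hom_def Pi_iff)
  then show ?thesis unfolding module_iso_def using bij_betw_trans[OF f(2) g(2)] by blast
qed

lemma (in lam_mod) iso_sym:
  fixes D :: "('v preproj, 'd) module"
  assumes "module_iso \<Lambda> M D" shows "module_iso \<Lambda> D M"
proof -
  obtain g where g: "g \<in> module_hom \<Lambda> M D" "bij_betw g (carrier M) (carrier D)"
    using assms unfolding module_iso_def by blast
  define w where "w = the_inv_into (carrier M) g"
  note w = iso_inverse[OF g, folded w_def]
  have "w (a \<odot>\<^bsub>D\<^esub> d) = a \<odot>\<^bsub>M\<^esub> w d" if a: "a \<in> carrier \<Lambda>" and d: "d \<in> carrier D" for a d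
  proof -
    obtain f where f: "f \<in> carrier P" "a = cls f" using a unfolding \<Lambda>_carrier by auto
    show ?thesis unfolding f(2) w(5)[OF f(1) d] smult_act[OF f(1)] ..
  qed
  then have "w \<in> module_hom \<Lambda> D M" using w(1,4) by (simp add: module_hom_def)
  moreover have "bij_betw w (carrier D) (carrier M)" unfolding w_def by (rule bij_betw_the_inv_into[OF g(2)])
  ultimately show ?thesis unfolding module_iso_def by blast
qed

context lam_hom begin

text \<open>The classes in \<open>M/Z\<close> of the vectors of \<open>\<sigma> i Z\<close> are its socle vectors at \<open>i\<close>.\<close>

lemma socle_image:
  assumes Z: "{x \<in> carrier M. h x = \<zero>\<^bsub>N\<^esub>} = Z" and y: "y \<in> M.\<sigma> i Z" "y \<notin> Z" and i: "i \<in> I"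
  shows "h y \<in> carrier N" "h y \<noteq> \<zero>\<^bsub>N\<^esub>" "N.act (M.ve i) (h y) = h y" "N.act (M.Out i) (h y) = \<zero>\<^bsub>N\<^esub>"
proof -
  have "M.sm Z" using ker_sm Z by simp
  then have yc: "y \<in> carrier M" using M.smD(1)[OF M.satur_sm] y(1) by blast
  then show "h y \<noteq> \<zero>\<^bsub>N\<^esub>" using y(2) Z by blast
  have "h y \<in> N.\<sigma> i {\<zero>\<^bsub>N\<^esub>}" using vimage_satur[of "{i}" "{\<zero>\<^bsub>N\<^esub>}"] Z y(1) by auto
  then show "h y \<in> carrier N" "N.act (M.ve i) (h y) = h y" "N.act (M.Out i) (h y) = \<zero>\<^bsub>N\<^esub>"
    using N.\<sigma>0_iff[OF i] by auto
qed

end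

locale lam_surj = lam_hom + assumes surj: "h ` carrier M = carrier N"

lemma (in lam_hom) onto_image: "lam_surj I E \<Omega> M (restrict_module N (h ` carrier M)) h"
proof -
  have sm: "N.sm (h ` carrier M)" by (rule image_sm[OF M.sm_carrier])
  have "h \<in> module_hom M.\<Lambda> M (restrict_module N (h ` carrier M))" using hom by (auto simp: module_hom_def)
  then have "lam_hom I E \<Omega> M (restrict_module N (h ` carrier M)) h"
    by (rule M.hom_lam_hom[OF N.sub_lam_mod[OF sm]])
  then show ?thesis by (intro lam_surj.intro lam_surj_axioms.intro) simp_all
qed

context lam_surj begin

lemma image_vimage: assumes "N.sm Y" shows "h ` {x \<in> carrier M. h x \<in> Y} = Y"
proof
  show "h ` {x \<in> carrier M. h x \<in> Y} \<subseteq> Y" by blast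
  show "Y \<subseteq> h ` {x \<in> carrier M. h x \<in> Y}"
  proof
    fix y assume y: "y \<in> Y"
    then have "y \<in> h ` carrier M" using surj N.smD(1)[OF assms] by blast
    then show "y \<in> h ` {x \<in> carrier M. h x \<in> Y}" using y by blast
  qed
qed

lemma vimage_proper: assumes "N.sm Y" "Y \<noteq> carrier N" shows "{x \<in> carrier M. h x \<in> Y} \<noteq> carrier M"
  using image_vimage[OF assms(1)] surj assms(2) by metis

context
  fixes R
  assumes R: "M.sm R" "R \<noteq> carrier M" and proper: "\<And>Y. M.sm Y \<Longrightarrow> Y \<noteq> carrier M \<Longrightarrow> Y \<subseteq> R"
    and nz: "carrier N \<noteq> {\<zero>\<^bsub>N\<^esub>}"
begin

text \<open>The preimages of two proper summands would lie in the maximal submodule \<open>R\<close> and together span \<open>M\<close>.\<close>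

lemma local_indecomposable: "indecomposable M.\<Lambda> N"
  unfolding indecomposable_def
proof (intro conjI nz allI impI)
  fix X X' assume c: "complementary M.\<Lambda> N X X'"
  then have X: "N.sm X" "N.sm X'" "X \<inter> X' = {\<zero>\<^bsub>N\<^esub>}" "set_add N X X' = carrier N"
    by (auto simp: complementary_def)
  define Y where "Y = {x \<in> carrier M. h x \<in> X}"
  define Y' where "Y' = {x \<in> carrier M. h x \<in> X'}"
  have Y: "M.sm Y" "M.sm Y'" unfolding Y_def Y'_def by (rule vimage_sm[OF X(1)] vimage_sm[OF X(2)])+
  show "X = {\<zero>\<^bsub>N\<^esub>} \<or> X' = {\<zero>\<^bsub>N\<^esub>}"
  proof (rule ccontr)
    assume "\<not> ?thesis"
    then have "X \<noteq> carrier N" "X' \<noteq> carrier N"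
      using X(3) N.smD(1)[OF X(1)] N.smD(1)[OF X(2)] by blast+
    then have sub: "Y \<subseteq> R" "Y' \<subseteq> R"
      using proper[OF Y(1)] proper[OF Y(2)] vimage_proper[OF X(1)] vimage_proper[OF X(2)]
      unfolding Y_def Y'_def by blast+
    have "carrier M \<subseteq> R"
    proof
      fix x assume x: "x \<in> carrier M"
      have "h x \<in> set_add N X X'" using X(4) x by simp
      then obtain a b where ab: "a \<in> X" "b \<in> X'" "h x = a \<oplus>\<^bsub>N\<^esub> b" unfolding set_add_def' by auto
      have "a \<in> h ` Y" "b \<in> h ` Y'"
        unfolding Y_def Y'_def image_vimage[OF X(1)] image_vimage[OF X(2)] by (rule ab(1), rule ab(2))
      then obtain y y' where y: "y \<in> Y" "y' \<in> Y'" "a = h y" "b = h y'" by blast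
      have yc: "y \<in> carrier M" "y' \<in> carrier M" using y by (auto simp: Y_def Y'_def)
      define z where "z = x \<ominus>\<^bsub>M\<^esub> y'"
      have zc: "z \<in> carrier M" using x yc by (simp add: z_def)
      have "h z = h x \<ominus>\<^bsub>N\<^esub> h y'" unfolding z_def by (rule h_diff[OF x yc(2)])
      also have "\<dots> = h y" unfolding ab(3) y(3,4) a_minus_def using yc by (simp add: N.M.a_assoc N.M.r_neg)
      finally have "z \<in> Y" using zc ab(1) y(3) by (simp add: Y_def)
      then have "z \<oplus>\<^bsub>M\<^esub> y' \<in> R" using sub y(2) M.smD(3)[OF R(1)] by blast
      moreover have "z \<oplus>\<^bsub>M\<^esub> y' = x" unfolding z_def a_minus_def using x yc by (simp add: M.M.a_assoc M.M.l_neg)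
      ultimately show "x \<in> R" by simp
    qed
    then show False using R M.smD(1)[OF R(1)] by blast
  qed
qed

text \<open>The quotient inherits the top of \<open>M\<close>. That the top is at \<open>i\<close> is expressed by a proper submodule
  containing all components away from \<open>i\<close>.\<close>

lemma top_image: assumes "carrier M \<subseteq> M.\<sigma> i R"
  shows "\<exists>X. N.sm X \<and> X \<noteq> carrier N \<and> carrier N \<subseteq> N.\<sigma> i X"
proof (intro exI conjI)
  show X: "N.sm (h ` R)" by (rule image_sm[OF R(1)])
  have ker: "{x \<in> carrier M. h x = \<zero>\<^bsub>N\<^esub>} \<subseteq> R"
  proof (rule proper[OF ker_sm])
    show "{x \<in> carrier M. h x = \<zero>\<^bsub>N\<^esub>} \<noteq> carrier M"
      using vimage_proper[OF N.sm_zero] nz by simp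
  qed
  show "h ` R \<noteq> carrier N"
  proof
    assume e: "h ` R = carrier N"
    have "carrier M \<subseteq> R"
    proof
      fix x assume x: "x \<in> carrier M"
      have "h x \<in> h ` R" using e x by simp
      then obtain y where y: "y \<in> R" "h x = h y" by blast
      have yc: "y \<in> carrier M" using M.smD(5)[OF R(1) y(1)] .
      have "h (x \<ominus>\<^bsub>M\<^esub> y) = h y \<ominus>\<^bsub>N\<^esub> h y" using h_diff[OF x yc] y(2) by (simp only:)
      also have "\<dots> = \<zero>\<^bsub>N\<^esub>" unfolding a_minus_def using yc by (simp add: N.M.r_neg)
      finally have "x \<ominus>\<^bsub>M\<^esub> y \<in> R" using ker x yc by auto
      then have "(x \<ominus>\<^bsub>M\<^esub> y) \<oplus>\<^bsub>M\<^esub> y \<in> R" using y(1) by (rule M.smD(3)[OF R(1)])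
      moreover have "(x \<ominus>\<^bsub>M\<^esub> y) \<oplus>\<^bsub>M\<^esub> y = x" unfolding a_minus_def using x yc by (simp add: M.M.a_assoc M.M.l_neg)
      ultimately show "x \<in> R" by simp
    qed
    then show False using R M.smD(1)[OF R(1)] by blast
  qed
  show "carrier N \<subseteq> N.\<sigma> i (h ` R)"
    unfolding N.sub_satur_iff[OF N.sm_carrier]
  proof (intro ballI)
    fix k y assume k: "k \<in> I - {i}" and "y \<in> carrier N"
    then obtain x where x: "x \<in> carrier M" "y = h x" using surj by blast
    have "M.act (M.ve k) x \<in> R" using assms k x(1) unfolding M.sub_satur_iff[OF M.sm_carrier] by blast
    moreover have "h (M.act (M.ve k) x) = N.act (M.ve k) y" using h_act[of "M.ve k" x] x k by simp
    ultimately show "N.act (M.ve k) y \<in> h ` R" by (metis imageI)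
  qed
qed

end

lemma top_preimage:
  assumes X: "N.sm X" "X \<noteq> carrier N" "carrier N \<subseteq> N.\<sigma> i X"
  shows "\<exists>Y. M.sm Y \<and> Y \<noteq> carrier M \<and> carrier M \<subseteq> M.\<sigma> i Y"
proof (intro exI conjI)
  show "M.sm {x \<in> carrier M. h x \<in> X}" by (rule vimage_sm[OF X(1)])
  show "{x \<in> carrier M. h x \<in> X} \<noteq> carrier M" by (rule vimage_proper[OF X(1,2)])
  show "carrier M \<subseteq> M.\<sigma> i {x \<in> carrier M. h x \<in> X}"
    unfolding vimage_satur[symmetric] using X(3) h_closed by blast
qed

end

section \<open>Submodules of sums of injective hulls\<close>

text \<open>The negatives in a direct sum are needed to recognize submodules of it.\<close>

lemma direct_sum_group:
  assumes "\<And>k. k \<in> A \<Longrightarrow> abelian_group (X k)" shows "abelian_group (direct_sum A X)"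
proof (rule abelian_groupI)
  note G = abelian_groupE[OF assms]
  note D = direct_sum_def
  show "x \<oplus>\<^bsub>direct_sum A X\<^esub> y \<in> carrier (direct_sum A X)"
    if "x \<in> carrier (direct_sum A X)" "y \<in> carrier (direct_sum A X)" for x y
    using that by (auto simp: D PiE_iff intro: G(1))
  show "\<zero>\<^bsub>direct_sum A X\<^esub> \<in> carrier (direct_sum A X)" using G(2) by (auto simp: D)
  show "x \<oplus>\<^bsub>direct_sum A X\<^esub> y \<oplus>\<^bsub>direct_sum A X\<^esub> z = x \<oplus>\<^bsub>direct_sum A X\<^esub> (y \<oplus>\<^bsub>direct_sum A X\<^esub> z)"
    if "x \<in> carrier (direct_sum A X)" "y \<in> carrier (direct_sum A X)" "z \<in> carrier (direct_sum A X)" for x y z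
    using that G(3) by (auto simp: D fun_eq_iff restrict_def PiE_iff)
  show "x \<oplus>\<^bsub>direct_sum A X\<^esub> y = y \<oplus>\<^bsub>direct_sum A X\<^esub> x"
    if "x \<in> carrier (direct_sum A X)" "y \<in> carrier (direct_sum A X)" for x y
    using that G(4) by (auto simp: D fun_eq_iff restrict_def PiE_iff)
  show "\<zero>\<^bsub>direct_sum A X\<^esub> \<oplus>\<^bsub>direct_sum A X\<^esub> x = x" if "x \<in> carrier (direct_sum A X)" for x
    using that G(5) by (auto simp: D fun_eq_iff restrict_def PiE_iff extensional_def)
  show "\<exists>y\<in>carrier (direct_sum A X). y \<oplus>\<^bsub>direct_sum A X\<^esub> x = \<zero>\<^bsub>direct_sum A X\<^esub>"
    if "x \<in> carrier (direct_sum A X)" for x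
  proof -
    have "\<forall>k\<in>A. \<exists>y\<in>carrier (X k). y \<oplus>\<^bsub>X k\<^esub> x k = \<zero>\<^bsub>X k\<^esub>" using that by (auto simp: D PiE_iff intro: G(6))
    then obtain y where "\<forall>k\<in>A. y k \<in> carrier (X k) \<and> y k \<oplus>\<^bsub>X k\<^esub> x k = \<zero>\<^bsub>X k\<^esub>" by metis
    then show ?thesis by (intro bexI[of _ "restrict y A"]) (auto simp: D)
  qed
qed

locale hull_family = preproj I E \<Omega> for I :: "'v set" and E and \<Omega> +
  fixes Q :: "'v \<Rightarrow> 'v preproj_mod" and N :: nat
  assumes dynkin: "dynkin_ADE I E"
    and bounded: "red v \<Longrightarrow> length v \<le> N"
    and hulls: "i \<in> I \<Longrightarrow> injective_hull I \<Omega> (simple_at i) (Q i)"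

sublocale hull_family \<subseteq> fd_family
  by (unfold_locales) (use hulls in \<open>auto simp: injective_hull_def injective_module_def\<close>)

context hull_family begin

lemma Q_hull: "i \<in> I \<Longrightarrow> inj_hull I E \<Omega> (Q i) i N"
  using Q_lam dynkin bounded hulls by (intro inj_hull.intro inj_hull_axioms.intro) auto

text \<open>Extend the embedding of the line through \<open>x\<close>, a copy of \<open>S\<^sub>i\<close>, into its injective hull.\<close>

lemma extend_socle_vector:
  fixes X :: "'v preproj_mod"
  assumes X: "lam_mod I E \<Omega> X" and i: "i \<in> I"
    and x: "x \<in> carrier X" "lam_mod.act I \<Omega> X (ve i) x = x" "lam_mod.act I \<Omega> X (Out i) x = \<zero>\<^bsub>X\<^esub>" "x \<noteq> \<zero>\<^bsub>X\<^esub>"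
  shows "\<exists>h\<in>module_hom \<Lambda> X (Q i). h x \<noteq> \<zero>\<^bsub>Q i\<^esub>"
proof -
  interpret X: lam_mod I E \<Omega> X by fact
  interpret Q: lam_mod I E \<Omega> "Q i" by (rule Q_lam[OF i])
  have sm: "X.sm (X.line x)" by (rule X.line_sm[OF x(1-3) i])
  let ?L = "restrict_module X (X.line x)"
  obtain \<iota> where \<iota>: "\<iota> \<in> module_hom \<Lambda> (simple_at i) (Q i)" "inj \<iota>"
    using hulls[OF i] unfolding injective_hull_def by (auto simp: simple_at_def)
  have \<iota>0: "\<iota> 0 = \<zero>\<^bsub>Q i\<^esub>"
  proof -
    have \<iota>_add: "\<forall>x y. \<iota> (x + y) = \<iota> x \<oplus>\<^bsub>Q i\<^esub> \<iota> y" and c: "\<iota> 0 \<in> carrier (Q i)"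
      using \<iota>(1) by (auto simp: module_hom_def simple_at_def)
    then show ?thesis using \<iota>_add[rule_format, of 0 0] by simp
  qed
  show ?thesis
  proof (rule X.line_iso[OF x i])
    fix \<phi> assume \<phi>: "\<phi> \<in> module_hom \<Lambda> ?L (simple_at i)" "bij_betw \<phi> (X.line x) UNIV" "\<And>c. \<phi> (X.sv c x) = c"
    have g: "\<iota> \<circ> \<phi> \<in> module_hom \<Lambda> ?L (Q i)"
      using \<phi>(1) \<iota>(1) by (simp add: module_hom_def Pi_iff)
    have incl: "id \<in> module_hom \<Lambda> ?L X" using X.smD(1)[OF sm] by (auto simp: module_hom_def)
    have inj: "\<forall>(X :: 'v preproj_mod) (Y :: 'v preproj_mod).
      \<forall>f \<in> module_hom \<Lambda> X Y. \<forall>g \<in> module_hom \<Lambda> X (Q i).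
        fd_module I \<Omega> X \<and> fd_module I \<Omega> Y \<and> inj_on f (carrier X) \<longrightarrow>
        (\<exists>h \<in> module_hom \<Lambda> Y (Q i). \<forall>x\<in>carrier X. h (f x) = g x)"
      using hulls[OF i] unfolding injective_hull_def injective_module_def by (elim conjE)
    have "\<exists>h \<in> module_hom \<Lambda> X (Q i). \<forall>z\<in>carrier ?L. h (id z) = (\<iota> \<circ> \<phi>) z"
      by (rule inj[rule_format, OF incl g]) (use X.sub_fd[OF sm] X.fd in simp)
    then obtain h where h: "h \<in> module_hom \<Lambda> X (Q i)" "\<forall>z\<in>carrier ?L. h (id z) = (\<iota> \<circ> \<phi>) z" by blast
    have x1: "X.sv 1 x = x" using x(1) by (rule X.C.s_one)
    have "x \<in> X.line x" using X.in_line(2)[OF x(1)] .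
    then have "h x = \<iota> (\<phi> (X.sv 1 x))" using h(2) x1 by simp
    also have "\<dots> = \<iota> 1" unfolding \<phi>(3) ..
    finally have hx: "h x = \<iota> 1" .
    have "h x \<noteq> \<zero>\<^bsub>Q i\<^esub>" unfolding hx \<iota>0[symmetric] using injD[OF \<iota>(2), of 1 0] by auto
    then show ?thesis using h(1) by blast
  qed
qed

text \<open>Choose finitely many maps to modules \<open>Q\<^sub>i\<close> with \<open>i \<in> J'\<close> whose common kernel has minimal dimension. If it
  were nonzero, a socle vector in it would provide a further map that makes it smaller. So the maps
  embed \<open>X\<close>.\<close>

lemma in_SubI:
  fixes X :: "'v preproj_mod"
  assumes X: "lam_mod I E \<Omega> X" and J: "J' \<subseteq> I"
    and soc: "\<And>Y. submodule Y \<Lambda> X \<Longrightarrow> Y \<noteq> {\<zero>\<^bsub>X\<^esub>} \<Longrightarrow> \<exists>i\<in>J'. \<exists>x\<in>Y. lam_mod.act I \<Omega> X (ve i) x = x \<and>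
      lam_mod.act I \<Omega> X (Out i) x = \<zero>\<^bsub>X\<^esub> \<and> x \<noteq> \<zero>\<^bsub>X\<^esub>"
  shows "in_Sub I \<Omega> (direct_sum J' Q) X"
proof -
  interpret X: lam_mod I E \<Omega> X by fact
  define ok where "ok \<Phi> \<longleftrightarrow> (\<forall>(i, h)\<in>set \<Phi>. i \<in> J' \<and> h \<in> module_hom \<Lambda> X (Q i))" for \<Phi>
  define ker where "ker \<Phi> = {x \<in> carrier X. \<forall>(i, h)\<in>set \<Phi>. h x = \<zero>\<^bsub>Q i\<^esub>}" for \<Phi> :: "('v \<times> ((nat \<Rightarrow> complex) \<Rightarrow> nat \<Rightarrow> complex)) list"
  have ker_Cons: "ker ((i, h) # \<Phi>) = {x \<in> carrier X. h x = \<zero>\<^bsub>Q i\<^esub>} \<inter> ker \<Phi>" for i h \<Phi>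
    by (auto simp: ker_def)
  have hl: "lam_hom I E \<Omega> X (Q i) h" if "i \<in> J'" "h \<in> module_hom \<Lambda> X (Q i)" for i h
    by (rule X.hom_lam_hom[OF Q_lam that(2)]) (use that J in auto)
  have ker_sm: "ok \<Phi> \<Longrightarrow> X.sm (ker \<Phi>)" for \<Phi>
  proof (induction \<Phi>)
    case Nil
    then show ?case using X.sm_carrier by (simp add: ker_def)
  next
    case (Cons a \<Phi>)
    obtain i h where a: "a = (i, h)" by (cases a)
    have "i \<in> J'" "h \<in> module_hom \<Lambda> X (Q i)" "ok \<Phi>" using Cons.prems by (auto simp: ok_def a)
    then show ?case unfolding a ker_Cons
      using X.sm_Int[OF lam_hom.ker_sm[OF hl] Cons.IH] by blast
  qed
  obtain \<Phi> where \<Phi>: "ok \<Phi>" "\<And>\<Psi>. ok \<Psi> \<Longrightarrow> X.C.cdim (ker \<Phi>) \<le> X.C.cdim (ker \<Psi>)"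
    using ex_has_least_nat[of ok "[]" "\<lambda>\<Phi>. X.C.cdim (ker \<Phi>)"] by (auto simp: ok_def)
  have ker0: "ker \<Phi> = {\<zero>\<^bsub>X\<^esub>}"
  proof (rule ccontr)
    assume "ker \<Phi> \<noteq> {\<zero>\<^bsub>X\<^esub>}"
    then obtain i x where x: "i \<in> J'" "x \<in> ker \<Phi>" "X.act (ve i) x = x" "X.act (Out i) x = \<zero>\<^bsub>X\<^esub>" "x \<noteq> \<zero>\<^bsub>X\<^esub>"
      using soc[OF ker_sm[OF \<Phi>(1)]] by blast
    have xc: "x \<in> carrier X" using x(2) by (simp add: ker_def)
    obtain h where h: "h \<in> module_hom \<Lambda> X (Q i)" "h x \<noteq> \<zero>\<^bsub>Q i\<^esub>"
      using extend_socle_vector[OF X _ xc x(3-5)] x(1) J by blast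
    have ok': "ok ((i, h) # \<Phi>)" using \<Phi>(1) x(1) h(1) by (simp add: ok_def)
    have sub: "ker ((i, h) # \<Phi>) \<subseteq> ker \<Phi>" unfolding ker_Cons by blast
    note c = X.sm_csub[OF ker_sm[OF ok']] X.sm_csub[OF ker_sm[OF \<Phi>(1)]]
    have "X.C.cdim (ker ((i, h) # \<Phi>)) = X.C.cdim (ker \<Phi>)"
      using X.C.cdim_psub(1)[OF c sub] \<Phi>(2)[OF ok'] by simp
    then have "ker ((i, h) # \<Phi>) = ker \<Phi>" by (rule X.C.cdim_psub(2)[OF c sub])
    then have "x \<in> ker ((i, h) # \<Phi>)" using x(2) by simp
    then show False using h(2) unfolding ker_Cons by blast
  qed
  define n where "n = length \<Phi>"
  let ?D = "direct_sum J' Q"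
  let ?S = "direct_sum {..<n} (\<lambda>_. ?D)"
  \<comment> \<open>The \<open>m\<close>-th map has a single target \<open>Q\<^sub>i\<close> and goes to the \<open>m\<close>-th copy of the direct sum.\<close>
  define e where "e x = (\<lambda>m\<in>{..<n}. \<lambda>j\<in>J'. if j = fst (\<Phi> ! m) then snd (\<Phi> ! m) x else \<zero>\<^bsub>Q j\<^esub>)" for x
  have mem: "fst (\<Phi> ! m) \<in> J'" "snd (\<Phi> ! m) \<in> module_hom \<Lambda> X (Q (fst (\<Phi> ! m)))" if "m < n" for m
  proof -
    have "(fst (\<Phi> ! m), snd (\<Phi> ! m)) \<in> set \<Phi>" using that by (simp add: n_def)
    then show "fst (\<Phi> ! m) \<in> J'" "snd (\<Phi> ! m) \<in> module_hom \<Lambda> X (Q (fst (\<Phi> ! m)))"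
      using \<Phi>(1) unfolding ok_def by blast+
  qed
  have QG: "abelian_group (Q j)" if "j \<in> J'" for j
  proof -
    interpret Qj: lam_mod I E \<Omega> "Q j" by (rule Q_lam) (use that J in auto)
    show ?thesis by (rule Qj.M.abelian_group_axioms)
  qed
  have SG: "abelian_group ?S" by (intro direct_sum_group QG)
  interpret S: abelian_group ?S by (rule SG)
  have e_hom: "e \<in> module_hom \<Lambda> X ?S"
  proof -
    have "e x \<in> carrier ?S" if "x \<in> carrier X" for x
    proof -
      have "snd (\<Phi> ! m) x \<in> carrier (Q (fst (\<Phi> ! m)))" if "m < n" for m
        using mem(2)[OF that] \<open>x \<in> carrier X\<close> by (auto simp: module_hom_def)
      then show ?thesis by (auto simp: e_def direct_sum_def abelian_groupE(2)[OF QG])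
    qed
    moreover have "e (x \<oplus>\<^bsub>X\<^esub> y) = e x \<oplus>\<^bsub>?S\<^esub> e y" if "x \<in> carrier X" "y \<in> carrier X" for x y
    proof -
      have "(if j = fst (\<Phi> ! m) then snd (\<Phi> ! m) (x \<oplus>\<^bsub>X\<^esub> y) else \<zero>\<^bsub>Q j\<^esub>) =
        (if j = fst (\<Phi> ! m) then snd (\<Phi> ! m) x else \<zero>\<^bsub>Q j\<^esub>) \<oplus>\<^bsub>Q j\<^esub>
        (if j = fst (\<Phi> ! m) then snd (\<Phi> ! m) y else \<zero>\<^bsub>Q j\<^esub>)" if mj: "m < n" "j \<in> J'" for m j
      proof (cases "j = fst (\<Phi> ! m)")
        case True
        then show ?thesis using mem(2)[OF mj(1)] \<open>x \<in> carrier X\<close> \<open>y \<in> carrier X\<close> by (simp add: module_hom_def)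
      next
        case False
        interpret Qj: abelian_group "Q j" by (rule QG[OF mj(2)])
        show ?thesis using False by simp
      qed
      then show ?thesis by (simp add: e_def direct_sum_def fun_eq_iff restrict_def)
    qed
    moreover have "e (a \<odot>\<^bsub>X\<^esub> x) = a \<odot>\<^bsub>?S\<^esub> e x" if "a \<in> carrier \<Lambda>" "x \<in> carrier X" for a x
    proof -
      have "(if j = fst (\<Phi> ! m) then snd (\<Phi> ! m) (a \<odot>\<^bsub>X\<^esub> x) else \<zero>\<^bsub>Q j\<^esub>) =
        a \<odot>\<^bsub>Q j\<^esub> (if j = fst (\<Phi> ! m) then snd (\<Phi> ! m) x else \<zero>\<^bsub>Q j\<^esub>)" if mj: "m < n" "j \<in> J'" for m j
      proof (cases "j = fst (\<Phi> ! m)")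
        case True
        then show ?thesis using mem(2)[OF mj(1)] \<open>x \<in> carrier X\<close> \<open>a \<in> carrier \<Lambda>\<close> by (simp add: module_hom_def)
      next
        case False
        interpret Qj: lam_mod I E \<Omega> "Q j" by (rule Q_lam) (use mj J in auto)
        obtain f where f: "f \<in> carrier P" "a = cls f" using \<open>a \<in> carrier \<Lambda>\<close> unfolding \<Lambda>_carrier by auto
        show ?thesis using False f(1) unfolding f(2) by (simp add: Qj.smult_act)
      qed
      then show ?thesis by (simp add: e_def direct_sum_def fun_eq_iff restrict_def)
    qed
    ultimately show ?thesis by (simp add: module_hom_def)
  qed
  have e_closed: "e x \<in> carrier ?S" if "x \<in> carrier X" for x using e_hom that by (auto simp: module_hom_def)
  have e_add: "e (x \<oplus>\<^bsub>X\<^esub> y) = e x \<oplus>\<^bsub>?S\<^esub> e y" if "x \<in> carrier X" "y \<in> carrier X" for x y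
    using e_hom that by (auto simp: module_hom_def)
  have e_act: "e (a \<odot>\<^bsub>X\<^esub> x) = a \<odot>\<^bsub>?S\<^esub> e x" if "a \<in> carrier \<Lambda>" "x \<in> carrier X" for a x
    using e_hom that by (auto simp: module_hom_def)
  have e_zero: "e \<zero>\<^bsub>X\<^esub> = \<zero>\<^bsub>?S\<^esub>"
  proof -
    have "e \<zero>\<^bsub>X\<^esub> = e \<zero>\<^bsub>X\<^esub> \<oplus>\<^bsub>?S\<^esub> e \<zero>\<^bsub>X\<^esub>" using e_add[OF X.M.zero_closed X.M.zero_closed] by simp
    then show ?thesis using e_closed[OF X.M.zero_closed] S.add.l_cancel_one' by simp
  qed
  have e_ker: "x = \<zero>\<^bsub>X\<^esub>" if x: "x \<in> carrier X" "e x = \<zero>\<^bsub>?S\<^esub>" for x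
  proof -
    have "h x = \<zero>\<^bsub>Q i\<^esub>" if ih: "(i, h) \<in> set \<Phi>" for i h
    proof -
      obtain m where m: "m < n" "\<Phi> ! m = (i, h)" using ih unfolding n_def in_set_conv_nth by blast
      have "e x m i = \<zero>\<^bsub>?S\<^esub> m i" using x(2) by simp
      then show ?thesis using m mem(1)[OF m(1)] by (simp add: e_def direct_sum_def)
    qed
    then have "x \<in> ker \<Phi>" using x(1) by (auto simp: ker_def)
    then show ?thesis using ker0 by simp
  qed
  have e_minus: "\<ominus>\<^bsub>?S\<^esub> e x = e (\<ominus>\<^bsub>X\<^esub> x)" if x: "x \<in> carrier X" for x
  proof (rule S.minus_equality)
    show "e (\<ominus>\<^bsub>X\<^esub> x) \<oplus>\<^bsub>?S\<^esub> e x = \<zero>\<^bsub>?S\<^esub>"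
      using e_add[OF X.M.a_inv_closed[OF x] x] x e_zero X.M.l_neg[OF x] by simp
  qed (use x e_closed in auto)
  have e_inj: "inj_on e (carrier X)"
  proof (rule inj_onI)
    fix x y assume xy: "x \<in> carrier X" "y \<in> carrier X" "e x = e y"
    have "e (x \<oplus>\<^bsub>X\<^esub> \<ominus>\<^bsub>X\<^esub> y) = e y \<oplus>\<^bsub>?S\<^esub> \<ominus>\<^bsub>?S\<^esub> e y"
      using e_add[OF xy(1) X.M.a_inv_closed[OF xy(2)]] e_minus[OF xy(2)] xy(3) by (simp only:)
    also have "\<dots> = \<zero>\<^bsub>?S\<^esub>" by (rule S.r_neg[OF e_closed[OF xy(2)]])
    finally have "x \<oplus>\<^bsub>X\<^esub> \<ominus>\<^bsub>X\<^esub> y = \<zero>\<^bsub>X\<^esub>" using e_ker xy by simp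
    then show "x = y" using X.M.minus_equality[of x "\<ominus>\<^bsub>X\<^esub> y"] xy by simp
  qed
  have sub: "submodule (e ` carrier X) \<Lambda> ?S"
  proof (intro submodule.intro subgroup.intro submodule_axioms.intro)
    show "e ` carrier X \<subseteq> carrier (add_monoid ?S)" using e_closed by auto
    show "\<one>\<^bsub>add_monoid ?S\<^esub> \<in> e ` carrier X" using imageI[OF X.M.zero_closed, of e] e_zero by simp
    show "a \<otimes>\<^bsub>add_monoid ?S\<^esub> b \<in> e ` carrier X" if ab: "a \<in> e ` carrier X" "b \<in> e ` carrier X" for a b
    proof -
      obtain x y where xy: "x \<in> carrier X" "y \<in> carrier X" "a = e x" "b = e y" using ab by blast
      have ab: "a \<otimes>\<^bsub>add_monoid ?S\<^esub> b = e (x \<oplus>\<^bsub>X\<^esub> y)" unfolding e_add[OF xy(1,2)] xy(3,4) by simp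
      show ?thesis unfolding ab by (rule imageI[OF X.M.a_closed[OF xy(1,2)]])
    qed
    show "inv\<^bsub>add_monoid ?S\<^esub> a \<in> e ` carrier X" if a: "a \<in> e ` carrier X" for a
    proof -
      obtain x where x: "x \<in> carrier X" "a = e x" using a by blast
      have inv: "inv\<^bsub>add_monoid ?S\<^esub> a = e (\<ominus>\<^bsub>X\<^esub> x)"
        unfolding x(2) by (rule e_minus[OF x(1), unfolded a_inv_def[of ?S]])
      show ?thesis unfolding inv by (rule imageI[OF X.M.a_inv_closed[OF x(1)]])
    qed
    show "a \<odot>\<^bsub>?S\<^esub> b \<in> e ` carrier X" if a: "a \<in> carrier \<Lambda>" and b: "b \<in> e ` carrier X" for a b
    proof -
      obtain x where x: "x \<in> carrier X" "b = e x" using b by blast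
      obtain f where f: "f \<in> carrier P" "a = cls f" using a unfolding \<Lambda>_carrier by auto
      have "a \<odot>\<^bsub>X\<^esub> x \<in> carrier X" using f x(1) by (simp add: X.smult_act)
      then show ?thesis unfolding x(2) e_act[OF a x(1), symmetric] by (rule imageI)
    qed
  qed
  have "e \<in> module_hom \<Lambda> X (restrict_module ?S (e ` carrier X))" using e_hom by (auto simp: module_hom_def)
  moreover have "bij_betw e (carrier X) (carrier (restrict_module ?S (e ` carrier X)))"
    using e_inj by (simp add: bij_betw_def)
  ultimately have "module_iso \<Lambda> X (restrict_module ?S (e ` carrier X))"
    unfolding module_iso_def by blast
  then show ?thesis unfolding in_Sub_def using X.fd sub by blast
qed

text \<open>All components of the image of such a vector are socle vectors at \<open>i\<close> of modules \<open>Q\<^sub>j\<close> with \<open>j \<noteq> i\<close>, hence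
  zero.\<close>

lemma in_SubD:
  fixes X :: "'v preproj_mod"
  assumes S: "in_Sub I \<Omega> (direct_sum J' Q) X" and J: "J' \<subseteq> I" and i: "i \<in> I" "i \<notin> J'"
    and x: "x \<in> carrier X" "lam_mod.act I \<Omega> X (ve i) x = x" "lam_mod.act I \<Omega> X (Out i) x = \<zero>\<^bsub>X\<^esub>"
  shows "x = \<zero>\<^bsub>X\<^esub>"
proof -
  have "fd_module I \<Omega> X" using S by (simp add: in_Sub_def)
  then interpret X: lam_mod I E \<Omega> X by unfold_locales
  let ?D = "direct_sum J' Q"
  obtain n :: nat and H where "submodule H \<Lambda> (direct_sum {..<n} (\<lambda>_. ?D))"
    "module_iso \<Lambda> X (restrict_module (direct_sum {..<n} (\<lambda>_. ?D)) H)"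
    using S unfolding in_Sub_def by (elim conjE exE)
  moreover define S where "S = direct_sum {..<n} (\<lambda>_. ?D)"
  ultimately have H: "submodule H \<Lambda> S" "module_iso \<Lambda> X (restrict_module S H)" by simp_all
  have HS: "H \<subseteq> carrier S" using subgroup.subset[OF submodule.axioms(1)[OF H(1)]] by simp
  obtain g where g: "g \<in> module_hom \<Lambda> X (restrict_module S H)" "bij_betw g (carrier X) H"
    using H(2) unfolding module_iso_def by auto
  have gS: "g y \<in> carrier S" if "y \<in> carrier X" for y using g(1) HS that by (auto simp: module_hom_def)
  have hom: "(\<lambda>y. g y m j) \<in> module_hom \<Lambda> X (Q j)" if "m < n" "j \<in> J'" for m j
    using g(1) gS that unfolding module_hom_def by (auto simp: S_def direct_sum_def PiE_iff)
  have comp: "g x m j = g \<zero>\<^bsub>X\<^esub> m j" if mj: "m < n" "j \<in> J'" for m j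
  proof -
    have jI: "j \<in> I" using mj J by blast
    interpret Qj: inj_hull I E \<Omega> "Q j" j N by (rule Q_hull[OF jI])
    interpret h: lam_hom I E \<Omega> X "Q j" "\<lambda>y. g y m j" by (rule X.hom_lam_hom[OF Qj.lam_mod_axioms hom[OF mj]])
    have "Qj.act (ve i) (g x m j) = g x m j" "Qj.act (Out i) (g x m j) = \<zero>\<^bsub>Q j\<^esub>"
      using h.h_act[of "ve i" x] h.h_act[of "Out i" x] x i h.h_zero by auto
    then have "g x m j \<in> Qj.\<sigma> i {\<zero>\<^bsub>Q j\<^esub>}" using Qj.\<sigma>0_iff[OF i(1)] h.h_closed[OF x(1)] by blast
    moreover have "Qj.\<sigma> i {\<zero>\<^bsub>Q j\<^esub>} = {\<zero>\<^bsub>Q j\<^esub>}"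
    proof (rule Qj.C.cdim_eq_0[OF Qj.sm_csub[OF Qj.satur_sm[OF Qj.sm_zero]]])
      have "Qj.\<sigma> i {\<zero>\<^bsub>Q j\<^esub>} = {x \<in> carrier (Q j). Qj.act (ve i) x = x \<and> Qj.act (Out i) x = \<zero>\<^bsub>Q j\<^esub>}"
        using Qj.\<sigma>0_iff[OF i(1)] by blast
      then show "Qj.C.cdim (Qj.\<sigma> i {\<zero>\<^bsub>Q j\<^esub>}) = 0" using Qj.socle_dim[OF i(1)] mj(2) i(2) by auto
    qed
    ultimately show ?thesis using h.h_zero by simp
  qed
  have PE: "g y \<in> (\<Pi>\<^sub>E m\<in>{..<n}. \<Pi>\<^sub>E j\<in>J'. carrier (Q j))" if "y \<in> carrier X" for y
    using gS[OF that] by (simp add: S_def direct_sum_def)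
  have "g x = g \<zero>\<^bsub>X\<^esub>"
  proof (rule PiE_ext[OF PE[OF x(1)] PE[OF X.M.zero_closed]])
    fix m assume m: "m \<in> {..<n}"
    show "g x m = g \<zero>\<^bsub>X\<^esub> m"
      by (rule PiE_ext[OF PiE_mem[OF PE[OF x(1)] m] PiE_mem[OF PE[OF X.M.zero_closed] m]])
        (use comp m in simp)
  qed
  then show ?thesis using g(2) x(1) X.M.zero_closed using inj_onD[OF bij_betw_imp_inj_on[OF g(2)]] by blast
qed

end

section \<open>Counting the summands\<close>

locale summand_family = hull_family I E \<Omega> Q N
  for I :: "'v set" and E and \<Omega> and Q :: "'v \<Rightarrow> 'v preproj_mod" and N :: nat +
  fixes T :: "'v preproj_mod" and ws :: "'v list" and f and \<pi> :: "'v \<Rightarrow> 'v"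
  assumes T: "lam_mod I E \<Omega> T" and fam: "summand_maps T ws f"
    and red_ws: "red ws" and maximal: "i \<in> I \<Longrightarrow> \<not> red (i # ws)"
    and \<pi>: "bij_betw \<pi> I I" "i \<in> I \<Longrightarrow> wp (rev ws) (\<alpha> i) = - \<alpha> (\<pi> i)"
begin

sublocale T: lam_mod I E \<Omega> T by (rule T)

abbreviation A where "A \<equiv> labels I ws"
abbreviation H where "H a \<equiv> f a ` carrier (Q (fst a))"
abbreviation L where "L a \<equiv> restrict_module T (H a)"

lemma ws_I: "set ws \<subseteq> I" using red_ws by (auto dest: red_letters)

lemma f_facts: assumes a: "a \<in> A"
  shows fst_I: "fst a \<in> I" and f_lam_hom: "lam_hom I E \<Omega> (Q (fst a)) T (f a)"
    and f_surj: "lam_surj I E \<Omega> (Q (fst a)) (L a) (f a)"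
    and H_sm: "T.sm (H a)"
    and f_ker: "{x \<in> carrier (Q (fst a)). f a x = \<zero>\<^bsub>T\<^esub>} = sigQ (fst a) (snd a)"
proof -
  show i: "fst a \<in> I" by (rule labels_in[OF ws_I a])
  have m: "f a \<in> module_hom \<Lambda> (Q (fst a)) T" using fam a by (simp add: summand_maps_def)
  show h: "lam_hom I E \<Omega> (Q (fst a)) T (f a)"
    by (rule lam_mod.hom_lam_hom[OF Q_lam[OF i] T m])
  show "lam_surj I E \<Omega> (Q (fst a)) (L a) (f a)" by (rule lam_hom.onto_image[OF h])
  show "T.sm (H a)" by (rule lam_hom.image_sm[OF h lam_mod.sm_carrier[OF Q_lam[OF i]]])
  show "{x \<in> carrier (Q (fst a)). f a x = \<zero>\<^bsub>T\<^esub>} = sigQ (fst a) (snd a)"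
    using fam a by (simp add: summand_maps_def)
qed

lemma direct_images: "T.direct A H"
  unfolding T.direct_def
proof (intro conjI ballI impI)
  show "finite A" by (rule finite_labels[OF finite_I])
  show "T.sm (H a)" if "a \<in> A" for a by (rule H_sm[OF that])
  show "\<exists>y\<in>Pi A H. x = (\<Oplus>\<^bsub>T\<^esub>a\<in>A. y a)" if x: "x \<in> carrier T" for x
  proof -
    obtain y where y: "y \<in> Pi A (\<lambda>a. carrier (Q (fst a)))" "x = (\<Oplus>\<^bsub>T\<^esub>a\<in>A. f a (y a))"
      using fam x unfolding summand_maps_def by blast
    show ?thesis 
    proof (rule bexI[where x = "\<lambda>a. f a (y a)"])
      show "(\<lambda>a. f a (y a)) \<in> Pi A H" by (intro Pi_I imageI) (use y(1) in \<open>auto simp: Pi_iff\<close>)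
    qed (rule y(2))
  qed
  fix y a assume y: "y \<in> Pi A H" and s: "(\<Oplus>\<^bsub>T\<^esub>a\<in>A. y a) = \<zero>\<^bsub>T\<^esub>" and a: "a \<in> A"
  have "\<forall>b\<in>A. \<exists>z. z \<in> carrier (Q (fst b)) \<and> y b = f b z" using y by (auto simp: Pi_iff)
  then obtain z where z: "\<forall>b\<in>A. z b \<in> carrier (Q (fst b)) \<and> y b = f b (z b)" by (rule bchoice[THEN exE])
  have zP: "z \<in> Pi A (\<lambda>a. carrier (Q (fst a)))" by (rule Pi_I) (use z in simp)
  have "(\<Oplus>\<^bsub>T\<^esub>a\<in>A. f a (z a)) = (\<Oplus>\<^bsub>T\<^esub>a\<in>A. y a)"
  proof (rule T.M.finsum_cong'[OF refl])
    show "y \<in> A \<rightarrow> carrier T" by (rule Pi_I) (use T.smD(5)[OF H_sm Pi_mem[OF y]] in blast)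
  qed (use z in auto)
  then have "(\<Oplus>\<^bsub>T\<^esub>a\<in>A. f a (z a)) = \<zero>\<^bsub>T\<^esub>" using s by simp
  then have "f a (z a) = \<zero>\<^bsub>T\<^esub>"
    using conjunct2[OF conjunct2[OF fam[unfolded summand_maps_def]]] zP a by (elim ballE impE) auto
  then show "y a = \<zero>\<^bsub>T\<^esub>" using z a by simp
qed

lemma H_nonzero: assumes "a \<in> A" shows "H a \<noteq> {\<zero>\<^bsub>T\<^esub>} \<longleftrightarrow> sigQ (fst a) (snd a) \<noteq> carrier (Q (fst a))"
proof -
  interpret h: lam_hom I E \<Omega> "Q (fst a)" T "f a" by (rule f_lam_hom[OF assms])
  have "H a = {\<zero>\<^bsub>T\<^esub>} \<longleftrightarrow> {x \<in> carrier (Q (fst a)). f a x = \<zero>\<^bsub>T\<^esub>} = carrier (Q (fst a))"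
  proof
    assume "{x \<in> carrier (Q (fst a)). f a x = \<zero>\<^bsub>T\<^esub>} = carrier (Q (fst a))"
    then have "f a x = \<zero>\<^bsub>T\<^esub>" if "x \<in> carrier (Q (fst a))" for x using that by blast
    moreover have "f a \<zero>\<^bsub>Q (fst a)\<^esub> \<in> H a" by (rule imageI[OF h.M.M.zero_closed])
    ultimately show "H a = {\<zero>\<^bsub>T\<^esub>}" by auto
  qed blast
  then show ?thesis unfolding f_ker[OF assms] by simp
qed

abbreviation summand where "summand k \<equiv> (ws ! k, take k ws)"

lemma ws_split: "k < length ws \<Longrightarrow> ws = take k ws @ ws ! k # drop (Suc k) ws"
  by (rule id_take_nth_drop)

lemma summand_in: "k < length ws \<Longrightarrow> summand k \<in> A" unfolding labels_iff by blast

text \<open>The kernel \<open>\<sigma>\<^sub>u 0\<close> is all of \<open>Q\<^sub>j\<close> if \<open>u = ws\<close>, but not if \<open>u\<close> is followed by \<open>j\<close> in a reduced word.\<close>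

lemma nonzero_iff: "a \<in> A \<and> H a \<noteq> {\<zero>\<^bsub>T\<^esub>} \<longleftrightarrow> (\<exists>k<length ws. a = summand k)"
proof
  assume a: "a \<in> A \<and> H a \<noteq> {\<zero>\<^bsub>T\<^esub>}"
  have "snd a \<noteq> ws"
  proof
    assume e: "snd a = ws"
    have j: "fst a \<in> I" using fst_I a by blast
    have "sigQ (fst a) (snd a) = carrier (Q (fst a))"
      unfolding e by (rule inj_hull.sig_full[OF Q_hull[OF j] red_ws maximal])
    then show False using a H_nonzero by blast
  qed
  then show "\<exists>k<length ws. a = summand k" using a labels_iff[of "fst a" "snd a" I ws] by (metis prod.collapse)
next
  assume "\<exists>k<length ws. a = summand k"
  then obtain k where k: "k < length ws" "a = summand k" by blast
  have j: "ws ! k \<in> I" using k ws_I by auto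
  have "sigQ (ws ! k) (take k ws) \<noteq> carrier (Q (ws ! k))"
    using inj_hull.sig_not_full[OF Q_hull[OF j], of "take k ws" "drop (Suc k) ws"] red_ws ws_split[OF k(1)] by simp
  then show "a \<in> A \<and> H a \<noteq> {\<zero>\<^bsub>T\<^esub>}" using H_nonzero[OF summand_in[OF k(1)]] summand_in[OF k(1)] k(2) by simp
qed

lemma radical:
  assumes "j \<in> I"
  obtains i where "i \<in> I" "\<pi> i = j" "lam_mod.\<rho> I \<Omega> (Q j) i (carrier (Q j)) \<noteq> carrier (Q j)"
    "submodule (lam_mod.\<rho> I \<Omega> (Q j) i (carrier (Q j))) \<Lambda> (Q j)"
    "\<And>Y. submodule Y \<Lambda> (Q j) \<Longrightarrow> Y \<noteq> carrier (Q j) \<Longrightarrow> Y \<subseteq> lam_mod.\<rho> I \<Omega> (Q j) i (carrier (Q j))"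
    "carrier (Q j) \<subseteq> lam_mod.satur I \<Omega> (Q j) {i} (lam_mod.\<rho> I \<Omega> (Q j) i (carrier (Q j)))"
proof -
  interpret Qj: inj_hull I E \<Omega> "Q j" j N by (rule Q_hull[OF assms])
  have "j \<in> \<pi> ` I" using assms bij_betw_imp_surj_on[OF \<pi>(1)] by simp
  then obtain i where i: "i \<in> I" "\<pi> i = j" by auto
  have inj: "inj_on \<pi> I" using \<pi>(1) by (simp add: bij_betw_def)
  note l = Qj.local_module[OF red_ws maximal \<pi>(2) inj i]
  have r: "Qj.sm (Qj.\<rho> i (carrier (Q j)))" by (rule Qj.\<rho>_sm[OF Qj.sm_carrier i(1)])
  show thesis
    by (rule that[OF i l(2) r l(1)]) (use Qj.\<rho>_\<sigma>_adjoint[OF Qj.sm_carrier r i(1)] in auto)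
qed

lemma indecomposable_summand: assumes a: "a \<in> A" "H a \<noteq> {\<zero>\<^bsub>T\<^esub>}" shows "indecomposable \<Lambda> (L a)"
proof (rule radical[OF fst_I[OF a(1)]])
  interpret h: lam_surj I E \<Omega> "Q (fst a)" "L a" "f a" by (rule f_surj[OF a(1)])
  fix i let ?R = "lam_mod.\<rho> I \<Omega> (Q (fst a)) i (carrier (Q (fst a)))"
  assume R: "?R \<noteq> carrier (Q (fst a))" "submodule ?R \<Lambda> (Q (fst a))"
    "\<And>Y. submodule Y \<Lambda> (Q (fst a)) \<Longrightarrow> Y \<noteq> carrier (Q (fst a)) \<Longrightarrow> Y \<subseteq> ?R"
  show ?thesis by (rule h.local_indecomposable[OF R(2,1,3)]) (use a(2) in simp_all)
qed

lemma kernels_increase: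
  assumes "k < l" "l < length ws" "ws ! k = ws ! l"
  shows "sigQ (ws ! k) (take k ws) \<subset> sigQ (ws ! k) (take l ws)"
proof -
  have j: "ws ! k \<in> I" using assms ws_I by auto
  have l: "take l ws = take k ws @ ws ! k # drop (Suc k) (take l ws)"
    using id_take_nth_drop[of k "take l ws"] assms by (simp add: min_def)
  have "red (take l ws @ drop l ws)" using red_ws by simp
  then have "red (take l ws)" by (rule red_appendD)
  then show ?thesis using inj_hull.sig_strict[OF Q_hull[OF j], of "take k ws" "drop (Suc k) (take l ws)"] l by simp
qed

text \<open>The tops determine \<open>j\<close>, and for the same \<open>j\<close> the kernels are strictly nested, so the dimensions differ.\<close>

lemma summands_distinct:
  assumes a: "a \<in> A" "H a \<noteq> {\<zero>\<^bsub>T\<^esub>}" and b: "b \<in> A" "H b \<noteq> {\<zero>\<^bsub>T\<^esub>}"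
    and iso: "module_iso \<Lambda> (L a) (L b)"
  shows "a = b"
proof -
  interpret Qa: inj_hull I E \<Omega> "Q (fst a)" "fst a" N by (rule Q_hull[OF fst_I[OF a(1)]])
  interpret Qb: inj_hull I E \<Omega> "Q (fst b)" "fst b" N by (rule Q_hull[OF fst_I[OF b(1)]])
  interpret fa: lam_surj I E \<Omega> "Q (fst a)" "L a" "f a" by (rule f_surj[OF a(1)])
  interpret fb: lam_surj I E \<Omega> "Q (fst b)" "L b" "f b" by (rule f_surj[OF b(1)])
  obtain g where g: "g \<in> module_hom \<Lambda> (L a) (L b)" "bij_betw g (H a) (H b)"
    using iso unfolding module_iso_def by auto
  interpret g: lam_hom I E \<Omega> "L a" "L b" g by (rule fa.N.hom_lam_hom[OF fb.N.lam_mod_axioms g(1)])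
  have "g \<circ> f a \<in> module_hom \<Lambda> (Q (fst a)) (L b)"
    using g(1) fa.hom by (simp add: module_hom_def Pi_iff)
  then have hom: "lam_hom I E \<Omega> (Q (fst a)) (L b) (g \<circ> f a)"
    by (rule Qa.hom_lam_hom[OF fb.N.lam_mod_axioms])
  have "(g \<circ> f a) ` carrier (Q (fst a)) = carrier (L b)"
    unfolding image_comp[symmetric] using g(2) by (simp add: bij_betw_def)
  then interpret ga: lam_surj I E \<Omega> "Q (fst a)" "L b" "g \<circ> f a"
    by (intro lam_surj.intro hom lam_surj_axioms.intro)
  define c where "c = fb.N.C.cdim (carrier (L b))"
  have fst_eq: "fst a = fst b"
  proof (rule radical[OF fst_I[OF a(1)]])
    fix i let ?R = "lam_mod.\<rho> I \<Omega> (Q (fst a)) i (carrier (Q (fst a)))"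
    assume i: "i \<in> I" "\<pi> i = fst a" and R: "?R \<noteq> carrier (Q (fst a))" "submodule ?R \<Lambda> (Q (fst a))"
      "\<And>Y. submodule Y \<Lambda> (Q (fst a)) \<Longrightarrow> Y \<noteq> carrier (Q (fst a)) \<Longrightarrow> Y \<subseteq> ?R"
      "carrier (Q (fst a)) \<subseteq> lam_mod.satur I \<Omega> (Q (fst a)) {i} ?R"
    have "\<exists>X. fb.N.sm X \<and> X \<noteq> carrier (L b) \<and> carrier (L b) \<subseteq> fb.N.\<sigma> i X"
      by (rule ga.top_image[OF R(2,1,3) _ R(4)]) (use b(2) in simp_all)
    then obtain X where X: "fb.N.sm X" "X \<noteq> carrier (L b)" "carrier (L b) \<subseteq> fb.N.\<sigma> i X" by blast
    obtain Y where Y: "Qb.sm Y" "Y \<noteq> carrier (Q (fst b))" "carrier (Q (fst b)) \<subseteq> Qb.\<sigma> i Y"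
      using fb.top_preimage[OF X] by blast
    have "Qb.\<rho> i (carrier (Q (fst b))) \<subseteq> Y" using Qb.\<rho>_\<sigma>_adjoint[OF Qb.sm_carrier Y(1) i(1)] Y(3) by simp
    then have "Qb.\<rho> i (carrier (Q (fst b))) \<noteq> carrier (Q (fst b))" using Y(2) Qb.smD(1)[OF Y(1)] by blast
    then have "\<pi> i = fst b" using Qb.top_vertex(1)[OF red_ws maximal \<pi>(2) i(1)] by blast
    then show ?thesis using i(2) by simp
  qed
  obtain k l where k: "k < length ws" "a = summand k" and l: "l < length ws" "b = summand l"
    using nonzero_iff a b by metis
  have "{x \<in> carrier (Q (fst a)). (g \<circ> f a) x = \<zero>\<^bsub>L b\<^esub>} = sigQ (fst a) (snd a)"
  proof -
    have "g (f a x) = \<zero>\<^bsub>L b\<^esub> \<longleftrightarrow> f a x = \<zero>\<^bsub>L a\<^esub>" if x: "x \<in> carrier (Q (fst a))" for x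
    proof
      assume "g (f a x) = \<zero>\<^bsub>L b\<^esub>"
      then have "g (f a x) = g \<zero>\<^bsub>L a\<^esub>" using g.h_zero by (simp only:)
      moreover have "f a x \<in> H a" "\<zero>\<^bsub>L a\<^esub> \<in> H a" using x fa.N.M.zero_closed by simp_all
      ultimately show "f a x = \<zero>\<^bsub>L a\<^esub>" using g(2) unfolding bij_betw_def inj_on_def by blast
    qed (use g.h_zero in \<open>simp only:\<close>)
    then show ?thesis using f_ker[OF a(1)] by auto
  qed
  then have d1: "Qa.C.cdim (carrier (Q (fst a))) =
      c + Qa.C.cdim (sigQ (fst a) (snd a))"
    using ga.rank[OF Qa.sm_carrier] ga.surj unfolding c_def by simp
  have "{x \<in> carrier (Q (fst b)). f b x = \<zero>\<^bsub>L b\<^esub>} = sigQ (fst b) (snd b)" using f_ker[OF b(1)] by simp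
  then have d2: "Qb.C.cdim (carrier (Q (fst b))) =
      c + Qb.C.cdim (sigQ (fst b) (snd b))"
    using fb.rank[OF Qb.sm_carrier] fb.surj unfolding c_def by simp
  have d: "Qa.C.cdim (sigQ (ws ! k) (take k ws)) = Qa.C.cdim (sigQ (ws ! k) (take l ws))"
    using d1 d2[folded fst_eq] k(2) l(2) by simp
  have jj: "ws ! k = ws ! l" using fst_eq k(2) l(2) by simp
  have sub: "Qa.C.csub (sigQ (ws ! k) u)" for u
    using Qa.sm_csub[OF Qa.sig_sm[OF Qa.sm_zero]] k(2) by simp
  have "\<not> k < l"
  proof
    assume kl: "k < l"
    have s: "sigQ (ws ! k) (take k ws) \<subset> sigQ (ws ! k) (take l ws)" by (rule kernels_increase[OF kl l(1) jj])
    then show False using Qa.C.cdim_psub(2)[OF sub sub _ d] by blast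
  qed
  moreover have "\<not> l < k"
  proof
    assume kl: "l < k"
    have s: "sigQ (ws ! k) (take l ws) \<subset> sigQ (ws ! k) (take k ws)"
      using kernels_increase[OF kl k(1)] jj by simp
    then show False using Qa.C.cdim_psub(2)[OF sub sub _ d[symmetric]] by blast
  qed
  ultimately show "a = b" using k(2) l(2) by (simp add: not_less)
qed

context
  fixes K :: "'v set" and m :: nat
  assumes K: "K \<subseteq> I" and m: "m \<le> length ws" and longest_K: "longest_element I E K (wp (take m ws))"
begin

lemma red_m: "red (take m ws)"
  using red_appendD(1)[of "take m ws" "drop m ws"] red_ws by simp

text \<open>The word \<open>take k ws\<close> starts with a reduced word of the longest element of the parabolic subgroup, so its
  submodule is closed under \<open>\<sigma> i\<close> for all \<open>i \<in> K\<close>, and the socle of the quotient lives outside \<open>K\<close>.\<close>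

lemma late_summand_in_Sub:
  assumes k: "k < length ws" "m \<le> k" shows "in_Sub I \<Omega> (direct_sum (I - K) Q) (L (summand k))"
proof -
  let ?j = "ws ! k" and ?h = "f (summand k)" and ?Z = "sigQ (ws ! k) (take k ws)"
  have j: "?j \<in> I" using k ws_I by auto
  interpret Qj: inj_hull I E \<Omega> "Q ?j" ?j N by (rule Q_hull[OF j])
  interpret h: lam_surj I E \<Omega> "Q ?j" "L (summand k)" ?h using f_surj[OF summand_in[OF k(1)]] by simp
  have ker: "{x \<in> carrier (Q ?j). ?h x = \<zero>\<^bsub>L (summand k)\<^esub>} = ?Z" using f_ker[OF summand_in[OF k(1)]] by simp
  have Zsm: "Qj.sm ?Z" by (rule Qj.sig_sm[OF Qj.sm_zero])
  have closed: "Qj.\<sigma> i ?Z = ?Z" if i: "i \<in> K" for i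
  proof -
    have "take k ws = take m ws @ drop m (take k ws)" using k by (metis append_take_drop_id min.absorb1 take_take)
    then have Z: "?Z = Qj.sig (take m ws) (Qj.sig (drop m (take k ws)) {\<zero>\<^bsub>Q ?j\<^esub>})"
      using Qj.sig_simps(3) by metis
    show ?thesis unfolding Z
      using Qj.sig_descent[OF Qj.sig_sm[OF Qj.sm_zero] red_m] i K longest_no_ascent(1)[OF longest_K red_m K i] by blast
  qed
  show ?thesis
  proof (rule in_SubI)
    show "lam_mod I E \<Omega> (L (summand k))" by (rule h.N.lam_mod_axioms)
    show "I - K \<subseteq> I" by blast
    fix Y assume Y: "h.N.sm Y" "Y \<noteq> {\<zero>\<^bsub>L (summand k)\<^esub>}"
    define Y' where "Y' = {x \<in> carrier (Q ?j). ?h x \<in> Y}"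
    have Y': "Qj.sm Y'" unfolding Y'_def by (rule h.vimage_sm[OF Y(1)])
    have sub: "?Z \<subseteq> Y'" unfolding Y'_def ker[symmetric] using h.N.smD(2)[OF Y(1)] by auto
    have "?Z \<noteq> Y'"
    proof
      assume e: "?Z = Y'"
      have "Y = ?h ` Y'" unfolding Y'_def by (rule h.image_vimage[OF Y(1), symmetric])
      then have "Y \<subseteq> {\<zero>\<^bsub>L (summand k)\<^esub>}" unfolding e[symmetric] ker[symmetric] by auto
      then show False using Y(2) h.N.smD(2)[OF Y(1)] by blast
    qed
    then obtain i y where y: "i \<in> I" "y \<in> Y'" "y \<in> Qj.\<sigma> i ?Z" "y \<notin> ?Z"
      using Qj.socle_step[OF Zsm Y'] sub by blast
    have "i \<notin> K" using closed y by blast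
    note s = h.socle_image[OF ker y(3,4,1)]
    have "?h y \<in> Y" using y(2) by (simp add: Y'_def)
    then show "\<exists>i\<in>I - K. \<exists>x\<in>Y. h.N.act (ve i) x = x \<and> h.N.act (Out i) x = \<zero>\<^bsub>L (summand k)\<^esub> \<and> x \<noteq> \<zero>\<^bsub>L (summand k)\<^esub>"
      using s y(1) \<open>i \<notin> K\<close> by blast
  qed
qed

text \<open>All letters up to position \<open>k\<close> lie in \<open>K\<close>, so the quotient has a socle vector at a vertex of \<open>K\<close>.\<close>

lemma early_summand_not_in_Sub:
  assumes k: "k < m" shows "\<not> in_Sub I \<Omega> (direct_sum (I - K) Q) (L (summand k))"
proof
  assume S: "in_Sub I \<Omega> (direct_sum (I - K) Q) (L (summand k))"
  let ?j = "ws ! k" and ?h = "f (summand k)" and ?Z = "sigQ (ws ! k) (take k ws)"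
  have kl: "k < length ws" using k m by simp
  have j: "?j \<in> I" using kl ws_I by auto
  interpret Qj: inj_hull I E \<Omega> "Q ?j" ?j N by (rule Q_hull[OF j])
  interpret h: lam_surj I E \<Omega> "Q ?j" "L (summand k)" ?h using f_surj[OF summand_in[OF kl]] by simp
  have ker: "{x \<in> carrier (Q ?j). ?h x = \<zero>\<^bsub>L (summand k)\<^esub>} = ?Z" using f_ker[OF summand_in[OF kl]] by simp
  have Zsm: "Qj.sm ?Z" by (rule Qj.sig_sm[OF Qj.sm_zero])
  have t: "take k ws @ [ws ! k] = take (Suc k) ws" using kl by (simp add: take_Suc_conv_app_nth)
  have "red (take (Suc k) ws)" using red_appendD(1)[of "take (Suc k) ws" "drop (Suc k) ws"] red_ws by simp
  moreover have "set (take (Suc k) ws) \<subseteq> K"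
  proof -
    have "set (take m ws) \<subseteq> K"
      by (rule parabolic_letters[OF _ red_m]) (use longest_K in \<open>simp add: longest_element_def\<close>)
    then show ?thesis using set_take_subset_set_take[of "Suc k" m ws] k by auto
  qed
  ultimately obtain i where i: "i \<in> K" "Qj.\<sigma> i ?Z \<noteq> ?Z"
    using Qj.parabolic_socle[of "take k ws" K] K t by auto
  obtain y where y: "y \<in> Qj.\<sigma> i ?Z" "y \<notin> ?Z" using i(2) Qj.satur_incl[OF Zsm, of "{i}"] by blast
  have iI: "i \<in> I" "i \<notin> I - K" using i(1) K by auto
  note s = h.socle_image[OF ker y iI(1)]
  have "?h y = \<zero>\<^bsub>L (summand k)\<^esub>" by (rule in_SubD[OF S _ iI s(1,3,4)]) blast
  then show False using s(2) by simp
qed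

text \<open>By Krull-Schmidt every indecomposable summand is isomorphic to one of the given ones, and these are
  pairwise non-isomorphic. Membership in the subcategory only depends on the isomorphism class.\<close>

lemma count_summands: "num_summands_in_Sub I \<Omega> (direct_sum (I - K) Q) T = length ws - m"
proof -
  let ?N = "direct_sum (I - K) Q"
  define \<H> where "\<H> = {X. direct_summand \<Lambda> T X \<and> indecomposable \<Lambda> (restrict_module T X) \<and>
    in_Sub I \<Omega> ?N (restrict_module T X)}"
  define R where "R = {(X, X') \<in> \<H> \<times> \<H>. module_iso \<Lambda> (restrict_module T X) (restrict_module T X')}"
  have \<H>_sm: "T.sm X" if "X \<in> \<H>" for X using that by (auto simp: \<H>_def direct_summand_def complementary_def)
  have iso_sym: "module_iso \<Lambda> (restrict_module T X') (restrict_module T X)"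
    if X: "X \<in> \<H>" and iso: "module_iso \<Lambda> (restrict_module T X) (restrict_module T X')" for X X'
    by (rule lam_mod.iso_sym[OF T.sub_lam_mod[OF \<H>_sm[OF X]] iso])
  have class_eq: "R `` {X} = R `` {X'}" if X: "X \<in> \<H>" "X' \<in> \<H>"
    and iso: "module_iso \<Lambda> (restrict_module T X) (restrict_module T X')" for X X'
    using module_iso_trans[OF iso] module_iso_trans[OF iso_sym[OF X(1) iso]] X unfolding R_def by blast
  define c where "c k = R `` {H (summand k)}" for k
  have in\<H>: "H (summand k) \<in> \<H>" if k: "k \<in> {m..<length ws}" for k
  proof -
    have a: "summand k \<in> A" "H (summand k) \<noteq> {\<zero>\<^bsub>T\<^esub>}" using nonzero_iff[of "summand k"] k by auto
    show ?thesis unfolding \<H>_def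
      using T.direct_summandI[OF direct_images a(1)] indecomposable_summand[OF a] late_summand_in_Sub[of k] k by auto
  qed
  have inj: "inj_on c {m..<length ws}"
  proof (rule inj_onI)
    fix k l assume kl: "k \<in> {m..<length ws}" "l \<in> {m..<length ws}" "c k = c l"
    have "H (summand l) \<in> R `` {H (summand l)}" using in\<H>[OF kl(2)] module_iso_refl by (auto simp: R_def)
    then have "H (summand l) \<in> R `` {H (summand k)}" using kl(3) by (simp add: c_def)
    then have iso: "module_iso \<Lambda> (L (summand k)) (L (summand l))" by (simp add: R_def)
    have "summand k = summand l"
      by (rule summands_distinct[OF _ _ _ _ iso]) (use nonzero_iff[of "summand k"] nonzero_iff[of "summand l"] kl in auto)
    then have "length (take k ws) = length (take l ws)" by simp
    then show "k = l" using kl by simp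
  qed
  have "\<H> // R = c ` {m..<length ws}"
  proof
    show "c ` {m..<length ws} \<subseteq> \<H> // R" 
    proof (rule image_subsetI)
      show "c k \<in> \<H> // R" if "k \<in> {m..<length ws}" for k unfolding c_def by (rule quotientI[OF in\<H>[OF that]])
    qed
    show "\<H> // R \<subseteq> c ` {m..<length ws}"
    proof
      fix C assume "C \<in> \<H> // R"
      then obtain X where X: "X \<in> \<H>" "C = R `` {X}" by (auto simp: quotient_def)
      have "\<exists>a\<in>A. H a \<noteq> {\<zero>\<^bsub>T\<^esub>} \<and> module_iso \<Lambda> (restrict_module T X) (L a)"
        by (rule T.summand_iso[OF direct_images indecomposable_summand]) (use X in \<open>auto simp: \<H>_def\<close>)
      then obtain k where k: "k < length ws" "module_iso \<Lambda> (restrict_module T X) (L (summand k))"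
        using nonzero_iff by metis
      have "in_Sub I \<Omega> ?N (L (summand k))"
      proof -
        have "in_Sub I \<Omega> ?N (restrict_module T X)" using X(1) by (simp add: \<H>_def)
        then obtain n Y where nY: "submodule Y \<Lambda> (direct_sum {..<n::nat} (\<lambda>_. ?N))"
          "module_iso \<Lambda> (restrict_module T X) (restrict_module (direct_sum {..<n} (\<lambda>_. ?N)) Y)"
          unfolding in_Sub_def by (elim conjE exE)
        then have "module_iso \<Lambda> (L (summand k)) (restrict_module (direct_sum {..<n} (\<lambda>_. ?N)) Y)"
          using module_iso_trans[OF iso_sym[OF X(1) k(2)]] by blast
        then show ?thesis unfolding in_Sub_def
          using T.sub_fd[OF H_sm[OF summand_in[OF k(1)]]] nY(1) by blast
      qed
      then have km: "k \<in> {m..<length ws}" using early_summand_not_in_Sub[of k] k(1) by (meson atLeastLessThan_iff not_le)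
      have "C = c k" unfolding c_def X(2) by (rule class_eq[OF X(1) in\<H>[OF km] k(2)])
      then show "C \<in> c ` {m..<length ws}" using km by blast
    qed
  qed
  then have "card (\<H> // R) = length ws - m" using card_image[OF inj] by simp
  then show ?thesis unfolding num_summands_in_Sub_def Let_def \<H>_def[symmetric] R_def[symmetric] .
qed

end

end

theorem proposition7p3:
  fixes I J K :: "'v set" and E :: "'v set set" and \<Omega> :: "('v \<times> 'v) set"
    and Q :: "'v \<Rightarrow> 'v preproj_mod" and T :: "'v preproj_mod"
    and w\<^sub>0 w\<^sub>0\<^sub>K :: "('v \<Rightarrow> int) \<Rightarrow> ('v \<Rightarrow> int)"
    and r r\<^sub>K :: nat and ws :: "'v list"
  assumes "dynkin_ADE I E"
    and "orientation E \<Omega>"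
    and "J \<subseteq> I" and "J \<noteq> {}" and "K = I - J"
    and "longest_element I E I w\<^sub>0" and "r = card (positive_roots I E)"
    and "longest_element I E K w\<^sub>0\<^sub>K" and "r\<^sub>K = coxeter_length I E w\<^sub>0\<^sub>K"
    and "\<And>i. i \<in> I \<Longrightarrow> injective_hull I \<Omega> (simple_at i) (Q i)"
    and "reduced_word I E w\<^sub>0 ws"
    and "reduced_word I E w\<^sub>0\<^sub>K (take r\<^sub>K ws)"
    and "T_dagger I \<Omega> Q ws T"
  shows "num_summands_in_Sub I \<Omega> (direct_sum J Q) T = r - r\<^sub>K"
proof -
  interpret simple_graph I E by (rule dynkin_graph(1)[OF assms(1)])
  interpret preproj I E \<Omega> by unfold_locales (rule assms(2))
  have ws: "red ws" "wp ws = w\<^sub>0" using assms(11) by (auto simp: reduced_word_red)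
  have longest: "longest_element I E I (wp ws)" using assms(6) ws(2) by simp
  have r: "r = length ws" using length_longest(1)[OF longest ws(1)] assms(7) by simp
  interpret hull_family I E \<Omega> Q "length ws"
    by unfold_locales (use assms(1,10) length_longest(2)[OF longest ws(1)] in auto)
  have wsI: "set ws \<subseteq> I" using ws(1) by (auto dest: red_letters)
  obtain f where T: "lam_mod I E \<Omega> T" and f: "summand_maps T ws f"
    using T_dagger_summand_maps[OF assms(13) wsI] by blast
  note neg = longest_neg[OF longest ws(1) subset_refl]
  have wK: "wp (take r\<^sub>K ws) = w\<^sub>0\<^sub>K" "length (take r\<^sub>K ws) = r\<^sub>K"
    using assms(9,12) by (auto simp: reduced_word_def)
  then have m: "r\<^sub>K \<le> length ws" by simp
  have J: "J = I - K" using assms(3,5) by blast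
  obtain \<pi> where \<pi>: "bij_betw \<pi> I I" "\<And>i. i \<in> I \<Longrightarrow> wp (rev ws) (\<alpha> i) = - \<alpha> (\<pi> i)"
    using longest_permutes_roots[OF neg(1,2) wsI] by metis
  have "summand_family I E \<Omega> Q (length ws) T ws f \<pi>"
    using hull_family_axioms T f ws(1) longest_no_ascent(1)[OF longest ws(1) subset_refl] \<pi>
    by (intro summand_family.intro summand_family_axioms.intro) auto
  then have "num_summands_in_Sub I \<Omega> (direct_sum (I - K) Q) T = length ws - r\<^sub>K"
    by (rule summand_family.count_summands) (use assms(5,8) m wK(1) in auto)
  then show ?thesis using J r by simp
qed

end
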